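(* Let $n\ge2$ and let $C$ be a closed curve in $\mathbb{C}^n$ of length $l$. Then $C$ bounds an isotropic surface $S\subset\mathbb{C}^n$ with $$\mathrm{Area}(S)\le \frac{3l^2}{8\sqrt2}.$$
   Context: $\mathbb{C}^n$ carries its standard flat metric and symplectic form $\omega$. A surface $S$ (piecewise smooth, compact with boundary, possibly non-orientable) is isotropic if $\omega$ restricts to $0$ on $S$. *)

theory Defs
  imports "HOL-Analysis.Analysis"
begin

text \<open>The standard symplectic form \<open>\<Sum>\<^sub>j dx\<^sub>j \<and> dy\<^sub>j\<close> on complex n-space, \<open>z\<^sub>j = x\<^sub>j + i y\<^sub>j\<close>.
  The flat metric is the inner product of the library on \<^typ>\<open>complex ^ 'n\<close>.\<close>

definition omega :: "complex ^ 'n \<Rightarrow> complex ^ 'n \<Rightarrow> real" where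
  "omega u v = (\<Sum>j\<in>UNIV. Re (u $ j) * Im (v $ j) - Im (u $ j) * Re (v $ j))"

text \<open>\<open>C_on k U f\<close>: for open \<open>U\<close>, \<open>f\<close> is of class \<open>C\<^sup>k\<close> on \<open>U\<close>.\<close>

primrec C_on :: "nat \<Rightarrow> 'a::real_normed_vector set \<Rightarrow> ('a \<Rightarrow> 'b::real_normed_vector) \<Rightarrow> bool" where
  "C_on 0 U f \<longleftrightarrow> continuous_on U f"
| "C_on (Suc k) U f \<longleftrightarrow> (\<forall>x\<in>U. f differentiable (at x)) \<and>
      (\<forall>v. C_on k U (\<lambda>x. frechet_derivative f (at x) v))"

definition smooth_on_open :: "'a::real_normed_vector set \<Rightarrow> ('a \<Rightarrow> 'b::real_normed_vector) \<Rightarrow> bool" where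
  "smooth_on_open U f \<longleftrightarrow> open U \<and> (\<forall>k. C_on k U f)"

definition smooth_upto_boundary ::
    "'a::real_normed_vector set \<Rightarrow> ('a \<Rightarrow> 'b::real_normed_vector) \<Rightarrow> bool" where
  "smooth_upto_boundary K f \<longleftrightarrow>
     (\<exists>U g. K \<subseteq> U \<and> smooth_on_open U g \<and> (\<forall>x\<in>K. g x = f x))"

text \<open>Closed curves are parametrized by the unit interval; neither injectivity nor
  nonvanishing velocity is required.\<close>

definition piecewise_smooth_path :: "(real \<Rightarrow> 'a::real_normed_vector) \<Rightarrow> bool" where
  "piecewise_smooth_path c \<longleftrightarrow> path c \<and>
     (\<exists>P. finite P \<and> 0 \<in> P \<and> 1 \<in> P \<and> P \<subseteq> {0..1} \<and>
        (\<forall>a\<in>P. \<forall>b\<in>P. a < b \<and> {a<..<b} \<inter> P = {} \<longrightarrow> smooth_upto_boundary {a..b} c))"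

definition closed_curve :: "(real \<Rightarrow> 'a::real_normed_vector) \<Rightarrow> bool" where
  "closed_curve c \<longleftrightarrow> piecewise_smooth_path c \<and> pathfinish c = pathstart c"

text \<open>The velocity is undefined at the finitely many break points, which do not affect
  the integral.\<close>

definition curve_length :: "(real \<Rightarrow> 'a::real_normed_vector) \<Rightarrow> real" where
  "curve_length c = integral {0..1} (\<lambda>t. norm (vector_derivative c (at t)))"

definition locally_plane_at :: "'a::topological_space set \<Rightarrow> 'a \<Rightarrow> bool" where
  "locally_plane_at M x \<longleftrightarrow>
     (\<exists>U. openin (top_of_set M) U \<and> x \<in> U \<and> U homeomorphic (UNIV :: (real \<times> real) set))"

definition locally_half_plane_at :: "'a::topological_space set \<Rightarrow> 'a \<Rightarrow> bool" where
  "locally_half_plane_at M x \<longleftrightarrow>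
     (\<exists>U. openin (top_of_set M) U \<and> x \<in> U \<and> U homeomorphic {p :: real \<times> real. 0 \<le> snd p})"

definition compact_surface :: "'a::topological_space set \<Rightarrow> bool" where
  "compact_surface M \<longleftrightarrow> compact M \<and> (\<forall>x\<in>M. locally_plane_at M x \<or> locally_half_plane_at M x)"

definition surface_boundary :: "'a::topological_space set \<Rightarrow> 'a set" where
  "surface_boundary M = {x\<in>M. \<not> locally_plane_at M x}"

text \<open>A triangulated surface is given by its finite set of triangles, each with an ordering
  of its vertices, which provides an affine parametrization over the standard triangle. Every
  finite two-dimensional simplicial complex has a linear realization in \<^typ>\<open>real ^ 5\<close>.\<close>

definition std_triangle :: "(real \<times> real) set" where
  "std_triangle = {(s, t). 0 \<le> s \<and> 0 \<le> t \<and> s + t \<le> 1}"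

fun triangle :: "'a::real_vector \<times> 'a \<times> 'a \<Rightarrow> 'a set" where
  "triangle (a, b, c) = convex hull {a, b, c}"

fun triangle_param :: "'a::real_vector \<times> 'a \<times> 'a \<Rightarrow> real \<times> real \<Rightarrow> 'a" where
  "triangle_param (a, b, c) (s, t) = a + s *\<^sub>R (b - a) + t *\<^sub>R (c - a)"

definition carrier_of :: "('a::real_vector \<times> 'a \<times> 'a) set \<Rightarrow> 'a set" where
  "carrier_of K = (\<Union>T\<in>K. triangle T)"

definition triangulated_surface :: "('a::euclidean_space \<times> 'a \<times> 'a) set \<Rightarrow> bool" where
  "triangulated_surface K \<longleftrightarrow>
     finite K \<and> inj_on triangle K \<and> (\<forall>(a, b, c)\<in>K. \<not> collinear {a, b, c}) \<and>
     triangulation (triangle ` K) \<and> compact_surface (carrier_of K)"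

text \<open>A piecewise smooth surface is a map from a triangulated compact surface, smooth up to the
  boundary on every triangle. The map need not be injective or immersive. Tangential conditions
  are imposed in the interiors of the triangles, where the derivative of the restriction of \<open>f\<close>
  to a triangle depends only on that restriction; they extend to the edges by continuity.\<close>

definition piecewise_smooth_surface ::
    "('a::euclidean_space \<times> 'a \<times> 'a) set \<Rightarrow> ('a \<Rightarrow> 'b::real_normed_vector) \<Rightarrow> bool" where
  "piecewise_smooth_surface K f \<longleftrightarrow>
     triangulated_surface K \<and> continuous_on (carrier_of K) f \<and>
     (\<forall>T\<in>K. smooth_upto_boundary std_triangle (f \<circ> triangle_param T))"

definition isotropic ::
    "('a::euclidean_space \<times> 'a \<times> 'a) set \<Rightarrow> ('a \<Rightarrow> complex ^ 'n) \<Rightarrow> bool" where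
  "isotropic K f \<longleftrightarrow>
     (\<forall>T\<in>K. \<forall>p\<in>interior std_triangle.
        \<forall>u v. omega (frechet_derivative (f \<circ> triangle_param T) (at p) u)
                   (frechet_derivative (f \<circ> triangle_param T) (at p) v) = 0)"

definition area_density :: "(real \<times> real \<Rightarrow> 'b::real_inner) \<Rightarrow> real \<times> real \<Rightarrow> real" where
  "area_density g p =
     (let u = frechet_derivative g (at p) (1, 0); v = frechet_derivative g (at p) (0, 1)
      in sqrt ((u \<bullet> u) * (v \<bullet> v) - (u \<bullet> v)\<^sup>2))"

definition area :: "('a::euclidean_space \<times> 'a \<times> 'a) set \<Rightarrow> ('a \<Rightarrow> 'b::real_inner) \<Rightarrow> real" where
  "area K f = (\<Sum>T\<in>K. integral (interior std_triangle) (area_density (f \<circ> triangle_param T)))"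

text \<open>The boundary of the surface is a single circle, on which \<open>f\<close> traces out the given closed curve.\<close>

definition bounds ::
    "(real \<Rightarrow> 'b) \<Rightarrow> ('a::euclidean_space \<times> 'a \<times> 'a) set \<Rightarrow> ('a \<Rightarrow> 'b) \<Rightarrow> bool" where
  "bounds c K f \<longleftrightarrow>
     (\<exists>h. simple_path h \<and> pathfinish h = pathstart h \<and>
        path_image h = surface_boundary (carrier_of K) \<and> (\<forall>t\<in>{0..1}. f (h t) = c t))"

end

theory Submission
  imports Defs "HOL-Computational_Algebra.Polynomial" "HOL-Library.Z2" "HOL-Library.Function_Algebras"
begin

text \<open>Only isotropic fillings of mod 2 chains are needed: a list of smooth isotropic triangles whose
  sides cancel modulo 2, up to the arcs of \<open>C\<close>, can be glued along equal sides, and the result is a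
  compact surface after two barycentric subdivisions. Triangles of rank one are free.

  Additivity of chains in Hermitian orthogonal directions shows that every closed chain of arcs of
  length \<open>h\<close> has a filling of area \<open>O(h\<^sup>2)\<close>. Hence \<open>C\<close> may be replaced by a polygon with short edges,
  which is coned off from its centroid. The triangle spanned by the centroid and an edge splits into a
  right triangle in a complex line, a triangle in a Lagrangian plane, and small triangles. A periodic
  isotropic surface over a complex line, assembled from an explicit patch, costs at most
  \<open>\<kappa> = 3.166\<close> per unit of area, so that a thin triangle of height \<open>r\<close> over an edge of length \<open>s\<close> costs
  at most \<open>sqrt (1 + \<kappa>\<^sup>2) r s / 2\<close>. The discrete Wirtinger inequality bounds the sum of these by
  \<open>sqrt (1 + \<kappa>\<^sup>2) l\<^sup>2 / (4 \<pi>)\<close>, which is less than \<open>3 l\<^sup>2 / (8 sqrt 2)\<close>.\<close>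

section \<open>Orbits of two involutions\<close>

text \<open>The target constant requires \<open>sqrt (1 + \<kappa>\<^sup>2)\<close> to stay below
  \<open>3 \<pi> / (2 sqrt 2)\<close>, about 3.332, so that \<kappa> has to be below 3.178; the
  value 3.166 leaves a gap of less than half a percent, whence the careful numerics. The factor
  \<open>sqrt (1 + \<kappa>\<^sup>2)\<close> is the maximum of
  \<open>\<kappa> cos t + sin t\<close>: the part of an edge in the complex line of its cone costs
  \<kappa>, the Hermitian orthogonal part costs 1. Coefficients modulo 2 serve twice: crude fillings
  arise by letting a chain cancel with itself, and equal curves can be glued whatever their
  directions, so that the surface may be non-orientable. Bounds for fillings hold up to an arbitrary
  positive error, which the strict inequality between the constants absorbs; a curve of length 0
  leaves no room for it and is treated apart. The surface has to be an embedded simplicial complex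
  bounded by one circle, although \<open>C\<close> may cross itself or stand still. Hence the
  combinatorics is built abstractly, its vertices are put in general position, and degenerate
  triangles keep the circle apart from the rest.\<close>

definition orb2 :: "('a \<Rightarrow> 'a) \<Rightarrow> ('a \<Rightarrow> 'a) \<Rightarrow> 'a \<Rightarrow> 'a set" where
  "orb2 f g x = {(u, v). v = f u \<or> v = g u}\<^sup>* `` {x}"

lemma orb2_self: "x \<in> orb2 f g x"
  by (auto simp: orb2_def)

lemma orb2_step: "y \<in> orb2 f g x \<Longrightarrow> f y \<in> orb2 f g x \<and> g y \<in> orb2 f g x"
  unfolding orb2_def by (auto intro: rtrancl_into_rtrancl)

lemma orb2_subset:
  assumes "x \<in> A" "\<And>y. y \<in> A \<Longrightarrow> f y \<in> A \<and> g y \<in> A"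
  shows "orb2 f g x \<subseteq> A"
proof
  fix y assume "y \<in> orb2 f g x"
  then have "(x, y) \<in> {(u, v). v = f u \<or> v = g u}\<^sup>*" by (auto simp: orb2_def)
  then show "y \<in> A" by induction (use assms in auto)
qed

lemma orb2_eq:
  assumes "\<And>y. f (f y) = y" "\<And>y. g (g y) = y" "y \<in> orb2 f g x"
  shows "orb2 f g y = orb2 f g x"
proof -
  have "sym {(u, v). v = f u \<or> v = g u}" using assms(1,2) by (auto simp: sym_def)
  then have "sym ({(u, v). v = f u \<or> v = g u}\<^sup>*)" by (rule sym_rtrancl)
  then have *: "(y, x) \<in> {(u, v). v = f u \<or> v = g u}\<^sup>*" "(x, y) \<in> {(u, v). v = f u \<or> v = g u}\<^sup>*"
    using assms(3) by (auto simp: orb2_def sym_def)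
  then show ?thesis unfolding orb2_def by (auto intro: rtrancl_trans)
qed

primrec walk :: "('a \<Rightarrow> 'a) \<Rightarrow> ('a \<Rightarrow> 'a) \<Rightarrow> 'a \<Rightarrow> nat \<Rightarrow> 'a" where
  "walk f g x 0 = x"
| "walk f g x (Suc n) = (if even n then f else g) (walk f g x n)"

lemma walk_in_orb2: "walk f g x n \<in> orb2 f g x"
  by (induction n) (auto simp: orb2_self dest: orb2_step)

context
  fixes f g :: "'a \<Rightarrow> 'a"
  assumes ff: "\<And>y. f (f y) = y" and gg: "\<And>y. g (g y) = y"
begin

lemma walk_back: "(if even n then f else g) (walk f g x (Suc n)) = walk f g x n"
  using ff gg by auto

text \<open>The two indices have opposite parity, so the forward step at \<open>i\<close> and the
  backward step at \<open>j\<close> apply the same involution. The coincidence therefore survives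
  while the distance drops by two, until two consecutive terms agree.\<close>

lemma walk_odd_period:
  assumes "walk f g x i = walk f g x j" "i < j" "odd (j - i)"
  shows "\<exists>k. i \<le> k \<and> k < j \<and> walk f g x (Suc k) = walk f g x k"
  using assms
proof (induction "j - i" arbitrary: i j rule: less_induct)
  case less
  show ?case
  proof (cases "j = Suc i")
    case True then show ?thesis using less.prems by (intro exI[of _ i]) auto
  next
    case False
    obtain j' where j: "j = Suc j'" using less.prems(2) by (cases j) auto
    have "Suc i < j'" using less.prems(2,3) False j by presburger
    note j' = j this
    have par: "even i = even j'" using less.prems(2,3) j' by auto
    have "walk f g x (Suc i) = walk f g x j'"
      using less.prems(1) walk_back[of j' x] par j' by (simp del: walk.simps(2) add: walk.simps(2)[of f g x i])
    moreover have "j' - Suc i < j - i" "odd (j' - Suc i)" using j' par less.prems by auto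
    ultimately obtain k where "Suc i \<le> k \<and> k < j' \<and> walk f g x (Suc k) = walk f g x k"
      using less.hyps[of j' "Suc i"] j' by blast
    then show ?thesis using j' by (intro exI[of _ k]) (auto simp del: walk.simps)
  qed
qed

lemma walk_even_period:
  assumes "walk f g x i = walk f g x (i + d)" "even d"
  shows "walk f g x d = x"
  using assms
proof (induction i)
  case (Suc i)
  have "walk f g x i = walk f g x (i + d)"
    using walk_back[of i x] walk_back[of "i + d" x] Suc.prems by (simp del: walk.simps)
  then show ?case using Suc by blast
qed auto

text \<open>Any repetition forces an earlier stationary step: at odd distance by folding, at even
  distance because the walk is back at \<open>x\<close> and the step before it was
  \<open>g x = x\<close>. Hence the terms up to the first stationary step are distinct; they are
  closed under both involutions and so exhaust the orbit.\<close>

lemma dihedral_path: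
  assumes fin: "finite (orb2 f g x)" and gx: "g x = x"
  obtains L where "0 < L" "inj_on (walk f g x) {..<L}" "walk f g x ` {..<L} = orb2 f g x"
    "(if odd L then f else g) (walk f g x (L - 1)) = walk f g x (L - 1)"
proof -
  let ?w = "walk f g x"
  have period: "\<exists>k<j. ?w (Suc k) = ?w k" if "?w i = ?w j" "i < j" for i j
  proof (cases "odd (j - i)")
    case True then show ?thesis using walk_odd_period[OF that] by blast
  next
    case False
    then have d: "?w (j - i) = x" using walk_even_period[of x i "j - i"] that by simp
    obtain k where k: "j - i = Suc k" using \<open>i < j\<close> by (cases "j - i") auto
    then have "odd k" using False by simp
    note k = k this
    have "?w k = x" using walk_back[of k x] d k gx by (simp del: walk.simps)
    then show ?thesis using k d that by (intro exI[of _ k]) (auto simp del: walk.simps)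
  qed
  have ex: "\<exists>n. ?w (Suc n) = ?w n"
  proof (rule ccontr)
    assume "\<not> ?thesis"
    then have "inj ?w" using period by (metis injI nat_neq_iff)
    moreover have "range ?w \<subseteq> orb2 f g x" using walk_in_orb2 by fast
    ultimately show False using fin finite_subset range_inj_infinite by blast
  qed
  define n where "n = (LEAST n. ?w (Suc n) = ?w n)"
  have n: "?w (Suc n) = ?w n" unfolding n_def using ex by (rule LeastI_ex)
  have nl: "?w (Suc k) \<noteq> ?w k" if "k < n" for k
    using not_less_Least[of k "\<lambda>n. ?w (Suc n) = ?w n"] that n_def by blast
  have inj: "inj_on ?w {..<Suc n}"
  proof (rule linorder_inj_onI)
    fix i j assume "i < j" "j \<in> {..<Suc n}" 
    then show "?w i \<noteq> ?w j" using period[of i j] nl by fastforce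
  qed auto
  have "orb2 f g x \<subseteq> ?w ` {..<Suc n}"
  proof (rule orb2_subset)
    show "x \<in> ?w ` {..<Suc n}" by (rule image_eqI[of _ _ 0]) auto
    fix y assume "y \<in> ?w ` {..<Suc n}"
    then obtain i where i: "i \<le> n" "y = ?w i" by (auto simp: less_Suc_eq_le)
    have A: "(if even i then f else g) y \<in> ?w ` {..<Suc n}"
    proof (cases "i = n")
      case True then show ?thesis using n i by auto
    next
      case False
      then show ?thesis using i by (intro image_eqI[of _ _ "Suc i"]) auto
    qed
    have B: "(if even i then g else f) y \<in> ?w ` {..<Suc n}"
    proof (cases i)
      case 0 then show ?thesis using gx i by (auto intro!: image_eqI[of _ _ 0])
    next
      case (Suc m) then show ?thesis using i walk_back[of m x] by (intro image_eqI[of _ _ m]) (auto simp del: walk.simps)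
    qed
    show "f y \<in> ?w ` {..<Suc n} \<and> g y \<in> ?w ` {..<Suc n}" using A B by (auto split: if_splits)
  qed
  then have "?w ` {..<Suc n} = orb2 f g x" using walk_in_orb2 by fast
  then show ?thesis using that[of "Suc n"] inj n by auto
qed

text \<open>Without fixed points no step is stationary, so repetitions occur only at even distance,
  and each implies a return to the start; the first return gives the length of the cycle.\<close>

lemma dihedral_cycle:
  assumes fin: "finite (orb2 f g x)" and nofix: "\<And>y. y \<in> orb2 f g x \<Longrightarrow> f y \<noteq> y \<and> g y \<noteq> y"
  obtains L where "0 < L" "even L" "walk f g x L = x" "inj_on (walk f g x) {..<L}"
    "walk f g x ` {..<L} = orb2 f g x"
proof -
  let ?w = "walk f g x"
  have ne: "?w (Suc k) \<noteq> ?w k" for k using nofix[OF walk_in_orb2[of f g x k]] by auto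
  have period: "even (j - i) \<and> ?w (j - i) = x" if "?w i = ?w j" "i < j" for i j
    using walk_odd_period[OF that] ne walk_even_period[of x i "j - i"] that by (auto simp del: walk.simps)
  have ex: "\<exists>n>0. ?w n = x"
  proof (rule ccontr)
    assume "\<not> ?thesis"
    then have "inj ?w" using period by (metis injI nat_neq_iff zero_less_diff)
    moreover have "range ?w \<subseteq> orb2 f g x" using walk_in_orb2 by fast
    ultimately show False using fin finite_subset range_inj_infinite by blast
  qed
  define L where "L = (LEAST n. 0 < n \<and> ?w n = x)"
  have L: "0 < L" "?w L = x" unfolding L_def using LeastI_ex[OF ex] by auto
  have Ll: "?w k \<noteq> x" if "0 < k" "k < L" for k
    using not_less_Least[of k "\<lambda>n. 0 < n \<and> ?w n = x"] that L_def by blast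
  have ev: "even L" using period[of 0 L] L by simp
  have inj: "inj_on ?w {..<L}"
  proof (rule linorder_inj_onI)
    fix i j assume "i < j" "j \<in> {..<L}" 
    then show "?w i \<noteq> ?w j" using period[of i j] Ll[of "j - i"] by fastforce
  qed auto
  have "orb2 f g x \<subseteq> ?w ` {..<L}"
  proof (rule orb2_subset)
    show "x \<in> ?w ` {..<L}" using L by (intro image_eqI[of _ _ 0]) auto
    fix y assume "y \<in> ?w ` {..<L}"
    then obtain i where i: "i < L" "y = ?w i" by auto
    have A: "(if even i then f else g) y \<in> ?w ` {..<L}"
    proof (cases "Suc i = L")
      case True 
      then have "(if even i then f else g) y = x" using i L by auto
      then show ?thesis using L by (intro image_eqI[of _ _ 0]) auto
    next
      case False
      then show ?thesis using i by (intro image_eqI[of _ _ "Suc i"]) auto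
    qed
    have B: "(if even i then g else f) y \<in> ?w ` {..<L}"
    proof (cases i)
      case 0 
      obtain m where m: "L = Suc m" using L by (cases L) auto
      then have "g x = ?w m" using walk_back[of m x] ev L by (auto simp del: walk.simps)
      then show ?thesis using 0 i m by (intro image_eqI[of _ _ m]) auto
    next
      case (Suc m) then show ?thesis using i walk_back[of m x] by (intro image_eqI[of _ _ m]) (auto simp del: walk.simps)
    qed
    show "f y \<in> ?w ` {..<L} \<and> g y \<in> ?w ` {..<L}" using A B by (auto split: if_splits)
  qed
  then have "?w ` {..<L} = orb2 f g x" using walk_in_orb2 by fast
  then show ?thesis using that[of L] inj L ev by auto
qed

end

section \<open>Surfaces from coloured triangulations\<close>

definition idx5 :: "5 \<Rightarrow> nat" where
  "idx5 = (SOME h. bij_betw h UNIV {1..5})"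

lemma idx5: "bij_betw idx5 UNIV {1..5}"
proof -
  have "\<exists>h. bij_betw h (UNIV :: 5 set) {1..5::nat}"
    using finite_same_card_bij[of "UNIV :: 5 set" "{1..5::nat}"] by simp
  then show ?thesis unfolding idx5_def by (rule someI_ex)
qed

definition moment :: "real \<Rightarrow> real ^ 5" where
  "moment t = (\<chi> i. t ^ idx5 i)"

text \<open>Vandermonde argument: the polynomial vanishing at the points other than \<open>s\<close>
  has degree at most 5, so the relation annihilates it, and only the term at \<open>s\<close>
  survives. Thus any six points of the curve are affinely independent.\<close>

lemma moment_independent:
  assumes A: "finite A" "card A \<le> 6" and s0: "(\<Sum>t\<in>A. c t) = 0"
    and s1: "(\<Sum>t\<in>A. c t *\<^sub>R moment t) = 0" and s: "s \<in> A"
  shows "c s = 0"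
proof -
  have pow: "(\<Sum>t\<in>A. c t * t ^ k) = 0" if "k \<le> 5" for k
  proof (cases "k = 0")
    case True then show ?thesis using s0 by simp
  next
    case False
    then have "k \<in> range idx5" using that idx5 by (auto simp: bij_betw_def)
    then obtain i where "k = idx5 i" by blast
    then show ?thesis using arg_cong[OF s1, of "\<lambda>v. v $ i"] by (simp add: moment_def)
  qed
  define p where "p = (\<Prod>t\<in>A - {s}. [:- t, 1:])"
  have "degree p \<le> card (A - {s})"
    unfolding p_def using degree_prod_sum_le[of "A - {s}" "\<lambda>t. [:- t, 1:]"] A by simp
  then have deg: "degree p \<le> 5" using A s by simp
  have "(\<Sum>t\<in>A. c t * poly p t) = (\<Sum>t\<in>A. \<Sum>k\<le>degree p. coeff p k * (c t * t ^ k))"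
    by (simp add: poly_altdef sum_distrib_left mult_ac)
  also have "\<dots> = (\<Sum>k\<le>degree p. coeff p k * (\<Sum>t\<in>A. c t * t ^ k))"
    by (subst sum.swap) (simp add: sum_distrib_left)
  also have "\<dots> = 0" using pow deg by simp
  finally have "(\<Sum>t\<in>A. c t * poly p t) = 0" .
  moreover have "c t * poly p t = 0" if "t \<in> A - {s}" for t
    using that A by (auto simp: p_def poly_prod)
  ultimately have "c s * poly p s = 0"
    using sum.remove[OF A(1) s, of "\<lambda>t. c t * poly p t"] by simp
  moreover have "poly p s \<noteq> 0" using A by (auto simp: p_def poly_prod)
  ultimately show ?thesis by simp
qed

text \<open>Barycentric coordinate on the parameter triangle; the corners \<open>(0,0)\<close>,
  \<open>(1,0)\<close>, \<open>(0,1)\<close> carry the colours 0, 1, 2.\<close>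

definition bcol :: "real \<times> real \<Rightarrow> nat \<Rightarrow> real" where
  "bcol p j = (if j = 0 then 1 - fst p - snd p else if j = 1 then fst p else snd p)"

lemma bcol_simps [simp]: "bcol p 0 = 1 - fst p - snd p" "bcol p (Suc 0) = fst p" "bcol p 2 = snd p"
  by (auto simp: bcol_def)

lemma continuous_on_bcol: "continuous_on S (\<lambda>p. bcol p j)"
proof -
  consider "j = 0" | "j = 1" | "j \<noteq> 0 \<and> j \<noteq> 1" by blast
  then show ?thesis by cases (auto simp: bcol_def intro!: continuous_intros)
qed

lemma lessThan3: "{..<3} = {0, 1, 2 :: nat}" by auto

lemma sum_bcol: "(\<Sum>j<3. bcol p j) = 1"
  by (simp add: lessThan3)

lemma all_less3: "(\<forall>j<3. Q j) \<longleftrightarrow> Q 0 \<and> Q 1 \<and> Q (2::nat)"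
  by (auto simp: less_Suc_eq numeral_3_eq_3 numeral_2_eq_2)

lemma mem_std_triangle: "p \<in> std_triangle \<longleftrightarrow> (\<forall>j<3. 0 \<le> bcol p j)"
  by (cases p) (auto simp: std_triangle_def all_less3)

lemma std_triangle_hull: "std_triangle = convex hull {(0,0), (1,0), (0,1)}"
  by (auto simp: std_triangle_def convex_hull_3_alt)

lemma compact_std_triangle: "compact std_triangle"
  unfolding std_triangle_hull by (intro finite_imp_compact_convex_hull) auto

text \<open>The conditionals list the two colours different from \<open>j\<close>. The colour is
  stored along with the orbit because orbits for different colours may coincide as sets.\<close>

definition gvert :: "(nat \<Rightarrow> 'a \<Rightarrow> 'a) \<Rightarrow> nat \<Rightarrow> 'a \<Rightarrow> nat \<times> 'a set" where
  "gvert a j x = (j, orb2 (a (if j = 0 then 1 else 0)) (a (if j = 2 then 1 else 2)) x)"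

lemma fst_gvert [simp]: "fst (gvert a j x) = j"
  by (simp add: gvert_def)

text \<open>A coloured triangulation: the triangles are the elements of \<open>X\<close>, and \<open>a k x\<close> is the
  neighbour of \<open>x\<close> across the edge opposite to the vertex of colour \<open>k\<close>, or \<open>x\<close> itself if that
  edge lies on the boundary. The vertices are therefore the orbits of pairs of involutions.\<close>

locale gem =
  fixes X :: "'a set" and a :: "nat \<Rightarrow> 'a \<Rightarrow> 'a"
  assumes finX: "finite X"
    and closed: "\<And>k x. k < 3 \<Longrightarrow> x \<in> X \<Longrightarrow> a k x \<in> X"
    and invol: "\<And>k x. k < 3 \<Longrightarrow> a k (a k x) = x"
    and edge: "\<And>k x y. k < 3 \<Longrightarrow> x \<in> X \<Longrightarrow> y \<in> X \<Longrightarrow>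
      (\<And>j. j < 3 \<Longrightarrow> j \<noteq> k \<Longrightarrow> gvert a j y = gvert a j x) \<Longrightarrow> y = x \<or> y = a k x"
    and tri: "\<And>x y. x \<in> X \<Longrightarrow> y \<in> X \<Longrightarrow> (\<And>j. j < 3 \<Longrightarrow> gvert a j y = gvert a j x) \<Longrightarrow> y = x"
begin

abbreviation "vert \<equiv> gvert a"

lemma vert_cross: "j < 3 \<Longrightarrow> k < 3 \<Longrightarrow> j \<noteq> k \<Longrightarrow> vert j (a k x) = vert j x"
  unfolding gvert_def
proof (intro arg_cong2[of _ _ _ _ Pair] refl orb2_eq)
  assume "j < 3" "k < 3" "j \<noteq> k"
  then have "k = (if j = 0 then 1 else 0) \<or> k = (if j = 2 then 1 else 2)" by auto
  then show "a k x \<in> orb2 (a (if j = 0 then 1 else 0)) (a (if j = 2 then 1 else 2)) x"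
    using orb2_step[OF orb2_self, where f="a (if j = 0 then 1 else 0)" and g="a (if j = 2 then 1 else 2)"]
    by (elim disjE; simp only:; blast)
qed (auto simp: invol)

definition "Vs = {vert j x |j x. j < 3 \<and> x \<in> X}"

lemma finite_Vs: "finite Vs"
proof -
  have "Vs = (\<lambda>(j, x). vert j x) ` ({..<3} \<times> X)" by (auto simp: Vs_def)
  then show ?thesis using finX by simp
qed

lemma vert_Vs: "j < 3 \<Longrightarrow> x \<in> X \<Longrightarrow> vert j x \<in> Vs"
  by (auto simp: Vs_def)

definition idx :: "nat \<times> 'a set \<Rightarrow> nat" where "idx = (SOME f. inj_on f Vs)"

lemma inj_idx: "inj_on idx Vs"
  unfolding idx_def using finite_imp_inj_to_nat_seg[OF finite_Vs] by (metis (mono_tags) someI)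

definition pos :: "nat \<times> 'a set \<Rightarrow> real ^ 5" where "pos v = moment (real (idx v))"

lemma pos_independent:
  assumes "A \<subseteq> Vs" "card A \<le> 6" "(\<Sum>v\<in>A. c v) = 0" "(\<Sum>v\<in>A. c v *\<^sub>R pos v) = 0" "v \<in> A"
  shows "c v = 0"
proof -
  define r where "r v = real (idx v)" for v
  have inj: "inj_on r A" using inj_idx assms(1) by (auto simp: inj_on_def r_def subset_iff)
  have fin: "finite A" using finite_subset[OF assms(1) finite_Vs] .
  define d where "d t = c (the_inv_into A r t)" for t
  have d: "d (r v) = c v" if "v \<in> A" for v using the_inv_into_f_f[OF inj that] by (simp add: d_def)
  have "d (r v) = 0"
  proof (rule moment_independent[where A="r ` A" and c=d and s="r v"])
    show "card (r ` A) \<le> 6" using assms(2) card_image_le[OF fin, of r] by linarith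
    show "(\<Sum>t\<in>r ` A. d t) = 0" using assms(3) d by (simp add: sum.reindex[OF inj])
    show "(\<Sum>t\<in>r ` A. d t *\<^sub>R moment t) = 0"
      using assms(4) d by (simp add: sum.reindex[OF inj] pos_def flip: r_def)
  qed (use fin assms in auto)
  then show ?thesis using d assms(5) by simp
qed

definition pt :: "'a \<Rightarrow> real \<times> real \<Rightarrow> real ^ 5" where
  "pt x p = (\<Sum>j<3. bcol p j *\<^sub>R pos (vert j x))"

text \<open>The barycentric coordinates of a point of the triangle \<open>x\<close>, extended by 0
  to all vertices, so that points of different triangles become comparable.\<close>

definition coef :: "'a \<Rightarrow> real \<times> real \<Rightarrow> nat \<times> 'a set \<Rightarrow> real" where
  "coef x p v = (if fst v < 3 \<and> v = vert (fst v) x then bcol p (fst v) else 0)"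

lemma coef_vert [simp]: "j < 3 \<Longrightarrow> coef x p (vert j x) = bcol p j"
  by (simp add: coef_def)

lemma inj_vert: "inj_on (\<lambda>j. vert j x) A"
  by (rule inj_onI) (metis fst_gvert)

lemma sum_coef:
  fixes F :: "_ \<Rightarrow> 'v::real_vector"
  assumes "finite A" "\<And>j. j < 3 \<Longrightarrow> vert j x \<in> A"
  shows "(\<Sum>v\<in>A. coef x p v *\<^sub>R F v) = (\<Sum>j<3. bcol p j *\<^sub>R F (vert j x))"
proof -
  have "(\<Sum>v\<in>A. coef x p v *\<^sub>R F v) = (\<Sum>v\<in>(\<lambda>j. vert j x) ` {..<3}. coef x p v *\<^sub>R F v)"
    using assms by (intro sum.mono_neutral_right) (auto simp: coef_def)
  also have "\<dots> = (\<Sum>j<3. bcol p j *\<^sub>R F (vert j x))"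
    by (subst sum.reindex[OF inj_vert]) simp
  finally show ?thesis .
qed

text \<open>Two triangles have at most six vertices together, and these are affinely independent, so
  a common point has the same coordinates in both. This is what makes the realization in dimension
  five embedded.\<close>

lemma coef_unique:
  assumes "x \<in> X" "y \<in> X" "pt x p = pt y q"
  shows "coef x p v = coef y q v"
proof -
  define A where "A = (\<lambda>j. vert j x) ` {..<3} \<union> (\<lambda>j. vert j y) ` {..<3}"
  have A: "finite A" "A \<subseteq> Vs" using assms vert_Vs by (auto simp: A_def)
  have "card A \<le> card ((\<lambda>j. vert j x) ` {..<3}) + card ((\<lambda>j. vert j y) ` {..<3})"
    unfolding A_def by (rule card_Un_le)
  also have "\<dots> \<le> 3 + 3" by (intro add_mono; rule order_trans[OF card_image_le]) auto
  finally have cA: "card A \<le> 6" by simp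
  have mem: "\<And>j. j < 3 \<Longrightarrow> vert j x \<in> A" "\<And>j. j < 3 \<Longrightarrow> vert j y \<in> A" by (auto simp: A_def)
  show ?thesis
  proof (cases "v \<in> A")
    case True
    have "coef x p v - coef y q v = 0"
    proof (rule pos_independent[OF A(2) cA])
      show "(\<Sum>v\<in>A. coef x p v - coef y q v) = 0"
        using sum_coef[OF A(1) mem(1), where F="\<lambda>_. 1::real"] sum_coef[OF A(1) mem(2), where F="\<lambda>_. 1::real"]
        by (simp add: sum_subtractf sum_bcol)
      show "(\<Sum>v\<in>A. (coef x p v - coef y q v) *\<^sub>R pos v) = 0"
        using sum_coef[OF A(1) mem(1), where F=pos] sum_coef[OF A(1) mem(2), where F=pos] assms(3)
        by (simp add: sum_subtractf scaleR_left_diff_distrib pt_def)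
    qed fact
    then show ?thesis by simp
  next
    case False
    then have "\<not> (fst v < 3 \<and> v = vert (fst v) x)" "\<not> (fst v < 3 \<and> v = vert (fst v) y)"
      using mem by metis+
    then show ?thesis unfolding coef_def by presburger
  qed
qed

lemma pt_inj: "x \<in> X \<Longrightarrow> pt x p = pt x q \<Longrightarrow> p = q"
  using coef_unique[of x x p q "vert 1 x"] coef_unique[of x x p q "vert 2 x"]
  by (auto intro!: prod_eqI)

lemma continuous_pt: "continuous_on S (pt x)"
  unfolding pt_def lessThan3 by (auto intro!: continuous_intros simp: bcol_def)

lemma pt_alt: "pt x (s, t) = (1 - s - t) *\<^sub>R pos (vert 0 x) + s *\<^sub>R pos (vert 1 x) + t *\<^sub>R pos (vert 2 x)"
  by (simp add: pt_def lessThan3)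

definition car :: "'a set \<Rightarrow> (real ^ 5) set" where
  "car A = (\<Union>x\<in>A. pt x ` std_triangle)"

lemma compact_pt: "compact (pt x ` std_triangle)"
  by (intro compact_continuous_image continuous_pt compact_std_triangle)

lemma compact_car: "A \<subseteq> X \<Longrightarrow> compact (car A)"
  unfolding car_def using finX compact_pt by (intro compact_UN) (auto intro: finite_subset)

text \<open>Each parametrization is a homeomorphism onto its compact image, and finitely many closed
  pieces paste; so continuity can be tested triangle by triangle in the parameters.\<close>

lemma paste:
  fixes f :: "real ^ 5 \<Rightarrow> 'c :: topological_space"
  assumes "A \<subseteq> X" "\<And>x. x \<in> A \<Longrightarrow> continuous_on std_triangle (\<lambda>p. f (pt x p))"
  shows "continuous_on (car A) f"
proof -
  have one: "continuous_on (pt x ` std_triangle) f" if x: "x \<in> A" for x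
  proof -
    have "inj_on (pt x) std_triangle" using pt_inj x assms by (auto simp: inj_on_def)
    then obtain g where g: "homeomorphism std_triangle (pt x ` std_triangle) (pt x) g"
      using homeomorphism_compact[OF compact_std_triangle continuous_pt refl] by blast
    have "continuous_on (pt x ` std_triangle) ((\<lambda>p. f (pt x p)) \<circ> g)"
      using homeomorphism_cont2[OF g] assms(2)[OF x] homeomorphism_image2[OF g]
      by (intro continuous_on_compose) simp_all
    then show ?thesis
      by (rule continuous_on_eq) (simp add: homeomorphism_apply2[OF g])
  qed
  have "finite A" using assms finX finite_subset by blast
  then show ?thesis using one unfolding car_def
  proof (induction A rule: finite_induct)
    case (insert x A)
    have "closed (\<Union>x\<in>A. pt x ` std_triangle)"
      using insert compact_pt by (intro compact_imp_closed compact_UN) auto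
    then show ?case using insert compact_imp_closed[OF compact_pt, of x]
      by (auto intro!: continuous_on_closed_Un)
  qed auto
qed

definition bc :: "real ^ 5 \<Rightarrow> nat \<times> 'a set \<Rightarrow> real" where
  "bc z v = (SOME r. \<exists>x\<in>X. \<exists>p. z = pt x p \<and> r = coef x p v)"

lemma bc_pt: "x \<in> X \<Longrightarrow> bc (pt x p) v = coef x p v"
  unfolding bc_def by (rule some_equality) (blast, metis coef_unique)

lemma continuous_bc: "continuous_on (car X) (\<lambda>z. bc z v)"
proof (rule paste)
  fix x assume "x \<in> X"
  then show "continuous_on std_triangle (\<lambda>p. bc (pt x p) v)"
    unfolding bc_pt[OF \<open>x \<in> X\<close>] coef_def
    by (cases "fst v < 3 \<and> v = vert (fst v) x")
       (auto intro!: continuous_on_bcol)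
qed auto

definition Tri :: "'a \<Rightarrow> (real ^ 5) \<times> (real ^ 5) \<times> (real ^ 5)" where
  "Tri x = (pos (vert 0 x), pos (vert 1 x), pos (vert 2 x))"

lemma triangle_param_Tri: "triangle_param (Tri x) p = pt x p"
  by (cases p) (simp add: Tri_def pt_alt algebra_simps)

lemma triangle_Tri: "triangle (Tri x) = pt x ` std_triangle"
proof -
  have "triangle (Tri x) = triangle_param (Tri x) ` std_triangle"
    unfolding Tri_def triangle.simps convex_hull_3_alt std_triangle_def
    by (auto simp: image_def)
  then show ?thesis by (simp add: triangle_param_Tri)
qed

lemma carrier_Tri: "carrier_of (Tri ` X) = car X"
  by (auto simp: carrier_of_def car_def triangle_Tri)

lemma pos_inj: "inj_on pos Vs"
proof (rule inj_onI, rule ccontr)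
  fix u v assume uv: "u \<in> Vs" "v \<in> Vs" "pos u = pos v" "u \<noteq> v"
  have "(if u = u then 1 else -1 :: real) = 0"
    using pos_independent[of "{u, v}" "\<lambda>w. if w = u then 1 else -1" u] uv by auto
  then show False by simp
qed

lemma Vx_independent:
  assumes "x \<in> X" shows "\<not> affine_dependent (pos ` (\<lambda>j::nat. vert j x) ` {..<3})"
    "card (pos ` (\<lambda>j::nat. vert j x) ` {..<3}) = 3"
proof -
  let ?V = "(\<lambda>j. vert j x) ` {..<3}"
  have V: "?V \<subseteq> Vs" using assms vert_Vs by auto
  have inj: "inj_on pos ?V" using pos_inj V inj_on_subset by blast
  have c: "card ?V = 3" by (simp add: card_image[OF inj_vert])
  then show "card (pos ` ?V) = 3" by (simp add: card_image[OF inj])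
  show "\<not> affine_dependent (pos ` ?V)"
  proof
    assume "affine_dependent (pos ` ?V)"
    then obtain U w where "sum U (pos ` ?V) = 0" "w \<in> pos ` ?V" "U w \<noteq> 0" "(\<Sum>v\<in>pos ` ?V. U v *\<^sub>R v) = 0"
      using affine_dependent_explicit_finite[of "pos ` ?V"] by auto
    moreover from this obtain v where v: "v \<in> ?V" "w = pos v" by blast
    ultimately have "(\<Sum>v\<in>?V. U (pos v)) = 0" "(\<Sum>v\<in>?V. U (pos v) *\<^sub>R pos v) = 0" "U (pos v) \<noteq> 0"
      by (simp_all only: sum.reindex[OF inj] comp_def not_False_eq_True)
    then show False using pos_independent[OF V _ _ _ v(1), of "\<lambda>v. U (pos v)"] c by simp
  qed
qed

lemma Tri_hull: "pt x ` std_triangle = convex hull (pos ` (\<lambda>j::nat. vert j x) ` {..<3})"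
  by (simp add: triangle_Tri[symmetric] Tri_def lessThan3)

text \<open>The coordinates of a common point agree, hence vanish at every vertex that is not common
  to both triangles.\<close>

lemma Int_Tri:
  assumes "x \<in> X" "y \<in> X"
  shows "pt x ` std_triangle \<inter> pt y ` std_triangle =
    convex hull (pos ` ((\<lambda>j. vert j x) ` {..<3} \<inter> (\<lambda>j. vert j y) ` {..<3}))"
proof -
  let ?V = "(\<lambda>j. vert j x) ` {..<3}" and ?W = "(\<lambda>j. vert j y) ` {..<3}"
  have inj: "inj_on pos (?V \<inter> ?W)" using pos_inj vert_Vs assms by (auto intro!: inj_on_subset[OF pos_inj])
  have "z \<in> convex hull (pos ` (?V \<inter> ?W))" if p: "p \<in> std_triangle" "q \<in> std_triangle" "z = pt x p" "z = pt y q" for z p q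
  proof -
    have eq: "coef x p v = coef y q v" for v using coef_unique assms p by metis
    have *: "(\<Sum>v\<in>?V \<inter> ?W. coef x p v *\<^sub>R F v) = (\<Sum>j<3. bcol p j *\<^sub>R F (vert j x))" for F :: "_ \<Rightarrow> 'v::real_vector"
    proof -
      have "coef x p v = 0" if "v \<in> ?V - ?V \<inter> ?W" for v
        using that unfolding eq by (auto simp: coef_def)
      then have "(\<Sum>v\<in>?V \<inter> ?W. coef x p v *\<^sub>R F v) = (\<Sum>v\<in>?V. coef x p v *\<^sub>R F v)"
        by (intro sum.mono_neutral_left) auto
      also have "\<dots> = (\<Sum>j<3. bcol p j *\<^sub>R F (vert j x))" by (rule sum_coef) auto
      finally show ?thesis .
    qed
    define u where "u w = coef x p (the_inv_into (?V \<inter> ?W) pos w)" for w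
    have u: "u (pos v) = coef x p v" if "v \<in> ?V \<inter> ?W" for v
      using the_inv_into_f_f[OF inj that] by (simp add: u_def)
    have "\<forall>w\<in>pos ` (?V \<inter> ?W). 0 \<le> u w"
      using u p(1) by (auto simp: mem_std_triangle)
    moreover have "sum u (pos ` (?V \<inter> ?W)) = 1"
      using *[of "\<lambda>_. 1::real"] u by (simp add: sum.reindex[OF inj] sum_bcol)
    moreover have "(\<Sum>w\<in>pos ` (?V \<inter> ?W). u w *\<^sub>R w) = z"
      using *[of pos] u p(3) by (simp add: sum.reindex[OF inj] pt_def)
    ultimately show ?thesis by (subst convex_hull_finite) auto
  qed
  moreover have "convex hull (pos ` (?V \<inter> ?W)) \<subseteq> pt x ` std_triangle \<inter> pt y ` std_triangle"
    unfolding Tri_hull by (intro Int_greatest hull_mono image_mono) auto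
  ultimately show ?thesis by blast
qed

lemma Tri_inj:
  assumes "x \<in> X" "y \<in> X" "pt x ` std_triangle = pt y ` std_triangle"
  shows "x = y"
proof -
  have "vert j x = vert j y" if j: "j < 3" for j
  proof -
    define p :: "real \<times> real" where "p = (if j = 0 then (0,0) else if j = 1 then (1,0) else (0,1))"
    have p: "p \<in> std_triangle" "bcol p j = 1" using j by (auto simp: p_def std_triangle_def bcol_def)
    then obtain q where q: "pt x p = pt y q" using assms(3) by blast
    have "coef y q (vert j x) = 1" using coef_unique[OF assms(1,2) q, of "vert j x"] j p by simp
    then show ?thesis by (auto simp: coef_def split: if_splits)
  qed
  then show ?thesis using tri assms by metis
qed

lemma triangulation_Tri: "triangulation (triangle ` Tri ` X)"
  unfolding triangulation_def
proof (intro conjI ballI allI impI)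
  show "finite (triangle ` Tri ` X)" using finX by simp
  fix T assume "T \<in> triangle ` Tri ` X"
  then obtain x where x: "x \<in> X" "T = pt x ` std_triangle" by (auto simp: triangle_Tri)
  show "\<exists>n. n simplex T"
    using Vx_independent[OF x(1)] x(2) by (intro exI[of _ 2]) (auto simp: simplex_def Tri_hull)
next
  fix T T' assume "T \<in> triangle ` Tri ` X \<and> T' \<in> triangle ` Tri ` X"
  then obtain x y where x: "x \<in> X" "T = pt x ` std_triangle" and y: "y \<in> X" "T' = pt y ` std_triangle"
    by (auto simp: triangle_Tri)
  show "T \<inter> T' face_of T"
    unfolding x(2) y(2) Int_Tri[OF x(1) y(1)] unfolding Tri_hull
    by (subst face_of_convex_hull_affine_independent[OF Vx_independent(1)[OF x(1)]])
       (rule exI, rule conjI[rotated], rule refl, intro image_mono Int_lower1)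
qed

lemma triangulated:
  assumes "compact_surface (car X)"
  shows "triangulated_surface (Tri ` X)"
  unfolding triangulated_surface_def carrier_Tri
proof (intro conjI assms triangulation_Tri)
  show "finite (Tri ` X)" using finX by simp
  show "inj_on triangle (Tri ` X)" using Tri_inj by (auto simp: inj_on_def triangle_Tri)
  have "\<not> collinear {pos (vert 0 x), pos (vert 1 x), pos (vert 2 x)}" if "x \<in> X" for x
    using Vx_independent[OF that] by (auto simp: collinear_3_eq_affine_dependent lessThan3 card_insert_if split: if_splits)
  then show "\<forall>(a, b, c)\<in>Tri ` X. \<not> collinear {a, b, c}" by (auto simp: Tri_def)
qed

end

section \<open>Polar charts of vertex stars\<close>

lemma polar_continuous:
  "continuous_on {q::real \<times> real. 0 \<le> fst q \<and> 0 \<le> snd q}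
    (\<lambda>q. ((fst q + snd q) * cos (m * (i + snd q / (fst q + snd q))),
          (fst q + snd q) * sin (m * (i + snd q / (fst q + snd q)))))"
  (is "continuous_on ?S ?f")
  unfolding continuous_on_eq_continuous_within
proof
  fix q assume q: "q \<in> ?S"
  show "continuous (at q within ?S) ?f"
  proof (cases "fst q + snd q = 0")
    case False
    then show ?thesis by (auto intro!: continuous_intros)
  next
    case True
    have 0: "((\<lambda>q. fst q + snd q) \<longlongrightarrow> 0) (at q within ?S)"
    proof -
      have "((\<lambda>q. fst q + snd q) \<longlongrightarrow> fst q + snd q) (at q within ?S)" by (intro tendsto_intros)
      then show ?thesis using True by simp
    qed
    \<comment> \<open>The angle has no limit at the centre, but the radius tends to 0 and dominates
      both components.\<close>
    have le: "norm (x * cos y) \<le> norm x" "norm (x * sin y) \<le> norm x" for x y :: real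
      by (auto simp: abs_mult mult_left_le)
    have "((\<lambda>q. (fst q + snd q) * cos (m * (i + snd q / (fst q + snd q)))) \<longlongrightarrow> 0) (at q within ?S)"
      by (rule Lim_null_comparison[OF always_eventually tendsto_norm_zero[OF 0]]) (intro allI le)
    moreover have "((\<lambda>q. (fst q + snd q) * sin (m * (i + snd q / (fst q + snd q)))) \<longlongrightarrow> 0) (at q within ?S)"
      by (rule Lim_null_comparison[OF always_eventually tendsto_norm_zero[OF 0]]) (intro allI le)
    ultimately have "(?f \<longlongrightarrow> (0, 0)) (at q within ?S)" by (rule tendsto_Pair)
    then show ?thesis using True by (simp add: continuous_within)
  qed
qed

lemma polar_eq:
  fixes R R' :: real
  assumes "(R * cos A, R * sin A) = (R' * cos B, R' * sin B)" "0 \<le> R" "0 \<le> R'"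
  shows "R = R'" "R \<noteq> 0 \<Longrightarrow> \<exists>n::int. A = B + 2 * pi * n"
proof -
  have "R\<^sup>2 = (R * cos A)\<^sup>2 + (R * sin A)\<^sup>2" by (simp add: power_mult_distrib flip: distrib_left)
  also have "\<dots> = (R' * cos B)\<^sup>2 + (R' * sin B)\<^sup>2" using assms(1) by simp
  also have "\<dots> = R'\<^sup>2" by (simp add: power_mult_distrib flip: distrib_left)
  finally show *: "R = R'" using assms by (simp add: power2_eq_iff_nonneg)
  show "\<exists>n::int. A = B + 2 * pi * n" if "R \<noteq> 0"
    using assms(1) * that sin_cos_eq_iff[of A B] by simp
qed

context gem
begin

text \<open>The union of the sides fixed by their own involution. It is identified with the
  topological boundary in \<open>surface_boundary_car\<close>.\<close>

definition bdry :: "(real ^ 5) set" where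
  "bdry = {pt x p |x m p. x \<in> X \<and> m < 3 \<and> a m x = x \<and> p \<in> std_triangle \<and> bcol p m = 0}"

end

text \<open>The fan of triangles around a vertex of colour \<open>k\<close>, in the order in which
  the alternating walk visits them: closed if \<open>cyc\<close> holds, as at an interior vertex,
  and otherwise with a free side at either end, as at a boundary vertex.\<close>

locale gem_star = gem X a for X :: "'a set" and a +
  fixes k c0 c1 :: nat and w :: "nat \<Rightarrow> 'a" and L :: nat and cyc :: bool
  assumes col: "k < 3" "c0 < 3" "c1 < 3" "k \<noteq> c0" "k \<noteq> c1" "c0 \<noteq> c1"
    and Lpos: "0 < L"
    and wX: "\<And>i. i < L \<Longrightarrow> w i \<in> X"
    and winj: "inj_on w {..<L}"
    and worb: "\<And>x. x \<in> X \<Longrightarrow> gvert a k x = gvert a k (w 0) \<Longrightarrow> \<exists>i<L. x = w i"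
    and wv: "\<And>i. i < L \<Longrightarrow> gvert a k (w i) = gvert a k (w 0)"
    and step: "\<And>i. Suc i < L \<Longrightarrow> w (Suc i) = a (if even i then c0 else c1) (w i)"
    and cycl: "cyc \<Longrightarrow> even L \<and> a c1 (w 0) = w (L - 1)"
    and path: "\<not> cyc \<Longrightarrow> a c1 (w 0) = w 0 \<and> a (if odd L then c0 else c1) (w (L - 1)) = w (L - 1)"
begin

text \<open>The walk leaves \<open>w i\<close> across the side opposite to colour
  \<open>c i\<close>. Hence the outer vertex of \<open>w i\<close> shared with its successor has
  colour \<open>d i\<close>, and the one shared with its predecessor has colour
  \<open>c i\<close>.\<close>

definition "c i = (if even i then c0 else c1)" for i :: nat
definition "d i = (if even i then c1 else c0)" for i :: nat

lemma cd: "c i < 3" "d i < 3" "c i \<noteq> k" "d i \<noteq> k" "c i \<noteq> d i" "c (Suc i) = d i" "d (Suc i) = c i"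
  using col by (auto simp: c_def d_def)

lemma col_cases: "j < 3 \<Longrightarrow> j = k \<or> j = c i \<or> j = d i"
  using col by (auto simp: c_def d_def)

lemma set3: "{..<3} = {k, c i, d i}"
  using col_cases[of _ i] cd[of i] col by auto

lemma w_eq: "i < L \<Longrightarrow> j < L \<Longrightarrow> w i = w j \<longleftrightarrow> i = j"
  using winj by (auto simp: inj_on_def)

lemma step_back:
  assumes "i < L" "0 < i" shows "a (d i) (w i) = w (i - 1)"
proof -
  obtain m where m: "i = Suc m" using assms by (cases i) auto
  show ?thesis using step[of m] assms m invol col by (auto simp: d_def)
qed

definition "v = vert k (w 0)"

text \<open>The outer vertices of the fan in order; the value at \<open>L\<close> is the far vertex
  of the last triangle, which in a closed fan is \<open>Y 0\<close> again
  (\<open>Y_L\<close>).\<close>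

definition Y :: "nat \<Rightarrow> nat \<times> 'a set" where
  "Y i = (if i < L then vert (c i) (w i) else vert (d (L - 1)) (w (L - 1)))"

lemma Y_left: "i < L \<Longrightarrow> vert (c i) (w i) = Y i" by (simp add: Y_def)

lemma Y_right: assumes "i < L" shows "vert (d i) (w i) = Y (Suc i)"
proof (cases "Suc i < L")
  case True
  then have "Y (Suc i) = vert (d i) (a (c i) (w i))" using cd by (simp add: Y_def step c_def)
  then show ?thesis using vert_cross[of "d i" "c i"] cd[of i] by auto
next
  case False
  then have "\<not> Suc i < L" "i = L - 1" using assms by simp_all
  then show ?thesis unfolding Y_def by (metis)
qed

lemma edge_w:
  assumes "i < L" "j < L" "vert (c i) (w j) = vert (c i) (w i)"
  shows "j = i \<or> w j = a (d i) (w i)"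
proof -
  have "w j = w i \<or> w j = a (d i) (w i)"
  proof (rule edge)
    fix m :: nat assume "m < 3" "m \<noteq> d i"
    then have "m = k \<or> m = c i" using col_cases by blast
    then show "vert m (w j) = vert m (w i)"
      using assms(3) wv[OF assms(1)] wv[OF assms(2)] by metis
  qed (use assms wX cd in auto)
  then show ?thesis using w_eq assms by auto
qed

lemma back_cases:
  assumes "i < L" "j < L" "w j = a (d i) (w i)" 
  shows "0 < i \<and> j = i - 1 \<or> i = 0 \<and> cyc \<and> j = L - 1 \<or> i = 0 \<and> \<not> cyc \<and> j = 0"
proof (cases "i = 0")
  case True
  then have "d i = c1" by (simp add: d_def)
  then have wj: "w j = a c1 (w 0)" using assms True by simp
  show ?thesis
  proof (cases cyc)
    case c: True
    then have "w j = w (L - 1)" using wj cycl by simp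
    then show ?thesis using w_eq[of j "L - 1"] assms Lpos True c by simp
  next
    case c: False
    then have "w j = w 0" using wj path by simp
    then show ?thesis using w_eq[of j 0] assms Lpos True c by simp
  qed
next
  case False
  then show ?thesis using step_back[of i] w_eq[of j "i - 1"] assms by auto
qed

lemma Y_neq:
  assumes "i < L" "j < L" "i \<noteq> j" shows "Y i \<noteq> Y j"
proof
  assume eq: "Y i = Y j"
  have cc: "c i = c j" using arg_cong[OF eq, of fst] assms by (simp add: Y_def)
  have "vert (c i) (w j) = vert (c i) (w i)" using eq assms cc by (simp add: Y_def)
  then have "w j = a (d i) (w i)" using edge_w assms by blast
  then consider "0 < i" "j = i - 1" | "i = 0" "cyc" "j = L - 1" | "i = 0" "j = 0"
    using back_cases assms by blast
  then show False
  proof cases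
    case 1 then have "i = Suc j" by simp
    then show ?thesis using cc cd by metis
  next
    case 2 then have "odd j" using cycl Lpos by (cases L) auto
    then show ?thesis using cc 2 col by (auto simp: c_def)
  qed (use assms in auto)
qed

lemma Y_neq_L:
  assumes "\<not> cyc" "i < L" shows "Y i \<noteq> Y L"
proof
  assume eq: "Y i = Y L"
  have cc: "c i = d (L - 1)" using arg_cong[OF eq, of fst] assms by (simp add: Y_def)
  then have ne: "i \<noteq> L - 1" using cd by metis
  have "vert (c i) (w (L - 1)) = vert (c i) (w i)" using eq assms cc by (simp add: Y_def)
  then have "w (L - 1) = a (d i) (w i)" using edge_w[of i "L - 1"] assms ne by auto
  then show False using back_cases[of i "L - 1"] assms ne by auto
qed

lemma Y_L: "cyc \<Longrightarrow> Y L = Y 0"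
proof -
  assume cyc
  then have "even L" "a c1 (w 0) = w (L - 1)" using cycl by auto
  then have "d (L - 1) = c0" using Lpos by (cases L) (auto simp: d_def)
  then show ?thesis using vert_cross[of c0 c1 "w 0"] col Lpos \<open>a c1 (w 0) = _\<close> by (simp add: Y_def c_def)
qed

text \<open>Two triangles forming a closed fan would have all three vertices in common, which
  \<open>tri\<close> forbids; a single one is excluded by parity.\<close>

lemma L_cyc: assumes cyc shows "3 \<le> L"
proof (rule ccontr)
  assume "\<not> ?thesis"
  moreover have "even L" using assms cycl by auto
  moreover have "L \<noteq> 1" using \<open>even L\<close> by auto
  ultimately have L: "L = 2" using Lpos by simp
  then have w1: "w 1 = a c0 (w 0)" "w 1 = a c1 (w 0)" using step[of 0] cycl assms by auto
  have "w 1 = w 0"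
  proof (rule tri)
    fix j :: nat assume "j < 3"
    then consider "j = k" | "j = c0" | "j = c1" using col_cases[of j 0] by (auto simp: c_def d_def)
    then show "vert j (w 1) = vert j (w 0)"
    proof cases
      case 1 then show ?thesis using wv[of 1] L by simp
    next
      case 2 then show ?thesis unfolding w1(2) by (simp add: vert_cross col)
    next
      case 3 then show ?thesis unfolding w1(1) using col by (metis vert_cross)
    qed
  qed (use wX L in auto)
  then show False using w_eq[of 0 1] L by auto
qed

lemma pt_w: "i < L \<Longrightarrow> pt (w i) p = bcol p k *\<^sub>R pos v + bcol p (c i) *\<^sub>R pos (Y i) + bcol p (d i) *\<^sub>R pos (Y (Suc i))"
  unfolding pt_def set3[of i] using cd[of i] wv[of i] Y_left[of i] Y_right[of i] by (simp add: v_def)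

lemma bcol_sum: "bcol p k + bcol p (c i) + bcol p (d i) = 1"
  using sum_bcol[of p] unfolding set3[of i] using cd[of i] by simp

lemma bc_v: "i < L \<Longrightarrow> bc (pt (w i) p) v = bcol p k"
  using bc_pt[OF wX] coef_vert[OF col(1), of "w i" p] wv[of i] by (simp add: v_def)

lemma bc_left: "i < L \<Longrightarrow> bc (pt (w i) p) (Y i) = bcol p (c i)"
  using bc_pt[OF wX] coef_vert[of "c i" "w i" p] cd Y_left by metis

lemma bc_right: "i < L \<Longrightarrow> bc (pt (w i) p) (Y (Suc i)) = bcol p (d i)"
  using bc_pt[OF wX] coef_vert[of "d i" "w i" p] cd Y_right by metis

lemma bc_other: assumes "i < L" "Y m \<noteq> Y i" "Y m \<noteq> Y (Suc i)" shows "bc (pt (w i) p) (Y m) = 0"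
proof -
  have "fst (Y m) \<noteq> k" using cd by (auto simp: Y_def)
  then have "Y m \<noteq> vert (fst (Y m)) (w i)" if "fst (Y m) < 3"
    using col_cases[OF that, of i] assms Y_left[of i] Y_right[of i] by metis
  then show ?thesis unfolding bc_pt[OF wX[OF assms(1)]] coef_def by auto
qed

text \<open>The angle taken up by one triangle: a closed fan fills the disc, an open one the upper
  half disc.\<close>

definition "\<mu> = (if cyc then 2 * pi else pi) / real L"

lemma mu: "0 < \<mu>" "\<mu> * L = (if cyc then 2 * pi else pi)"
  using Lpos by (auto simp: \<mu>_def)

lemma mu_le: assumes "i < L" "u \<le> 1" shows "\<mu> * (real i + u) \<le> \<mu> * L"
proof (rule mult_left_mono)
  show "real i + u \<le> L" using of_nat_mono[of "Suc i" L, where 'a=real] assms by simp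
qed (use mu(1) in simp)

text \<open>The angle of a point, in units of \<mu>, times its radius \<open>1 - bc z v\<close>. In
  a closed fan \<open>Y 0\<close> has to count as 0 on the first triangle and as \<open>L\<close> on
  the last; a positive coordinate at \<open>Y (L - 1)\<close> detects the last triangle, since
  elsewhere it occurs only where the coordinate at \<open>Y 0\<close> vanishes.\<close>

definition theta :: "real ^ 5 \<Rightarrow> real" where
  "theta z = (if cyc then (\<Sum>m<L. real m * bc z (Y m)) + (if 0 < bc z (Y (L - 1)) then L * bc z (Y 0) else 0)
     else (\<Sum>m\<le>L. real m * bc z (Y m)))"

lemma theta_path: "\<not> cyc \<Longrightarrow> theta z = (\<Sum>m\<le>L. real m * bc z (Y m))"
  unfolding theta_def by simp

lemma theta_cyc: "cyc \<Longrightarrow> theta z = (\<Sum>m<L. real m * bc z (Y m)) + (if 0 < bc z (Y (L - 1)) then L * bc z (Y 0) else 0)"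
  unfolding theta_def by simp

definition chi :: "real ^ 5 \<Rightarrow> real \<times> real" where
  "chi z = ((1 - bc z v) * cos (\<mu> * (theta z / (1 - bc z v))), (1 - bc z v) * sin (\<mu> * (theta z / (1 - bc z v))))"

definition pv :: "nat \<Rightarrow> real \<times> real \<Rightarrow> real \<times> real" where
  "pv i p = (let l = bcol p (c i); r = bcol p (d i) in
     ((l + r) * cos (\<mu> * (i + r / (l + r))), (l + r) * sin (\<mu> * (i + r / (l + r)))))"

text \<open>The exception is the spoke to \<open>Y 0\<close> seen from the last triangle: there 0
  replaces \<open>L\<close> times the radius, a difference of one full turn that \<open>chi\<close>
  does not notice.\<close>

lemma theta_pt:
  assumes i: "i < L" and p: "p \<in> std_triangle"
  shows "theta (pt (w i) p) = i * bcol p (c i) + Suc i * bcol p (d i) \<or>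
    cyc \<and> Suc i = L \<and> bcol p (c i) = 0 \<and> theta (pt (w i) p) = 0"
proof (cases cyc)
  case False
  let ?z = "pt (w i) p"
  have "(\<Sum>m\<le>L. real m * bc ?z (Y m)) = (\<Sum>m\<in>{i, Suc i}. real m * bc ?z (Y m))"
  proof (rule sum.mono_neutral_right)
    show "\<forall>m\<in>{..L} - {i, Suc i}. real m * bc ?z (Y m) = 0"
    proof
      fix m assume m: "m \<in> {..L} - {i, Suc i}"
      have "Y m \<noteq> Y i" "Y m \<noteq> Y (Suc i)"
        using m i Y_neq[of m i] Y_neq_L[OF False, of i] Y_neq[of m "Suc i"] Y_neq_L[OF False, of m]
          Y_neq_L[OF False, of "Suc i"] by (auto simp: le_less, (metis Suc_lessI)+)
      then show "real m * bc ?z (Y m) = 0" using bc_other[OF i] by simp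
    qed
  qed (use i in auto)
  then show ?thesis using theta_path[OF False, of ?z] bc_left[OF i] bc_right[OF i] by simp
next
  case True
  let ?z = "pt (w i) p"
  note L3 = L_cyc[OF True]
  show ?thesis
  proof (cases "Suc i = L")
    case False
    then have si: "Suc i < L" using i by simp
    have other: "bc ?z (Y m) = 0" if "m < L" "m \<noteq> i" "m \<noteq> Suc i" for m
      using bc_other[OF i] Y_neq that i si by metis
    have "(\<Sum>m<L. real m * bc ?z (Y m)) = (\<Sum>m\<in>{i, Suc i}. real m * bc ?z (Y m))"
      using other si by (intro sum.mono_neutral_right) auto
    moreover have "(if 0 < bc ?z (Y (L - 1)) then L * bc ?z (Y 0) else 0) = 0"
    proof (cases "L - 1 = Suc i")
      case True then show ?thesis using other[of 0] L3 by auto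
    next
      case False then show ?thesis using other[of "L - 1"] si by auto
    qed
    ultimately show ?thesis using theta_cyc[OF True, of ?z] bc_left[OF i] bc_right[OF i] by simp
  next
    case False': True
    have iL: "i = L - 1" using False' by simp
    have Y0: "bc ?z (Y 0) = bcol p (d i)" using bc_right[OF i] False' Y_L[OF True] by simp
    have bcL: "bc ?z (Y (L - 1)) = bcol p (c i)" using bc_left[OF i] iL by metis
    have other: "bc ?z (Y m) = 0" if "m < L" "m \<noteq> i" "m \<noteq> 0" for m
      using bc_other[OF i, of m] Y_neq[of m i] Y_neq[of m 0] that i False' Y_L[OF True] by auto
    have "(\<Sum>m<L. real m * bc ?z (Y m)) = (\<Sum>m\<in>{i}. real m * bc ?z (Y m))"
    proof (rule sum.mono_neutral_right)
      show "\<forall>m\<in>{..<L} - {i}. real m * bc ?z (Y m) = 0"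
      proof
        fix m assume "m \<in> {..<L} - {i}"
        then show "real m * bc ?z (Y m) = 0" using other[of m] by (cases "m = 0") auto
      qed
    qed (use i in auto)
    moreover have "0 \<le> bcol p (c i)" using p cd by (auto simp: mem_std_triangle)
    ultimately have "theta ?z = i * bcol p (c i) + (if 0 < bcol p (c i) then L * bcol p (d i) else 0)"
      "0 \<le> bcol p (c i)"
      using theta_cyc[OF True, of ?z] bc_left[OF i, of p] Y0 bcL by simp_all
    then show ?thesis using True False' by (cases "bcol p (c i) = 0") auto
  qed
qed

lemma chi_pt:
  assumes i: "i < L" and p: "p \<in> std_triangle"
  shows "chi (pt (w i) p) = pv i p"
proof -
  define l r where "l = bcol p (c i)" and "r = bcol p (d i)"
  have lr: "1 - bc (pt (w i) p) v = l + r" using bc_v[OF i] bcol_sum[of p i] by (simp add: l_def r_def)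
  have pvi: "pv i p = ((l + r) * cos (\<mu> * (i + r / (l + r))), (l + r) * sin (\<mu> * (i + r / (l + r))))"
    by (simp add: pv_def l_def r_def Let_def)
  show ?thesis
  proof (cases "l + r = 0")
    case True then show ?thesis by (simp add: chi_def lr pvi)
  next
    case False
    from theta_pt[OF i p] consider "theta (pt (w i) p) = i * l + Suc i * r"
      | "cyc" "Suc i = L" "l = 0" "theta (pt (w i) p) = 0" by (auto simp: l_def r_def)
    then show ?thesis
    proof cases
      case 1
      then have "theta (pt (w i) p) / (l + r) = i + r / (l + r)" using False by (simp add: field_simps)
      then show ?thesis by (simp add: chi_def lr pvi)
    next
      case 2
      then have "\<mu> * (i + r / (l + r)) = 2 * pi" using False mu(2) by (simp add: field_simps flip: 2(2))
      then show ?thesis unfolding chi_def lr pvi by (simp add: 2(4))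
    qed
  qed
qed

abbreviation "St \<equiv> car (w ` {..<L})"

lemma St_sub: "w ` {..<L} \<subseteq> X" using wX by auto

lemma St_cases: assumes "z \<in> St" obtains i p where "i < L" "p \<in> std_triangle" "z = pt (w i) p"
  using assms by (auto simp: car_def)

lemma continuous_chi: "continuous_on St chi"
proof (rule paste[OF St_sub])
  fix x assume "x \<in> w ` {..<L}"
  then obtain i where i: "i < L" "x = w i" by auto
  have "continuous_on std_triangle (\<lambda>p. (bcol p (c i), bcol p (d i)))"
    by (intro continuous_on_Pair continuous_on_bcol)
  moreover have "(\<lambda>p. (bcol p (c i), bcol p (d i))) ` std_triangle \<subseteq> {q. 0 \<le> fst q \<and> 0 \<le> snd q}"
    using cd by (auto simp: mem_std_triangle)
  ultimately have "continuous_on std_triangle (pv i)"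
    using continuous_on_compose2[OF polar_continuous, of std_triangle "\<lambda>p. (bcol p (c i), bcol p (d i))" \<mu> i]
    by (simp add: pv_def Let_def)
  then show "continuous_on std_triangle (\<lambda>p. chi (pt x p))"
    by (rule continuous_on_eq) (simp add: i chi_pt)
qed

lemma norm_chi: "z \<in> St \<Longrightarrow> norm (chi z) = 1 - bc z v"
proof (erule St_cases)
  fix i p assume *: "i < L" "p \<in> std_triangle" "z = pt (w i) p"
  have "0 \<le> bcol p (c i)" "0 \<le> bcol p (d i)" using *(2) cd by (auto simp: mem_std_triangle)
  then have "0 \<le> 1 - bc z v" using bc_v[OF *(1), of p] bcol_sum[of p i] *(3) by simp
  moreover have "(norm (chi z))\<^sup>2 = (1 - bc z v)\<^sup>2"
    by (simp add: norm_prod_def chi_def power_mult_distrib flip: distrib_left)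
  ultimately show ?thesis by (simp add: power2_eq_iff_nonneg)
qed

lemma inj_chi: "inj_on chi St"
proof (rule inj_onI, elim St_cases)
  fix z z' i p j q
  assume eq: "chi z = chi z'" and i: "i < L" "p \<in> std_triangle" "z = pt (w i) p"
    and j: "j < L" "q \<in> std_triangle" "z' = pt (w j) q"
  define l r l' r' where lr: "l = bcol p (c i)" "r = bcol p (d i)" "l' = bcol q (c j)" "r' = bcol q (d j)"
  have nn: "0 \<le> l" "0 \<le> r" "0 \<le> l'" "0 \<le> r'" using i j cd unfolding lr by (auto simp: mem_std_triangle)
  have "pv i p = pv j q" using eq chi_pt i j by simp
  then have pe: "((l + r) * cos (\<mu> * (i + r / (l + r))), (l + r) * sin (\<mu> * (i + r / (l + r)))) =
     ((l' + r') * cos (\<mu> * (j + r' / (l' + r'))), (l' + r') * sin (\<mu> * (j + r' / (l' + r'))))"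
    by (simp add: pv_def Let_def lr)
  note P = polar_eq[OF pe]
  have R: "l + r = l' + r'" using P(1) nn by simp
  have k1: "bcol p k = 1 - (l + r)" and k2: "bcol q k = 1 - (l' + r')"
    using bcol_sum[of p i] bcol_sum[of q j] by (simp_all add: lr)
  have z: "z = (1 - (l + r)) *\<^sub>R pos v + l *\<^sub>R pos (Y i) + r *\<^sub>R pos (Y (Suc i))"
    "z' = (1 - (l' + r')) *\<^sub>R pos v + l' *\<^sub>R pos (Y j) + r' *\<^sub>R pos (Y (Suc j))"
    using pt_w[OF i(1), of p] pt_w[OF j(1), of q] k1 k2 i j by (simp_all add: lr)
  show "z = z'"
  proof (cases "l + r = 0")
    case True
    then have "l = 0" "r = 0" "l' = 0" "r' = 0" using nn R by auto
    then show ?thesis using z by simp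
  next
    case False
    then obtain n :: int where n: "\<mu> * (i + r / (l + r)) = \<mu> * (j + r' / (l' + r')) + 2 * pi * n"
      using P(2) nn by auto
    define u u' where u: "u = r / (l + r)" "u' = r' / (l' + r')"
    have r: "r = u * (l + r)" "l = (1 - u) * (l + r)" "r' = u' * (l + r)" "l' = (1 - u') * (l + r)"
    proof -
      have "u * (l + r) = r" "u' * (l + r) = r'" using False R by (auto simp: u)
      then show "r = u * (l + r)" "l = (1 - u) * (l + r)" "r' = u' * (l + r)" "l' = (1 - u') * (l + r)"
        using R by (auto simp: left_diff_distrib)
    qed
    have u01: "0 \<le> u" "u \<le> 1" "0 \<le> u'" "u' \<le> 1" using nn by (auto simp: u divide_le_eq)
    have n': "\<mu> * (i + u) = \<mu> * (j + u') + 2 * pi * n" using n by (simp add: u)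
    have bd: "0 \<le> \<mu> * (i + u)" "0 \<le> \<mu> * (j + u')" using mu u01 by auto
    have "\<mu> * (i + u) \<le> \<mu> * L" "\<mu> * (j + u') \<le> \<mu> * L"
      using mu_le u01 i(1) j(1) by auto
    moreover have "\<mu> * L \<le> 2 * pi" "\<not> cyc \<longrightarrow> \<mu> * L \<le> pi"
      unfolding mu(2) by simp_all
    ultimately have bd2: "\<mu> * (i + u) \<le> 2 * pi" "\<mu> * (j + u') \<le> 2 * pi"
      "\<not> cyc \<longrightarrow> \<mu> * (i + u) \<le> pi \<and> \<mu> * (j + u') \<le> pi"
      by (blast intro: order_trans)+
    have "\<bar>2 * pi * n\<bar> \<le> 2 * pi" using n' bd bd2 by linarith
    then have "\<bar>real_of_int n\<bar> \<le> 1" by (simp add: abs_mult)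
    then have "n = 0 \<or> n = 1 \<or> n = -1" by linarith
    \<comment> \<open>A full turn separates only the two readings of the spoke to
      \<open>Y 0\<close>: angle \<open>2 * pi\<close> from the last triangle, angle 0 from the
      first.\<close>
    moreover have wrap: "cyc \<and> Suc i = L \<and> u = 1 \<and> j = 0 \<and> u' = 0"
      if "\<mu> * (i + u) = \<mu> * (j + u') + 2 * pi" "i < L" "j < L" "0 \<le> u" "u \<le> 1" "0 \<le> u'" "0 \<le> \<mu> * (j + u')"
        "\<mu> * (i + u) \<le> 2 * pi" "\<not> cyc \<longrightarrow> \<mu> * (i + u) \<le> pi" for i j u u'
    proof -
      have "cyc" using that pi_gt_zero by linarith
      then have muL: "\<mu> * L = 2 * pi" unfolding mu(2) by simp
      have "\<mu> * (j + u') = 0" "\<mu> * (i + u) = \<mu> * L" using that muL by linarith+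
      then have "j + u' = 0" "i + u = L" using mu(1) by auto
      moreover have "real i + 1 \<le> L" using \<open>i < L\<close> by linarith
      ultimately show ?thesis using \<open>cyc\<close> that by (auto; linarith)
    qed
    have same: "z = z'" if "real i + u = j + u'"
    proof -
      \<comment> \<open>Equal angular positions in different triangles occur only on the spoke
        between two consecutive ones.\<close>
      consider "i = j" | "j = Suc i" | "i = Suc j" | "real i + 2 \<le> j" | "real j + 2 \<le> i" by linarith
      then show ?thesis
      proof cases
        case 1 then have "u = u'" using that by simp
        then have "l = l'" "r = r'" using r by metis+
        then show ?thesis using z R 1 by simp
      next
        case 2 then have "u = 1" "u' = 0" using that u01 by auto
        then have "l = 0" "r' = 0" using r(2,3) by simp_all
        then show ?thesis using z R 2 by simp
      next
        case 3 then have "u = 0" "u' = 1" using that u01 by auto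
        then have "r = 0" "l' = 0" using r(1,4) by simp_all
        then show ?thesis using z R 3 by simp
      qed (use that u01 in linarith)+
    qed
    ultimately consider "n = 0" | "n = 1" | "n = -1" by blast
    then show ?thesis
    proof cases
      case 1 then show ?thesis using same n' mu(1) by simp
    next
      case 2
      then have "cyc \<and> Suc i = L \<and> u = 1 \<and> j = 0 \<and> u' = 0" using wrap[of i u j u'] n' i(1) j(1) u01 bd bd2 by simp
      moreover from this have "l = 0" "r' = 0" using r(2,3) by simp_all
      ultimately show ?thesis using z R Y_L by simp
    next
      case 3
      then have "cyc \<and> Suc j = L \<and> u' = 1 \<and> i = 0 \<and> u = 0" using wrap[of j u' i u] n' i(1) j(1) u01 bd bd2 by simp
      moreover from this have "r = 0" "l' = 0" using r(1,4) by simp_all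
      ultimately show ?thesis using z R Y_L by simp
    qed
  qed
qed

lemma std_mk:
  assumes "0 \<le> b" "0 \<le> l" "0 \<le> r" "b + l + r = 1"
  obtains p where "p \<in> std_triangle" "bcol p k = b" "bcol p (c i) = l" "bcol p (d i) = r"
proof -
  define g where "g j = (if j = k then b else if j = c i then l else r)" for j
  have "(\<Sum>j<3. g j) = 1" unfolding set3[of i] using cd[of i] assms by (simp add: g_def)
  then have s: "g 0 + g 1 + g 2 = 1" by (simp add: lessThan3)
  have bg: "bcol (g 1, g 2) j = g j" if "j < 3" for j
    using that s by (auto simp: bcol_def less_Suc_eq numeral_3_eq_3 numeral_2_eq_2)
  have "(g 1, g 2) \<in> std_triangle" using bg assms by (simp add: mem_std_triangle g_def)
  then show ?thesis using that bg col(1) cd[of i] by (simp add: g_def)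
qed

definition D :: "(real \<times> real) set" where
  "D = (if cyc then UNIV else {p. 0 \<le> snd p})"

lemma chi_surj:
  assumes "q \<in> D" "norm q < 1"
  shows "q \<in> chi ` {z \<in> St. 0 < bc z v}"
proof -
  define R where "R = norm q"
  have R2: "R\<^sup>2 = (fst q)\<^sup>2 + (snd q)\<^sup>2" by (simp add: R_def norm_prod_def)
  have "\<exists>t. 0 \<le> t \<and> t \<le> \<mu> * L \<and> q = (R * cos t, R * sin t)"
  proof (cases "R = 0")
    case True then show ?thesis using mu Lpos by (intro exI[of _ 0]) (auto simp: R_def zero_prod_def)
  next
    case False
    then have Rp: "0 < R" by (simp add: R_def)
    have 1: "(fst q / R)\<^sup>2 + (snd q / R)\<^sup>2 = 1" using False by (simp add: power_divide R2[symmetric] flip: add_divide_distrib)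
    have "\<exists>t. 0 \<le> t \<and> t \<le> \<mu> * L \<and> fst q / R = cos t \<and> snd q / R = sin t"
    proof (cases cyc)
      case True
      then show ?thesis using sincos_total_2pi_le[OF 1] mu(2) by auto
    next
      case False
      then have "0 \<le> snd q" using assms(1) unfolding D_def by simp
      then have "0 \<le> snd q / R" using Rp by simp
      then show ?thesis using sincos_total_pi[OF _ 1] mu(2) False by auto
    qed
    then obtain t where "0 \<le> t" "t \<le> \<mu> * L" "fst q / R = cos t" "snd q / R = sin t" by blast
    then show ?thesis using False by (intro exI[of _ t]) (auto intro!: prod_eqI simp: field_simps)
  qed
  then obtain t where t: "0 \<le> t" "t \<le> \<mu> * L" "q = (R * cos t, R * sin t)" by blast
  define s where "s = t / \<mu>"
  have s: "0 \<le> s" "s \<le> L" "t = \<mu> * s" using t mu(1) by (auto simp: s_def field_simps)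
  \<comment> \<open>The extreme position \<open>s = L\<close> is assigned to the end of the last
    triangle, because its integer part is no index of a triangle.\<close>
  obtain i u where iu: "i < L" "0 \<le> u" "u \<le> (1::real)" "s = real i + u"
  proof (cases "s = L")
    case True then show ?thesis using that[of "L - 1" 1] Lpos by (auto simp: of_nat_diff)
  next
    case False
    then have "nat \<lfloor>s\<rfloor> < L" using s by linarith
    then show ?thesis using that[of "nat \<lfloor>s\<rfloor>" "s - real (nat \<lfloor>s\<rfloor>)"] s(1) by linarith
  qed
  have R01: "0 \<le> R" "R < 1" using assms by (auto simp: R_def)
  obtain p where p: "p \<in> std_triangle" "bcol p k = 1 - R" "bcol p (c i) = R * (1 - u)" "bcol p (d i) = R * u"
    by (rule std_mk[of "1 - R" "R * (1 - u)" "R * u" i]) (use iu R01 in \<open>auto simp: algebra_simps mult_left_le\<close>)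
  have sum: "R * (1 - u) + R * u = R" by (simp add: algebra_simps)
  have "chi (pt (w i) p) = q"
    using chi_pt[OF iu(1) p(1)] by (cases "R = 0") (simp_all add: pv_def p sum t(3) s(3) iu(4))
  moreover have "pt (w i) p \<in> St" using p iu by (auto simp: car_def)
  moreover have "0 < bc (pt (w i) p) v" using bc_v[OF iu(1)] p R01 by simp
  ultimately show ?thesis by (intro image_eqI[of _ _ "pt (w i) p"]) auto
qed

lemma chi_D: assumes "z \<in> St" shows "chi z \<in> D"
  using assms
proof (rule St_cases)
  fix i p assume *: "i < L" "p \<in> std_triangle" "z = pt (w i) p"
  define l r where lr: "l = bcol p (c i)" "r = bcol p (d i)"
  have nn: "0 \<le> l" "0 \<le> r" using * cd unfolding lr by (auto simp: mem_std_triangle)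
  have "0 \<le> sin (\<mu> * (i + r / (l + r)))" if "\<not> cyc"
  proof (rule sin_ge_zero)
    have "\<mu> * (i + r / (l + r)) \<le> \<mu> * L"
    proof (rule mu_le[OF *(1)])
      show "r / (l + r) \<le> 1" using nn by (auto simp: divide_le_eq)
    qed
    then show "\<mu> * (i + r / (l + r)) \<le> pi" unfolding mu(2) using that by simp
  qed (use mu nn in auto)
  then have "\<not> cyc \<longrightarrow> 0 \<le> snd (pv i p)" using nn unfolding pv_def Let_def lr by simp
  then show ?thesis using chi_pt[OF *(1,2)] *(3) unfolding D_def by simp
qed

lemma star_sub: "{z \<in> car X. 0 < bc z v} = {z \<in> St. 0 < bc z v}"
proof (intro equalityI subsetI)
  fix z assume "z \<in> {z \<in> car X. 0 < bc z v}"
  then obtain x p where x: "x \<in> X" "p \<in> std_triangle" "z = pt x p" "0 < bc z v"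
    by (auto simp: car_def)
  then have "0 < coef x p v" using bc_pt by metis
  then have "vert k x = vert k (w 0)" by (auto simp: coef_def v_def split: if_splits)
  then obtain i where "i < L" "x = w i" using worb x by blast
  then show "z \<in> {z \<in> St. 0 < bc z v}" using x by (auto simp: car_def)
qed (use St_sub in \<open>auto simp: car_def\<close>)

definition "star = {z \<in> car X. 0 < bc z v}"

lemma star_image: "chi ` star = D \<inter> ball 0 1"
  using chi_D norm_chi chi_surj unfolding star_def star_sub by fastforce

lemma star_homeo: "\<exists>g. homeomorphism star (D \<inter> ball 0 1) chi g"
proof -
  obtain g where g: "homeomorphism St (chi ` St) chi g"
    using homeomorphism_compact[OF compact_car[OF St_sub] continuous_chi refl inj_chi] by blast
  have "homeomorphism star (chi ` star) chi g"
    by (rule homeomorphism_of_subsets[OF g]) (auto simp: star_def star_sub)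
  then show ?thesis by (auto simp: star_image)
qed

text \<open>In an open fan the free sides are the first and the last spoke, at angles 0 and \<pi>,
  which together form the diameter; a closed fan has no free side at its centre.\<close>

lemma star_bdry: assumes z: "z \<in> star" shows "z \<in> bdry \<longleftrightarrow> \<not> cyc \<and> snd (chi z) = 0"
proof
  assume "z \<in> bdry"
  then obtain x m p where x: "x \<in> X" "m < 3" "a m x = x" "p \<in> std_triangle" "bcol p m = 0" "z = pt x p"
    by (auto simp: bdry_def)
  have "0 < coef x p v" using z x bc_pt by (simp add: star_def)
  then have vx: "vert k x = vert k (w 0)" "0 < bcol p k" by (auto simp: coef_def v_def split: if_splits)
  then obtain i where i: "i < L" "x = w i" using worb x by blast
  define l r where lr: "l = bcol p (c i)" "r = bcol p (d i)"
  have "m \<noteq> k" using vx x by auto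
  then consider "m = c i" | "m = d i" using col_cases x by blast
  then show "\<not> cyc \<and> snd (chi z) = 0"
  proof cases
    case 1
    have iL: "Suc i = L"
    proof (rule ccontr)
      assume "Suc i \<noteq> L"
      then have "Suc i < L" using i by simp
      then show False using step[of i] x(3) i 1 w_eq[of i "Suc i"] by (simp add: c_def)
    qed
    have nc: "\<not> cyc"
    proof
      assume cyc
      then have "c i = c1" using cycl iL by (auto simp: c_def)
      then have "a c1 (w i) = w i" "a c1 (w 0) = w i" using x(3) i 1 cycl \<open>cyc\<close> iL by auto
      then have "w 0 = w i" using invol col by metis
      then show False using w_eq[of 0 i] i Lpos iL L_cyc[OF \<open>cyc\<close>] by auto
    qed
    have l0: "l = 0" using x(5) 1 by (simp add: lr)
    have "real L = real i + 1" unfolding iL[symmetric] by simp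
    then have "r = 0 \<or> \<mu> * (i + r / (l + r)) = \<mu> * L" using l0 by (cases "r = 0") simp_all
    then have "r = 0 \<or> \<mu> * (i + r / (l + r)) = pi" unfolding mu(2) using nc by simp
    then have "snd (pv i p) = 0" using l0 unfolding pv_def Let_def lr[symmetric] by (elim disjE) simp_all
    then show ?thesis using nc chi_pt[OF i(1) x(4)] x(6) i(2) by simp
  next
    case 2
    have "w i = a (d i) (w i)" using x(3) i 2 by simp
    then have i0: "i = 0" "\<not> cyc"
      using back_cases[OF i(1) i(1)] i L_cyc by auto
    have r0: "r = 0" using x(5) 2 by (simp add: lr)
    have "snd (pv i p) = 0" unfolding pv_def Let_def lr[symmetric] by (simp add: r0 i0(1))
    then show ?thesis using i0 chi_pt[OF i(1) x(4)] x(6) i(2) by simp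
  qed
next
  assume *: "\<not> cyc \<and> snd (chi z) = 0"
  have "z \<in> St" using z by (simp add: star_def star_sub)
  then obtain i p where i: "i < L" "p \<in> std_triangle" "z = pt (w i) p" by (rule St_cases)
  define l r where lr: "l = bcol p (c i)" "r = bcol p (d i)"
  have nn: "0 \<le> l" "0 \<le> r" using i cd unfolding lr by (auto simp: mem_std_triangle)
  define u where "u = r / (l + r)"
  have u01: "0 \<le> u" "u \<le> 1" using nn by (auto simp: u_def divide_le_eq)
  have "(l + r) * sin (\<mu> * (i + u)) = 0"
  proof -
    have "snd (pv i p) = 0" using conjunct2[OF *] chi_pt[OF i(1,2)] i(3) by metis
    then show ?thesis unfolding pv_def Let_def lr[symmetric] u_def[symmetric] by simp
  qed
  moreover have "0 \<le> \<mu> * (i + u)" using mu u01 by auto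
  moreover have le: "\<mu> * (i + u) \<le> pi"
  proof -
    have "\<mu> * (i + u) \<le> \<mu> * L" using mu_le u01 i(1) by auto
    then show ?thesis unfolding mu(2) using * by simp
  qed
  ultimately consider "l + r = 0" | "\<mu> * (i + u) = 0" | "\<mu> * (i + u) = pi"
    using sin_gt_zero by (metis less_eq_real_def mult_eq_0_iff order_less_irrefl)
  then have "l = 0 \<and> r = 0 \<or> i = 0 \<and> r = 0 \<or> Suc i = L \<and> l = 0"
  proof cases
    case 1 then show ?thesis using nn by auto
  next
    case 2 then have "real i + u = 0" using mu by auto
    then have "i = 0" "u = 0" using u01 by auto
    then show ?thesis using nn by (auto simp: u_def)
  next
    case 3
    then have "\<mu> * (i + u) = \<mu> * L" unfolding mu(2) using * by simp
    then have "real i + u = L" using mu(1) by simp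
    moreover have "real i + 1 \<le> L" using i by linarith
    ultimately have "u = 1" "real i + 1 = L" using u01 by auto
    then show ?thesis using nn by (auto simp: u_def divide_eq_1_iff split: if_splits)
  qed
  moreover have zz: "z = (1 - (l + r)) *\<^sub>R pos v + l *\<^sub>R pos (Y i) + r *\<^sub>R pos (Y (Suc i))"
  proof -
    have "bcol p k = 1 - (l + r)" using bcol_sum[of p i] by (simp add: lr)
    then show ?thesis using pt_w[OF i(1), of p] i by (simp add: lr)
  qed
  ultimately consider "i = 0" "r = 0" | "Suc i = L" "l = 0" | "l = 0" "r = 0" by blast
  then show "z \<in> bdry"
  proof cases
    case 1
    then show ?thesis using i path * wX col cd lr unfolding bdry_def
      by (intro CollectI exI[of _ "w 0"] exI[of _ "c1"] exI[of _ p]) (auto simp: d_def)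
  next
    case 2
    then have "a (c i) (w i) = w i" using path * by (auto simp: c_def)
    then show ?thesis using i wX cd lr 2 unfolding bdry_def
      by (intro CollectI exI[of _ "w i"] exI[of _ "c i"] exI[of _ p]) auto
  next
    case 3
    obtain q where q: "q \<in> std_triangle" "bcol q k = 1" "bcol q (c 0) = 0" "bcol q (d 0) = 0"
      by (rule std_mk[of 1 0 0 0]) auto
    have "z = pt (w 0) q" using pt_w[OF Lpos, of q] q zz 3 by simp
    then show ?thesis using q path * wX[OF Lpos] col unfolding bdry_def
      by (intro CollectI exI[of _ "w 0"] exI[of _ "c1"] exI[of _ q]) (auto simp: d_def)
  qed
qed

end

section \<open>The surface property and the boundary\<close>

lemma orb2_commute: "orb2 f g x = orb2 g f x"
  by (simp add: orb2_def disj_commute)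

lemma homeomorphic_half_ball:
  "({p :: real \<times> real. 0 \<le> snd p} \<inter> ball 0 1) homeomorphic {p :: real \<times> real. 0 \<le> snd p}"
proof -
  let ?H = "{p :: real \<times> real. 0 \<le> snd p}"
  let ?f = "\<lambda>z::real \<times> real. z /\<^sub>R (1 - norm z)" and ?g = "\<lambda>z::real \<times> real. z /\<^sub>R (1 + norm z)"
  have ne: "1 + norm z \<noteq> 0" for z :: "real \<times> real" using norm_ge_zero[of z] by linarith
  have "homeomorphism (?H \<inter> ball 0 1) ?H ?f ?g"
  proof (rule homeomorphismI)
    show "continuous_on (?H \<inter> ball 0 1) ?f" by (auto intro!: continuous_intros)
    show "continuous_on ?H ?g" using ne by (auto intro!: continuous_intros)
    show "?f ` (?H \<inter> ball 0 1) \<subseteq> ?H" by auto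
    show "?g ` ?H \<subseteq> ?H \<inter> ball 0 1"
    proof -
      have "norm (?g z) < 1" for z by (simp add: abs_of_pos add_pos_nonneg divide_simps)
      moreover have "0 \<le> snd (?g z)" if "0 \<le> snd z" for z using that by simp
      ultimately show ?thesis
        by (intro image_subsetI IntI CollectI) (simp_all only: mem_Collect_eq mem_ball_0)
    qed
    show "?g (?f z) = z" if "z \<in> ?H \<inter> ball 0 1" for z
    proof -
      have "norm z < 1" using that by simp
      then have "1 + norm (?f z) = 1 / (1 - norm z)" by (simp add: field_simps)
      then show ?thesis using \<open>norm z < 1\<close> by simp
    qed
    show "?f (?g z) = z" for z
    proof -
      have "1 - norm (?g z) = 1 / (1 + norm z)" using ne[of z] by (simp add: field_simps abs_of_pos add_pos_nonneg)
      then show ?thesis using ne[of z] by simp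
    qed
  qed
  then show ?thesis unfolding homeomorphic_def by blast
qed

context gem
begin

lemma orbit_star:
  assumes y: "y \<in> X" and col: "k < 3" "c0 < 3" "c1 < 3" "k \<noteq> c0" "k \<noteq> c1" "c0 \<noteq> c1"
    and L: "0 < L" "inj_on (walk (a c0) (a c1) y) {..<L}" "walk (a c0) (a c1) y ` {..<L} = orb2 (a c0) (a c1) y"
    and c: "cyc \<Longrightarrow> even L \<and> walk (a c0) (a c1) y L = y"
    and p: "\<not> cyc \<Longrightarrow> a c1 y = y \<and> (if odd L then a c0 else a c1) (walk (a c0) (a c1) y (L - 1)) = walk (a c0) (a c1) y (L - 1)"
  shows "gem_star X a k c0 c1 (walk (a c0) (a c1) y) L cyc"
proof -
  let ?w = "walk (a c0) (a c1) y"
  have gv: "gvert a k x = (k, orb2 (a c0) (a c1) x)" for x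
  proof -
    have "(if k = 0 then 1 else 0) = c0 \<and> (if k = 2 then 1 else 2) = c1 \<or>
      (if k = 0 then 1 else 0) = c1 \<and> (if k = 2 then 1 else 2) = c0" using col by auto
    then show ?thesis unfolding gvert_def
      by (elim disjE conjE) (simp_all only: orb2_commute[of "a c1" "a c0"])
  qed
  have "orb2 (a c0) (a c1) y \<subseteq> X" by (rule orb2_subset) (use y closed col in auto)
  then have wX: "?w i \<in> X" for i using walk_in_orb2[of "a c0" "a c1" y i] by blast
  have wv: "gvert a k (?w i) = gvert a k (?w 0)" for i
    using orb2_eq[OF invol[OF col(2)] invol[OF col(3)] walk_in_orb2] by (simp add: gv)
  show ?thesis
  proof (unfold_locales)
    fix x assume "x \<in> X" "gvert a k x = gvert a k (?w 0)"
    then have "x \<in> orb2 (a c0) (a c1) y" using orb2_self[of x "a c0" "a c1"] by (simp add: gv)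
    then show "\<exists>i<L. x = ?w i" using L(3) by blast
  next
    assume cyc
    then obtain m where m: "L = Suc m" "odd m" "?w (Suc m) = y" using c L(1) by (cases L) auto
    then have "a c1 y = ?w m" using invol[OF col(3), of "?w m"] by simp
    then show "even L \<and> a c1 (?w 0) = ?w (L - 1)" using m by simp
  next
    assume "\<not> cyc"
    then show "a c1 (?w 0) = ?w 0 \<and> a (if odd L then c0 else c1) (?w (L - 1)) = ?w (L - 1)"
      using p by (simp split: if_splits)
  qed (use col L wX wv in auto)
qed

definition star_of :: "nat \<times> 'a set \<Rightarrow> (real ^ 5) set" where
  "star_of v = {z \<in> car X. 0 < bc z v}"

text \<open>If one of the two involutions fixes a triangle of the orbit, the walk can start there
  and yields an open fan, hence a half disc; otherwise the orbit is a cycle and yields a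
  disc.\<close>

lemma chart:
  assumes x: "x \<in> X" and k: "k < 3"
  obtains chi g and cyc :: bool where
    "homeomorphism (star_of (vert k x)) ((if cyc then UNIV else {p. 0 \<le> snd p}) \<inter> ball (0 :: real \<times> real) 1) chi g"
    "\<And>z. z \<in> star_of (vert k x) \<Longrightarrow> z \<in> bdry \<longleftrightarrow> \<not> cyc \<and> snd (chi z) = 0"
proof -
  note goal = that
  have *: thesis if "gem_star X a k c0 c1 w L cyc" "vert k (w 0) = vert k x" for c0 c1 w L cyc
  proof -
    interpret gem_star X a k c0 c1 w L cyc by (rule that(1))
    have st: "star = star_of (vert k x)" using that(2) by (simp add: star_def star_of_def v_def)
    obtain g where "homeomorphism star (D \<inter> ball 0 1) chi g" using star_homeo by blast
    then show thesis using star_bdry unfolding st D_def by (intro goal[of cyc chi g]) auto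
  qed
  define c0 c1 :: nat where "c0 = (if k = 0 then 1 else 0)" and "c1 = (if k = 2 then 1 else 2)"
  have col: "c0 < 3" "c1 < 3" "k \<noteq> c0" "k \<noteq> c1" "c0 \<noteq> c1" using k by (auto simp: c0_def c1_def)
  let ?O = "orb2 (a c0) (a c1) x"
  have OX: "?O \<subseteq> X" by (rule orb2_subset) (use x closed col in auto)
  then have fin: "finite ?O" using finX finite_subset by blast
  have vk: "vert k y = vert k x" if "y \<in> ?O" for y
    using orb2_eq[OF invol[OF col(1)] invol[OF col(2)] that] unfolding gvert_def c0_def c1_def by simp
  consider (1) y where "y \<in> ?O" "a c1 y = y" | (2) y where "y \<in> ?O" "a c0 y = y"
    | (3) "\<And>y. y \<in> ?O \<Longrightarrow> a c0 y \<noteq> y \<and> a c1 y \<noteq> y" by blast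
  then show thesis
  proof cases
    case 1
    have "finite (orb2 (a c0) (a c1) y)" using orb2_eq[OF invol[OF col(1)] invol[OF col(2)] 1(1)] fin by simp
    then obtain L where L: "0 < L"
      "inj_on (walk (a c0) (a c1) y) {..<L}" "walk (a c0) (a c1) y ` {..<L} = orb2 (a c0) (a c1) y"
      "(if odd L then a c0 else a c1) (walk (a c0) (a c1) y (L - 1)) = walk (a c0) (a c1) y (L - 1)"
      by (rule dihedral_path[OF invol[OF col(1)] invol[OF col(2)] _ 1(2)])
    show thesis
      by (rule *[OF orbit_star[OF _ k col L(1-3), of False]]) (use 1 L(4) OX vk in auto)
  next
    \<comment> \<open>An open fan starts at a fixed triangle of the second involution, so the two
      colours are exchanged here.\<close>
    case 2
    have "finite (orb2 (a c1) (a c0) y)" using orb2_eq[OF invol[OF col(1)] invol[OF col(2)] 2(1)] fin by (simp add: orb2_commute[of "a c1"])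
    then obtain L where L: "0 < L"
      "inj_on (walk (a c1) (a c0) y) {..<L}" "walk (a c1) (a c0) y ` {..<L} = orb2 (a c1) (a c0) y"
      "(if odd L then a c1 else a c0) (walk (a c1) (a c0) y (L - 1)) = walk (a c1) (a c0) y (L - 1)"
      by (rule dihedral_path[OF invol[OF col(2)] invol[OF col(1)] _ 2(2)])
    show thesis
      by (rule *[OF orbit_star[OF _ k col(2,1,4,3) col(5)[symmetric] L(1-3), of False]]) (use 2 L(4) OX vk in auto)
  next
    case 3
    obtain L where L: "0 < L" "even L" "walk (a c0) (a c1) x L = x"
      "inj_on (walk (a c0) (a c1) x) {..<L}" "walk (a c0) (a c1) x ` {..<L} = ?O"
      by (rule dihedral_cycle[OF invol[OF col(1)] invol[OF col(2)] fin 3])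
    show thesis
      by (rule *[OF orbit_star[OF x k col L(1,4,5), of True]]) (use L in auto)
  qed
qed

lemma openin_star: "openin (top_of_set (car X)) (star_of v)"
proof -
  have "star_of v = car X \<inter> (\<lambda>z. bc z v) -` {0<..}" by (auto simp: star_of_def)
  then show ?thesis using continuous_openin_preimage_gen[OF continuous_bc open_greaterThan] by simp
qed

lemma in_some_star:
  assumes "z \<in> car X" obtains x k where "x \<in> X" "k < 3" "z \<in> star_of (vert k x)"
proof -
  obtain x p where x: "x \<in> X" "p \<in> std_triangle" "z = pt x p" using assms by (auto simp: car_def)
  have "\<exists>k<3. 0 < bcol p k"
  proof (rule ccontr)
    assume "\<not> ?thesis"
    then have "(\<Sum>j<3. bcol p j) \<le> 0" by (intro sum_nonpos) force
    then show False by (simp add: sum_bcol)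
  qed
  then obtain k where "k < 3" "0 < bcol p k" by blast
  then show ?thesis using that[of x k] x assms bc_pt[OF x(1), of p "vert k x"] by (simp add: star_of_def)
qed

lemma compact_surface_car: "compact_surface (car X)"
  unfolding compact_surface_def
proof (intro conjI ballI)
  show "compact (car X)" by (rule compact_car) simp
  fix z assume "z \<in> car X"
  then obtain x k where x: "x \<in> X" "k < 3" "z \<in> star_of (vert k x)" by (rule in_some_star)
  obtain chi g cyc where c: "homeomorphism (star_of (vert k x)) ((if cyc then UNIV else {p. 0 \<le> snd p}) \<inter> ball (0 :: real \<times> real) 1) chi g"
    by (rule chart[OF x(1,2)]) (rule that)
  show "locally_plane_at (car X) z \<or> locally_half_plane_at (car X) z"
  proof (cases cyc)
    case True
    then have "star_of (vert k x) homeomorphic ball (0 :: real \<times> real) 1"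
      using c unfolding homeomorphic_def by auto
    then have "star_of (vert k x) homeomorphic (UNIV :: (real \<times> real) set)"
      using homeomorphic_ball01_UNIV by (rule homeomorphic_trans)
    then show ?thesis using x openin_star unfolding locally_plane_at_def by blast
  next
    case False
    then have "star_of (vert k x) homeomorphic ({p :: real \<times> real. 0 \<le> snd p} \<inter> ball 0 1)"
      using c unfolding homeomorphic_def by auto
    then have "star_of (vert k x) homeomorphic {p :: real \<times> real. 0 \<le> snd p}"
      using homeomorphic_half_ball by (rule homeomorphic_trans)
    then show ?thesis using x openin_star unfolding locally_half_plane_at_def by blast
  qed
qed

lemma bdry_sub: "bdry \<subseteq> car X" by (auto simp: bdry_def car_def)

lemma interior_plane:
  assumes z: "z \<in> car X" "z \<notin> bdry" shows "locally_plane_at (car X) z"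
proof -
  obtain x k where x: "x \<in> X" "k < 3" "z \<in> star_of (vert k x)" by (rule in_some_star[OF z(1)])
  obtain chi g cyc where c: "homeomorphism (star_of (vert k x)) ((if cyc then UNIV else {p. 0 \<le> snd p}) \<inter> ball (0 :: real \<times> real) 1) chi g"
    and b: "\<And>z. z \<in> star_of (vert k x) \<Longrightarrow> z \<in> bdry \<longleftrightarrow> \<not> cyc \<and> snd (chi z) = 0"
    by (rule chart[OF x(1,2)]) (rule that, assumption, blast)
  let ?S = "star_of (vert k x)"
  define W where "W = (if cyc then UNIV else {p. 0 < snd p}) \<inter> ball (0 :: real \<times> real) 1"
  have cz: "chi z \<in> (if cyc then UNIV else {p. 0 \<le> snd p}) \<inter> ball 0 1"
    using homeomorphism_image1[OF c] x(3) by blast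
  then have "chi z \<in> W" using b[OF x(3)] z(2) by (auto simp: W_def split: if_splits)
  moreover have "open {p :: real \<times> real. 0 < snd p}" by (intro open_Collect_less continuous_intros)
  then have "open W" by (auto simp: W_def)
  ultimately obtain e where e: "0 < e" "ball (chi z) e \<subseteq> W" by (meson open_contains_ball)
  have sub: "ball (chi z) e \<subseteq> (if cyc then UNIV else {p. 0 \<le> snd p}) \<inter> ball 0 1"
    using e(2) by (auto simp: W_def split: if_splits)
  let ?U = "?S \<inter> chi -` ball (chi z) e"
  have "openin (top_of_set ?S) ?U"
    by (rule continuous_openin_preimage_gen[OF homeomorphism_cont1[OF c]]) simp
  then have "openin (top_of_set (car X)) ?U" using openin_trans openin_star by blast
  moreover have "z \<in> ?U" using x e by simp
  moreover have "?U homeomorphic (UNIV :: (real \<times> real) set)"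
  proof -
    have "chi ` ?U = ball (chi z) e"
    proof (intro equalityI subsetI)
      fix q assume q: "q \<in> ball (chi z) e"
      then have "q \<in> chi ` ?S" unfolding homeomorphism_image1[OF c] using sub by (rule rev_subsetD)
      then obtain s where "s \<in> ?S" "q = chi s" by (rule imageE)
      then show "q \<in> chi ` ?U" using q by simp
    qed auto
    then have "homeomorphism ?U (ball (chi z) e) chi g"
      by (rule homeomorphism_of_subsets[OF c Int_lower1 sub])
    then have "?U homeomorphic ball (chi z) e" unfolding homeomorphic_def by blast
    then show ?thesis using homeomorphic_ball_UNIV[OF e(1)] by (rule homeomorphic_trans)
  qed
  ultimately show ?thesis unfolding locally_plane_at_def by blast
qed

text \<open>Invariance of domain: the half-disc chart would map a planar neighbourhood of a boundary
  point onto an open set around a point of the diameter, but it takes values in the closed half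
  plane.\<close>

lemma bdry_not_plane:
  assumes z: "z \<in> bdry" shows "\<not> locally_plane_at (car X) z"
proof
  assume "locally_plane_at (car X) z"
  then obtain U where U: "openin (top_of_set (car X)) U" "z \<in> U" "(UNIV :: (real \<times> real) set) homeomorphic U"
    unfolding locally_plane_at_def by (metis homeomorphic_sym)
  then obtain h h' where h: "homeomorphism (UNIV :: (real \<times> real) set) U h h'" by (auto simp: homeomorphic_def)
  obtain x k where x: "x \<in> X" "k < 3" "z \<in> star_of (vert k x)" by (rule in_some_star[OF subsetD[OF bdry_sub z]])
  obtain chi g cyc where c: "homeomorphism (star_of (vert k x)) ((if cyc then UNIV else {p. 0 \<le> snd p}) \<inter> ball (0 :: real \<times> real) 1) chi g"
    and b: "\<And>z. z \<in> star_of (vert k x) \<Longrightarrow> z \<in> bdry \<longleftrightarrow> \<not> cyc \<and> snd (chi z) = 0"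
    by (rule chart[OF x(1,2)]) (rule that, assumption, blast)
  let ?S = "star_of (vert k x)"
  have nc: "\<not> cyc" "snd (chi z) = 0" using b[OF x(3)] z by auto
  let ?W = "UNIV \<inter> h -` (U \<inter> ?S)"
  have "openin (top_of_set U) (U \<inter> ?S)"
    by (rule openin_subset_trans[OF openin_Int[OF U(1) openin_star]]) (use openin_imp_subset[OF U(1)] in auto)
  then have "openin (top_of_set UNIV) ?W"
    by (rule continuous_openin_preimage[OF homeomorphism_cont1[OF h], rotated]) (use homeomorphism_image1[OF h] in auto)
  then have oW: "open ?W" by simp
  have hU: "h q \<in> U" for q using homeomorphism_image1[OF h] by blast
  have "continuous_on ?W (chi \<circ> h)"
    by (intro continuous_on_compose continuous_on_subset[OF homeomorphism_cont1[OF h]]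
        continuous_on_subset[OF homeomorphism_cont1[OF c]]) auto
  moreover have "inj_on (chi \<circ> h) ?W"
  proof (rule inj_onI)
    fix p q assume pq: "p \<in> ?W" "q \<in> ?W" "(chi \<circ> h) p = (chi \<circ> h) q"
    then have eq: "g (chi (h p)) = g (chi (h q))" by simp
    have gp: "g (chi (h p)) = h p" and gq: "g (chi (h q)) = h q"
      using pq(1,2) by (simp_all add: homeomorphism_apply1[OF c])
    have "h p = h q" by (rule trans[OF trans[OF gp[symmetric] eq] gq])
    then have "h' (h p) = h' (h q)" by (rule arg_cong)
    then show "p = q" by (simp add: homeomorphism_apply1[OF h])
  qed
  ultimately have op: "open ((chi \<circ> h) ` ?W)" using oW invariance_of_domain by blast
  have "chi z \<in> (chi \<circ> h) ` ?W"
    using homeomorphism_apply2[OF h U(2)] U(2) x(3) by (intro image_eqI[of _ _ "h' z"]) auto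
  then obtain e where e: "0 < e" "ball (chi z) e \<subseteq> (chi \<circ> h) ` ?W" using op by (meson open_contains_ball)
  have "(fst (chi z), - e / 2) \<in> ball (chi z) e"
    using e nc by (cases "chi z") (auto simp: dist_Pair_Pair dist_norm)
  then have "(fst (chi z), - e / 2) \<in> (chi \<circ> h) ` ?W" using e(2) by blast
  then obtain q where q: "q \<in> ?W" "chi (h q) = (fst (chi z), - e / 2)" by (auto simp: image_iff)
  have "chi (h q) \<in> chi ` ?S" using q(1) by (intro imageI) simp
  then have "chi (h q) \<in> {p. 0 \<le> snd p}" unfolding homeomorphism_image1[OF c] using nc by simp
  then show False using q e by simp
qed

lemma surface_boundary_car: "surface_boundary (car X) = bdry"
  unfolding surface_boundary_def using interior_plane bdry_not_plane bdry_sub by blast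

end

section \<open>Maps of triangulated surfaces\<close>

lemma frechet_derivative_cong_open:
  assumes "open S" "x \<in> S" "\<And>y. y \<in> S \<Longrightarrow> f y = g y"
  shows "frechet_derivative f (at x) = frechet_derivative g (at x)"
proof -
  have "(f has_derivative F) (at x) \<longleftrightarrow> (g has_derivative F) (at x)" for F
    using has_derivative_transform_within_open[OF _ assms(1,2), of f F UNIV g]
      has_derivative_transform_within_open[OF _ assms(1,2), of g F UNIV f] assms(3) by auto
  then show ?thesis by (simp add: frechet_derivative_def)
qed

lemma integral_std_triangle_le:
  fixes q :: "real \<times> real \<Rightarrow> real"
  assumes "0 \<le> D" "\<And>p. p \<in> interior std_triangle \<Longrightarrow> q p \<le> D"
  shows "integral (interior std_triangle) q \<le> D / 2"
proof (cases "q integrable_on interior std_triangle")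
  \<comment> \<open>A function that is not integrable has integral 0 by convention.\<close>
  case False then show ?thesis using assms by (simp add: not_integrable_integral)
next
  case True
  have B: "insert 0 Basis = {(0::real,0::real), (1,0), (0,1)}" by (auto simp: Basis_prod_def zero_prod_def)
  have m: "measure lebesgue std_triangle = 1 / 2"
    using content_std_simplex[where 'a="real \<times> real"] borel_compact[OF compact_std_triangle]
    by (simp add: B std_triangle_hull measure_completion)
  have bdd: "bounded (interior std_triangle)"
    using compact_imp_bounded[OF compact_std_triangle] interior_subset bounded_subset by blast
  have im: "interior std_triangle \<in> lmeasurable" using bdd by (simp add: lmeasurable_open)
  have "measure lebesgue (interior std_triangle) \<le> measure lebesgue std_triangle"
    by (rule measure_mono_fmeasurable[OF interior_subset _ lmeasurable_compact[OF compact_std_triangle]])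
      (use im in auto)
  then have le: "measure lebesgue (interior std_triangle) \<le> 1 / 2" using m by simp
  have int: "((\<lambda>p. D) has_integral D * measure lebesgue (interior std_triangle)) (interior std_triangle)"
  proof -
    have "((\<lambda>p. 1 :: real) has_integral measure lebesgue (interior std_triangle)) (interior std_triangle)"
      using im lmeasurable_iff_integrable_on[of "interior std_triangle"] lmeasure_integral[OF im]
      by (simp add: has_integral_integrable_integral)
    then show ?thesis using has_integral_mult_right[of "\<lambda>p. 1" _ "interior std_triangle" D] by simp
  qed
  have "integral (interior std_triangle) q \<le> integral (interior std_triangle) (\<lambda>p. D)"
    using True assms(2) int by (intro integral_le) (auto simp: integrable_on_def)
  also have "\<dots> = D * measure lebesgue (interior std_triangle)" using int by (rule integral_unique)
  also have "\<dots> \<le> D * (1 / 2)" using le assms(1) by (rule mult_left_mono)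
  finally show ?thesis by simp
qed

lemma three: "i < 3 \<Longrightarrow> j < 3 \<Longrightarrow> k < 3 \<Longrightarrow> i \<noteq> j \<Longrightarrow> i \<noteq> k \<Longrightarrow> j \<noteq> k \<Longrightarrow> {..<3} = {i, j, k :: nat}"
  by (rule card_subset_eq[symmetric]) auto

text \<open>The area density is bounded rather than the area, because a pointwise bound passes to
  subtriangles with the determinant as factor (\<open>good_sub\<close>). As the parameter triangle
  has area 1/2, the image has area at most \<open>D / 2\<close>.\<close>

definition good :: "(real \<times> real \<Rightarrow> complex ^ 'n) \<Rightarrow> real \<Rightarrow> bool" where
  "good g D \<longleftrightarrow> 0 \<le> D \<and> smooth_upto_boundary std_triangle g \<and>
     (\<forall>p\<in>interior std_triangle.
        (\<forall>u v. omega (frechet_derivative g (at p) u) (frechet_derivative g (at p) v) = 0) \<and>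
        area_density g p \<le> D)"

lemma smooth_upto_boundary_continuous: "smooth_upto_boundary K f \<Longrightarrow> continuous_on K f"
  unfolding smooth_upto_boundary_def smooth_on_open_def
  by (metis C_on.simps(1) continuous_on_eq continuous_on_subset)

text \<open>The side of the parameter triangle from the corner of colour \<open>e\<close> to the
  corner of colour \<open>e'\<close>, at constant speed.\<close>

definition ept :: "nat \<Rightarrow> nat \<Rightarrow> real \<Rightarrow> real \<times> real" where
  "ept e e' u = (if e = 1 then 1 - u else if e' = 1 then u else 0, if e = 2 then 1 - u else if e' = 2 then u else 0)"

lemma bcol_ept:
  assumes "e < 3" "e' < 3" "e \<noteq> e'" "m < 3" "m \<noteq> e" "m \<noteq> e'"
  shows "bcol (ept e e' u) e = 1 - u" "bcol (ept e e' u) e' = u" "bcol (ept e e' u) m = 0"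
  using assms by (auto simp: ept_def bcol_def less_Suc_eq numeral_3_eq_3 numeral_2_eq_2)

lemma ept_std:
  assumes "e < 3" "e' < 3" "e \<noteq> e'" "0 \<le> u" "u \<le> 1" shows "ept e e' u \<in> std_triangle"
  using assms by (auto simp: ept_def std_triangle_def)

lemma bcol_eqI: assumes "\<And>j. j < 3 \<Longrightarrow> bcol p j = bcol q j" shows "p = q"
  using assms[of 1] assms[of 2] by (auto intro: prod_eqI)

text \<open>The boundary edges are \<open>(\<beta> j, m j)\<close> for \<open>j < M\<close>, in cyclic order, running from the vertex of
  colour \<open>e j\<close> to that of colour \<open>e' j\<close>.\<close>

locale gem_map = gem X a for X :: "'a set" and a +
  fixes H :: "'a \<Rightarrow> real \<times> real \<Rightarrow> complex ^ 'n" and D :: "'a \<Rightarrow> real"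
    and M :: nat and \<beta> :: "nat \<Rightarrow> 'a" and m e e' :: "nat \<Rightarrow> nat" and y :: "nat \<Rightarrow> nat \<times> 'a set"
  assumes good: "\<And>x. x \<in> X \<Longrightarrow> good (H x) (D x)"
    and compat: "\<And>x k p. x \<in> X \<Longrightarrow> k < 3 \<Longrightarrow> p \<in> std_triangle \<Longrightarrow> bcol p k = 0 \<Longrightarrow> H x p = H (a k x) p"
    and M3: "3 \<le> M"
    and \<beta>X: "\<And>j. j < M \<Longrightarrow> \<beta> j \<in> X"
    and colm: "\<And>j. j < M \<Longrightarrow> m j < 3 \<and> e j < 3 \<and> e' j < 3 \<and> m j \<noteq> e j \<and> m j \<noteq> e' j \<and> e j \<noteq> e' j"
    and fixm: "\<And>j. j < M \<Longrightarrow> a (m j) (\<beta> j) = \<beta> j"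
    and y0: "\<And>j. j < M \<Longrightarrow> gvert a (e j) (\<beta> j) = y j"
    and y1: "\<And>j. j < M \<Longrightarrow> gvert a (e' j) (\<beta> j) = y (Suc j)"
    and yM: "y M = y 0"
    and yinj: "inj_on y {..<M}"
    and all_bdry: "\<And>x k. x \<in> X \<Longrightarrow> k < 3 \<Longrightarrow> a k x = x \<Longrightarrow> \<exists>j<M. x = \<beta> j \<and> k = m j"
begin

definition f :: "real ^ 5 \<Rightarrow> complex ^ 'n" where
  "f z = (SOME c. \<exists>x\<in>X. \<exists>p\<in>std_triangle. z = pt x p \<and> c = H x p)"

text \<open>The point has the same coordinates in both triangles, and the number of vanishing ones
  decides: none forces equal triangles; one forces equal triangles or neighbours across that side;
  two mean a common vertex, around which the value is carried along the orbit by
  \<open>compat\<close>.\<close>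

lemma H_unique:
  assumes x: "x \<in> X" "p \<in> std_triangle" and x': "x' \<in> X" "q \<in> std_triangle" and eq: "pt x p = pt x' q"
  shows "H x p = H x' q"
proof -
  have co: "coef x p v = coef x' q v" for v by (rule coef_unique[OF x(1) x'(1) eq])
  have same: "vert j x = vert j x'" if "j < 3" "bcol p j \<noteq> 0" for j
    using co[of "vert j x"] that by (auto simp: coef_def split: if_splits)
  have "bcol p j = bcol q j" if j: "j < 3" for j
  proof (cases "bcol p j = 0")
    case False
    then show ?thesis using co[of "vert j x"] same[OF j] j by (simp add: coef_def)
  next
    case True
    show ?thesis
    proof (rule ccontr)
      assume "bcol p j \<noteq> bcol q j"
      then have "bcol q j \<noteq> 0" using True by simp
      then show False using co[of "vert j x'"] True j by (auto simp: coef_def split: if_splits)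
    qed
  qed
  then have pq: "p = q" by (rule bcol_eqI)
  have s1: "(\<Sum>j<3. bcol p j) = 1" by (rule sum_bcol)
  consider (all) "\<forall>j<3. bcol p j \<noteq> 0"
    | (one) k where "k < 3" "bcol p k = 0" "\<forall>j<3. j \<noteq> k \<longrightarrow> bcol p j \<noteq> 0"
    | (two) i k where "i < 3" "k < 3" "i \<noteq> k" "bcol p i = 0" "bcol p k = 0"
    by blast
  then show ?thesis
  proof cases
    case all
    have "x' = x" by (rule tri[OF x(1) x'(1)]) (use same all in simp)
    then show ?thesis by (simp add: pq)
  next
    case one
    have "x' = x \<or> x' = a k x" by (rule edge[OF one(1) x(1) x'(1)]) (use same one in simp)
    then show ?thesis using compat[OF x(1) one(1) x(2) one(2)] pq by auto
  next
    case two
    obtain j where j: "j < 3" "j \<noteq> i" "j \<noteq> k"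
    proof -
      define j :: nat where "j = (if i \<noteq> 0 \<and> k \<noteq> 0 then 0 else if i \<noteq> 1 \<and> k \<noteq> 1 then 1 else 2)"
      have "j < 3 \<and> j \<noteq> i \<and> j \<noteq> k" using two(1-3) by (auto simp: j_def)
      then show thesis using that by blast
    qed
    have "bcol p j = 1"
    proof -
      have "{..<3} = {i, j, k}" by (rule three) (use two(1-3) j in auto)
      then show ?thesis using s1 two j by simp
    qed
    then have "vert j x = vert j x'" using same[OF j(1)] by simp
    then have "snd (vert j x') = snd (vert j x)" by simp
    then have mem: "x' \<in> snd (vert j x)" using orb2_self[of x'] by (auto simp: gvert_def)
    have jik: "{..<3} = {j, i, k}" by (rule three) (use two(1-3) j in auto)
    have "(if j = 0 then 1 else 0) \<in> {..<3} - {j}" "(if j = 2 then 1 else 2) \<in> {..<3} - {j}"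
      using j(1) by auto
    then have ik: "(if j = 0 then 1 else 0) \<in> {i, k}" "(if j = 2 then 1 else 2) \<in> {i, k}"
      unfolding jik by blast+
    have "snd (vert j x) \<subseteq> {z \<in> X. H z p = H x p}"
      unfolding gvert_def snd_conv
    proof (rule orb2_subset)
      fix z assume z: "z \<in> {z \<in> X. H z p = H x p}"
      have "a l z \<in> {z \<in> X. H z p = H x p}" if "l \<in> {i, k}" for l
        using that z two closed compat[of z l p] x(2) by auto
      then show "a (if j = 0 then 1 else 0) z \<in> {z \<in> X. H z p = H x p} \<and>
        a (if j = 2 then 1 else 2) z \<in> {z \<in> X. H z p = H x p}" using ik by (intro conjI) blast+
    qed (use x in auto)
    then show ?thesis using mem pq by auto
  qed
qed

lemma f_pt: assumes x: "x \<in> X" "p \<in> std_triangle" shows "f (pt x p) = H x p"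
  unfolding f_def
proof (rule some_equality)
  fix c assume "\<exists>x'\<in>X. \<exists>q\<in>std_triangle. pt x p = pt x' q \<and> c = H x' q"
  then obtain x' q where "x' \<in> X" "q \<in> std_triangle" "pt x p = pt x' q" "c = H x' q" by blast
  then show "c = H x p" using H_unique[OF x, of x' q] by simp
qed (use x in blast)

lemma f_surface: "piecewise_smooth_surface (Tri ` X) f"
  unfolding piecewise_smooth_surface_def
proof (intro conjI ballI)
  show "triangulated_surface (Tri ` X)" by (rule triangulated[OF compact_surface_car])
  show "continuous_on (carrier_of (Tri ` X)) f"
    unfolding carrier_Tri
  proof (rule paste)
    fix x assume x: "x \<in> X"
    have "continuous_on std_triangle (H x)"
      using good[OF x] smooth_upto_boundary_continuous by (auto simp: good_def)
    then show "continuous_on std_triangle (\<lambda>p. f (pt x p))"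
      by (rule continuous_on_eq) (simp add: f_pt x)
  qed simp
  fix T assume "T \<in> Tri ` X"
  then obtain x where x: "x \<in> X" "T = Tri x" by auto
  have "smooth_upto_boundary std_triangle (H x)" using good[OF x(1)] by (simp add: good_def)
  then show "smooth_upto_boundary std_triangle (f \<circ> triangle_param T)"
    using f_pt[OF x(1)] by (simp add: smooth_upto_boundary_def x(2) triangle_param_Tri)
qed

lemma deriv_f:
  assumes "x \<in> X" "p \<in> interior std_triangle"
  shows "frechet_derivative (f \<circ> triangle_param (Tri x)) (at p) = frechet_derivative (H x) (at p)"
  by (rule frechet_derivative_cong_open[OF open_interior assms(2)])
     (use f_pt[OF assms(1)] interior_subset in \<open>auto simp: triangle_param_Tri\<close>)

lemma f_isotropic: "isotropic (Tri ` X) f"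
  unfolding isotropic_def
proof (intro ballI)
  fix T p assume "T \<in> Tri ` X" and p: "p \<in> interior std_triangle"
  then obtain x where x: "x \<in> X" "T = Tri x" by auto
  show "\<forall>u v. omega (frechet_derivative (f \<circ> triangle_param T) (at p) u)
      (frechet_derivative (f \<circ> triangle_param T) (at p) v) = 0"
    using good[OF x(1)] p unfolding x(2) deriv_f[OF x(1) p] by (simp add: good_def)
qed

lemma f_area: "area (Tri ` X) f \<le> (\<Sum>x\<in>X. D x / 2)"
proof -
  have inj: "inj_on Tri X" using Tri_inj by (auto simp: inj_on_def triangle_Tri[symmetric])
  have "area (Tri ` X) f = (\<Sum>x\<in>X. integral (interior std_triangle) (area_density (f \<circ> triangle_param (Tri x))))"
    by (simp add: area_def sum.reindex[OF inj])
  also have "\<dots> \<le> (\<Sum>x\<in>X. D x / 2)"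
  proof (intro sum_mono integral_std_triangle_le)
    fix x p assume x: "x \<in> X" and p: "p \<in> interior std_triangle"
    show "area_density (f \<circ> triangle_param (Tri x)) p \<le> D x"
      using good[OF x] p unfolding area_density_def deriv_f[OF x p] by (simp add: good_def area_density_def)
  qed (use good in \<open>simp add: good_def\<close>)
  finally show ?thesis .
qed

lemma pt_e: "j < M \<Longrightarrow> pt (\<beta> j) (ept (e j) (e' j) u) = (1 - u) *\<^sub>R pos (y j) + u *\<^sub>R pos (y (Suc j))"
proof -
  assume j: "j < M"
  have "{..<3} = {m j, e j, e' j}" by (rule three) (use colm[OF j] in auto)
  then show ?thesis using colm[OF j] bcol_ept[of "e j" "e' j" "m j" u] y0[OF j] y1[OF j] by (simp add: pt_def)
qed

lemma boundary_loop:
  fixes \<tau> :: "nat \<Rightarrow> real"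
  assumes \<tau>: "\<tau> 0 = 0" "\<tau> M = 1" "\<And>j. j < M \<Longrightarrow> \<tau> j < \<tau> (Suc j)"
  obtains h where "simple_path h" "pathfinish h = pathstart h" "path_image h = surface_boundary (carrier_of (Tri ` X))"
    "\<And>j u. j < M \<Longrightarrow> 0 \<le> u \<Longrightarrow> u \<le> 1 \<Longrightarrow>
       f (h ((1 - u) * \<tau> j + u * \<tau> (Suc j))) = H (\<beta> j) (ept (e j) (e' j) u)"
proof -
  have mono: "\<tau> i \<le> \<tau> j" if "i \<le> j" "j \<le> M" for i j
    using that
  proof (induction j rule: dec_induct)
    case (step n) then show ?case using \<tau>(3)[of n] by simp
  qed simp
  \<comment> \<open>The polygon through the \<open>y j\<close> is written with clamped increments:
    \<open>r j\<close> rises from 0 to 1 between \<open>\<tau> j\<close> and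
    \<open>\<tau> (Suc j)\<close> and is constant elsewhere, so that continuity is
    immediate.\<close>
  define r where "r j t = max 0 (min 1 ((t - \<tau> j) / (\<tau> (Suc j) - \<tau> j)))" for j t
  define h where "h t = pos (y 0) + (\<Sum>j<M. r j t *\<^sub>R (pos (y (Suc j)) - pos (y j)))" for t
  have seg: "h ((1 - u) * \<tau> j + u * \<tau> (Suc j)) = pt (\<beta> j) (ept (e j) (e' j) u)"
    if j: "j < M" and u: "0 \<le> u" "u \<le> 1" for j u
  proof -
    define t where "t = (1 - u) * \<tau> j + u * \<tau> (Suc j)"
    have lt: "\<tau> j < \<tau> (Suc j)" using \<tau>(3)[OF j] .
    have td: "t - \<tau> j = u * (\<tau> (Suc j) - \<tau> j)" "\<tau> (Suc j) - t = (1 - u) * (\<tau> (Suc j) - \<tau> j)"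
      by (simp_all add: t_def algebra_simps)
    have tb: "\<tau> j \<le> t" "t \<le> \<tau> (Suc j)"
      using td u lt by (smt (verit) mult_nonneg_nonneg)+
    have rj: "r j t = u" using td lt u by (simp add: r_def)
    have r1: "r i t = 1" if "i < j" for i
    proof -
      have "\<tau> (Suc i) \<le> t" "\<tau> i < \<tau> (Suc i)" using mono[of "Suc i" j] tb that j \<tau>(3)[of i] by auto
      then show ?thesis by (simp add: r_def le_divide_eq)
    qed
    have r0: "r i t = 0" if "j < i" "i < M" for i
    proof -
      have "t \<le> \<tau> i" "\<tau> i < \<tau> (Suc i)" using mono[of "Suc j" i] tb that \<tau>(3)[of i] by auto
      then have "(t - \<tau> i) / (\<tau> (Suc i) - \<tau> i) \<le> 0" by (simp add: divide_nonpos_pos)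
      then show ?thesis by (simp add: r_def)
    qed
    have "(\<Sum>i<M. r i t *\<^sub>R (pos (y (Suc i)) - pos (y i))) = (\<Sum>i<Suc j. r i t *\<^sub>R (pos (y (Suc i)) - pos (y i)))"
      by (rule sum.mono_neutral_right) (use j r0 in auto)
    also have "\<dots> = (\<Sum>i<j. pos (y (Suc i)) - pos (y i)) + u *\<^sub>R (pos (y (Suc j)) - pos (y j))"
      using r1 rj by simp
    finally have split: "(\<Sum>i<M. r i t *\<^sub>R (pos (y (Suc i)) - pos (y i))) =
      (\<Sum>i<j. pos (y (Suc i)) - pos (y i)) + u *\<^sub>R (pos (y (Suc j)) - pos (y j))" .
    have "h t = pos (y 0) + ((\<Sum>i<j. pos (y (Suc i)) - pos (y i)) + u *\<^sub>R (pos (y (Suc j)) - pos (y j)))"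
      unfolding h_def split ..
    also have "\<dots> = (1 - u) *\<^sub>R pos (y j) + u *\<^sub>R pos (y (Suc j))"
      using sum_lessThan_telescope[of "\<lambda>i. pos (y i)" j] by (simp add: algebra_simps)
    finally show ?thesis using pt_e[OF j] by (simp add: t_def)
  qed
  have cov: "\<exists>j<M. \<exists>u. 0 \<le> u \<and> u < 1 \<and> t = (1 - u) * \<tau> j + u * \<tau> (Suc j)" if t: "0 \<le> t" "t < 1" for t
  proof -
    define j where "j = Max {i. i < M \<and> \<tau> i \<le> t}"
    have fin: "finite {i. i < M \<and> \<tau> i \<le> t}" by simp
    have "0 \<in> {i. i < M \<and> \<tau> i \<le> t}" using M3 \<tau>(1) t by auto
    then have jm: "j \<in> {i. i < M \<and> \<tau> i \<le> t}" unfolding j_def using Max_in[OF fin] by blast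
    then have j: "j < M" "\<tau> j \<le> t" by auto
    have "t < \<tau> (Suc j)"
    proof (rule ccontr)
      assume "\<not> ?thesis"
      then have le: "\<tau> (Suc j) \<le> t" by simp
      then have "Suc j \<noteq> M" using \<tau>(2) t by auto
      then have "Suc j \<in> {i. i < M \<and> \<tau> i \<le> t}" using j le by auto
      then have "Suc j \<le> j" unfolding j_def[symmetric] using Max_ge[OF fin] j_def by auto
      then show False by simp
    qed
    moreover define u where "u = (t - \<tau> j) / (\<tau> (Suc j) - \<tau> j)"
    ultimately have "0 \<le> u" "u < 1" "u * (\<tau> (Suc j) - \<tau> j) = t - \<tau> j" using j \<tau>(3)[OF j(1)] by (auto simp: divide_less_eq)
    then show ?thesis using j by (intro exI[of _ j] conjI exI[of _ u]) (auto simp: algebra_simps)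
  qed
  have h01: "h 1 = h 0"
    using seg[of "M - 1" 1] seg[of 0 0] M3 \<tau>(1,2) yM pt_e[of "M - 1" 1] pt_e[of 0 0] by simp
  have cont: "continuous_on {0..1} h"
    unfolding h_def r_def using \<tau>(3) by (intro continuous_intros) (auto simp: less_imp_neq[symmetric])
  have bch: "bc (h ((1 - u) * \<tau> j + u * \<tau> (Suc j))) v = (if v = y j then 1 - u else if v = y (Suc j) then u else 0)"
    if j: "j < M" and u: "0 \<le> u" "u \<le> 1" for j u v
  proof -
    have "y j = vert (e j) (\<beta> j)" "y (Suc j) = vert (e' j) (\<beta> j)" using y0 y1 j by auto
    moreover have "fst v = m j \<or> fst v = e j \<or> fst v = e' j" if "fst v < 3"
    proof -
      have "{..<3} = {m j, e j, e' j}" by (rule three) (use colm[OF j] in auto)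
      then show ?thesis using that by blast
    qed
    ultimately show ?thesis
      unfolding seg[OF j u] bc_pt[OF \<beta>X[OF j]] coef_def
      using bcol_ept[of "e j" "e' j" "m j" u] colm[OF j] by auto
  qed
  have yy: "y i = y k \<Longrightarrow> i = k" if "i < M" "k < M" for i k using yinj that by (auto simp: inj_on_def)
  have ysuc: "Suc i = k \<or> Suc i = M \<and> k = 0" if "y (Suc i) = y k" "i < M" "k < M" for i k
  proof (cases "Suc i = M")
    case True
    then have "y 0 = y k" using that(1) yM by simp
    then show ?thesis using yy[of 0 k] that(2,3) M3 True by simp
  next
    case False
    then show ?thesis using yy[of "Suc i" k] that by simp
  qed
  have inj: "s = t" if s: "0 \<le> s" "s < 1" and t: "0 \<le> t" "t < 1" and eq: "h s = h t" for s t
  proof -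
    obtain j u where j: "j < M" "0 \<le> u" "u < 1" "s = (1 - u) * \<tau> j + u * \<tau> (Suc j)" using cov[OF s] by blast
    obtain k w where k: "k < M" "0 \<le> w" "w < 1" "t = (1 - w) * \<tau> k + w * \<tau> (Suc k)" using cov[OF t] by blast
    have b: "(if v = y j then 1 - u else if v = y (Suc j) then u else 0) = (if v = y k then 1 - w else if v = y (Suc k) then w else 0)" for v
      using bch[of j u v] bch[of k w v] j k eq by simp
    have "y j = y k \<or> y j = y (Suc k)" using b[of "y j"] j by (auto split: if_splits)
    moreover have "y k = y j \<or> y k = y (Suc j)" using b[of "y k"] k by (auto split: if_splits)
    ultimately have dis: "y j = y k \<or> y (Suc k) = y j \<and> y (Suc j) = y k" by metis
    \<comment> \<open>Two different edges with the same pair of ends would close up to a cycle of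
      length two, which \<open>3 \<le> M\<close> excludes.\<close>
    have jk: "j = k"
    proof (rule ccontr)
      assume ne: "j \<noteq> k"
      then have "y (Suc k) = y j" "y (Suc j) = y k" using dis yy[OF j(1) k(1)] by blast+
      then have "Suc k = j \<or> Suc k = M \<and> j = 0" "Suc j = k \<or> Suc j = M \<and> k = 0"
        using ysuc j(1) k(1) by blast+
      then show False using M3 by linarith
    qed
    then have "u = w" using b[of "y j"] by simp
    then show ?thesis using jk j k by simp
  qed
  have "loop_free h"
    unfolding loop_free_def
  proof (intro ballI impI)
    fix s t :: real assume s: "s \<in> {0..1}" "t \<in> {0..1}" "h s = h t"
    consider "s < 1" "t < 1" | "s = 1" "t = 1" | "s = 1" "t < 1" | "t = 1" "s < 1" using s by force
    then show "s = t \<or> s = 0 \<and> t = 1 \<or> s = 1 \<and> t = 0"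
    proof cases
      case 3 then show ?thesis using inj[of 0 t] s h01 by auto
    next
      case 4 then show ?thesis using inj[of s 0] s h01 by auto
    qed (use inj s in auto)
  qed
  then have "simple_path h" using cont by (simp add: simple_path_def path_def)
  moreover have "path_image h = bdry"
  proof (intro equalityI subsetI)
    fix z assume "z \<in> path_image h"
    then obtain t where t: "0 \<le> t" "t \<le> 1" "z = h t" by (auto simp: path_image_def)
    have "\<exists>t. 0 \<le> t \<and> t < 1 \<and> z = h t"
    proof (cases "t = 1")
      case True then show ?thesis using t h01 by (intro exI[of _ 0]) simp
    next
      case False then show ?thesis using t by (intro exI[of _ t]) simp
    qed
    then obtain t where t: "0 \<le> t" "t < 1" "z = h t" by blast
    obtain j u where j: "j < M" "0 \<le> u" "u < 1" "t = (1 - u) * \<tau> j + u * \<tau> (Suc j)" using cov[OF t(1,2)] by blast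
    have "z = pt (\<beta> j) (ept (e j) (e' j) u)" using seg[of j u] t j by simp
    then show "z \<in> bdry" unfolding bdry_def
      using \<beta>X fixm colm[OF j(1)] j ept_std[of "e j" "e' j" u] bcol_ept(3)[of "e j" "e' j" "m j" u] by (intro CollectI exI conjI) auto
  next
    fix z assume "z \<in> bdry"
    then obtain x k p where x: "x \<in> X" "k < 3" "a k x = x" "p \<in> std_triangle" "bcol p k = 0" "z = pt x p"
      by (auto simp: bdry_def)
    obtain j where j: "j < M" "x = \<beta> j" "k = m j" using all_bdry[OF x(1-3)] by blast
    define u where "u = bcol p (e' j)"
    have set3: "{..<3} = {m j, e j, e' j}" by (rule three) (use colm[OF j(1)] in auto)
    have "bcol p (e j) + u = 1" using sum_bcol[of p] x(5) colm[OF j(1)] by (simp add: set3 u_def j)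
    then have be: "bcol p (e j) = 1 - u" by simp
    have u: "0 \<le> u" "u \<le> 1" 
    proof -
      have "0 \<le> bcol p (e j)" "0 \<le> bcol p (e' j)" using x(4) colm[OF j(1)] unfolding mem_std_triangle by blast+
      then show "0 \<le> u" "u \<le> 1" using be by (simp_all add: u_def)
    qed
    have "p = ept (e j) (e' j) u"
    proof (rule bcol_eqI)
      fix i :: nat assume "i < 3"
      then have "i \<in> {m j, e j, e' j}" using set3 by blast
      then show "bcol p i = bcol (ept (e j) (e' j) u) i"
        using be x(5) j colm[OF j(1)] bcol_ept[of "e j" "e' j" "m j" u] by (auto simp: u_def)
    qed
    then have z: "z = h ((1 - u) * \<tau> j + u * \<tau> (Suc j))" using seg[OF j(1) u] x(6) j(2) by simp
    have "(1 - u) * \<tau> j + u * \<tau> (Suc j) \<in> {0..1}"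
    proof -
      have t01: "0 \<le> \<tau> j" "\<tau> j \<le> 1" "0 \<le> \<tau> (Suc j)" "\<tau> (Suc j) \<le> 1" using mono[of 0 j] mono[of j M] mono[of 0 "Suc j"] mono[of "Suc j" M] \<tau> j(1) by auto
      have "(1 - u) * \<tau> j + u * \<tau> (Suc j) \<le> 1" by (rule convex_bound_le) (use t01 u in auto)
      then show ?thesis using t01 u by simp
    qed
    then show "z \<in> path_image h" unfolding z path_image_def by blast
  qed
  ultimately show ?thesis
    using that[of h] h01 seg f_pt \<beta>X ept_std colm
    by (simp add: pathfinish_def pathstart_def carrier_Tri surface_boundary_car)
qed

end

section \<open>Smooth maps and affine changes of parameter\<close>

lemma C_on_cong:
  assumes "open U" "\<And>x. x \<in> U \<Longrightarrow> f x = g x" "C_on k U f" shows "C_on k U g"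
  using assms(2,3)
proof (induction k arbitrary: f g)
  case 0 then show ?case by (simp add: continuous_on_cong[of U U f g])
next
  case (Suc k)
  have fr: "frechet_derivative f (at x) = frechet_derivative g (at x)" if "x \<in> U" for x
    by (rule frechet_derivative_cong_open[OF assms(1) that Suc.prems(1)])
  have "g differentiable (at x)" if x: "x \<in> U" for x
  proof -
    have "(f has_derivative frechet_derivative f (at x)) (at x)"
      using Suc.prems(2) x by (simp add: frechet_derivative_works)
    then have "(g has_derivative frechet_derivative f (at x)) (at x)"
      by (rule has_derivative_transform_within_open[OF _ assms(1) x]) (simp add: Suc.prems(1))
    then show ?thesis by (rule differentiableI)
  qed
  moreover have "C_on k U (\<lambda>x. frechet_derivative g (at x) v)" for v
    by (rule Suc.IH[of "\<lambda>x. frechet_derivative f (at x) v"]) (use fr Suc.prems(2) in auto)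
  ultimately show ?case by simp
qed

lemma C_on_subset: "C_on k U f \<Longrightarrow> V \<subseteq> U \<Longrightarrow> C_on k V f"
  by (induction k arbitrary: f) (auto intro: continuous_on_subset)

lemma C_on_affine:
  assumes L: "bounded_linear L" and U: "open U" and C: "C_on k U f"
  shows "C_on k ((\<lambda>x. c + L x) -` U) (\<lambda>x. f (c + L x))"
  using C
proof (induction k arbitrary: f)
  case 0
  have "continuous_on UNIV (\<lambda>x. c + L x)" by (intro continuous_intros bounded_linear.continuous_on[OF L])
  then have "continuous_on ((\<lambda>x. c + L x) -` U) (\<lambda>x. c + L x)" by (rule continuous_on_subset) simp
  then show ?case using continuous_on_compose2[of U f "(\<lambda>x. c + L x) -` U" "\<lambda>x. c + L x"] 0 by auto
next
  case (Suc k)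
  let ?A = "\<lambda>x. c + L x"
  have cont: "continuous_on UNIV ?A" by (intro continuous_intros bounded_linear.continuous_on[OF L])
  have oV: "open (?A -` U)" by (rule open_vimage[OF U cont])
  have der: "((\<lambda>x. f (?A x)) has_derivative (\<lambda>v. frechet_derivative f (at (?A x)) (L v))) (at x)"
    if "x \<in> ?A -` U" for x
  proof -
    have "(f has_derivative frechet_derivative f (at (?A x))) (at (?A x))"
      using Suc.prems that by (simp add: frechet_derivative_works)
    moreover have "(?A has_derivative L) (at x)"
      using has_derivative_add[OF has_derivative_const bounded_linear_imp_has_derivative[OF L]] by simp
    ultimately show ?thesis using diff_chain_at[of ?A L x f] by (simp add: o_def)
  qed
  have fr: "frechet_derivative (\<lambda>x. f (?A x)) (at x) = (\<lambda>v. frechet_derivative f (at (?A x)) (L v))"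
    if "x \<in> ?A -` U" for x
    using frechet_derivative_at[OF der[OF that]] by simp
  have "C_on k (?A -` U) (\<lambda>x. frechet_derivative (\<lambda>x. f (?A x)) (at x) v)" for v
    by (rule C_on_cong[OF oV _ Suc.IH[of "\<lambda>y. frechet_derivative f (at y) (L v)"]]) (use fr Suc.prems in auto)
  then show ?case using der by (auto intro: differentiableI)
qed

lemma smooth_upto_boundary_affine:
  assumes "smooth_upto_boundary K f" "bounded_linear L" "\<And>x. x \<in> K' \<Longrightarrow> c + L x \<in> K"
  shows "smooth_upto_boundary K' (\<lambda>x. f (c + L x))"
proof -
  obtain U g where g: "K \<subseteq> U" "open U" "\<And>k. C_on k U g" "\<And>x. x \<in> K \<Longrightarrow> g x = f x"
    using assms(1) unfolding smooth_upto_boundary_def smooth_on_open_def by blast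
  have "continuous_on UNIV (\<lambda>x. c + L x)" by (intro continuous_intros bounded_linear.continuous_on[OF assms(2)])
  then have "open ((\<lambda>x. c + L x) -` U)" by (rule open_vimage[OF g(2)])
  then show ?thesis
    unfolding smooth_upto_boundary_def smooth_on_open_def
    using assms(3) g C_on_affine[OF assms(2) g(2,3)]
    by (intro exI[of _ "(\<lambda>x. c + L x) -` U"] exI[of _ "\<lambda>x. g (c + L x)"]) auto
qed

lemma smooth_upto_differentiable:
  assumes "smooth_upto_boundary K f" "x \<in> interior K"
  shows "f differentiable (at x)"
proof -
  obtain U g where g: "K \<subseteq> U" "open U" "C_on 1 U g" "\<And>x. x \<in> K \<Longrightarrow> g x = f x"
    using assms(1) unfolding smooth_upto_boundary_def smooth_on_open_def by blast
  have "x \<in> U" using interior_subset[of K] g(1) assms(2) by blast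
  then have "g differentiable (at x)" using g(3) by simp
  then obtain g' where "(g has_derivative g') (at x)" by (auto simp: differentiable_def)
  then have "(f has_derivative g') (at x)"
    by (rule has_derivative_transform_within_open[OF _ open_interior assms(2)]) (use g interior_subset in blast)
  then show ?thesis by (rule differentiableI)
qed

definition det2 :: "real \<times> real \<Rightarrow> real \<times> real \<Rightarrow> real" where
  "det2 p q = fst p * snd q - snd p * fst q"

lemma triangle_param_affine:
  "triangle_param (P, Q, R) p = P + (fst p *\<^sub>R (Q - P) + snd p *\<^sub>R (R - P))"
  by (cases p) (simp add: algebra_simps)

lemma bounded_linear_tp: "bounded_linear (\<lambda>p :: real \<times> real. fst p *\<^sub>R (A :: 'a::real_normed_vector) + snd p *\<^sub>R B)"
  by (intro bounded_linear_add bounded_linear_compose[OF bounded_linear_scaleR_left bounded_linear_fst]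
      bounded_linear_compose[OF bounded_linear_scaleR_left bounded_linear_snd])

lemma convex_std_triangle: "convex std_triangle"
  by (simp add: std_triangle_hull)

lemma triangle_param_std:
  assumes "P \<in> std_triangle" "Q \<in> std_triangle" "R \<in> std_triangle" "p \<in> std_triangle"
  shows "triangle_param (P, Q, R) p \<in> std_triangle"
proof -
  have "convex hull {P, Q, R} \<subseteq> std_triangle" using assms convex_std_triangle by (intro hull_minimal) auto
  moreover have "triangle_param (P, Q, R) p \<in> convex hull {P, Q, R}"
    using assms(4) by (cases p) (auto simp: convex_hull_3_alt std_triangle_def)
  ultimately show ?thesis by blast
qed

text \<open>Precomposition with an affine map multiplies the Gram determinant by the square of its
  determinant and preserves isotropy. A nonzero determinant makes the map open, so interior points
  go to interior points, where \<open>good\<close> gives information.\<close>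

lemma good_sub:
  fixes g :: "real \<times> real \<Rightarrow> complex ^ 'n"
  assumes g: "good g D" and P: "P \<in> std_triangle" "Q \<in> std_triangle" "R \<in> std_triangle"
    and d: "det2 (Q - P) (R - P) \<noteq> 0"
  shows "good (\<lambda>p. g (triangle_param (P, Q, R) p)) (D * \<bar>det2 (Q - P) (R - P)\<bar>)"
proof -
  define L where "L p = fst p *\<^sub>R (Q - P) + snd p *\<^sub>R (R - P)" for p :: "real \<times> real"
  have L: "bounded_linear L" unfolding L_def by (rule bounded_linear_tp)
  have A: "triangle_param (P, Q, R) p = P + L p" for p by (simp add: triangle_param_affine L_def)
  have injL: "inj L"
  proof -
    have "p = 0" if "L p = 0" for p
    proof -
      have 1: "fst p * fst (Q - P) + snd p * fst (R - P) = 0" "fst p * snd (Q - P) + snd p * snd (R - P) = 0"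
        using arg_cong[OF that, of fst] arg_cong[OF that, of snd] by (simp_all add: L_def)
      have e: "fst p * det2 (Q - P) (R - P) = (fst p * fst (Q - P) + snd p * fst (R - P)) * snd (R - P)
          - (fst p * snd (Q - P) + snd p * snd (R - P)) * fst (R - P)"
        "snd p * det2 (Q - P) (R - P) = (fst p * snd (Q - P) + snd p * snd (R - P)) * fst (Q - P)
          - (fst p * fst (Q - P) + snd p * fst (R - P)) * snd (Q - P)"
        unfolding det2_def by algebra+
      have "fst p * det2 (Q - P) (R - P) = 0" "snd p * det2 (Q - P) (R - P) = 0"
        unfolding e 1 by simp_all
      then show ?thesis using d by (simp add: prod_eq_iff)
    qed
    then show ?thesis using linear_injective_0[of L] L bounded_linear.linear by blast
  qed
  have int: "P + L p \<in> interior std_triangle" if p: "p \<in> interior std_triangle" for p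
  proof -
    have "open ((\<lambda>p. P + L p) ` interior std_triangle)"
    proof (rule invariance_of_domain)
      show "continuous_on (interior std_triangle) (\<lambda>p. P + L p)"
        by (intro continuous_intros bounded_linear.continuous_on[OF L])
      show "inj_on (\<lambda>p. P + L p) (interior std_triangle)" using injL by (auto simp: inj_on_def inj_def)
    qed simp
    moreover have "(\<lambda>p. P + L p) ` interior std_triangle \<subseteq> std_triangle"
      using triangle_param_std[OF P] interior_subset unfolding A by blast
    ultimately show ?thesis using p interior_maximal by blast
  qed
  have fr: "frechet_derivative (\<lambda>p. g (P + L p)) (at p) = (\<lambda>v. frechet_derivative g (at (P + L p)) (L v))"
    and lin: "linear (frechet_derivative g (at (P + L p)))"
    if p: "p \<in> interior std_triangle" for p
  proof -
    have "g differentiable (at (P + L p))"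
      using smooth_upto_differentiable int[OF p] g by (auto simp: good_def)
    then have 1: "(g has_derivative frechet_derivative g (at (P + L p))) (at (P + L p))"
      by (simp add: frechet_derivative_works)
    then show "linear (frechet_derivative g (at (P + L p)))" by (rule has_derivative_linear)
    have "((\<lambda>p. P + L p) has_derivative L) (at p)"
      using has_derivative_add[OF has_derivative_const bounded_linear_imp_has_derivative[OF L]] by simp
    from diff_chain_at[OF this 1] show "frechet_derivative (\<lambda>p. g (P + L p)) (at p) = (\<lambda>v. frechet_derivative g (at (P + L p)) (L v))"
      using frechet_derivative_at by (fastforce simp: o_def)
  qed
  show ?thesis
    unfolding good_def A
  proof (intro conjI ballI allI)
    show "0 \<le> D * \<bar>det2 (Q - P) (R - P)\<bar>" using g by (simp add: good_def)
    show "smooth_upto_boundary std_triangle (\<lambda>p. g (P + L p))"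
      using smooth_upto_boundary_affine[of std_triangle g L std_triangle P] g L triangle_param_std[OF P]
      by (simp add: good_def A)
    fix p assume p: "p \<in> interior std_triangle"
    show "omega (frechet_derivative (\<lambda>p. g (P + L p)) (at p) u) (frechet_derivative (\<lambda>p. g (P + L p)) (at p) v) = 0" for u v
      unfolding fr[OF p] using g int[OF p] unfolding good_def by blast
    define u v where "u = frechet_derivative g (at (P + L p)) (1, 0)" and "v = frechet_derivative g (at (P + L p)) (0, 1)"
    have uv: "frechet_derivative g (at (P + L p)) q = fst q *\<^sub>R u + snd q *\<^sub>R v" for q
    proof -
      have "q = fst q *\<^sub>R (1, 0) + snd q *\<^sub>R (0, 1)" by (simp add: prod_eq_iff)
      then show ?thesis unfolding u_def v_def using linear_add[OF lin[OF p]] linear_scale[OF lin[OF p]] by metis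
    qed
    have L10: "L (1, 0) = Q - P" "L (0, 1) = R - P" by (simp_all add: L_def)
    define a b c e where "a = fst (Q - P)" and "b = snd (Q - P)" and "c = fst (R - P)" and "e = snd (R - P)"
    have dd: "det2 (Q - P) (R - P) = a * e - b * c" by (simp add: det2_def a_def b_def c_def e_def)
    have "area_density (\<lambda>p. g (P + L p)) p =
      sqrt (((a *\<^sub>R u + b *\<^sub>R v) \<bullet> (a *\<^sub>R u + b *\<^sub>R v)) * ((c *\<^sub>R u + e *\<^sub>R v) \<bullet> (c *\<^sub>R u + e *\<^sub>R v))
        - ((a *\<^sub>R u + b *\<^sub>R v) \<bullet> (c *\<^sub>R u + e *\<^sub>R v))\<^sup>2)"
      unfolding area_density_def fr[OF p] L10 uv by (simp add: a_def b_def c_def e_def Let_def)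
    also have "((a *\<^sub>R u + b *\<^sub>R v) \<bullet> (a *\<^sub>R u + b *\<^sub>R v)) * ((c *\<^sub>R u + e *\<^sub>R v) \<bullet> (c *\<^sub>R u + e *\<^sub>R v))
        - ((a *\<^sub>R u + b *\<^sub>R v) \<bullet> (c *\<^sub>R u + e *\<^sub>R v))\<^sup>2 = (a * e - b * c)\<^sup>2 * ((u \<bullet> u) * (v \<bullet> v) - (u \<bullet> v)\<^sup>2)"
      unfolding inner_add_left inner_add_right inner_scaleR_left inner_scaleR_right inner_commute[of v u] by algebra
    also have "sqrt \<dots> = \<bar>a * e - b * c\<bar> * area_density g (P + L p)"
      by (simp add: real_sqrt_mult area_density_def u_def v_def Let_def)
    also have "\<dots> \<le> \<bar>a * e - b * c\<bar> * D"
      using g int[OF p] by (intro mult_left_mono) (auto simp: good_def)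
    finally show "area_density (\<lambda>p. g (P + L p)) p \<le> D * \<bar>det2 (Q - P) (R - P)\<bar>" unfolding dd by (simp add: mult.commute)
  qed
qed

section \<open>Barycentric subdivision and glueing\<close>

definition centre :: "real \<times> real" where "centre = (1/3, 1/3)"
definition cpt :: "nat \<Rightarrow> real \<times> real" where
  "cpt k = (if k = 0 then (0,0) else if k = 1 then (1,0) else (0,1))"

definition third :: "nat \<Rightarrow> nat \<Rightarrow> nat" where "third k i = 3 - i - k"

definition pieces :: "(nat \<times> nat) set" where
  "pieces = {(0,1), (0,2), (1,0), (1,2), (2,0), (2,1)}"

lemma pieces_iff: "(k, i) \<in> pieces \<longleftrightarrow> k < 3 \<and> i < 3 \<and> k \<noteq> i"
  by (auto simp: pieces_def less_Suc_eq numeral_3_eq_3 numeral_2_eq_2)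

lemma finite_pieces: "finite pieces" "card pieces = 6" by (auto simp: pieces_def)

lemma third: "(k, i) \<in> pieces \<Longrightarrow> (third k i, i) \<in> pieces \<and> (k, third k i) \<in> pieces \<and>
    third (third k i) i = k \<and> third k (third k i) = i"
  by (auto simp: pieces_def third_def)

lemma third_cases: "(k, i) \<in> pieces \<Longrightarrow> (k', i) \<in> pieces \<Longrightarrow> k' = k \<or> k' = third k i"
  "(k, i) \<in> pieces \<Longrightarrow> (k, i') \<in> pieces \<Longrightarrow> i' = i \<or> i' = third k i"
  by (auto simp: pieces_def third_def)

definition bary :: "nat \<Rightarrow> nat \<Rightarrow> real \<times> real \<Rightarrow> real \<times> real" where
  "bary k i = triangle_param (cpt k, (1/2) *\<^sub>R (cpt k + cpt (third k i)), centre)"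

lemma bary_det: "(k, i) \<in> pieces \<Longrightarrow>
    \<bar>det2 ((1/2) *\<^sub>R (cpt k + cpt (third k i)) - cpt k) (centre - cpt k)\<bar> = 1 / 6"
  by (auto simp: pieces_def third_def det2_def cpt_def centre_def)

lemma bary_corner: "cpt k \<in> std_triangle" "(1/2) *\<^sub>R (cpt k + cpt j) \<in> std_triangle" "centre \<in> std_triangle"
  by (auto simp: cpt_def centre_def std_triangle_def)

lemma bary_std: "p \<in> std_triangle \<Longrightarrow> bary k i p \<in> std_triangle"
  unfolding bary_def by (intro triangle_param_std bary_corner)

text \<open>The side opposite to new colour 0 joins a midpoint to the barycentre, that opposite to
  colour 1 joins a vertex to the barycentre; both are shared within the old triangle. Only the side
  opposite to colour 2, half of an old side, leads out of it.\<close>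

lemma bary_cross0: "(k, i) \<in> pieces \<Longrightarrow> bcol p 0 = 0 \<Longrightarrow> bary (third k i) i p = bary k i p"
  by (cases p) (auto simp: pieces_def third_def bary_def cpt_def centre_def field_simps)

lemma bary_cross1: "(k, i) \<in> pieces \<Longrightarrow> bcol p 1 = 0 \<Longrightarrow> bary k (third k i) p = bary k i p"
  by (cases p) (auto simp: pieces_def third_def bary_def cpt_def centre_def field_simps)

lemma bary_cross2: "(k, i) \<in> pieces \<Longrightarrow> bcol p 2 = 0 \<Longrightarrow> bcol (bary k i p) i = 0"
  by (cases p) (auto simp: pieces_def third_def bary_def cpt_def centre_def bcol_def field_simps)

text \<open>The barycentric subdivision of a coloured triangulation given by involutions \<open>\<alpha> k\<close>: the piece
  \<open>(\<phi>, k, i)\<close> is spanned by the vertex of colour \<open>k\<close>, the midpoint of the side opposite to colour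
  \<open>i\<close> and the barycentre of \<open>\<phi>\<close>; these corners get the colours 0, 1, 2.\<close>

locale flags =
  fixes F :: "'f set" and \<alpha> :: "nat \<Rightarrow> 'f \<Rightarrow> 'f"
  assumes finF: "finite F"
    and clF: "\<And>k x. k < 3 \<Longrightarrow> x \<in> F \<Longrightarrow> \<alpha> k x \<in> F"
    and inF: "\<And>k x. k < 3 \<Longrightarrow> \<alpha> k (\<alpha> k x) = x"
begin

definition X :: "('f \<times> nat \<times> nat) set" where "X = F \<times> pieces"

definition a :: "nat \<Rightarrow> 'f \<times> nat \<times> nat \<Rightarrow> 'f \<times> nat \<times> nat" where
  "a c x = (case x of (\<phi>, k, i) \<Rightarrow> if (k, i) \<in> pieces then
     (if c = 0 then (\<phi>, third k i, i) else if c = 1 then (\<phi>, k, third k i) else (\<alpha> i \<phi>, k, i)) else x)"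

lemma a_simps: assumes "(k, i) \<in> pieces"
  shows "a 0 (\<phi>, k, i) = (\<phi>, third k i, i)" "a 1 (\<phi>, k, i) = (\<phi>, k, third k i)"
    "a (Suc 0) (\<phi>, k, i) = (\<phi>, k, third k i)" "a 2 (\<phi>, k, i) = (\<alpha> i \<phi>, k, i)"
  using assms by (auto simp: a_def)

lemma a_invol: assumes "c < 3" shows "a c (a c x) = x"
proof (cases x)
  case (fields \<phi> k i)
  show ?thesis
  proof (cases "(k, i) \<in> pieces")
    case True
    then have "i < 3" by (simp add: pieces_iff)
    then show ?thesis using True third[OF True] inF unfolding fields a_def by auto
  qed (simp add: fields a_def)
qed

lemma a_closed: assumes "c < 3" "x \<in> X" shows "a c x \<in> X"
proof -
  obtain \<phi> k i where x: "x = (\<phi>, k, i)" "\<phi> \<in> F" "(k, i) \<in> pieces" using assms(2) by (auto simp: X_def)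
  then show ?thesis using third[OF x(3)] clF[of i \<phi>] by (auto simp: a_def X_def pieces_iff)
qed

text \<open>The moves \<open>a 0\<close> and \<open>a 1\<close> stay inside an old triangle, so a
  barycentre determines its triangle.\<close>

lemma inv2: assumes "(\<phi>, k, i) \<in> X" "gvert a 2 y = gvert a 2 (\<phi>, k, i)" shows "fst y = \<phi>"
proof -
  have "orb2 (a 0) (a 1) (\<phi>, k, i) \<subseteq> {y \<in> X. fst y = \<phi>}"
    by (rule orb2_subset) (use assms(1) a_closed in \<open>auto simp: a_def X_def split: if_splits\<close>)
  moreover have "y \<in> orb2 (a 0) (a 1) (\<phi>, k, i)"
    using assms(2) orb2_self[of y "a 0" "a 1"] by (simp add: gvert_def)
  ultimately show ?thesis by blast
qed

text \<open>The midpoint of a side determines the side, hence its triangle up to the involution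
  across that side.\<close>

lemma inv1: assumes "(\<phi>, k, i) \<in> X" "gvert a 1 y = gvert a 1 (\<phi>, k, i)"
  shows "(fst y = \<phi> \<or> fst y = \<alpha> i \<phi>) \<and> snd (snd y) = i"
proof -
  let ?A = "{y \<in> X. (fst y = \<phi> \<or> fst y = \<alpha> i \<phi>) \<and> snd (snd y) = i}"
  have i3: "i < 3" using assms(1) by (auto simp: X_def pieces_iff)
  have "a 0 z \<in> ?A \<and> a 2 z \<in> ?A" if z: "z \<in> ?A" for z
  proof -
    have "a 0 z \<in> X" "a 2 z \<in> X" using a_closed z by auto
    moreover obtain \<psi> l where zz: "z = (\<psi>, l, i)" "(l, i) \<in> pieces" "\<psi> = \<phi> \<or> \<psi> = \<alpha> i \<phi>"
      using z by (cases z) (auto simp: X_def)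
    ultimately show ?thesis using inF[OF i3] by (auto simp: a_simps[OF zz(2)])
  qed
  then have "orb2 (a 0) (a 2) (\<phi>, k, i) \<subseteq> ?A" by (rule orb2_subset[rotated]) (use assms(1) in auto)
  moreover have "y \<in> orb2 (a 0) (a 2) (\<phi>, k, i)"
    using assms(2) orb2_self[of y "a 0" "a 2"] by (simp add: gvert_def)
  ultimately show ?thesis by blast
qed

text \<open>An old vertex determines its colour \<open>k\<close>. The set \<open>B\<close> may be
  any set invariant under the old involutions of the other colours: \<open>UNIV\<close> when only
  the colour matters, a small one when vertices are to be told apart.\<close>

lemma inv0: assumes x: "(\<phi>, k, i) \<in> X" and eq: "gvert a 0 y = gvert a 0 (\<phi>, k, i)"
    and B: "\<phi> \<in> B" "\<And>\<psi> j. \<psi> \<in> B \<Longrightarrow> j < 3 \<Longrightarrow> j \<noteq> k \<Longrightarrow> \<alpha> j \<psi> \<in> B"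
  shows "fst (snd y) = k \<and> fst y \<in> B"
proof -
  let ?A = "{y \<in> X. fst (snd y) = k \<and> fst y \<in> B}"
  have "a 1 z \<in> ?A \<and> a 2 z \<in> ?A" if z: "z \<in> ?A" for z
  proof -
    have 1: "a 1 z \<in> X" "a 2 z \<in> X" using a_closed z by auto
    obtain \<psi> j where zz: "z = (\<psi>, k, j)" "(k, j) \<in> pieces" "\<psi> \<in> B"
      using z by (cases z) (auto simp: X_def)
    then have "\<alpha> j \<psi> \<in> B" using B(2) by (auto simp: pieces_iff)
    then show ?thesis using 1 zz unfolding zz(1) a_simps(2,4)[OF zz(2)] by simp
  qed
  then have "orb2 (a 1) (a 2) (\<phi>, k, i) \<subseteq> ?A" by (rule orb2_subset[rotated]) (use x B in auto)
  moreover have "y \<in> orb2 (a 1) (a 2) (\<phi>, k, i)"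
    using eq orb2_self[of y "a 1" "a 2"] by (simp add: gvert_def)
  ultimately show ?thesis by blast
qed

text \<open>Whatever the involutions, one barycentric subdivision makes triangles and sides
  determined by their vertices; before it, different triangles may well have the same
  vertices.\<close>

sublocale gem X a
proof
  show "finite X" using finF finite_pieces by (simp add: X_def)
  show "a c x \<in> X" if "c < 3" "x \<in> X" for c x using a_closed that .
  show "a c (a c x) = x" if "c < 3" for c x using a_invol that .
  have *: "(\<exists>\<phi> k i. x = (\<phi>, k, i) \<and> (k, i) \<in> pieces \<and> x \<in> X)" if "x \<in> X" for x using that by (auto simp: X_def)
  show "y = x \<or> y = a c x"  if c3: "c < 3" and xX: "x \<in> X" and yX: "y \<in> X" and j: "\<And>j. j < 3 \<Longrightarrow> j \<noteq> c \<Longrightarrow> gvert a j y = gvert a j x" for c x y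
  proof -
    obtain \<phi> k i where x: "x = (\<phi>, k, i)" "(k, i) \<in> pieces" "(\<phi>, k, i) \<in> X" using *[OF xX] by blast
    obtain \<psi> l m where y: "y = (\<psi>, l, m)" "(l, m) \<in> pieces" using *[OF yX] by blast
    have v2: "c \<noteq> 2 \<Longrightarrow> \<psi> = \<phi>" using inv2[OF x(3), of y] j[of 2] x y by simp
    have v1: "c \<noteq> 1 \<Longrightarrow> (\<psi> = \<phi> \<or> \<psi> = \<alpha> i \<phi>) \<and> m = i" using inv1[OF x(3), of y] j[of 1] x y by simp
    have v0: "c \<noteq> 0 \<Longrightarrow> l = k" using inv0[OF x(3), of y UNIV] j[of 0] x y by simp
    consider "c = 0" | "c = 1" | "c = 2" using c3 by linarith
    then show ?thesis
    proof cases
      case 1 then show ?thesis using v1 v2 third_cases(1)[OF x(2), of l] x y a_simps(1)[OF x(2)] by auto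
    next
      case 2 then show ?thesis using v0 v2 third_cases(2)[OF x(2), of m] x y a_simps(2)[OF x(2)] by auto
    next
      case 3 then show ?thesis using v0 v1 x y a_simps(4)[OF x(2)] by auto
    qed
  qed
  show "y = x" if xX: "x \<in> X" and yX: "y \<in> X" and j: "\<And>j. j < 3 \<Longrightarrow> gvert a j y = gvert a j x" for x y
  proof -
    obtain \<phi> k i where x: "x = (\<phi>, k, i)" "(\<phi>, k, i) \<in> X" using *[OF xX] by blast
    show ?thesis using inv2[OF x(2), of y] inv1[OF x(2), of y] inv0[OF x(2), of y UNIV] j[of 0] j[of 1] j[of 2] x
      by (cases y) auto
  qed
qed

text \<open>An old vertex of colour 0 remains one vertex: its orbit lifts to the pieces at that
  corner. This turns the hypothesis \<open>link\<close> of \<open>realization\<close> into equality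
  of boundary vertices.\<close>

lemma vert0_lift:
  assumes "\<psi> \<in> orb2 (\<alpha> 1) (\<alpha> 2) \<phi>"
  shows "gvert a 0 (\<psi>, 0, 2) = gvert a 0 (\<phi>, 0, 2)"
proof -
  have p: "(0, 2) \<in> pieces" "(0, 1) \<in> pieces" "third 0 2 = 1" "third 0 1 = 2" by (auto simp: pieces_def third_def)
  have step: "gvert a 0 (\<alpha> 2 \<psi>, 0, 2) = gvert a 0 (\<psi>, 0, 2)" "gvert a 0 (\<alpha> 1 \<psi>, 0, 2) = gvert a 0 (\<psi>, 0, 2)" for \<psi>
  proof -
    show "gvert a 0 (\<alpha> 2 \<psi>, 0, 2) = gvert a 0 (\<psi>, 0, 2)"
      using vert_cross[of 0 2 "(\<psi>, 0, 2)"] by (simp add: a_simps p)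
    have "gvert a 0 (\<psi>, 0, 1) = gvert a 0 (\<psi>, 0, 2)" for \<psi>
      using vert_cross[of 0 1 "(\<psi>, 0, 2)"] a_simps(2)[OF p(1), of \<psi>] p(3) by simp
    moreover have "gvert a 0 (\<alpha> 1 \<psi>, 0, 1) = gvert a 0 (\<psi>, 0, 1)"
      using vert_cross[of 0 2 "(\<psi>, 0, 1)"] a_simps(4)[OF p(2), of \<psi>] by simp
    ultimately show "gvert a 0 (\<alpha> 1 \<psi>, 0, 2) = gvert a 0 (\<psi>, 0, 2)" by simp
  qed
  have "orb2 (\<alpha> 1) (\<alpha> 2) \<phi> \<subseteq> {\<psi>. gvert a 0 (\<psi>, 0, 2) = gvert a 0 (\<phi>, 0, 2)}"
    by (rule orb2_subset) (use step in auto)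
  then show ?thesis using assms by blast
qed

end

definition xnext :: "nat \<Rightarrow> nat" where "xnext s = (if s = 2 then 0 else s + 1)"
definition xprev :: "nat \<Rightarrow> nat" where "xprev s = (if s = 0 then 2 else s - 1)"

definition midp :: "nat \<Rightarrow> real \<times> real" where "midp s = (1/2) *\<^sub>R (cpt s + cpt (xnext s))"
definition corner :: "nat \<Rightarrow> bool \<Rightarrow> real \<times> real" where "corner s b = cpt (if b then xnext s else s)"

definition side_pt :: "nat \<Rightarrow> real \<Rightarrow> real \<times> real" where
  "side_pt s u = (1 - u) *\<^sub>R cpt s + u *\<^sub>R cpt (xnext s)"

lemma lt3: "s < 3 \<Longrightarrow> s = 0 \<or> s = 1 \<or> s = (2::nat)" by linarith

text \<open>Triangles \<open>g j\<close> (\<open>j \<in> J\<close>) whose sides \<open>(j, s)\<close> are glued in pairs by \<open>\<pi>\<close>, reversing the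
  direction where \<open>\<epsilon>\<close> holds; the sides \<open>\<sigma> i\<close> are left over and form the boundary. The flag
  \<open>(j, s, b)\<close> is the piece of \<open>g j\<close> between the end \<open>b\<close> and the midpoint of side \<open>s\<close>.\<close>

locale glueing =
  fixes J :: "'j set" and g :: "'j \<Rightarrow> real \<times> real \<Rightarrow> complex ^ 'n" and D :: "'j \<Rightarrow> real"
    and \<pi> :: "'j \<times> nat \<Rightarrow> 'j \<times> nat" and \<epsilon> :: "'j \<times> nat \<Rightarrow> bool"
    and m :: nat and \<sigma> :: "nat \<Rightarrow> 'j \<times> nat"
  assumes finJ: "finite J" and goodg: "\<And>j. j \<in> J \<Longrightarrow> good (g j) (D j)"
    and \<pi>J: "\<And>j s. j \<in> J \<Longrightarrow> s < 3 \<Longrightarrow> \<pi> (j, s) \<in> J \<times> {..<3}"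
    and \<pi>\<pi>: "\<And>x. \<pi> (\<pi> x) = x" and \<epsilon>\<pi>: "\<And>x. \<epsilon> (\<pi> x) = \<epsilon> x" and \<epsilon>fix: "\<And>x. \<pi> x = x \<Longrightarrow> \<not> \<epsilon> x"
    and glue: "\<And>j s u. j \<in> J \<Longrightarrow> s < 3 \<Longrightarrow> 0 \<le> u \<Longrightarrow> u \<le> 1 \<Longrightarrow>
      g (fst (\<pi> (j, s))) (side_pt (snd (\<pi> (j, s))) (if \<epsilon> (j, s) then 1 - u else u)) = g j (side_pt s u)"
    and m0: "0 < m"
    and \<sigma>J: "\<And>i. i < m \<Longrightarrow> \<sigma> i \<in> J \<times> {..<3}" and \<sigma>fix: "\<And>i. i < m \<Longrightarrow> \<pi> (\<sigma> i) = \<sigma> i"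
    and \<sigma>inj: "inj_on \<sigma> {..<m}"
    and \<sigma>all: "\<And>x. x \<in> J \<times> {..<3} \<Longrightarrow> \<pi> x = x \<Longrightarrow> \<exists>i<m. x = \<sigma> i"
begin

definition F :: "('j \<times> nat \<times> bool) set" where "F = J \<times> {..<3} \<times> UNIV"

text \<open>The first subdivision, with corner, midpoint and centre coloured 0, 1, 2:
  \<open>\<alpha> 0\<close> exchanges the ends of the side, \<open>\<alpha> 1\<close> passes to the
  other side at the same corner, \<open>\<alpha> 2\<close> crosses the side by the glueing. The
  second subdivision is the one of \<open>flags\<close>.\<close>

definition \<alpha> :: "nat \<Rightarrow> 'j \<times> nat \<times> bool \<Rightarrow> 'j \<times> nat \<times> bool" where
  "\<alpha> c x = (case x of (j, s, b) \<Rightarrow>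
     if c = 0 then (j, s, \<not> b)
     else if c = 1 then (if s < 3 then (j, (if b then xnext s else xprev s), \<not> b) else x)
     else (fst (\<pi> (j, s)), snd (\<pi> (j, s)), if \<epsilon> (j, s) then \<not> b else b))"

lemma xnext_prev: "s < 3 \<Longrightarrow> xnext s < 3 \<and> xprev s < 3 \<and> xnext (xprev s) = s \<and> xprev (xnext s) = s"
  by (auto simp: xnext_def xprev_def)

lemma \<alpha>_simps: "\<alpha> 0 (j, s, b) = (j, s, \<not> b)"
  "s < 3 \<Longrightarrow> \<alpha> 1 (j, s, b) = (j, (if b then xnext s else xprev s), \<not> b)"
  "s < 3 \<Longrightarrow> \<alpha> (Suc 0) (j, s, b) = (j, (if b then xnext s else xprev s), \<not> b)"
  "\<alpha> 2 (j, s, b) = (fst (\<pi> (j, s)), snd (\<pi> (j, s)), if \<epsilon> (j, s) then \<not> b else b)"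
  by (auto simp: \<alpha>_def)

lemma finite_F: "finite F" using finJ by (simp add: F_def)

lemma \<alpha>F: assumes "c < 3" "x \<in> F" shows "\<alpha> c x \<in> F"
proof -
  obtain j s b where x: "x = (j, s, b)" "j \<in> J" "s < 3" using assms(2) by (auto simp: F_def)
  have "\<pi> (j, s) \<in> J \<times> {..<3}" by (rule \<pi>J[OF x(2,3)])
  then show ?thesis using x xnext_prev[OF x(3)] by (auto simp: \<alpha>_def F_def mem_Times_iff)
qed

lemma \<alpha>\<alpha>: "\<alpha> c (\<alpha> c x) = x"
proof (cases x)
  case (fields j s b)
  have p: "(fst (\<pi> (j, s)), snd (\<pi> (j, s))) = \<pi> (j, s)" by simp
  show ?thesis unfolding fields \<alpha>_def using xnext_prev[of s]
    by (auto simp: p \<pi>\<pi> \<epsilon>\<pi>)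
qed

sublocale flags F \<alpha>
  by unfold_locales (use finite_F \<alpha>F \<alpha>\<alpha> in auto)

definition fl :: "'j \<times> nat \<times> bool \<Rightarrow> real \<times> real \<Rightarrow> real \<times> real" where
  "fl x = (case x of (j, s, b) \<Rightarrow> triangle_param (corner s b, midp s, centre))"

definition G :: "'j \<times> nat \<times> bool \<Rightarrow> real \<times> real \<Rightarrow> complex ^ 'n" where
  "G x p = g (fst x) (fl x p)"

lemma fl_corners: "corner s b \<in> std_triangle" "midp s \<in> std_triangle"
  unfolding corner_def midp_def by (rule bary_corner)+

lemma good_G: assumes "x \<in> F" shows "good (G x) (D (fst x) / 6)"
proof -
  obtain j s b where x: "x = (j, s, b)" "j \<in> J" "s < 3" using assms by (auto simp: F_def)
  have d: "\<bar>det2 (midp s - corner s b) (centre - corner s b)\<bar> = 1 / 6"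
    using lt3[OF x(3)] by (auto simp: det2_def midp_def corner_def cpt_def centre_def xnext_def)
  then have "det2 (midp s - corner s b) (centre - corner s b) \<noteq> 0" by auto
  from good_sub[OF goodg[OF x(2)] fl_corners(1) fl_corners(2) bary_corner(3) this]
  moreover have "G x = (\<lambda>p. g j (triangle_param (corner s b, midp s, centre) p))"
    by (simp add: G_def fl_def x fun_eq_iff)
  ultimately show ?thesis unfolding d by (simp add: x)
qed

lemma G_side: assumes "x \<in> F" "u \<in> {0..1}"
  shows "G x (u, 0) = g (fst x) (side_pt (fst (snd x)) (if snd (snd x) then 1 - u / 2 else u / 2))"
proof -
  obtain j s b where x: "x = (j, s, b)" "j \<in> J" "s < 3" using assms by (auto simp: F_def)
  have "fl x (u, 0) = side_pt s (if b then 1 - u / 2 else u / 2)"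
    by (auto simp: x fl_def side_pt_def corner_def midp_def algebra_simps)
       (simp_all flip: scaleR_add_left)
  then show ?thesis by (simp add: G_def x)
qed

lemma compat_G: assumes x: "x \<in> F" and c: "c < 3" and p: "p \<in> std_triangle" "bcol p c = 0"
  shows "G x p = G (\<alpha> c x) p"
proof -
  obtain j s b where xx: "x = (j, s, b)" "j \<in> J" "s < 3" using x by (auto simp: F_def)
  consider "c = 0" | "c = 1" | "c = 2" using c by linarith
  then show ?thesis
  proof cases
    case 1
    then have "fst p + snd p = 1" using p by simp
    then have "fl (j, s, b) p = fl (j, s, \<not> b) p"
      unfolding fl_def by (cases p) (auto simp: algebra_simps simp flip: scaleR_add_left)
    then show ?thesis using 1 by (simp add: G_def xx \<alpha>_simps)
  next
    case 2
    then have "fst p = 0" using p by simp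
    moreover have "corner (if b then xnext s else xprev s) (\<not> b) = corner s b"
      using xnext_prev[OF xx(3)] by (auto simp: corner_def)
    ultimately have "fl (j, s, b) p = fl (\<alpha> 1 (j, s, b)) p"
      using xx(3) by (cases p) (simp add: fl_def \<alpha>_simps)
    moreover have "fst (\<alpha> 1 (j, s, b)) = j" using xx(3) by (simp add: \<alpha>_simps)
    ultimately show ?thesis using 2 by (simp add: G_def xx)
  next
    case 3
    then have p0: "p = (fst p, 0)" using p by (simp add: prod_eq_iff)
    have u: "fst p \<in> {0..1}" using p by (auto simp: std_triangle_def)
    have F2: "\<alpha> 2 x \<in> F" using \<alpha>F[of 2] x by simp
    define w where "w = (if b then 1 - fst p / 2 else fst p / 2)"
    have w: "0 \<le> w" "w \<le> 1" using u by (auto simp: w_def)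
    have "G (\<alpha> 2 x) (fst p, 0) = g j (side_pt s w)"
      using G_side[OF F2 u] glue[OF xx(2,3) w] by (auto simp: xx \<alpha>_simps w_def split: if_splits)
    moreover have "G x (fst p, 0) = g j (side_pt s w)" using G_side[OF x u] by (simp add: xx w_def)
    ultimately show ?thesis using p0 3 by metis
  qed
qed

definition H :: "('j \<times> nat \<times> bool) \<times> nat \<times> nat \<Rightarrow> real \<times> real \<Rightarrow> complex ^ 'n" where
  "H x p = (case x of (\<phi>, k, i) \<Rightarrow> G \<phi> (bary k i p))"

lemma good_H: assumes "x \<in> X" shows "good (H x) (D (fst (fst x)) / 36)"
proof -
  obtain \<phi> k i where x: "x = (\<phi>, k, i)" "\<phi> \<in> F" "(k, i) \<in> pieces" using assms by (auto simp: X_def)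
  note d = bary_det[OF x(3)]
  then have "det2 ((1/2) *\<^sub>R (cpt k + cpt (third k i)) - cpt k) (centre - cpt k) \<noteq> 0" by auto
  from good_sub[OF good_G[OF x(2)] bary_corner(1) bary_corner(2) bary_corner(3) this]
  moreover have "H x = (\<lambda>p. G \<phi> (bary k i p))" by (simp add: H_def x fun_eq_iff)
  ultimately show ?thesis unfolding d by (simp add: bary_def x)
qed

lemma compat_H: assumes x: "x \<in> X" and c: "c < 3" and p: "p \<in> std_triangle" "bcol p c = 0"
  shows "H x p = H (a c x) p"
proof -
  obtain \<phi> k i where xx: "x = (\<phi>, k, i)" "\<phi> \<in> F" "(k, i) \<in> pieces" using x by (auto simp: X_def)
  consider "c = 0" | "c = 1" | "c = 2" using c by linarith
  then show ?thesis
  proof cases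
    case 1 then show ?thesis using bary_cross0[OF xx(3)] p by (simp add: H_def xx a_simps)
  next
    case 2 then show ?thesis using bary_cross1[OF xx(3)] p by (simp add: H_def xx a_simps)
  next
    case 3
    have "i < 3" using xx(3) by (simp add: pieces_iff)
    then show ?thesis
      using compat_G[OF xx(2) _ bary_std[OF p(1)] bary_cross2[OF xx(3)]] p 3 xx(3)
      by (simp add: H_def xx a_simps)
  qed
qed

text \<open>Each boundary side contributes four boundary edges of the subdivision.\<close>

definition be :: "nat \<Rightarrow> ('j \<times> nat \<times> bool) \<times> nat \<times> nat" where
  "be n = ((fst (\<sigma> (n div 4)), snd (\<sigma> (n div 4)), 2 \<le> n mod 4), if n mod 4 = 0 \<or> n mod 4 = 3 then 0 else 1, 2)"

text \<open>Boundary vertices alternate between colour 0, the ends and midpoints of sides, and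
  colour 1, the quarter points; the index \<open>4 * m\<close> is reset to 0 to close the
  cycle.\<close>

definition bv :: "nat \<Rightarrow> nat \<times> (('j \<times> nat \<times> bool) \<times> nat \<times> nat) set" where
  "bv n = gvert a (if even n then 0 else 1) (be (if n = 4 * m then 0 else n))"

definition fs :: "nat \<Rightarrow> bool \<Rightarrow> 'j \<times> nat \<times> bool" where "fs i b = (fst (\<sigma> i), snd (\<sigma> i), b)"

lemma fsF: "i < m \<Longrightarrow> fs i b \<in> F" using \<sigma>J[of i] by (auto simp: fs_def F_def mem_Times_iff)

lemma \<alpha>_fs: "i < m \<Longrightarrow> \<alpha> 2 (fs i b) = fs i b" "\<alpha> 0 (fs i b) = fs i (\<not> b)"
  using \<sigma>fix[of i] \<epsilon>fix[of "\<sigma> i"] by (auto simp: fs_def \<alpha>_simps)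

lemma fs_inj: "i < m \<Longrightarrow> i' < m \<Longrightarrow> fs i b = fs i' b' \<longleftrightarrow> i = i' \<and> b = b'"
  using inj_onD[OF \<sigma>inj, of i i'] by (auto simp: fs_def prod_eq_iff)

lemma div_mod_4: "r < 4 \<Longrightarrow> (4 * i + r) div 4 = i \<and> (4 * i + r) mod 4 = (r :: nat)"
  by simp

lemma be_simps:
  "be (4 * i) = (fs i False, 0, 2)" "be (4 * i + 1) = (fs i False, 1, 2)"
  "be (4 * i + 2) = (fs i True, 1, 2)" "be (4 * i + 3) = (fs i True, 0, 2)"
  using div_mod_4[of 0 i] div_mod_4[of 1 i] div_mod_4[of 2 i] div_mod_4[of 3 i]
  by (simp_all only: be_def fs_def; simp)+

lemma be_cases: fixes n :: nat obtains i where "n = 4 * i" | i where "n = 4 * i + 1" | i where "n = 4 * i + 2" | i where "n = 4 * i + 3"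
proof -
  have "n = 4 * (n div 4) + n mod 4" by simp
  moreover have "n mod 4 = 0 \<or> n mod 4 = 1 \<or> n mod 4 = 2 \<or> n mod 4 = 3" by linarith
  ultimately show ?thesis using that by (metis add.right_neutral)
qed

lemma p2: "(0, 2) \<in> pieces" "(1, 2) \<in> pieces" "third 0 2 = 1" "third 1 2 = 0"  "third 1 0 = 2" "third 1 2 = 0" "(1, 0) \<in> pieces"
  by (auto simp: pieces_def third_def)

text \<open>By \<open>link\<close>, consecutive boundary sides meet in a vertex of the glued
  complex; by \<open>sep\<close>, the initial vertices of different boundary sides remain distinct.
  Together they make the boundary a single embedded circle.\<close>

lemma realization:
  fixes \<tau> :: "nat \<Rightarrow> real"
  assumes link: "\<And>i. i < m \<Longrightarrow> fs (if Suc i = m then 0 else Suc i) False \<in> orb2 (\<alpha> 1) (\<alpha> 2) (fs i True)"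
    and sep: "\<And>i i'. i < m \<Longrightarrow> i' < m \<Longrightarrow> fs i' False \<in> orb2 (\<alpha> 1) (\<alpha> 2) (fs i False) \<Longrightarrow> i' = i"
    and \<tau>: "\<tau> 0 = 0" "\<tau> m = 1" "\<And>i. i < m \<Longrightarrow> \<tau> i < \<tau> (Suc i)"
  shows "\<exists>(K :: ((real ^ 5) \<times> (real ^ 5) \<times> (real ^ 5)) set) f h. piecewise_smooth_surface K f \<and> isotropic K f \<and>
    area K f \<le> (\<Sum>j\<in>J. D j / 2) \<and> simple_path h \<and> pathfinish h = pathstart h \<and>
    path_image h = surface_boundary (carrier_of K) \<and>
    (\<forall>i<m. \<forall>v\<in>{0..1}. f (h ((1 - v) * \<tau> i + v * \<tau> (Suc i))) = g (fst (\<sigma> i)) (side_pt (snd (\<sigma> i)) v))"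
proof -
  have beX: "be n \<in> X" if "n < 4 * m" for n
  proof -
    have "n div 4 < m" using that by linarith
    then show ?thesis using fsF[of "n div 4"] by (auto simp: be_def fs_def X_def pieces_def)
  qed
  have v1: "gvert a (Suc 0) (fs i b, 0, 2) = gvert a (Suc 0) (fs i b, 1, 2)" for i b
    using vert_cross[of 1 0 "(fs i b, 0, 2)"] a_simps(1)[OF p2(1)] p2(3) by simp
  have E: "gvert a 0 (fs i True, 1, 2) = gvert a 0 (fs i False, 1, 2)" for i
  proof -
    have s: "gvert a 0 (fs i b, 1, 0) = gvert a 0 (fs i b, 1, 2)" for b
      using vert_cross[of 0 1 "(fs i b, 1, 2)"] a_simps(2)[OF p2(2)] p2 by simp
    have "gvert a 0 (\<alpha> 0 (fs i False), 1, 0) = gvert a 0 (fs i False, 1, 0)"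
      using vert_cross[of 0 2 "(fs i False, 1, 0)"] a_simps(4)[OF p2(7)] by simp
    then show ?thesis using s by (simp add: \<alpha>_fs)
  qed
  have nxt: "gvert a 0 (fs i True, 0, 2) = gvert a 0 (fs (if Suc i = m then 0 else Suc i) False, 0, 2)" if "i < m" for i
    using vert0_lift[OF link[OF that]] by simp
  have bvn: "bv k = gvert a (if even k then 0 else 1) (be k)" if "k \<noteq> 4 * m" for k
    using that by (simp add: bv_def)
  have e: "bv (Suc n) = gvert a (if even n then 1 else 0) (be n)" if n: "n < 4 * m" for n
  proof (cases rule: be_cases[of n])
    case (1 i)
    then have ne: "Suc n \<noteq> 4 * m" and s: "Suc n = 4 * i + 1" by presburger+
    show ?thesis unfolding bvn[OF ne] unfolding s unfolding 1 be_simps using v1 by simp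
  next
    case (2 i)
    then have ne: "Suc n \<noteq> 4 * m" and s: "Suc n = 4 * i + 2" by presburger+
    show ?thesis unfolding bvn[OF ne] unfolding s unfolding 2 be_simps using E by simp
  next
    case (3 i)
    then have ne: "Suc n \<noteq> 4 * m" and s: "Suc n = 4 * i + 3" by presburger+
    show ?thesis unfolding bvn[OF ne] unfolding s unfolding 3 be_simps using v1 by simp
  next
    case (4 i)
    then have "i < m" "Suc n = 4 * Suc i" using n by auto
    have "bv (4 * Suc i) = gvert a 0 (fs (if Suc i = m then 0 else Suc i) False, 0, 2)"
      using be_simps(1)[of 0] be_simps(1)[of "Suc i"] unfolding bv_def by simp
    then show ?thesis using nxt[OF \<open>i < m\<close>] unfolding \<open>Suc n = 4 * Suc i\<close> unfolding 4 be_simps by simp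
  qed
  have gm: "gem_map X a H (\<lambda>x. D (fst (fst x)) / 36) (4 * m) be (\<lambda>_. 2) (\<lambda>n. if even n then 0 else 1) (\<lambda>n. if even n then 1 else 0) bv"
  proof
    show "good (H x) (D (fst (fst x)) / 36)" if "x \<in> X" for x by (rule good_H[OF that])
    show "H x p = H (a k x) p" if "x \<in> X" "k < 3" "p \<in> std_triangle" "bcol p k = 0" for x k p by (rule compat_H[OF that])
    show "3 \<le> 4 * m" using m0 by simp
    show "be n \<in> X" if "n < 4 * m" for n using beX that .
    show "a 2 (be n) = be n" if n: "n < 4 * m" for n
    proof -
      have "n div 4 < m" using n by linarith
      then show ?thesis using \<alpha>_fs(1)[of "n div 4"] beX[OF n] unfolding be_def fs_def[symmetric]
        by (auto simp: X_def a_simps)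
    qed
    show "gvert a (if even n then 0 else 1) (be n) = bv n" if "n < 4 * m" for n
      using that by (simp add: bv_def)
    show "gvert a (if even n then 1 else 0) (be n) = bv (Suc n)" if "n < 4 * m" for n using e[OF that] by simp
    show "bv (4 * m) = bv 0" by (simp add: bv_def)
    show "\<exists>n<4 * m. x = be n \<and> k = 2" if x: "x \<in> X" "k < 3" "a k x = x" for x k
    proof -
      obtain j s b l i where xx: "x = ((j, s, b), l, i)" "(j, s, b) \<in> F" "(l, i) \<in> pieces" using x(1) by (auto simp: X_def)
      have k2: "k = 2" using x(2,3) xx(3) by (auto simp: xx a_def pieces_def third_def split: if_splits dest!: lt3)
      then have fx: "\<alpha> i (j, s, b) = (j, s, b)" using x(3) a_simps(4)[OF xx(3)] by (simp add: xx)
      then have i2: "i = 2" using xx(2,3) by (auto simp: \<alpha>_def F_def pieces_def split: if_splits)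
      then have "\<pi> (j, s) = (j, s)" using fx by (auto simp: \<alpha>_simps prod_eq_iff)
      then obtain r where r: "r < m" "(j, s) = \<sigma> r" using \<sigma>all[of "(j, s)"] xx(2) by (auto simp: F_def)
      then have fr: "(j, s, b) = fs r b" by (simp add: fs_def flip: r(2))
      have l: "l = 0 \<or> l = 1" using xx(3) i2 by (auto simp: pieces_def)
      define n where "n = 4 * r + (if b then (if l = 0 then 3 else 2) else l)"
      have "n < 4 * m" using r(1) l by (auto simp: n_def)
      moreover have "x = be n" using l fr i2 be_simps[of r] by (auto simp: n_def xx)
      ultimately show ?thesis using k2 by blast
    qed
    show "inj_on bv {..<4 * m}"
    proof (rule inj_onI)
      fix n n' assume nn: "n \<in> {..<4 * m}" "n' \<in> {..<4 * m}" and eq: "bv n = bv n'"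
      have par: "even n = even n'" using arg_cong[OF eq, of fst] nn by (auto simp: bv_def split: if_splits)
      have eqv: "gvert a (if even n then 0 else 1) (be n') = gvert a (if even n then 0 else 1) (be n)"
        using eq nn par by (auto simp: bv_def)
      define i i' b b' where "i = n div 4" and "i' = n' div 4" and "b = (2 \<le> n mod 4)" and "b' = (2 \<le> n' mod 4)"
      have im: "i < m" "i' < m" using nn by (auto simp: i_def i'_def)
      have be_n: "be n = (fs i b, if n mod 4 = 0 \<or> n mod 4 = 3 then 0 else 1, 2)"
        "be n' = (fs i' b', if n' mod 4 = 0 \<or> n' mod 4 = 3 then 0 else 1, 2)"
        by (simp_all add: be_def fs_def i_def i'_def b_def b'_def)
      have same: "n = n'" if "i' = i" "b' = b"
      proof -
        have "n mod 4 = n' mod 4" using that(2) par unfolding b_def b'_def by presburger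
        then show ?thesis using that(1) mult_div_mod_eq[of 4 n] mult_div_mod_eq[of 4 n'] by (simp add: i_def i'_def)
      qed
      \<comment> \<open>A quarter point lies in a single flag, since \<open>\<alpha> 2\<close> fixes
        the flags on the boundary.\<close>
      have key: "n = n'" if ev: "\<not> even n"
      proof -
        have "(fs i b, if n mod 4 = 0 \<or> n mod 4 = 3 then 0 else 1, 2) \<in> X" using beX[of n] nn be_n by simp
        from inv1[OF this, of "be n'"] have "fst (be n') = fs i b \<or> fst (be n') = \<alpha> 2 (fs i b)"
          using eqv ev be_n by simp
        then have "fs i' b' = fs i b" using \<alpha>_fs(1)[OF im(1)] be_n by simp
        then show ?thesis using fs_inj[OF im(2,1)] same by blast
      qed
      have key2: "n = n'" if ev: "even n"
      proof -
        have bn: "be n = (fs i b, if b then 1 else 0, 2)" "be n' = (fs i' b', if b' then 1 else 0, 2)"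
        proof -
          have "even n'" using par ev by simp
          then have "(n mod 4 = 0 \<or> n mod 4 = 3) = (\<not> b)" "(n' mod 4 = 0 \<or> n' mod 4 = 3) = (\<not> b')"
            using ev unfolding b_def b'_def by presburger+
          then show "be n = (fs i b, if b then 1 else 0, 2)" "be n' = (fs i' b', if b' then 1 else 0, 2)"
            using be_n by simp_all
        qed
        have eq0: "gvert a 0 (be n') = gvert a 0 (fs i b, if b then 1 else 0, 2)" using eqv ev bn by simp
        have X1: "(fs i b, if b then 1 else 0, 2) \<in> X" using beX[of n] nn bn by simp
        have bb: "b' = b" using inv0[OF X1 eq0, of UNIV] by (auto simp: bn split: if_splits)
        show ?thesis
        proof (cases b)
          case True
          \<comment> \<open>Here the vertex is the midpoint of a boundary side, whose two flags form
            a set invariant under \<open>\<alpha> 0\<close> and \<open>\<alpha> 2\<close>.\<close>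
          have "fst (be n') \<in> {fs i True, fs i False}"
          proof (rule conjunct2[OF inv0[OF X1 eq0]])
            show "fs i b \<in> {fs i True, fs i False}" using True by simp
            fix \<psi> j assume \<psi>: "\<psi> \<in> {fs i True, fs i False}" and j: "j < 3" "j \<noteq> (if b then 1 else 0 :: nat)"
            have "j = 0 \<or> j = 2" using j True lt3[of j] by auto
            then show "\<alpha> j \<psi> \<in> {fs i True, fs i False}"
              using \<psi> \<alpha>_fs(1)[OF im(1)] \<alpha>_fs(2) by (elim disjE insertE) simp_all
          qed
          then have "i' = i" using bn bb True fs_inj[OF im(2,1)] by auto
          then show ?thesis using same bb by blast
        next
          case False
          \<comment> \<open>Here the vertex is the initial corner of the side, and
            \<open>sep\<close> tells such corners apart.\<close>
          have "fst (be n') \<in> orb2 (\<alpha> 1) (\<alpha> 2) (fs i False)"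
          proof (rule conjunct2[OF inv0[OF X1 eq0]])
            show "fs i b \<in> orb2 (\<alpha> 1) (\<alpha> 2) (fs i False)" using False orb2_self by simp
            fix \<psi> j assume psi: "\<psi> \<in> orb2 (\<alpha> 1) (\<alpha> 2) (fs i False)" and j: "j < 3" "j \<noteq> (if b then 1 else 0 :: nat)"
            have "j = 1 \<or> j = 2" using j False lt3[of j] by auto
            then show "\<alpha> j \<psi> \<in> orb2 (\<alpha> 1) (\<alpha> 2) (fs i False)"
              using orb2_step[OF psi] by (elim disjE) simp_all
          qed
          then have "i' = i" using sep[OF im] bn bb False by simp
          then show ?thesis using same bb by blast
        qed
      qed
      show "n = n'" using key key2 by blast
    qed
  qed auto
  interpret gm: gem_map X a H "\<lambda>x. D (fst (fst x)) / 36" "4 * m" be "\<lambda>_. 2" "\<lambda>n. if even n then 0 else 1" "\<lambda>n. if even n then 1 else 0" bv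
    by (rule gm)
  define T where "T n = \<tau> (n div 4) + (n mod 4) / 4 * (\<tau> (Suc (n div 4)) - \<tau> (n div 4))" for n
  have T0: "T 0 = 0" "T (4 * m) = 1" using \<tau> by (auto simp: T_def)
  have T4: "T (4 * i + r) = \<tau> i + r / 4 * (\<tau> (Suc i) - \<tau> i)" if "r \<le> 4" for i r
    using that by (cases "r = 4") (auto simp: T_def)
  have T1: "T n < T (Suc n)" if "n < 4 * m" for n
  proof -
    obtain i r where ir: "n = 4 * i + r" "r < 4" by (metis mod_less_divisor mult_div_mod_eq zero_less_numeral)
    then have "i < m" using that by linarith
    then have "0 < \<tau> (Suc i) - \<tau> i" using \<tau>(3) by simp
    then have "real r / 4 * (\<tau> (Suc i) - \<tau> i) < real (Suc r) / 4 * (\<tau> (Suc i) - \<tau> i)"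
      by (intro mult_strict_right_mono) auto
    then show ?thesis using T4[of r i] T4[of "Suc r" i] ir by simp
  qed
  obtain h where h: "simple_path h" "pathfinish h = pathstart h" "path_image h = surface_boundary (carrier_of (Tri ` X))"
    "\<And>n u. n < 4 * m \<Longrightarrow> 0 \<le> u \<Longrightarrow> u \<le> 1 \<Longrightarrow> gm.f (h ((1 - u) * T n + u * T (Suc n))) =
      H (be n) (ept (if even n then 0 else 1) (if even n then 1 else 0) u)"
    using gm.boundary_loop[OF T0 T1] by blast
  \<comment> \<open>Each triangle has six flags with six pieces each, and every piece has the bound
    \<open>D j / 36\<close>.\<close>
  have "(\<Sum>x\<in>X. D (fst (fst x)) / 36 / 2) = (\<Sum>j\<in>J. \<Sum>s\<in>{..<3::nat}. \<Sum>b\<in>(UNIV :: bool set). \<Sum>q\<in>pieces. D j / 36 / 2)"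
  proof -
    have XX: "X = (J \<times> {..<3} \<times> UNIV) \<times> pieces" unfolding X_def unfolding F_def by (rule refl)
    show ?thesis unfolding XX by (simp only: sum.cartesian_product' fst_conv)
  qed
  also have "\<dots> = (\<Sum>j\<in>J. D j / 2)" by (simp add: finite_pieces UNIV_bool)
  finally have ar: "(\<Sum>x\<in>X. D (fst (fst x)) / 36 / 2) = (\<Sum>j\<in>J. D j / 2)" .
  have main: "gm.f (h ((1 - v) * \<tau> i + v * \<tau> (Suc i))) = g (fst (\<sigma> i)) (side_pt (snd (\<sigma> i)) v)"
    if i: "i < m" and v: "0 \<le> v" "v \<le> 1" for i v
  proof -
    \<comment> \<open>The quarter of the side that contains \<open>v\<close>; the end
      \<open>v = 1\<close> is put into the last quarter.\<close>
    define r where "r = (if v = 1 then 3 else nat \<lfloor>4 * v\<rfloor>)"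
    define u where "u = 4 * v - real r"
    have r: "r \<le> 3" "0 \<le> u" "u \<le> 1"
    proof -
      have "\<lfloor>4 * v\<rfloor> \<le> 3" if "v \<noteq> 1"
      proof -
        have "4 * v < 4" using v that by simp
        then show ?thesis by linarith
      qed
      then show "r \<le> 3" by (auto simp: r_def nat_le_iff)
      show "0 \<le> u" "u \<le> 1" using v by (auto simp: u_def r_def) linarith+
    qed
    have vv: "v = (r + u) / 4" by (simp add: u_def)
    let ?n = "4 * i + r"
    have n: "?n < 4 * m" using i r by linarith
    have "(1 - u) * T ?n + u * T (Suc ?n) = (1 - v) * \<tau> i + v * \<tau> (Suc i)"
    proof -
      have "T ?n = \<tau> i + real r / 4 * (\<tau> (Suc i) - \<tau> i)" "T (Suc ?n) = \<tau> i + (real r + 1) / 4 * (\<tau> (Suc i) - \<tau> i)"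
        using T4[of r i] T4[of "Suc r" i] r(1) by simp_all
      then show ?thesis unfolding vv by (simp only:) (simp add: field_simps)
    qed
    then have 1: "gm.f (h ((1 - v) * \<tau> i + v * \<tau> (Suc i))) = H (be ?n) (ept (if even ?n then 0 else 1) (if even ?n then 1 else 0) u)"
      using h(4)[OF n r(2,3)] by simp
    have f: "fl (fs i b) p = triangle_param (corner (snd (\<sigma> i)) b, midp (snd (\<sigma> i)), centre) p" for b p
      by (simp add: fl_def fs_def)
    have G: "G (fs i b) (w, 0) = g (fst (\<sigma> i)) (side_pt (snd (\<sigma> i)) (if b then 1 - w / 2 else w / 2))" if "w \<in> {0..1}" for b w
      using G_side[OF fsF[OF i] that, of b] by (simp add: fs_def)
    have b0: "bary 0 2 (u, 0) = (u / 2, 0)" "bary 0 2 (ept 0 1 u) = (u / 2, 0)" "bary 0 2 (ept 1 0 u) = ((1 - u) / 2, 0)"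
      "bary 1 2 (ept 0 1 u) = (1 - u / 2, 0)" "bary 1 2 (ept 1 0 u) = ((1 + u) / 2, 0)" for u
      by (simp_all add: bary_def ept_def cpt_def third_def centre_def field_simps)
    have "r = 0 \<or> r = 1 \<or> r = 2 \<or> r = 3" using r(1) by linarith
    then have "H (be ?n) (ept (if even ?n then 0 else 1) (if even ?n then 1 else 0) u) = g (fst (\<sigma> i)) (side_pt (snd (\<sigma> i)) v)"
    proof (elim disjE)
      assume "r = 0" then show ?thesis using r G[of "u / 2" False] be_simps(1)[of i] b0 by (simp add: H_def vv)
    next
      assume "r = 1" then show ?thesis using r G[of "(1 + u) / 2" False] be_simps(2)[of i] b0 by (simp add: H_def vv)
    next
      assume "r = 2" then show ?thesis using r G[of "1 - u / 2" True] be_simps(3)[of i] b0 by (simp add: H_def vv field_simps)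
    next
      assume "r = 3" then show ?thesis using r G[of "(1 - u) / 2" True] be_simps(4)[of i] b0 by (simp add: H_def vv field_simps)
    qed
    then show ?thesis using 1 by simp
  qed
  show ?thesis
    using gm.f_surface gm.f_isotropic gm.f_area h(1-3) main unfolding ar
    by (intro exI[of _ "Tri ` X"] exI[of _ gm.f] exI[of _ h]) auto
qed

end

section \<open>Isotropic chains modulo 2\<close>

lemma C_on_linear:
  assumes L: "bounded_linear L" and U: "open U" and f: "C_on k U f"
  shows "C_on k U (\<lambda>x. L (f x))"
  using f
proof (induction k arbitrary: f)
  case 0 then show ?case by (simp add: bounded_linear.continuous_on[OF L])
next
  case (Suc k)
  have der: "((\<lambda>x. L (f x)) has_derivative (\<lambda>v. L (frechet_derivative f (at x) v))) (at x)" if "x \<in> U" for x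
    by (rule bounded_linear.has_derivative[OF L]) (use Suc.prems that in \<open>simp add: frechet_derivative_works\<close>)
  have fr: "frechet_derivative (\<lambda>x. L (f x)) (at x) = (\<lambda>v. L (frechet_derivative f (at x) v))" if "x \<in> U" for x
    using frechet_derivative_at[OF der[OF that]] by simp
  have "C_on k U (\<lambda>x. frechet_derivative (\<lambda>x. L (f x)) (at x) v)" for v
    by (rule C_on_cong[OF U _ Suc.IH[of "\<lambda>y. frechet_derivative f (at y) v"]]) (use fr Suc.prems in auto)
  then show ?case using der by (auto intro: differentiableI)
qed

lemma C_on_plus:
  assumes U: "open U" and f: "C_on k U f" "C_on k U g"
  shows "C_on k U (\<lambda>x. f x + g x)"
  using f
proof (induction k arbitrary: f g)
  case 0 then show ?case by (simp add: continuous_on_add)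
next
  case (Suc k)
  have der: "((\<lambda>x. f x + g x) has_derivative (\<lambda>v. frechet_derivative f (at x) v + frechet_derivative g (at x) v)) (at x)" if "x \<in> U" for x
    by (rule has_derivative_add) (use Suc.prems that in \<open>simp_all add: frechet_derivative_works\<close>)
  have fr: "frechet_derivative (\<lambda>x. f x + g x) (at x) = (\<lambda>v. frechet_derivative f (at x) v + frechet_derivative g (at x) v)" if "x \<in> U" for x
    using frechet_derivative_at[OF der[OF that]] by simp
  have "C_on k U (\<lambda>x. frechet_derivative (\<lambda>x. f x + g x) (at x) v)" for v
    by (rule C_on_cong[OF U _ Suc.IH[of "\<lambda>y. frechet_derivative f (at y) v" "\<lambda>y. frechet_derivative g (at y) v"]])
      (use fr Suc.prems in auto)
  then show ?case using der by (auto intro: differentiableI)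
qed

lemma C_on_const: "C_on k U (\<lambda>x. c)"
  by (induction k arbitrary: c) (auto simp: frechet_derivative_const)

lemma C_on_affine_map: "bounded_linear L \<Longrightarrow> C_on k U (\<lambda>x. c + L x)"
proof -
  assume L: "bounded_linear L"
  have der: "((\<lambda>x. c + L x) has_derivative L) (at x)" for x
    using has_derivative_add[OF has_derivative_const bounded_linear_imp_has_derivative[OF L]] by simp
  then have fr: "frechet_derivative (\<lambda>x. c + L x) (at x) = L" for x using frechet_derivative_at by metis
  show ?thesis
  proof (cases k)
    case 0
    then show ?thesis by (auto intro!: continuous_intros bounded_linear.continuous_on[OF L])
  qed (use der fr in \<open>auto intro: differentiableI C_on_const\<close>)
qed

lemma omega_lin:
  "omega (h *\<^sub>R x + k *\<^sub>R y) (h' *\<^sub>R x + k' *\<^sub>R y) = (h * k' - k * h') * omega x y"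
  unfolding omega_def sum_distrib_left by (rule sum.cong[OF refl]) (simp add: algebra_simps)

lemma interior_std_triangle_bounds:
  assumes "p \<in> interior std_triangle" shows "0 < fst p" "0 < snd p" "fst p + snd p < 1"
proof -
  have "std_triangle \<subseteq> {p. (1, 0) \<bullet> p \<ge> (0::real)}" "std_triangle \<subseteq> {p. (0, 1) \<bullet> p \<ge> (0::real)}"
    "std_triangle \<subseteq> {p. (1, 1) \<bullet> p \<le> (1::real)}" by (auto simp: std_triangle_def inner_prod_def)
  from this[THEN interior_mono] have
    "p \<in> interior {p. (1, 0) \<bullet> p \<ge> (0::real)}" "p \<in> interior {p. (0, 1) \<bullet> p \<ge> (0::real)}"
    "p \<in> interior {p. (1, 1) \<bullet> p \<le> (1::real)}" using assms by blast+
  moreover have "interior {p. (1, 0) \<bullet> p \<ge> (0::real)} = {p :: real \<times> real. (1, 0) \<bullet> p > 0}"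
    "interior {p. (0, 1) \<bullet> p \<ge> (0::real)} = {p :: real \<times> real. (0, 1) \<bullet> p > 0}"
    by (rule interior_halfspace_ge, simp add: zero_prod_def)+
  moreover have "interior {p. (1, 1) \<bullet> p \<le> (1::real)} = {p :: real \<times> real. (1, 1) \<bullet> p < 1}"
    by (rule interior_halfspace_le) (simp add: zero_prod_def)
  ultimately show "0 < fst p" "0 < snd p" "fst p + snd p < 1" by (simp_all only:) (simp_all add: inner_prod_def)
qed

text \<open>The speed is bounded on the open interval only, because the derivative at an end point
  depends on values of \<gamma> outside the unit interval.\<close>

definition sarc :: "(real \<Rightarrow> 'a::real_normed_vector) \<Rightarrow> real \<Rightarrow> bool" where
  "sarc \<gamma> M \<longleftrightarrow> smooth_upto_boundary {0..1} \<gamma> \<and> (\<forall>t\<in>{0<..<1}. norm (vector_derivative \<gamma> (at t)) \<le> M)"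

text \<open>The tangent planes are spanned by a vector in the range of \<open>A\<close> and one in
  the range of \<open>B\<close>, hence isotropic. The first curve is run backwards so that the side
  \<open>(1 - u, u)\<close> of the parameter triangle becomes the diagonal
  \<open>A (\<gamma> u) + B (\<delta> u)\<close>.\<close>

lemma good_product:
  fixes A B :: "'x::real_normed_vector \<Rightarrow> complex ^ 'n"
  assumes A: "bounded_linear A" and B: "bounded_linear B" and AB: "\<And>x y. omega (A x) (B y) = 0"
    and a: "\<And>x. norm (A x) \<le> a * norm x" "0 \<le> a" and b: "\<And>x. norm (B x) \<le> b * norm x" "0 \<le> b"
    and g: "sarc \<gamma> M" and d: "sarc \<delta> N" "0 \<le> M" "0 \<le> N"
  shows "good (\<lambda>q. p + A (\<gamma> (1 - fst q)) + B (\<delta> (snd q))) (a * M * (b * N))"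
proof -
  obtain U g1 where g1: "{0..1} \<subseteq> U" "open U" "\<And>k. C_on k U g1" "\<And>x. x \<in> {0..1} \<Longrightarrow> g1 x = \<gamma> x"
    using g unfolding sarc_def smooth_upto_boundary_def smooth_on_open_def by blast
  obtain U' d1 where d1: "{0..1} \<subseteq> U'" "open U'" "\<And>k. C_on k U' d1" "\<And>x. x \<in> {0..1} \<Longrightarrow> d1 x = \<delta> x"
    using d unfolding sarc_def smooth_upto_boundary_def smooth_on_open_def by blast
  have l1: "bounded_linear (\<lambda>q :: real \<times> real. - fst q)" by (intro bounded_linear_minus bounded_linear_fst)
  let ?V1 = "(\<lambda>q :: real \<times> real. 1 + - fst q) -` U" and ?V2 = "(\<lambda>q :: real \<times> real. 0 + snd q) -` U'"
  have o1: "open ?V1" "open ?V2" by (rule open_vimage, fact, intro continuous_intros)+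
  have c1: "C_on k ?V1 (\<lambda>q. g1 (1 + - fst q))" for k by (rule C_on_affine[OF l1 g1(2,3)])
  have c2: "C_on k ?V2 (\<lambda>q. d1 (0 + snd q))" for k by (rule C_on_affine[OF bounded_linear_snd d1(2,3)])
  have cA: "C_on k (?V1 \<inter> ?V2) (\<lambda>q. A (g1 (1 + - fst q)))" for k
    by (rule C_on_linear[OF A _ C_on_subset[OF c1]]) (use o1 in auto)
  have cB: "C_on k (?V1 \<inter> ?V2) (\<lambda>q. B (d1 (0 + snd q)))" for k
    by (rule C_on_linear[OF B _ C_on_subset[OF c2]]) (use o1 in auto)
  have cG: "C_on k (?V1 \<inter> ?V2) (\<lambda>q. p + A (g1 (1 + - fst q)) + B (d1 (0 + snd q)))" for k
    by (intro C_on_plus C_on_const cA cB) (use o1 in auto)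
  have inn: "1 - fst q \<in> {0..1}" "snd q \<in> {0..1}" if "q \<in> std_triangle" for q
    using that by (auto simp: std_triangle_def)
  have sm: "smooth_upto_boundary std_triangle (\<lambda>q. p + A (\<gamma> (1 - fst q)) + B (\<delta> (snd q)))"
    unfolding smooth_upto_boundary_def smooth_on_open_def
  proof (intro exI conjI allI ballI)
    show "std_triangle \<subseteq> ?V1 \<inter> ?V2" using inn subsetD[OF g1(1)] subsetD[OF d1(1)] by (intro subsetI IntI vimageI2) simp_all
    show "open (?V1 \<inter> ?V2)" using o1 by auto
    show "C_on k (?V1 \<inter> ?V2) (\<lambda>q. p + A (g1 (1 + - fst q)) + B (d1 (0 + snd q)))" for k by (rule cG)
    show "p + A (g1 (1 + - fst q)) + B (d1 (0 + snd q)) = p + A (\<gamma> (1 - fst q)) + B (\<delta> (snd q))" if "q \<in> std_triangle" for q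
      using g1(4)[OF inn(1)[OF that]] d1(4)[OF inn(2)[OF that]] by simp
  qed
  have vd: "(\<eta> has_derivative (\<lambda>h. h *\<^sub>R vector_derivative \<eta> (at t))) (at t)"
    if "smooth_upto_boundary {0..1} \<eta>" "t \<in> {0<..<1}" for \<eta> :: "real \<Rightarrow> 'x" and t
  proof -
    have "t \<in> interior {0..1}" using that by (simp add: interior_atLeastAtMost_real)
    then show ?thesis using smooth_upto_differentiable[OF that(1)] vector_derivative_works has_vector_derivative_def by metis
  qed
  have der: "frechet_derivative (\<lambda>q. p + A (\<gamma> (1 - fst q)) + B (\<delta> (snd q))) (at q) =
      (\<lambda>h. (- fst h) *\<^sub>R A (vector_derivative \<gamma> (at (1 - fst q))) + snd h *\<^sub>R B (vector_derivative \<delta> (at (snd q))))"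
    and t1: "1 - fst q \<in> {0<..<1}" and t2: "snd q \<in> {0<..<1}"
    if "q \<in> interior std_triangle" for q
  proof -
    note i = interior_std_triangle_bounds[OF that]
    show t: "1 - fst q \<in> {0<..<1}" "snd q \<in> {0<..<1}" using i by auto
    have 1: "((\<lambda>q. 1 - fst q) has_derivative (\<lambda>h. - fst h)) (at q)"
      by (auto intro!: derivative_eq_intros)
    have 2: "((\<lambda>q. snd q) has_derivative (\<lambda>h. snd h)) (at q)" by (auto intro!: derivative_eq_intros)
    have "((\<lambda>q. \<gamma> (1 - fst q)) has_derivative (\<lambda>h. (- fst h) *\<^sub>R vector_derivative \<gamma> (at (1 - fst q)))) (at q)"
      using diff_chain_at[OF 1 vd[OF _ t(1)]] g unfolding sarc_def by (simp add: o_def)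
    from bounded_linear.has_derivative[OF A this]
    have A': "((\<lambda>q. A (\<gamma> (1 - fst q))) has_derivative (\<lambda>h. (- fst h) *\<^sub>R A (vector_derivative \<gamma> (at (1 - fst q))))) (at q)"
      by (simp add: bounded_linear.linear[OF A, THEN linear_scale] bounded_linear.linear[OF A, THEN linear_neg])
    have "((\<lambda>q. \<delta> (snd q)) has_derivative (\<lambda>h. snd h *\<^sub>R vector_derivative \<delta> (at (snd q)))) (at q)"
      using diff_chain_at[OF 2 vd[OF _ t(2)]] d unfolding sarc_def by (simp add: o_def)
    from bounded_linear.has_derivative[OF B this]
    have B': "((\<lambda>q. B (\<delta> (snd q))) has_derivative (\<lambda>h. snd h *\<^sub>R B (vector_derivative \<delta> (at (snd q))))) (at q)"
      by (simp add: bounded_linear.linear[OF B, THEN linear_scale])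
    have "((\<lambda>q. p + A (\<gamma> (1 - fst q)) + B (\<delta> (snd q))) has_derivative
      (\<lambda>h. 0 + (- fst h) *\<^sub>R A (vector_derivative \<gamma> (at (1 - fst q))) + snd h *\<^sub>R B (vector_derivative \<delta> (at (snd q))))) (at q)"
      by (intro has_derivative_add has_derivative_const A' B')
    from frechet_derivative_at[OF this] show "frechet_derivative (\<lambda>q. p + A (\<gamma> (1 - fst q)) + B (\<delta> (snd q))) (at q) =
      (\<lambda>h. (- fst h) *\<^sub>R A (vector_derivative \<gamma> (at (1 - fst q))) + snd h *\<^sub>R B (vector_derivative \<delta> (at (snd q))))" by simp
  qed
  show ?thesis
    unfolding good_def
  proof (intro conjI ballI allI sm)
    show "0 \<le> a * M * (b * N)" using a b d by simp
    fix q assume q: "q \<in> interior std_triangle"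
    show "omega (frechet_derivative (\<lambda>q. p + A (\<gamma> (1 - fst q)) + B (\<delta> (snd q))) (at q) u)
       (frechet_derivative (\<lambda>q. p + A (\<gamma> (1 - fst q)) + B (\<delta> (snd q))) (at q) v) = 0" for u v
      unfolding der[OF q] omega_lin AB by simp
    define X Y where "X = A (vector_derivative \<gamma> (at (1 - fst q)))" and "Y = B (vector_derivative \<delta> (at (snd q)))"
    have X: "norm X \<le> a * M"
      using a(1)[of "vector_derivative \<gamma> (at (1 - fst q))"] mult_left_mono[OF _ a(2)] g t1[OF q] unfolding sarc_def X_def by (meson order_trans)
    have Y: "norm Y \<le> b * N"
      using b(1)[of "vector_derivative \<delta> (at (snd q))"] mult_left_mono[OF _ b(2)] d(1) t2[OF q] unfolding sarc_def Y_def by (meson order_trans)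
    have "area_density (\<lambda>q. p + A (\<gamma> (1 - fst q)) + B (\<delta> (snd q))) q = sqrt ((X \<bullet> X) * (Y \<bullet> Y) - (X \<bullet> Y)\<^sup>2)"
      unfolding area_density_def der[OF q] by (simp add: X_def Y_def Let_def)
    also have "\<dots> \<le> sqrt ((norm X * norm Y)\<^sup>2)"
      by (rule real_sqrt_le_mono) (simp add: power_mult_distrib power2_norm_eq_inner)
    also have "\<dots> = norm X * norm Y" by simp
    also have "\<dots> \<le> a * M * (b * N)" using X Y by (intro mult_mono) (use a d in auto)
    finally show "area_density (\<lambda>q. p + A (\<gamma> (1 - fst q)) + B (\<delta> (snd q))) q \<le> a * M * (b * N)" .
  qed
qed

lemma good_affine:
  fixes x y z :: "complex ^ 'n"
  assumes "omega (y - x) (z - x) = 0"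
  shows "good (triangle_param (x, y, z)) (sqrt (((y - x) \<bullet> (y - x)) * ((z - x) \<bullet> (z - x)) - ((y - x) \<bullet> (z - x))\<^sup>2))"
proof -
  let ?L = "\<lambda>p :: real \<times> real. fst p *\<^sub>R (y - x) + snd p *\<^sub>R (z - x)"
  have t: "triangle_param (x, y, z) = (\<lambda>p. x + ?L p)" by (rule ext) (rule triangle_param_affine)
  have der: "((\<lambda>p. x + ?L p) has_derivative ?L) (at p)" for p
    using has_derivative_add[OF has_derivative_const bounded_linear_imp_has_derivative[OF bounded_linear_tp]] by simp
  have fr: "frechet_derivative (\<lambda>p. x + ?L p) (at p) = ?L" for p using frechet_derivative_at[OF der] by simp
  have sm: "smooth_upto_boundary std_triangle (\<lambda>p. x + ?L p)"
    unfolding smooth_upto_boundary_def smooth_on_open_def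
    by (intro exI[of _ UNIV] exI[of _ "\<lambda>p. x + ?L p"]) (auto intro!: C_on_affine_map bounded_linear_tp)
  have cs: "((y - x) \<bullet> (z - x))\<^sup>2 \<le> ((y - x) \<bullet> (y - x)) * ((z - x) \<bullet> (z - x))" by (rule Cauchy_Schwarz_ineq)
  show ?thesis unfolding t good_def fr using sm cs
    by (simp add: omega_lin assms area_density_def fr Let_def)
qed

text \<open>A curve on the unit interval up to reversal. Edges of 1-chains are these classes.\<close>

definition cls :: "(real \<Rightarrow> 'a) \<Rightarrow> (real \<Rightarrow> 'a) set" where
  "cls \<gamma> = {restrict \<gamma> {0..1}, restrict (\<lambda>u. \<gamma> (1 - u)) {0..1}}"

definition sg :: "(real \<Rightarrow> 'a) \<Rightarrow> (real \<Rightarrow> 'a) set \<Rightarrow> bit" where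
  "sg \<gamma> = (\<lambda>k. if k = cls \<gamma> then 1 else 0)"

lemma sg_cong: "(\<And>u. 0 \<le> u \<Longrightarrow> u \<le> 1 \<Longrightarrow> \<gamma> u = \<delta> u) \<Longrightarrow> sg \<gamma> = sg \<delta>"
proof -
  assume *: "\<And>u. 0 \<le> u \<Longrightarrow> u \<le> 1 \<Longrightarrow> \<gamma> u = \<delta> u"
  have "restrict \<gamma> {0..1} = restrict \<delta> {0..1}" "restrict (\<lambda>u. \<gamma> (1 - u)) {0..1} = restrict (\<lambda>u. \<delta> (1 - u)) {0..1}"
    using * by (auto simp: restrict_def)
  then show ?thesis by (simp add: sg_def cls_def)
qed

lemma sg_rev: "sg (\<lambda>u. \<gamma> (1 - u)) = sg \<gamma>" by (simp add: sg_def cls_def insert_commute)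

lemma chain_self [simp]: "(c :: 'k \<Rightarrow> bit) + c = 0" "c + (c + d) = d"
proof -
  have b: "(x :: bit) + x = 0" for x by (cases x) simp_all
  show "c + c = 0" by (rule ext) (simp only: plus_fun_def b zero_fun_def)
  then show "c + (c + d) = d" by (simp add: add.assoc[symmetric])
qed

definition bd :: "(real \<times> real \<Rightarrow> 'a) \<Rightarrow> (real \<Rightarrow> 'a) set \<Rightarrow> bit" where
  "bd g = sg (\<lambda>u. g (side_pt 0 u)) + sg (\<lambda>u. g (side_pt 1 u)) + sg (\<lambda>u. g (side_pt 2 u))"

lemma side_pt_simps: "side_pt 0 u = (u, 0)" "side_pt 1 u = (1 - u, u)" "side_pt (Suc 0) u = (1 - u, u)" "side_pt 2 u = (0, 1 - u)"
  by (simp_all add: side_pt_def cpt_def xnext_def)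

text \<open>A list lets a triangle occur repeatedly, and concatenation realises the sum of
  chains.\<close>

definition fills :: "((real \<times> real \<Rightarrow> complex ^ 'n) \<times> real) list \<Rightarrow> ((real \<Rightarrow> complex ^ 'n) set \<Rightarrow> bit) \<Rightarrow> bool" where
  "fills xs c \<longleftrightarrow> (\<forall>x\<in>set xs. good (fst x) (snd x)) \<and> sum_list (map (\<lambda>x. bd (fst x)) xs) = c"

text \<open>The area \<open>A\<close> need only be approached. This makes the notion closed under
  limits (\<open>Fil_limit\<close>), so that bounds from ever finer subdivisions become bounds
  without error terms.\<close>

definition Fil :: "((real \<Rightarrow> complex ^ 'n) set \<Rightarrow> bit) \<Rightarrow> real \<Rightarrow> bool" where
  "Fil c A \<longleftrightarrow> (\<forall>\<epsilon>>0. \<exists>xs. fills xs c \<and> sum_list (map (\<lambda>x. snd x / 2) xs) \<le> A + \<epsilon>)"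

lemma Fil_mono: "Fil c A \<Longrightarrow> A \<le> B \<Longrightarrow> Fil c B"
  unfolding Fil_def by (meson add_right_mono order_trans)

lemma Fil_0 [simp]: "0 \<le> A \<Longrightarrow> Fil 0 A"
  unfolding Fil_def fills_def by (intro allI impI exI[of _ "[]"]) simp

lemma Fil_add: assumes "Fil c A" "Fil d B" shows "Fil (c + d) (A + B)"
  unfolding Fil_def
proof (intro allI impI)
  fix \<epsilon> :: real assume "0 < \<epsilon>"
  then have "0 < \<epsilon> / 2" by simp
  then obtain xs ys where "fills xs c" "fills ys d" and
    s: "sum_list (map (\<lambda>x. snd x / 2) xs) \<le> A + \<epsilon> / 2" "sum_list (map (\<lambda>x. snd x / 2) ys) \<le> B + \<epsilon> / 2"
    using assms unfolding Fil_def by blast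
  then have "fills (xs @ ys) (c + d)" by (auto simp: fills_def)
  moreover have "sum_list (map (\<lambda>x. snd x / 2) (xs @ ys)) \<le> A + B + \<epsilon>" using s by simp
  ultimately show "\<exists>xs. fills xs (c + d) \<and> sum_list (map (\<lambda>x. snd x / 2) xs) \<le> A + B + \<epsilon>" by blast
qed

lemma Fil_limit: assumes "\<And>\<epsilon>. 0 < \<epsilon> \<Longrightarrow> Fil c (A + \<epsilon>)" shows "Fil c A"
  unfolding Fil_def
proof (intro allI impI)
  fix \<epsilon> :: real assume "0 < \<epsilon>"
  then have e: "0 < \<epsilon> / 2" by simp
  show "\<exists>xs. fills xs c \<and> sum_list (map (\<lambda>x. snd x / 2) xs) \<le> A + \<epsilon>"
    using assms[OF e] e unfolding Fil_def by (metis add.assoc field_sum_of_halves)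
qed

lemma Fil_sum: "finite I \<Longrightarrow> (\<And>i. i \<in> I \<Longrightarrow> Fil (c i) (A i)) \<Longrightarrow> Fil (\<Sum>i\<in>I. c i) (\<Sum>i\<in>I. A i)"
  by (induction I rule: finite_induct) (auto intro: Fil_add)

lemma Fil_diff: assumes "Fil (c + d) A" "Fil c B" shows "Fil d (A + B)"
  using Fil_add[OF assms(2,1)] by (simp add: add.commute)

lemma Fil_good: "good g D \<Longrightarrow> Fil (bd g) (D / 2)"
  unfolding Fil_def fills_def by (intro allI impI exI[of _ "[(g, D)]"]) simp

definition seg :: "'a::real_vector \<Rightarrow> 'a \<Rightarrow> (real \<Rightarrow> 'a) set \<Rightarrow> bit" where
  "seg a b = sg (\<lambda>u. (1 - u) *\<^sub>R a + u *\<^sub>R b)"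

lemma seg_commute: "seg a b = seg b a"
  unfolding seg_def using sg_rev[of "\<lambda>u. (1 - u) *\<^sub>R a + u *\<^sub>R b"] by (simp add: add.commute)

definition tri :: "'a::real_vector \<Rightarrow> 'a \<Rightarrow> 'a \<Rightarrow> (real \<Rightarrow> 'a) set \<Rightarrow> bit" where
  "tri a b c = seg a b + seg b c + seg c a"

lemma bd_affine: "bd (triangle_param (a, b, c)) = tri a b c"
proof -
  have 1: "sg (\<lambda>u. triangle_param (a, b, c) (side_pt 0 u)) = seg a b"
    unfolding seg_def by (rule sg_cong) (simp add: side_pt_simps algebra_simps)
  have 2: "sg (\<lambda>u. triangle_param (a, b, c) (side_pt 1 u)) = seg b c"
    unfolding seg_def by (rule sg_cong) (simp add: side_pt_simps algebra_simps)
  have 3: "sg (\<lambda>u. triangle_param (a, b, c) (side_pt 2 u)) = seg c a"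
    unfolding seg_def by (rule sg_cong) (simp add: side_pt_simps algebra_simps)
  show ?thesis unfolding bd_def tri_def 1 2 3 ..
qed

lemma Fil_tri:
  fixes a b c :: "complex ^ 'n"
  assumes "omega (b - a) (c - a) = 0"
    and "((b - a) \<bullet> (b - a)) * ((c - a) \<bullet> (c - a)) - ((b - a) \<bullet> (c - a))\<^sup>2 \<le> (2 * A)\<^sup>2" "0 \<le> A"
  shows "Fil (tri a b c) A"
proof -
  have "sqrt (((b - a) \<bullet> (b - a)) * ((c - a) \<bullet> (c - a)) - ((b - a) \<bullet> (c - a))\<^sup>2) \<le> 2 * A"
    using real_sqrt_le_mono[OF assms(2)] assms(3) unfolding real_sqrt_abs by simp
  then show ?thesis using Fil_mono[OF Fil_good[OF good_affine[OF assms(1)]], of A] unfolding bd_affine by simp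
qed

section \<open>Crude fillings\<close>

lemma omega_skew: "omega u v = - omega v u"
  unfolding omega_def sum_negf[symmetric] by (rule sum.cong[OF refl]) (simp add: algebra_simps)

lemma sarc_line: "norm y \<le> M \<Longrightarrow> sarc (\<lambda>t. t *\<^sub>R y) M"
proof -
  assume y: "norm y \<le> M"
  have "smooth_upto_boundary {0..1} (\<lambda>t :: real. t *\<^sub>R y)"
    unfolding smooth_upto_boundary_def smooth_on_open_def
    using C_on_affine_map[OF bounded_linear_scaleR_left, of _ UNIV 0 y]
    by (intro exI[of _ UNIV] exI[of _ "\<lambda>t. t *\<^sub>R y"]) simp
  moreover have "vector_derivative (\<lambda>t. t *\<^sub>R y) (at t) = y" for t
    by (rule vector_derivative_at) (auto intro!: derivative_eq_intros)
  ultimately show ?thesis using y by (simp add: sarc_def)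
qed

lemma sarc_translate: "sarc \<gamma> M \<Longrightarrow> sarc (\<lambda>t. \<gamma> t + c) M"
proof -
  assume g: "sarc \<gamma> M"
  then obtain U f where f: "{0..1} \<subseteq> U" "open U" "\<And>k. C_on k U f" "\<And>x. x \<in> {0..1} \<Longrightarrow> f x = \<gamma> x"
    unfolding sarc_def smooth_upto_boundary_def smooth_on_open_def by blast
  then have "smooth_upto_boundary {0..1} (\<lambda>t. \<gamma> t + c)"
    unfolding smooth_upto_boundary_def smooth_on_open_def
    by (intro exI[of _ U] exI[of _ "\<lambda>t. f t + c"]) (auto intro!: C_on_plus C_on_const)
  moreover have "vector_derivative (\<lambda>t. \<gamma> t + c) (at t) = vector_derivative \<gamma> (at t)" for t
    by (simp add: vector_derivative_def has_vector_derivative_add_const)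
  ultimately show ?thesis using g by (simp add: sarc_def)
qed

text \<open>With ranges orthogonal for \<open>omega\<close>, one curve may move in the range of
  \<open>A\<close> and another in that of \<open>B\<close> independently, and the surface swept out
  is isotropic.\<close>

locale orth =
  fixes A B :: "complex ^ 'n \<Rightarrow> complex ^ 'n" and a :: real
  assumes A: "bounded_linear A" and B: "bounded_linear B" and AB: "\<And>x y. omega (A x) (B y) = 0"
    and a: "0 \<le> a" "\<And>x. norm (A x) \<le> a * norm x" "\<And>x. norm (B x) \<le> a * norm x"
begin

lemma swap: "orth B A a"
proof (rule orth.intro)
  show "omega (B x) (A y) = 0" for x y using omega_skew[of "B x" "A y"] AB[of y x] by simp
qed (use A B a in auto)

lemmas linA = bounded_linear.linear[OF A]
lemmas linB = bounded_linear.linear[OF B]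

lemma product:
  assumes "sarc \<gamma> M" "sarc \<delta> M" "0 \<le> M"
  shows "Fil (sg (\<lambda>u. p + A (\<gamma> u) + B (\<delta> 0)) + sg (\<lambda>u. p + A (\<gamma> u) + B (\<delta> u)) + sg (\<lambda>u. p + A (\<gamma> 1) + B (\<delta> u))) ((a * M)\<^sup>2)"
proof -
  let ?g = "\<lambda>q. p + A (\<gamma> (1 - fst q)) + B (\<delta> (snd q))"
  have "good ?g (a * M * (a * M))"
    by (rule good_product) (use A B AB a assms in auto)
  from Fil_good[OF this] have "Fil (bd ?g) ((a * M)\<^sup>2)"
    by (rule Fil_mono) (use zero_le_power2[of "a * M"] in \<open>simp add: power2_eq_square mult_ac\<close>)
  moreover have "bd ?g = sg (\<lambda>u. p + A (\<gamma> u) + B (\<delta> 0)) + sg (\<lambda>u. p + A (\<gamma> u) + B (\<delta> u)) + sg (\<lambda>u. p + A (\<gamma> 1) + B (\<delta> u))"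
    using sg_rev[of "\<lambda>u. p + A (\<gamma> u) + B (\<delta> 0)"] sg_rev[of "\<lambda>u. p + A (\<gamma> 1) + B (\<delta> u)"]
    unfolding bd_def side_pt_simps by simp
  ultimately show ?thesis by (simp add: mult.assoc)
qed

end

text \<open>The product triangle of the two curves and the one with their roles exchanged share the
  diagonal, which cancels; what remains is the boundary of the product of \<gamma> with a
  segment.\<close>

lemma (in orth) translate:
  assumes g: "sarc \<gamma> M" and y: "norm y \<le> M"
  shows "Fil (sg (\<lambda>u. p + A (\<gamma> u)) + sg (\<lambda>u. p + B y + A (\<gamma> u)) + seg (p + A (\<gamma> 1)) (p + A (\<gamma> 1) + B y)
     + seg (p + A (\<gamma> 0)) (p + A (\<gamma> 0) + B y)) (2 * (a * M)\<^sup>2)"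
proof -
  interpret s: orth B A a by (rule swap)
  have M: "0 \<le> M" using y norm_ge_zero order_trans by blast
  have e: "sg (\<lambda>u. p + B (u *\<^sub>R y) + A (\<gamma> u)) = sg (\<lambda>u. p + A (\<gamma> u) + B (u *\<^sub>R y))"
    by (rule sg_cong) (simp add: add_ac)
  have 1: "sg (\<lambda>u. p + A (\<gamma> 1) + B (u *\<^sub>R y)) = seg (p + A (\<gamma> 1)) (p + A (\<gamma> 1) + B y)"
    unfolding seg_def by (rule sg_cong) (simp add: linear_scale[OF linB] algebra_simps)
  have 2: "sg (\<lambda>u. p + B (u *\<^sub>R y) + A (\<gamma> 0)) = seg (p + A (\<gamma> 0)) (p + A (\<gamma> 0) + B y)"
    unfolding seg_def by (rule sg_cong) (simp add: linear_scale[OF linB] algebra_simps)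
  show ?thesis
    using Fil_add[OF product[OF g sarc_line[OF y] M, of p] s.product[OF sarc_line[OF y] g M, of p]]
    unfolding e 1 2 by (simp add: linear_0[OF linB] add_ac)
qed

lemma (in orth) rectangle:
  assumes x: "norm x \<le> M" and y: "norm y \<le> M"
  shows "Fil (seg p (p + A x) + seg (p + B y) (p + B y + A x) + seg (p + A x) (p + A x + B y) + seg p (p + B y)) (2 * (a * M)\<^sup>2)"
proof -
  have 1: "sg (\<lambda>u. q + A (u *\<^sub>R x)) = seg q (q + A x)" for q
    unfolding seg_def by (rule sg_cong) (simp add: linear_scale[OF linA] algebra_simps)
  show ?thesis using translate[OF sarc_line[OF x] y, of p] by (simp add: 1 linear_0[OF linA])
qed

text \<open>One product triangle, two translations and two rectangles, with factors 1 + 2 + 2 + 2 +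
  2 = 9. The defect \<open>k\<close> depends on the end points only, so it disappears from closed
  chains.\<close>

lemma (in orth) additive:
  fixes p :: "complex ^ 'n"
  assumes g: "sarc \<gamma> M" "norm (\<gamma> 0) \<le> M" "norm (\<gamma> 1) \<le> M"
  defines "k \<equiv> \<lambda>x. seg (p + A x) (p + A x + B x) + seg p (p + B x)"
  shows "Fil (sg (\<lambda>u. p + (A (\<gamma> u) + B (\<gamma> u))) + sg (\<lambda>u. p + A (\<gamma> u)) + sg (\<lambda>u. p + B (\<gamma> u)) + (k (\<gamma> 0) + k (\<gamma> 1))) (9 * (a * M)\<^sup>2)"
proof -
  interpret s: orth B A a by (rule swap)
  have M: "0 \<le> M" using g(2) norm_ge_zero order_trans by blast
  have e: "sg (\<lambda>u. p + A (\<gamma> u) + B (\<gamma> 0)) = sg (\<lambda>u. p + B (\<gamma> 0) + A (\<gamma> u))"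
    "sg (\<lambda>u. p + A (\<gamma> u) + B (\<gamma> u)) = sg (\<lambda>u. p + (A (\<gamma> u) + B (\<gamma> u)))" by (rule sg_cong, simp add: add_ac)+
  have f: "p + B y + A x = p + A x + B y" for x y by (simp add: add_ac)
  note P = product[OF g(1) g(1) M, of p, unfolded e]
    and T1 = translate[OF g(1) g(2), of p] and T2 = s.translate[OF g(1) g(3), of p]
    and R1 = rectangle[OF g(3) g(2), of p] and R2 = rectangle[OF g(3) g(3), of p]
  show ?thesis
    using Fil_add[OF Fil_add[OF Fil_add[OF Fil_add[OF P T1] T2] R1] R2]
    by (simp add: k_def f add_ac seg_commute)
qed

definition chn :: "complex ^ 'n \<Rightarrow> (complex ^ 'n \<Rightarrow> complex ^ 'n) \<Rightarrow> (real \<Rightarrow> complex ^ 'n) list \<Rightarrow> (real \<Rightarrow> complex ^ 'n) set \<Rightarrow> bit" where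
  "chn p A \<Gamma> = sum_list (map (\<lambda>\<gamma>. sg (\<lambda>u. p + A (\<gamma> u))) \<Gamma>)"

text \<open>The last clause expresses that every point is an end point of an even number of arcs.\<close>

definition closed_arcs :: "(real \<Rightarrow> complex ^ 'n) list \<Rightarrow> real \<Rightarrow> bool" where
  "closed_arcs \<Gamma> M \<longleftrightarrow> 0 \<le> M \<and> (\<forall>\<gamma>\<in>set \<Gamma>. sarc \<gamma> M \<and> norm (\<gamma> 0) \<le> M \<and> norm (\<gamma> 1) \<le> M) \<and>
     (\<forall>h :: complex ^ 'n \<Rightarrow> (real \<Rightarrow> complex ^ 'n) set \<Rightarrow> bit. sum_list (map (\<lambda>\<gamma>. h (\<gamma> 0) + h (\<gamma> 1)) \<Gamma>) = 0)"

lemma Fil_sum_list: "(\<And>x. x \<in> set xs \<Longrightarrow> Fil (c x) r) \<Longrightarrow> Fil (sum_list (map c xs)) (real (length xs) * r)"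
proof (induction xs)
  case (Cons x xs)
  then have "Fil (c x + sum_list (map c xs)) (r + real (length xs) * r)" by (intro Fil_add) auto
  then show ?case by (simp only: list.map sum_list.Cons length_Cons of_nat_Suc distrib_right mult_1_left)
qed simp

lemma (in orth) chn_additive:
  assumes \<Gamma>: "closed_arcs \<Gamma> M" and AB': "\<And>x. C x = A x + B x"
  shows "Fil (chn p C \<Gamma> + chn p A \<Gamma> + chn p B \<Gamma>) (real (length \<Gamma>) * (9 * (a * M)\<^sup>2))"
proof -
  define k where "k x = seg (p + A x) (p + A x + B x) + seg p (p + B x)" for x
  have "Fil (\<Sum>\<gamma>\<leftarrow>\<Gamma>. sg (\<lambda>u. p + (A (\<gamma> u) + B (\<gamma> u))) + sg (\<lambda>u. p + A (\<gamma> u)) + sg (\<lambda>u. p + B (\<gamma> u)) + (k (\<gamma> 0) + k (\<gamma> 1)))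
     (real (length \<Gamma>) * (9 * (a * M)\<^sup>2))"
    unfolding k_def by (rule Fil_sum_list, rule additive) (use \<Gamma> in \<open>auto simp: closed_arcs_def\<close>)
  moreover have "(\<Sum>\<gamma>\<leftarrow>\<Gamma>. k (\<gamma> 0) + k (\<gamma> 1)) = 0" using \<Gamma> unfolding closed_arcs_def by blast
  ultimately show ?thesis unfolding chn_def AB' by (simp add: sum_list_addf)
qed

definition planar :: "'n \<Rightarrow> 'n \<Rightarrow> real \<Rightarrow> real \<Rightarrow> complex ^ 'n \<Rightarrow> complex ^ 'n" where
  "planar k m r s x = (\<chi> j. if j = k then r *\<^sub>R (x $ k) else if j = m then s *\<^sub>R (x $ k) else 0)"

lemma linear_bounded_vec: "linear A \<Longrightarrow> bounded_linear (A :: complex ^ 'n \<Rightarrow> complex ^ 'n)"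
  by (simp add: linear_conv_bounded_linear)

lemma norm_axis: "norm (axis k c :: complex ^ 'n) = norm c"
proof -
  have "(norm ((axis k c :: complex ^ 'n) $ i))\<^sup>2 = (if i = k then (norm c)\<^sup>2 else 0)" for i by (simp add: axis_def)
  then show ?thesis by (simp add: norm_vec_def L2_set_def)
qed

lemma planar_linear: "bounded_linear (planar k m r s)"
  by (rule linear_bounded_vec, rule linearI) (auto simp: planar_def vec_eq_iff scaleR_add_right)

lemma planar_norm: fixes k m :: "'n::finite" assumes "\<bar>r\<bar> \<le> 1" "\<bar>s\<bar> \<le> 1" "k \<noteq> m" shows "norm (planar k m r s x) \<le> 2 * norm x"
proof -
  have e: "planar k m r s x = axis k (r *\<^sub>R (x $ k)) + axis m (s *\<^sub>R (x $ k))"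
    using assms(3) by (auto simp: planar_def vec_eq_iff axis_def)
  have "norm (planar k m r s x) \<le> \<bar>r\<bar> * norm (x $ k) + \<bar>s\<bar> * norm (x $ k)"
    unfolding e using norm_triangle_ineq[of "axis k (r *\<^sub>R (x $ k))" "axis m (s *\<^sub>R (x $ k))"] by (simp add: norm_axis)
  also have "\<dots> \<le> 1 * norm (x $ k) + 1 * norm (x $ k)" using assms by (intro add_mono mult_right_mono) auto
  also have "\<dots> \<le> 2 * norm x" using Finite_Cartesian_Product.norm_nth_le[of x k] by simp
  finally show ?thesis .
qed

lemma planar_orth:
  fixes k m :: "'n::finite"
  assumes "\<bar>r\<bar> \<le> 1" "\<bar>s\<bar> \<le> 1" "\<bar>r'\<bar> \<le> 1" "\<bar>s'\<bar> \<le> 1" "k \<noteq> m" "r * r' + s * s' = 0"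
  shows "orth (planar k m r s) (planar k m r' s') 2"
proof (rule orth.intro)
  fix x y :: "complex ^ 'n"
  have "omega (planar k m r s x) (planar k m r' s' y) =
     (\<Sum>j\<in>UNIV. (if j = k then r * r' * (Re (x $ k) * Im (y $ k) - Im (x $ k) * Re (y $ k)) else 0) +
       (if j = m then s * s' * (Re (x $ k) * Im (y $ k) - Im (x $ k) * Re (y $ k)) else 0))"
    unfolding omega_def by (rule sum.cong[OF refl]) (use assms(5) in \<open>auto simp: planar_def algebra_simps\<close>)
  also have "\<dots> = (r * r' + s * s') * (Re (x $ k) * Im (y $ k) - Im (x $ k) * Re (y $ k))"
    unfolding sum.distrib by (simp add: algebra_simps)
  finally show "omega (planar k m r s x) (planar k m r' s' y) = 0" using assms(6) by simp
qed (use assms planar_norm planar_linear in auto)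

text \<open>Rotating a closed chain by 45 degrees into a second coordinate and applying additivity in two
  orthogonal frames gives \<open>w 1 0 \<sim> w 0 \<onehalf> + w 0 (-\<onehalf>)\<close>; the right hand side is even in the first
  coordinate, hence a second application makes it cancel with itself modulo 2.\<close>

lemma planar_null:
  fixes k m :: "'n::finite" and M :: real
  assumes \<Gamma>: "closed_arcs \<Gamma> M" and km: "k \<noteq> m"
  shows "Fil (chn p (planar k m 1 0) \<Gamma>) (real (length \<Gamma>) * (324 * M\<^sup>2))"
proof -
  define w where "w r s = chn p (planar k m r s) \<Gamma>" for r s
  define Q where "Q = real (length \<Gamma>) * (9 * (2 * M)\<^sup>2)"
  have add: "Fil (w (r + r') (s + s') + w r s + w r' s') Q"
    if "\<bar>r\<bar> \<le> 1" "\<bar>s\<bar> \<le> 1" "\<bar>r'\<bar> \<le> 1" "\<bar>s'\<bar> \<le> 1" "r * r' + s * s' = 0" for r s r' s'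
    unfolding w_def Q_def
    by (rule orth.chn_additive[OF planar_orth \<Gamma>]) (use that km in \<open>auto simp: planar_def vec_eq_iff scaleR_add_left\<close>)
  \<comment> \<open>The vector \<open>(2 r, 0)\<close> is the sum of the orthogonal vectors
    \<open>(r, r)\<close> and \<open>(r, - r)\<close>, each of which is split along the axes; the
    two copies of \<open>w r 0\<close> cancel.\<close>
  have x: "Fil (w (2 * r) 0 + w 0 r + w 0 (- r)) (3 * Q)" if "\<bar>r\<bar> \<le> 1" for r
    using Fil_add[OF Fil_add[OF add[of r r r "- r"] add[of r 0 0 r]] add[of r 0 0 "- r"]] that
    by (simp add: add_ac)
  have y: "Fil (w 0 (2 * r) + w r 0 + w (- r) 0) (3 * Q)" if "\<bar>r\<bar> \<le> 1" for r
    using Fil_add[OF Fil_add[OF add[of r r "- r" r] add[of r 0 0 r]] add[of "- r" 0 0 r]] that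
    by (simp add: add_ac)
  have "Fil (w 1 0) (9 * Q)"
    using Fil_add[OF Fil_add[OF x[of "1/2"] y[of "1/4"]] y[of "-1/4"]] by (simp add: add_ac)
  then show ?thesis unfolding w_def by (rule Fil_mono) (simp add: Q_def power_mult_distrib)
qed

definition coords :: "'n set \<Rightarrow> complex ^ 'n \<Rightarrow> complex ^ 'n" where
  "coords S x = (\<chi> j. if j \<in> S then x $ j else 0)"

lemma coords_norm: "norm (coords S x) \<le> norm x"
  unfolding norm_vec_def by (rule L2_set_mono) (auto simp: coords_def)

lemma Fil_const: "Fil (sg (\<lambda>u. p :: complex ^ 'n)) 0"
proof -
  have "omega (0 :: complex ^ 'n) 0 = 0" by (simp add: omega_def)
  then have "Fil (tri p p p) 0" by (intro Fil_tri) auto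
  moreover have "seg p p = sg (\<lambda>u. p)" unfolding seg_def by (rule sg_cong) (simp add: algebra_simps)
  ultimately show ?thesis by (simp add: tri_def)
qed

text \<open>Coordinates are added one at a time. Different coordinates are Hermitian orthogonal, so
  additivity costs \<open>9 * 2\<^sup>2 = 36\<close>, and the new coordinate alone costs 324 by
  \<open>planar_null\<close>, which rotates it into a second coordinate; together 360 per arc and
  coordinate, in units of \<open>M\<^sup>2\<close>.\<close>

lemma crude:
  assumes n: "CARD('n) \<ge> 2" and \<Gamma>: "closed_arcs (\<Gamma> :: (real \<Rightarrow> complex ^ 'n) list) M"
  shows "Fil (\<Sum>\<gamma>\<leftarrow>\<Gamma>. sg (\<lambda>u. p + \<gamma> u)) (real (length \<Gamma>) * (360 * real CARD('n) * M\<^sup>2))"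
proof -
  have main: "Fil (chn p (coords S) \<Gamma>) (real (card S) * (real (length \<Gamma>) * (360 * M\<^sup>2)))" if "finite S" for S :: "'n set"
    using that
  proof (induction S rule: finite_induct)
    case empty
    have "coords {} x = 0" for x :: "complex ^ 'n" by (simp add: coords_def vec_eq_iff)
    then show ?case using Fil_sum_list[of \<Gamma> "\<lambda>\<gamma>. sg (\<lambda>u. p)" 0] Fil_const[of p] by (simp add: chn_def)
  next
    case (insert k S)
    have "\<exists>m. k \<noteq> m"
    proof (rule ccontr)
      assume "\<not> ?thesis"
      then have "(UNIV :: 'n set) = {k}" by auto
      then have "CARD('n) = card {k}" by (rule arg_cong)
      then show False using n by simp
    qed
    then obtain m where m: "k \<noteq> m" ..
    interpret orth "coords S" "planar k m 1 0" 2
    proof (rule orth.intro)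
      show "bounded_linear (coords S)"
        by (rule linear_bounded_vec, rule linearI) (auto simp: coords_def vec_eq_iff)
      show "omega (coords S x) (planar k m 1 0 y) = 0" for x y
        unfolding omega_def by (rule sum.neutral) (use insert(2) in \<open>auto simp: coords_def planar_def\<close>)
      show "norm (coords S x) \<le> 2 * norm x" for x using coords_norm[of S x] norm_ge_zero[of x] by linarith
      show "norm (planar k m 1 0 x) \<le> 2 * norm x" for x by (rule planar_norm) (use m in auto)
    qed (auto intro: planar_linear)
    have "Fil (chn p (coords (insert k S)) \<Gamma> + chn p (coords S) \<Gamma> + chn p (planar k m 1 0) \<Gamma>) (real (length \<Gamma>) * (9 * (2 * M)\<^sup>2))"
      by (rule chn_additive[OF \<Gamma>]) (use insert(2) m in \<open>auto simp: coords_def planar_def vec_eq_iff\<close>)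
    from Fil_add[OF Fil_add[OF this insert.IH] planar_null[OF \<Gamma> m, of p]]
    have "Fil (chn p (coords (insert k S)) \<Gamma>)
      (real (length \<Gamma>) * (9 * (2 * M)\<^sup>2) + real (card S) * (real (length \<Gamma>) * (360 * M\<^sup>2)) + real (length \<Gamma>) * (324 * M\<^sup>2))"
      by (simp add: add_ac)
    then show ?case by (rule Fil_mono) (use insert(1,2) in \<open>simp add: power_mult_distrib algebra_simps\<close>)
  qed
  have "coords UNIV x = x" for x :: "complex ^ 'n" by (simp add: coords_def vec_eq_iff)
  then have "Fil (\<Sum>\<gamma>\<leftarrow>\<Gamma>. sg (\<lambda>u. p + \<gamma> u)) (real CARD('n) * (real (length \<Gamma>) * (360 * M\<^sup>2)))"
    using main[of UNIV] by (simp add: chn_def)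
  then show ?thesis by (rule Fil_mono) (simp add: algebra_simps)
qed

text \<open>The triangle need not be isotropic. The constant, \<open>3 * 360\<close> for the three
  sides, is large, but the bound is quadratic in the size, so small triangles are negligible when
  their number grows only like the inverse of their size.\<close>

lemma crude_tri:
  fixes x y z :: "complex ^ 'n" and M :: real
  assumes n: "CARD('n) \<ge> 2" and M: "norm (y - x) \<le> M" "norm (z - x) \<le> M" "norm (z - y) \<le> M"
  shows "Fil (tri x y z) (1080 * real CARD('n) * M\<^sup>2)"
proof -
  let ?\<Gamma> = "[\<lambda>t. t *\<^sub>R (y - x), \<lambda>t. t *\<^sub>R (z - y) + (y - x), \<lambda>t. t *\<^sub>R (x - z) + (z - x)]"
  have M0: "0 \<le> M" using M(1) norm_ge_zero order_trans by blast
  have "norm (x - z) \<le> M" using M by (simp add: norm_minus_commute)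
  then have "closed_arcs ?\<Gamma> M"
  proof -
    have s: "sarc (\<lambda>t. t *\<^sub>R (y - x)) M" "sarc (\<lambda>t. t *\<^sub>R (z - y) + (y - x)) M" "sarc (\<lambda>t. t *\<^sub>R (x - z) + (z - x)) M"
      using M \<open>norm (x - z) \<le> M\<close> by (auto intro!: sarc_line sarc_translate)
    show ?thesis unfolding closed_arcs_def
      by (intro conjI allI, fact M0, use M M0 s in simp, simp add: add_ac)
  qed
  from crude[OF n this, of x] have "Fil (\<Sum>\<gamma>\<leftarrow>?\<Gamma>. sg (\<lambda>u. x + \<gamma> u)) (1080 * real CARD('n) * M\<^sup>2)" by (simp add: mult.assoc)
  moreover have "(\<Sum>\<gamma>\<leftarrow>?\<Gamma>. sg (\<lambda>u. x + \<gamma> u)) = tri x y z"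
  proof -
    have "sg (\<lambda>u. x + u *\<^sub>R (y - x)) = seg x y" "sg (\<lambda>u. x + (u *\<^sub>R (z - y) + (y - x))) = seg y z"
      "sg (\<lambda>u. x + (u *\<^sub>R (x - z) + (z - x))) = seg z x"
      unfolding seg_def by (rule sg_cong, simp add: algebra_simps)+
    then show ?thesis by (simp add: tri_def add_ac)
  qed
  ultimately show ?thesis by simp
qed

lemma crude_arc:
  fixes \<gamma> :: "real \<Rightarrow> complex ^ 'n"
  assumes n: "CARD('n) \<ge> 2" and g: "sarc \<gamma> M" "norm (\<gamma> 1 - \<gamma> 0) \<le> M"
  shows "Fil (sg \<gamma> + seg (\<gamma> 0) (\<gamma> 1)) (720 * real CARD('n) * M\<^sup>2)"
proof -
  let ?\<Gamma> = "[\<lambda>t. \<gamma> t + - \<gamma> 0, \<lambda>t. t *\<^sub>R (\<gamma> 1 - \<gamma> 0)]"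
  have M0: "0 \<le> M" using g(2) norm_ge_zero order_trans by blast
  have "closed_arcs ?\<Gamma> M"
  proof -
    have s: "sarc (\<lambda>t. \<gamma> t + - \<gamma> 0) M" "sarc (\<lambda>t. t *\<^sub>R (\<gamma> 1 - \<gamma> 0)) M"
      by (rule sarc_translate[OF g(1)], rule sarc_line[OF g(2)])
    show ?thesis unfolding closed_arcs_def
      by (intro conjI allI, fact M0, use g M0 s in simp, simp add: add_ac)
  qed
  from crude[OF n this, of "\<gamma> 0"] have "Fil (\<Sum>\<gamma>'\<leftarrow>?\<Gamma>. sg (\<lambda>u. \<gamma> 0 + \<gamma>' u)) (720 * real CARD('n) * M\<^sup>2)" by (simp add: mult.assoc)
  moreover have "sg (\<lambda>u. \<gamma> 0 + u *\<^sub>R (\<gamma> 1 - \<gamma> 0)) = seg (\<gamma> 0) (\<gamma> 1)"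
    unfolding seg_def by (rule sg_cong) (simp add: algebra_simps)
  ultimately show ?thesis by (simp add: mult.assoc)
qed

section \<open>Squares and triangles in complex lines\<close>

lemmas chain_ac = add.assoc add.commute add.left_commute chain_self add_0_left add_0_right

definition J :: "complex ^ 'n \<Rightarrow> complex ^ 'n" where "J x = (\<chi> j. \<i> * x $ j)"

lemma linear_J: "linear J"
  by (rule linearI) (auto simp: J_def vec_eq_iff algebra_simps scaleR_conv_of_real)

lemma inner_complex_vec: "(x :: complex ^ 'n) \<bullet> y = (\<Sum>j\<in>UNIV. Re (x $ j) * Re (y $ j) + Im (x $ j) * Im (y $ j))"
  by (simp add: inner_vec_def inner_complex_def)

lemma omega_J: "omega x y = J x \<bullet> y"
  unfolding inner_complex_vec omega_def by (rule sum.cong[OF refl]) (simp add: J_def)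

lemma inner_J: "J x \<bullet> J y = x \<bullet> y" "x \<bullet> J y = - (J x \<bullet> y)"
proof -
  show "J x \<bullet> J y = x \<bullet> y"
    unfolding inner_complex_vec by (rule sum.cong[OF refl]) (simp add: J_def)
  show "x \<bullet> J y = - (J x \<bullet> y)" for x y :: "complex ^ 'n"
    unfolding inner_complex_vec sum_negf[symmetric] by (rule sum.cong[OF refl]) (simp add: J_def)
qed

lemma inner_J_self: "x \<bullet> J x = 0" "J x \<bullet> x = 0"
  using inner_J(2)[of x x] by (simp_all add: inner_commute)

lemma J_J: "J (J x) = - x" by (simp add: J_def vec_eq_iff)

lemma norm_J: "norm (J x) = norm x" unfolding norm_eq_sqrt_inner inner_J(1) ..

lemma telescope2: "(\<Sum>i<N. f i + f (Suc i)) = (f 0 + f N :: 'k \<Rightarrow> bit)"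
  by (induction N) (simp_all only: sum.lessThan_Suc lessThan_0 sum.empty chain_ac)

lemma Fil_collinear: fixes p d :: "complex ^ 'n" shows "Fil (tri (p + r *\<^sub>R d) (p + s *\<^sub>R d) (p + t *\<^sub>R d)) 0"
proof (rule Fil_tri)
  have e: "p + s *\<^sub>R d - (p + r *\<^sub>R d) = (s - r) *\<^sub>R d" for s r by (simp add: algebra_simps)
  show "omega (p + s *\<^sub>R d - (p + r *\<^sub>R d)) (p + t *\<^sub>R d - (p + r *\<^sub>R d)) = 0"
    unfolding e using omega_lin[of "s - r" d 0 d "t - r" 0] by simp
  show "(p + s *\<^sub>R d - (p + r *\<^sub>R d)) \<bullet> (p + s *\<^sub>R d - (p + r *\<^sub>R d)) * ((p + t *\<^sub>R d - (p + r *\<^sub>R d)) \<bullet> (p + t *\<^sub>R d - (p + r *\<^sub>R d)))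
      - ((p + s *\<^sub>R d - (p + r *\<^sub>R d)) \<bullet> (p + t *\<^sub>R d - (p + r *\<^sub>R d)))\<^sup>2 \<le> (2 * 0)\<^sup>2"
    unfolding e inner_scaleR_left inner_scaleR_right by (simp add: power2_eq_square)
qed simp

lemma Fil_seg_self: "Fil (seg p p) 0" for p :: "complex ^ 'n"
  using Fil_collinear[of p 0 0 0 0] by (simp add: tri_def)

lemma subdivide:
  fixes p d :: "complex ^ 'n"
  shows "Fil ((\<Sum>j<N. seg (p + t j *\<^sub>R d) (p + t (Suc j) *\<^sub>R d)) + seg (p + t 0 *\<^sub>R d) (p + t N *\<^sub>R d)) 0"
proof (induction N)
  case 0 show ?case using Fil_seg_self by (simp only: lessThan_0 sum.empty add_0_left)
next
  case (Suc N)
  from Fil_add[OF Suc Fil_collinear[of p "t 0" d "t N" "t (Suc N)"]]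
  show ?case by (simp only: tri_def sum.lessThan_Suc chain_ac seg_commute)
qed

section \<open>The patch and the cell over a square\<close>

type_synonym r4 = "real \<times> real \<times> real \<times> real"

text \<open>An entry \<open>(x, y, u, v)\<close> has the coordinate \<open>x + i y\<close> in the
  first and \<open>u + i v\<close> in the second complex line. The entries are rational, so that the
  isotropy of all twenty triangles holds exactly and can be evaluated.\<close>

definition patch_vertex :: "nat \<Rightarrow> r4" where
  "patch_vertex i = [
    (0, 0, 287853 / 339880, 0),
    (0, 0, 2941597857 / 4235681950, 808661350843 / 1626501868800),
    (0, 0, 5527159317663 / 16335379465160, 318315036766747 / 448056122472960),
    (0, 0, 0, 3 / 4),
    (37 / 48, 0, 29 / 40, 0),
    (33421 / 80640, 1 / 20, 3 / 4, 8497 / 26880),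
    (1379 / 5760, 1 / 8, 17 / 40, 15173 / 23040),
    (651 / 5272, 651 / 5272, 0, 3 / 4),
    (113 / 144, 1 / 8, 3 / 5, 11 / 48),
    (123 / 224, 9 / 40, 9 / 20, 2725 / 5376),
    (3 / 8, 3 / 8, 0, 131 / 192),
    (17 / 20, 3 / 10, 2 / 5, 1 / 4),
    (29 / 40, 9 / 20, 6 / 25, 17 / 40),
    (5 / 11, 5 / 11, 0, 5 / 8),
    (1, 0, 3 / 5, 0),
    (1, 1, 0, 0)] ! i"

text \<open>The patch, found by numerical minimisation of the area among isotropic surfaces, lies over the
  triangle \<open>(0,0), (1,0), (1,1)\<close> of the first of two complex lines; its sides lie in Lagrangian planes,
  so that reflections continue it to a cell over the square \<open>[-1,1] \<times> [-1,1]\<close>. An entry consists of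
  three vertices and an upper bound of the area of their triangle.\<close>

definition patch :: "(nat \<times> nat \<times> nat \<times> real) list" where
  "patch = [
    (0, 4, 5, 12547 / 100000), (0, 5, 1, 2171 / 20000), (1, 5, 6, 8987 / 100000), (1, 6, 2, 2803 / 50000),
    (2, 6, 7, 5477 / 100000), (2, 7, 3, 119 / 4000), (4, 14, 8, 229 / 6250), (4, 8, 5, 2993 / 50000),
    (5, 8, 9, 3701 / 50000), (5, 9, 6, 1489 / 20000), (6, 9, 10, 8827 / 100000), (6, 10, 7, 1987 / 25000),
    (14, 11, 8, 4601 / 100000), (8, 11, 12, 203 / 6250), (8, 12, 9, 59 / 800), (9, 12, 13, 1873 / 25000),
    (9, 13, 10, 3323 / 100000), (11, 15, 12, 12043 / 100000), (12, 15, 13, 3861 / 25000), (14, 15, 11, 1703 / 10000)]"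

fun om4 :: "r4 \<Rightarrow> r4 \<Rightarrow> r4 \<Rightarrow> real" where
  "om4 (a, b, c, d) (x, y, z, w) (x', y', z', w') = (x - a) * (y' - b) - (y - b) * (x' - a) + (z - c) * (w' - d) - (w - d) * (z' - c)"

fun in4 :: "r4 \<Rightarrow> r4 \<Rightarrow> r4 \<Rightarrow> real" where
  "in4 (a, b, c, d) (x, y, z, w) (x', y', z', w') = (x - a) * (x' - a) + (y - b) * (y' - b) + (z - c) * (z' - c) + (w - d) * (w' - d)"

definition small_iso :: "r4 \<Rightarrow> r4 \<Rightarrow> r4 \<Rightarrow> real \<Rightarrow> bool" where
  "small_iso P Q R A \<longleftrightarrow> 0 \<le> A \<and> om4 P Q R = 0 \<and> in4 P Q Q * in4 P R R - (in4 P Q R)\<^sup>2 \<le> (2 * A)\<^sup>2"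

lemma patch_iso: "\<forall>(i, j, k, A)\<in>set patch. small_iso (patch_vertex i) (patch_vertex j) (patch_vertex k) A"
  by (simp add: patch_def patch_vertex_def small_iso_def power2_eq_square)

lemma patch_area: "(\<Sum>(i, j, k, A)\<leftarrow>patch. A) \<le> 1583 / 1000"
  by (simp add: patch_def)

text \<open>The sides along which reflected copies are attached: over the leg \<open>y = 0\<close>,
  over the diagonal \<open>x = y\<close>, and over the corner \<open>(0, 0)\<close>. The remaining
  side from vertex 14 to vertex 15 lies over \<open>x = 1\<close>.\<close>

definition "patch_OA = [(0, 4), (4, 14)]"
definition "patch_OB = [(3, 7), (7, 10), (10, 13), (13, 15)]"
definition "patch_O = [(0, 1), (1, 2), (2, 3)]"

definition chain4 :: "(nat \<times> nat) list \<Rightarrow> (nat \<Rightarrow> nat \<Rightarrow> 'k \<Rightarrow> bit) \<Rightarrow> 'k \<Rightarrow> bit" where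
  "chain4 es S = sum_list (map (\<lambda>(i, j). S i j) es)"

lemma patch_boundary:
  fixes S :: "nat \<Rightarrow> nat \<Rightarrow> 'k \<Rightarrow> bit"
  assumes S: "\<And>i j. S i j = S j i"
  shows "(\<Sum>(i, j, k, A)\<leftarrow>patch. S i j + S j k + S k i) = chain4 patch_OA S + chain4 patch_OB S + chain4 patch_O S + S 14 15"
proof -
  have T: "c + d = 0 \<Longrightarrow> c = d" for c d :: "'k \<Rightarrow> bit" by (metis add.right_neutral chain_self(2))
  show ?thesis
    by (rule T) (simp only: patch_def chain4_def patch_OA_def patch_OB_def patch_O_def list.map sum_list.Cons sum_list.Nil prod.case chain_ac S)
qed

text \<open>The dihedral group of the square acting on \<open>(x, y)\<close>, extended to
  \<open>(u, v)\<close> such that \<open>omega\<close> is preserved up to sign. Element 2 fixes the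
  side over the leg, element 4 the side over the diagonal, and element 1 the side over the origin,
  each of them pointwise.\<close>

definition symm :: "nat \<Rightarrow> r4 \<Rightarrow> r4" where
  "symm g = (\<lambda>(x, y, u, v). [(x, y, u, v), (- x, - y, u, v), (x, - y, u, - v), (- x, y, u, - v),
     (y, x, - u, v), (- y, - x, - u, v), (- y, x, - u, - v), (y, - x, - u, - v)] ! g)"

lemma symm_simps:
  "symm 0 (x, y, u, v) = (x, y, u, v)" "symm 1 (x, y, u, v) = (- x, - y, u, v)"
  "symm 2 (x, y, u, v) = (x, - y, u, - v)" "symm 3 (x, y, u, v) = (- x, y, u, - v)"
  "symm 4 (x, y, u, v) = (y, x, - u, v)" "symm 5 (x, y, u, v) = (- y, - x, - u, v)"
  "symm 6 (x, y, u, v) = (- y, x, - u, - v)" "symm 7 (x, y, u, v) = (y, - x, - u, - v)"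
  "symm (Suc 0) (x, y, u, v) = (- x, - y, u, v)"
  by (simp_all add: symm_def)

lemma patch_vertex_simps:
  "patch_vertex 0 = (0, 0, 287853 / 339880, 0)"
  "patch_vertex 1 = (0, 0, 2941597857 / 4235681950, 808661350843 / 1626501868800)"
  "patch_vertex 2 = (0, 0, 5527159317663 / 16335379465160, 318315036766747 / 448056122472960)"
  "patch_vertex 3 = (0, 0, 0, 3 / 4)"
  "patch_vertex 4 = (37 / 48, 0, 29 / 40, 0)"
  "patch_vertex 5 = (33421 / 80640, 1 / 20, 3 / 4, 8497 / 26880)"
  "patch_vertex 6 = (1379 / 5760, 1 / 8, 17 / 40, 15173 / 23040)"
  "patch_vertex 7 = (651 / 5272, 651 / 5272, 0, 3 / 4)"
  "patch_vertex 8 = (113 / 144, 1 / 8, 3 / 5, 11 / 48)"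
  "patch_vertex 9 = (123 / 224, 9 / 40, 9 / 20, 2725 / 5376)"
  "patch_vertex 10 = (3 / 8, 3 / 8, 0, 131 / 192)"
  "patch_vertex 11 = (17 / 20, 3 / 10, 2 / 5, 1 / 4)"
  "patch_vertex 12 = (29 / 40, 9 / 20, 6 / 25, 17 / 40)"
  "patch_vertex 13 = (5 / 11, 5 / 11, 0, 5 / 8)"
  "patch_vertex 14 = (1, 0, 3 / 5, 0)"
  "patch_vertex 15 = (1, 1, 0, 0)"
  "patch_vertex (Suc 0) = (0, 0, 2941597857 / 4235681950, 808661350843 / 1626501868800)"
  by (simp_all add: patch_vertex_def)

lemma less8: "g < 8 \<Longrightarrow> g = 0 \<or> g = 1 \<or> g = 2 \<or> g = 3 \<or> g = 4 \<or> g = 5 \<or> g = 6 \<or> g = (7 :: nat)" by linarith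

lemma symm_iso: assumes "g < 8" "small_iso P Q R A" shows "small_iso (symm g P) (symm g Q) (symm g R) A"
proof -
  obtain a b c d where P: "P = (a, b, c, d)" by (cases P)
  obtain x y z w where Q: "Q = (x, y, z, w)" by (cases Q)
  obtain x' y' z' w' where R: "R = (x', y', z', w')" by (cases R)
  have "in4 (symm g P) (symm g Q) (symm g Q) = in4 P Q Q \<and> in4 (symm g P) (symm g R) (symm g R) = in4 P R R \<and>
     in4 (symm g P) (symm g Q) (symm g R) = in4 P Q R \<and>
     (om4 (symm g P) (symm g Q) (symm g R) = om4 P Q R \<or> om4 (symm g P) (symm g Q) (symm g R) = - om4 P Q R)"
    using less8[OF assms(1)] unfolding P Q R by (elim disjE) (simp_all add: symm_simps algebra_simps)
  then show ?thesis using assms(2) unfolding small_iso_def by auto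
qed

locale frame =
  fixes p e f :: "complex ^ 'n"
  assumes ee: "e \<bullet> e = 1" and ff: "f \<bullet> f = 1" and ef: "e \<bullet> f = 0" "J e \<bullet> f = 0" and n2: "CARD('n) \<ge> 2"
begin

definition pt :: "real \<Rightarrow> real \<Rightarrow> real \<Rightarrow> real \<Rightarrow> complex ^ 'n" where
  "pt x y u v = p + (x *\<^sub>R e + y *\<^sub>R J e + u *\<^sub>R f + v *\<^sub>R J f)"

lemma pt_diff: "pt x y u v - pt a b c d = (x - a) *\<^sub>R e + (y - b) *\<^sub>R J e + (u - c) *\<^sub>R f + (v - d) *\<^sub>R J f"
  by (simp add: pt_def algebra_simps)

lemma frame_inner:
  "(x *\<^sub>R e + y *\<^sub>R J e + u *\<^sub>R f + v *\<^sub>R J f) \<bullet> (x' *\<^sub>R e + y' *\<^sub>R J e + u' *\<^sub>R f + v' *\<^sub>R J f) = x * x' + y * y' + u * u' + v * v'"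
proof -
  have a: "f \<bullet> e = 0" "f \<bullet> J e = 0" "e \<bullet> J f = 0" "J f \<bullet> e = 0" "J e \<bullet> J f = 0" "J f \<bullet> J e = 0"
    using ef inner_J(2)[of e f] inner_J(1)[of e f] inner_commute[of e f] inner_commute[of "J e" f]
      inner_commute[of e "J f"] inner_commute[of "J e" "J f"] by simp_all
  show ?thesis by (simp add: inner_add_left inner_add_right ee ff ef a inner_J(1) inner_J_self)
qed

lemma frame_omega:
  "omega (x *\<^sub>R e + y *\<^sub>R J e + u *\<^sub>R f + v *\<^sub>R J f) (x' *\<^sub>R e + y' *\<^sub>R J e + u' *\<^sub>R f + v' *\<^sub>R J f) = x * y' - y * x' + u * v' - v * u'"
proof -
  have "J (x *\<^sub>R e + y *\<^sub>R J e + u *\<^sub>R f + v *\<^sub>R J f) = (- y) *\<^sub>R e + x *\<^sub>R J e + (- v) *\<^sub>R f + u *\<^sub>R J f"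
    by (simp add: linear_add[OF linear_J] linear_scale[OF linear_J] J_J)
  then show ?thesis unfolding omega_J by (simp only: frame_inner)
qed

fun at4 :: "real \<Rightarrow> real \<Rightarrow> real \<Rightarrow> r4 \<Rightarrow> complex ^ 'n" where
  "at4 h x y (a, b, c, d) = pt (x + h * a) (y + h * b) (h * c) (h * d)"

lemma Fil_at4:
  assumes "small_iso P Q R A"
  shows "Fil (tri (at4 h x y P) (at4 h x y Q) (at4 h x y R)) (h\<^sup>2 * A)"
proof -
  obtain a b c d where P: "P = (a, b, c, d)" by (cases P)
  obtain a1 b1 c1 d1 where Q: "Q = (a1, b1, c1, d1)" by (cases Q)
  obtain a2 b2 c2 d2 where R: "R = (a2, b2, c2, d2)" by (cases R)
  have i: "(at4 h x y Q - at4 h x y P) \<bullet> (at4 h x y Q - at4 h x y P) = h\<^sup>2 * in4 P Q Q"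
    "(at4 h x y R - at4 h x y P) \<bullet> (at4 h x y R - at4 h x y P) = h\<^sup>2 * in4 P R R"
    "(at4 h x y Q - at4 h x y P) \<bullet> (at4 h x y R - at4 h x y P) = h\<^sup>2 * in4 P Q R"
    "omega (at4 h x y Q - at4 h x y P) (at4 h x y R - at4 h x y P) = h\<^sup>2 * om4 P Q R"
    unfolding P Q R at4.simps pt_diff frame_inner frame_omega by (simp_all add: power2_eq_square algebra_simps)
  have s: "0 \<le> A" "om4 P Q R = 0" "in4 P Q Q * in4 P R R - (in4 P Q R)\<^sup>2 \<le> (2 * A)\<^sup>2" using assms by (simp_all add: small_iso_def)
  have "h\<^sup>2 * in4 P Q Q * (h\<^sup>2 * in4 P R R) - (h\<^sup>2 * in4 P Q R)\<^sup>2 = h\<^sup>2 * h\<^sup>2 * (in4 P Q Q * in4 P R R - (in4 P Q R)\<^sup>2)"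
    by (simp add: power2_eq_square algebra_simps)
  also have "\<dots> \<le> h\<^sup>2 * h\<^sup>2 * (2 * A)\<^sup>2" using s(3) by (rule mult_left_mono) simp
  also have "\<dots> = (2 * (h\<^sup>2 * A))\<^sup>2" by (simp add: power2_eq_square)
  finally show ?thesis by (intro Fil_tri) (simp_all only: i s, auto simp: s)
qed

text \<open>Over each side of the square the cell ends in a broken line, whose apex at height
  \<open>3 / 5\<close> is patch vertex 14 or its mirror image. The broken line depends only on the
  place and direction of the side, so adjacent cells fit together.\<close>

definition vroof :: "real \<Rightarrow> real \<Rightarrow> real \<Rightarrow> (real \<Rightarrow> complex ^ 'n) set \<Rightarrow> bit" where
  "vroof h x y = seg (pt x (y - h) 0 0) (pt x y (h * (3 / 5)) 0) + seg (pt x y (h * (3 / 5)) 0) (pt x (y + h) 0 0)"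

definition hroof :: "real \<Rightarrow> real \<Rightarrow> real \<Rightarrow> (real \<Rightarrow> complex ^ 'n) set \<Rightarrow> bit" where
  "hroof h x y = seg (pt (x - h) y 0 0) (pt x y (- (h * (3 / 5))) 0) + seg (pt x y (- (h * (3 / 5))) 0) (pt (x + h) y 0 0)"

text \<open>Eight copies of the patch. Each side over a leg, over a diagonal or over the centre is
  shared by two copies and cancels, leaving the four roofs; the area is
  \<open>8 * 1583 / 1000\<close> in units of \<open>h\<^sup>2\<close>.\<close>

lemma cell: "Fil (vroof h (x - h) y + vroof h (x + h) y + hroof h x (y - h) + hroof h x (y + h)) (12664 / 1000 * h\<^sup>2)"
proof -
  define V where "V g i = at4 h x y (symm g (patch_vertex i))" for g i
  define S where "S g i j = seg (V g i) (V g j)" for g i j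
  have 1: "Fil (chain4 patch_OA (S g) + chain4 patch_OB (S g) + chain4 patch_O (S g) + S g 14 15) (h\<^sup>2 * (1583 / 1000))" if g: "g < 8" for g
  proof -
    have *: "Fil (\<Sum>(i, j, k, A)\<leftarrow>ps. S g i j + S g j k + S g k i) (h\<^sup>2 * (\<Sum>(i, j, k, A)\<leftarrow>ps. A))" if "set ps \<subseteq> set patch" for ps
      using that
    proof (induction ps)
      case (Cons q ps)
      obtain i j k A where q: "q = (i, j, k, A)" by (cases q)
      have "small_iso (patch_vertex i) (patch_vertex j) (patch_vertex k) A" using patch_iso Cons.prems q by auto
      from Fil_at4[OF symm_iso[OF g this], of h x y] have "Fil (S g i j + S g j k + S g k i) (h\<^sup>2 * A)" by (simp only: tri_def S_def V_def)
      from Fil_add[OF this Cons.IH] Cons.prems show ?case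
        by (simp only: q list.map sum_list.Cons prod.case distrib_left list.set insert_subset simp_thms)
    qed (simp only: list.map sum_list.Nil mult_zero_right Fil_0 order_refl)
    have sy: "S g i j = S g j i" for i j unfolding S_def by (rule seg_commute)
    have "h\<^sup>2 * (\<Sum>(i, j, k, A)\<leftarrow>patch. A) \<le> h\<^sup>2 * (1583 / 1000)" using patch_area by (rule mult_left_mono) simp
    then show ?thesis using Fil_mono[OF *[OF subset_refl]] unfolding patch_boundary[of "S g", OF sy] by simp
  qed
  have VA: "V 2 0 = V 0 0" "V 3 0 = V 1 0" "V 6 0 = V 4 0" "V 7 0 = V 5 0" "V 2 4 = V 0 4" "V 3 4 = V 1 4" "V 6 4 = V 4 4" "V 7 4 = V 5 4" "V 2 14 = V 0 14" "V 3 14 = V 1 14" "V 6 14 = V 4 14" "V 7 14 = V 5 14"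
    by (simp_all add: V_def symm_simps patch_vertex_simps)
  have VB: "V 4 3 = V 0 3" "V 5 3 = V 1 3" "V 7 3 = V 2 3" "V 6 3 = V 3 3" "V 4 7 = V 0 7" "V 5 7 = V 1 7" "V 7 7 = V 2 7" "V 6 7 = V 3 7" "V 4 10 = V 0 10" "V 5 10 = V 1 10" "V 7 10 = V 2 10" "V 6 10 = V 3 10" "V 4 13 = V 0 13" "V 5 13 = V 1 13" "V 7 13 = V 2 13" "V 6 13 = V 3 13" "V 4 15 = V 0 15" "V 5 15 = V 1 15" "V 7 15 = V 2 15" "V 6 15 = V 3 15"
    by (simp_all add: V_def symm_simps patch_vertex_simps)
  have VO: "V 1 0 = V 0 0" "V 3 0 = V 2 0" "V 5 0 = V 4 0" "V 7 0 = V 6 0" "V 1 1 = V 0 1" "V 3 1 = V 2 1" "V 5 1 = V 4 1" "V 7 1 = V 6 1" "V 1 2 = V 0 2" "V 3 2 = V 2 2" "V 5 2 = V 4 2" "V 7 2 = V 6 2" "V 1 3 = V 0 3" "V 3 3 = V 2 3" "V 5 3 = V 4 3" "V 7 3 = V 6 3"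
    by (simp_all add: V_def symm_simps patch_vertex_simps)
  have VD: "V 0 14 = pt (x + h) y (h * (3 / 5)) 0" "V 0 15 = pt (x + h) (y + h) 0 0" "V 1 14 = pt (x - h) y (h * (3 / 5)) 0" "V 1 15 = pt (x - h) (y - h) 0 0" "V 2 14 = pt (x + h) y (h * (3 / 5)) 0" "V 2 15 = pt (x + h) (y - h) 0 0" "V 3 14 = pt (x - h) y (h * (3 / 5)) 0" "V 3 15 = pt (x - h) (y + h) 0 0" "V 4 14 = pt x (y + h) (- (h * (3 / 5))) 0" "V 4 15 = pt (x + h) (y + h) 0 0" "V 5 14 = pt x (y - h) (- (h * (3 / 5))) 0" "V 5 15 = pt (x - h) (y - h) 0 0" "V 6 14 = pt x (y + h) (- (h * (3 / 5))) 0" "V 6 15 = pt (x - h) (y + h) 0 0" "V 7 14 = pt x (y - h) (- (h * (3 / 5))) 0" "V 7 15 = pt (x + h) (y - h) 0 0"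
    by (simp_all add: V_def symm_simps patch_vertex_simps)
  have A: "chain4 patch_OA (S 2) = chain4 patch_OA (S 0)" "chain4 patch_OA (S 3) = chain4 patch_OA (S 1)"
    "chain4 patch_OA (S 6) = chain4 patch_OA (S 4)" "chain4 patch_OA (S 7) = chain4 patch_OA (S 5)"
    by (simp_all only: chain4_def patch_OA_def S_def list.map prod.case VA)
  have B: "chain4 patch_OB (S 4) = chain4 patch_OB (S 0)" "chain4 patch_OB (S 5) = chain4 patch_OB (S 1)"
    "chain4 patch_OB (S 7) = chain4 patch_OB (S 2)" "chain4 patch_OB (S 6) = chain4 patch_OB (S 3)"
    by (simp_all only: chain4_def patch_OB_def S_def list.map prod.case VB)
  have C: "chain4 patch_O (S 1) = chain4 patch_O (S 0)" "chain4 patch_O (S 3) = chain4 patch_O (S 2)"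
    "chain4 patch_O (S 5) = chain4 patch_O (S 4)" "chain4 patch_O (S 7) = chain4 patch_O (S 6)"
    by (simp_all only: chain4_def patch_O_def S_def list.map prod.case VO)
  have D: "S 0 14 15 + S 1 14 15 + S 2 14 15 + S 3 14 15 + S 4 14 15 + S 5 14 15 + S 6 14 15 + S 7 14 15 =
     vroof h (x - h) y + vroof h (x + h) y + hroof h x (y - h) + hroof h x (y + h)"
    by (simp only: S_def VD vroof_def hroof_def chain_ac seg_commute)
  have "Fil (S 0 14 15 + S 1 14 15 + S 2 14 15 + S 3 14 15 + S 4 14 15 + S 5 14 15 + S 6 14 15 + S 7 14 15) (h\<^sup>2 * (1583 / 1000) + h\<^sup>2 * (1583 / 1000) + h\<^sup>2 * (1583 / 1000) + h\<^sup>2 * (1583 / 1000) + h\<^sup>2 * (1583 / 1000) + h\<^sup>2 * (1583 / 1000) + h\<^sup>2 * (1583 / 1000) + h\<^sup>2 * (1583 / 1000))"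
    using Fil_add[OF Fil_add[OF Fil_add[OF Fil_add[OF Fil_add[OF Fil_add[OF Fil_add[OF 1[of 0] 1[of 1]] 1[of 2]] 1[of 3]] 1[of 4]] 1[of 5]] 1[of 6]] 1[of 7]]
    by (simp only: A B C chain_ac)
  then show ?thesis unfolding D by (rule Fil_mono) simp
qed

end

section \<open>Rectangles and right triangles in a complex line\<close>

definition crudeK :: "'n::finite itself \<Rightarrow> real" where "crudeK _ = 1080 * real CARD('n)"

lemma tri_perm: "tri a b c = tri b c a" "tri a b c = tri a c b"
  by (simp_all only: tri_def chain_ac seg_commute)

context frame begin

abbreviation "s x y x' y' \<equiv> seg (pt x y 0 0) (pt x' y' 0 0)"

definition Rect :: "real \<Rightarrow> real \<Rightarrow> real \<Rightarrow> real \<Rightarrow> (real \<Rightarrow> complex ^ 'n) set \<Rightarrow> bit" where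
  "Rect x y a b = s x y (x + a) y + s (x + a) y (x + a) (y + b) + s x (y + b) (x + a) (y + b) + s x y x (y + b)"

lemma pt_line: "pt x y 0 0 = (p + y *\<^sub>R J e) + x *\<^sub>R e" "pt x y 0 0 = (p + x *\<^sub>R e) + y *\<^sub>R J e"
  by (simp_all add: pt_def algebra_simps)

lemma hcol: "Fil (tri (pt r y 0 0) (pt t y 0 0) (pt q y 0 0)) 0"
  unfolding pt_line(1) by (rule Fil_collinear)

lemma vcol: "Fil (tri (pt x r 0 0) (pt x t 0 0) (pt x q 0 0)) 0"
  unfolding pt_line(2) by (rule Fil_collinear)

lemma hsub: "Fil ((\<Sum>j<N. s (t j) y (t (Suc j)) y) + s (t 0) y (t N) y) 0"
  unfolding pt_line(1) by (rule subdivide)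

lemma vsub: "Fil ((\<Sum>j<N. s x (t j) x (t (Suc j))) + s x (t 0) x (t N)) 0"
  unfolding pt_line(2) by (rule subdivide)

lemma norm_e: "norm e = 1" "norm (J e) = 1"
  using ee inner_J(1)[of e e] by (simp_all add: norm_eq_sqrt_inner)

lemma pt_dist: "\<bar>x - x'\<bar> \<le> m \<Longrightarrow> \<bar>y - y'\<bar> \<le> m \<Longrightarrow> norm (pt x y 0 0 - pt x' y' 0 0) \<le> 2 * m"
  using norm_triangle_ineq[of "(x - x') *\<^sub>R e" "(y - y') *\<^sub>R J e"] by (simp add: pt_diff norm_e)

lemma crude_pt:
  assumes "\<bar>x' - x\<bar> \<le> m" "\<bar>y' - y\<bar> \<le> m" "\<bar>x'' - x\<bar> \<le> m" "\<bar>y'' - y\<bar> \<le> m" "\<bar>x'' - x'\<bar> \<le> m" "\<bar>y'' - y'\<bar> \<le> m"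
  shows "Fil (tri (pt x y 0 0) (pt x' y' 0 0) (pt x'' y'' 0 0)) (crudeK TYPE('n) * (2 * m)\<^sup>2)"
  unfolding crudeK_def by (rule crude_tri[OF n2]; rule pt_dist; fact)

lemma rect_crude:
  assumes "\<bar>a\<bar> \<le> m" "\<bar>b\<bar> \<le> m"
  shows "Fil (Rect x y a b) (8 * crudeK TYPE('n) * m\<^sup>2)"
proof -
  have m: "0 \<le> m" using assms by linarith
  have 1: "Fil (tri (pt x y 0 0) (pt (x + a) y 0 0) (pt (x + a) (y + b) 0 0)) (crudeK TYPE('n) * (2 * m)\<^sup>2)"
    by (rule crude_pt) (use assms m in auto)
  have 2: "Fil (tri (pt x y 0 0) (pt (x + a) (y + b) 0 0) (pt x (y + b) 0 0)) (crudeK TYPE('n) * (2 * m)\<^sup>2)"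
    by (rule crude_pt) (use assms m in auto)
  have e: "tri (pt x y 0 0) (pt (x + a) y 0 0) (pt (x + a) (y + b) 0 0) + tri (pt x y 0 0) (pt (x + a) (y + b) 0 0) (pt x (y + b) 0 0) = Rect x y a b"
    by (simp only: tri_def Rect_def chain_ac seg_commute)
  show ?thesis using Fil_add[OF 1 2] unfolding e by (rule Fil_mono) (simp add: power_mult_distrib)
qed

text \<open>The cap between a roof and its straight side is a triangle in an isotropic plane, of
  area \<open>3 / 5 * h\<^sup>2\<close>. The rougher bound suffices, since caps occur only along the
  rim of a grid.\<close>

lemma roof:
  "Fil (vroof h x y + s x (y - h) x (y + h)) (h\<^sup>2)" "Fil (hroof h x y + s (x - h) y (x + h) y) (h\<^sup>2)"
proof -
  have i: "small_iso (0, - 1, 0, 0) (0, 0, 3 / 5, 0) (0, 1, 0, 0) 1" "small_iso (- 1, 0, 0, 0) (0, 0, - 3 / 5, 0) (1, 0, 0, 0) 1"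
    by (simp_all add: small_iso_def power2_eq_square)
  have v: "at4 h x y (0, - 1, 0, 0) = pt x (y - h) 0 0" "at4 h x y (0, 0, 3 / 5, 0) = pt x y (h * (3 / 5)) 0"
    "at4 h x y (0, 1, 0, 0) = pt x (y + h) 0 0" "at4 h x y (- 1, 0, 0, 0) = pt (x - h) y 0 0"
    "at4 h x y (0, 0, - 3 / 5, 0) = pt x y (- (h * (3 / 5))) 0" "at4 h x y (1, 0, 0, 0) = pt (x + h) y 0 0" by simp_all
  show "Fil (vroof h x y + s x (y - h) x (y + h)) (h\<^sup>2)"
    using Fil_at4[OF i(1), of h x y] unfolding v tri_def vroof_def mult_1_right by (simp only: seg_commute)
  show "Fil (hroof h x y + s (x - h) y (x + h) y) (h\<^sup>2)"
    using Fil_at4[OF i(2), of h x y] unfolding v tri_def hroof_def mult_1_right by (simp only: seg_commute)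
qed

text \<open>Roofs over inner sides belong to two cells and telescope away. Only the
  \<open>2 * (N + M)\<close> outer roofs are capped, a cost of lower order as \<open>h\<close> tends
  to 0.\<close>

lemma grid:
  "Fil (Rect x y (2 * real N * h) (2 * real M * h)) (12664 / 1000 * (real N * real M * h\<^sup>2) + 2 * (real N + real M) * h\<^sup>2)"
proof -
  define r where "r i = x + 2 * real i * h" for i
  define t where "t j = y + 2 * real j * h" for j
  define V where "V i j = vroof h (r i) (t j + h)" for i j
  define H where "H i j = hroof h (r i + h) (t j)" for i j
  have rr: "r i + h - h = r i" "r i + h + h = r (Suc i)" "t i + h - h = t i" "t i + h + h = t (Suc i)" for i
    by (simp_all add: r_def t_def algebra_simps)
  have c: "Fil ((V i j + V (Suc i) j) + (H i j + H i (Suc j))) (12664 / 1000 * h\<^sup>2)" for i j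
    using cell[of h "r i + h" "t j + h"] unfolding rr V_def H_def by (simp only: add.assoc)
  have 1: "Fil (\<Sum>i<N. \<Sum>j<M. (V i j + V (Suc i) j) + (H i j + H i (Suc j))) (\<Sum>i<N. \<Sum>j<M. 12664 / 1000 * h\<^sup>2)"
    by (intro Fil_sum c) auto
  have e: "(\<Sum>i<N. \<Sum>j<M. (V i j + V (Suc i) j) + (H i j + H i (Suc j))) =
      ((\<Sum>j<M. V 0 j) + (\<Sum>j<M. V N j)) + ((\<Sum>i<N. H i 0) + (\<Sum>i<N. H i M))"
  proof -
    have "(\<Sum>i<N. \<Sum>j<M. V i j + V (Suc i) j) = (\<Sum>j<M. \<Sum>i<N. V i j + V (Suc i) j)" by (rule sum.swap)
    also have "\<dots> = (\<Sum>j<M. V 0 j + V N j)"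
      by (rule sum.cong[OF refl], rule telescope2)
    finally have a: "(\<Sum>i<N. \<Sum>j<M. V i j + V (Suc i) j) = (\<Sum>j<M. V 0 j + V N j)" .
    have b: "(\<Sum>i<N. \<Sum>j<M. H i j + H i (Suc j)) = (\<Sum>i<N. H i 0 + H i M)"
      by (rule sum.cong[OF refl], rule telescope2)
    have "(\<Sum>i<N. \<Sum>j<M. (V i j + V (Suc i) j) + (H i j + H i (Suc j))) =
       (\<Sum>i<N. (\<Sum>j<M. V i j + V (Suc i) j) + (\<Sum>j<M. H i j + H i (Suc j)))"
      by (rule sum.cong[OF refl], rule sum.distrib)
    also have "\<dots> = (\<Sum>i<N. \<Sum>j<M. V i j + V (Suc i) j) + (\<Sum>i<N. \<Sum>j<M. H i j + H i (Suc j))" by (rule sum.distrib)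
    also have "\<dots> = (\<Sum>j<M. V 0 j + V N j) + (\<Sum>i<N. H i 0 + H i M)" unfolding a b ..
    finally show ?thesis unfolding sum.distrib .
  qed
  have v: "Fil ((\<Sum>j<M. V i j) + s (r i) (t 0) (r i) (t M)) (real M * h\<^sup>2)" for i
  proof -
    have "Fil (V i j + s (r i) (t j) (r i) (t (Suc j))) (h\<^sup>2)" for j
      using roof(1)[of h "r i" "t j + h"] unfolding rr V_def .
    then have "Fil (\<Sum>j<M. V i j + s (r i) (t j) (r i) (t (Suc j))) (\<Sum>j<M. h\<^sup>2)" by (intro Fil_sum) auto
    from Fil_add[OF this vsub[of "r i" t M]] show ?thesis unfolding sum.distrib by (simp only: chain_ac) simp
  qed
  have w: "Fil ((\<Sum>i<N. H i j) + s (r 0) (t j) (r N) (t j)) (real N * h\<^sup>2)" for j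
  proof -
    have "Fil (H i j + s (r i) (t j) (r (Suc i)) (t j)) (h\<^sup>2)" for i
      using roof(2)[of h "r i + h" "t j"] unfolding rr H_def .
    then have "Fil (\<Sum>i<N. H i j + s (r i) (t j) (r (Suc i)) (t j)) (\<Sum>i<N. h\<^sup>2)" by (intro Fil_sum) auto
    from Fil_add[OF this hsub[of r "t j" N]] show ?thesis unfolding sum.distrib by (simp only: chain_ac) simp
  qed
  have R: "Rect x y (2 * real N * h) (2 * real M * h) = s (r 0) (t 0) (r N) (t 0) + s (r N) (t 0) (r N) (t M) + s (r 0) (t M) (r N) (t M) + s (r 0) (t 0) (r 0) (t M)"
    by (simp only: Rect_def r_def t_def of_nat_0 mult_zero_right mult_zero_left add_0_right)
  have "Fil (Rect x y (2 * real N * h) (2 * real M * h))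
     ((\<Sum>i<N. \<Sum>j<M. 12664 / 1000 * h\<^sup>2) + real M * h\<^sup>2 + real M * h\<^sup>2 + real N * h\<^sup>2 + real N * h\<^sup>2)"
    using Fil_add[OF Fil_add[OF Fil_add[OF Fil_add[OF 1[unfolded e] v[of 0]] v[of N]] w[of 0]] w[of M]]
    unfolding R by (simp only: chain_ac)
  then show ?thesis by (rule Fil_mono) (simp add: algebra_simps)
qed

text \<open>What a grid leaves over is no wider than a cell and is filled crudely; for a fixed
  rectangle the number of boxes grows like \<open>1 / h\<close>, so their total cost is
  \<open>O(h)\<close>.\<close>

lemma strip:
  assumes "\<bar>r\<bar> \<le> 2 * h" "0 \<le> h"
  shows "Fil (Rect x y (2 * real N * h) r) (real N * (32 * crudeK TYPE('n) * h\<^sup>2))"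
proof -
  define q where "q i = x + 2 * real i * h" for i
  define v where "v i = s (q i) y (q i) (y + r)" for i
  have qq: "q i + 2 * h = q (Suc i)" for i by (simp add: q_def algebra_simps)
  have "Fil (Rect (q i) y (2 * h) r) (8 * crudeK TYPE('n) * (2 * h)\<^sup>2)" for i by (rule rect_crude) (use assms in auto)
  then have "Fil ((v i + v (Suc i)) + (s (q i) y (q (Suc i)) y + s (q i) (y + r) (q (Suc i)) (y + r))) (8 * crudeK TYPE('n) * (2 * h)\<^sup>2)" for i
    unfolding Rect_def qq v_def by (simp only: chain_ac)
  then have "Fil (\<Sum>i<N. (v i + v (Suc i)) + (s (q i) y (q (Suc i)) y + s (q i) (y + r) (q (Suc i)) (y + r))) (\<Sum>i<N. 8 * crudeK TYPE('n) * (2 * h)\<^sup>2)"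
    by (intro Fil_sum) auto
  then have 1: "Fil ((v 0 + v N) + ((\<Sum>i<N. s (q i) y (q (Suc i)) y) + (\<Sum>i<N. s (q i) (y + r) (q (Suc i)) (y + r)))) (\<Sum>i<N. 8 * crudeK TYPE('n) * (2 * h)\<^sup>2)"
    unfolding sum.distrib telescope2[of v, unfolded sum.distrib] .
  have R: "Rect x y (2 * real N * h) r = s (q 0) y (q N) y + v N + s (q 0) (y + r) (q N) (y + r) + v 0"
    by (simp only: Rect_def q_def v_def of_nat_0 mult_zero_right mult_zero_left add_0_right)
  have "Fil (Rect x y (2 * real N * h) r) ((\<Sum>i<N. 8 * crudeK TYPE('n) * (2 * h)\<^sup>2) + 0 + 0)"
    using Fil_add[OF Fil_add[OF 1 hsub[of q y N]] hsub[of q "y + r" N]] unfolding R by (simp only: chain_ac)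
  then show ?thesis by (rule Fil_mono) (simp add: power_mult_distrib)
qed

lemma K0: "0 \<le> crudeK TYPE('n)" by (simp add: crudeK_def)

text \<open>A square of side \<open>2 * h\<close> costs \<open>12.664 * h\<^sup>2\<close>, which is
  3.166 per unit of area.\<close>

lemma rect:
  assumes a: "0 < a" and b: "0 \<le> b"
  shows "Fil (Rect x y a b) (3166 / 1000 * (a * b))"
proof (rule Fil_limit)
  fix \<epsilon> :: real assume eps: "0 < \<epsilon>"
  \<comment> \<open>With \<open>N\<close> columns, the caps and the strip together cost at most
    \<open>C / N\<close>.\<close>
  define C where "C = (a + b + 16 * crudeK TYPE('n) * a) * a / 2"
  have "0 \<le> C" using a b K0 by (simp add: C_def)
  obtain N :: nat where N0: "C / \<epsilon> + 1 < real N" using reals_Archimedean2 by blast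
  have N: "0 < N" using N0 eps \<open>0 \<le> C\<close> by (cases N) (auto simp: field_simps add_nonneg_pos not_less)
  have NC: "C / real N \<le> \<epsilon>"
  proof -
    have "C / \<epsilon> \<le> real N" using N0 by linarith
    then show ?thesis using N eps by (simp add: field_simps)
  qed
  define h where "h = a / (2 * real N)"
  have h: "0 < h" "2 * real N * h = a" using a N by (simp_all add: h_def)
  define M where "M = nat \<lfloor>b / (2 * h)\<rfloor>"
  have "0 \<le> b / (2 * h)" using b h by simp
  then have M: "real M \<le> b / (2 * h)" "b / (2 * h) < real M + 1" unfolding M_def by linarith+
  then have M: "2 * real M * h \<le> b" "b - 2 * real M * h \<le> 2 * h" using h(1) by (simp_all add: field_simps)
  let ?y = "y + 2 * real M * h" and ?r = "b - 2 * real M * h"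
  have g: "Fil (Rect x y a (2 * real M * h)) (12664 / 1000 * (real N * real M * h\<^sup>2) + 2 * (real N + real M) * h\<^sup>2)"
    using grid[of x y N h M] unfolding h(2) .
  have st: "Fil (Rect x ?y a ?r) (real N * (32 * crudeK TYPE('n) * h\<^sup>2))"
    using strip[of ?r h x ?y N] M h unfolding h(2) by simp
  have yb: "?y + ?r = y + b" by simp
  have "Fil (Rect x y a b) (12664 / 1000 * (real N * real M * h\<^sup>2) + 2 * (real N + real M) * h\<^sup>2 + real N * (32 * crudeK TYPE('n) * h\<^sup>2) + 0 + 0)"
    using Fil_add[OF Fil_add[OF Fil_add[OF g st] vcol[of x y ?y "y + b"]] vcol[of "x + a" y ?y "y + b"]]
    unfolding Rect_def yb tri_def by (simp only: chain_ac seg_commute)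
  moreover have "12664 / 1000 * (real N * real M * h\<^sup>2) + 2 * (real N + real M) * h\<^sup>2 + real N * (32 * crudeK TYPE('n) * h\<^sup>2) + 0 + 0
      \<le> 3166 / 1000 * (a * b) + \<epsilon>"
  proof -
    have "12664 / 1000 * (real N * real M * h\<^sup>2) = 3166 / 1000 * ((2 * real N * h) * (2 * real M * h))" by (simp add: power2_eq_square)
    also have "\<dots> \<le> 3166 / 1000 * (a * b)" unfolding h(2) using M(1) a by (intro mult_left_mono) auto
    finally have 1: "12664 / 1000 * (real N * real M * h\<^sup>2) \<le> 3166 / 1000 * (a * b)" .
    have "2 * (real N + real M) * h\<^sup>2 + real N * (32 * crudeK TYPE('n) * h\<^sup>2) = (2 * real N * h + 2 * real M * h + 16 * crudeK TYPE('n) * (2 * real N * h)) * h"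
      by (simp add: power2_eq_square algebra_simps)
    also have "\<dots> \<le> (a + b + 16 * crudeK TYPE('n) * a) * h" unfolding h(2) using M(1) h(1) by (intro mult_right_mono) auto
    also have "\<dots> = C / real N" by (simp add: C_def h_def)
    finally show ?thesis using 1 NC by linarith
  qed
  ultimately show "Fil (Rect x y a b) (3166 / 1000 * (a * b) + \<epsilon>)" by (rule Fil_mono)
qed

definition T :: "real \<Rightarrow> real \<Rightarrow> real \<Rightarrow> real \<Rightarrow> (real \<Rightarrow> complex ^ 'n) set \<Rightarrow> bit" where
  "T x y a b = tri (pt x y 0 0) (pt (x + a) y 0 0) (pt x (y + b) 0 0)"

text \<open>The rectangle spanned by the right angle and the midpoint of the hypotenuse leaves two
  triangles of half the size.\<close>

lemma T_step:
  assumes a: "0 < a" "0 \<le> b" and c: "Fil (T (x + a / 2) y (a / 2) (b / 2)) c" "Fil (T x (y + b / 2) (a / 2) (b / 2)) c"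
  shows "Fil (T x y a b) (3166 / 1000 * (a * b) / 4 + 2 * c)"
proof -
  have "pt (x + a) y 0 0 = (pt x y 0 0 + a *\<^sub>R e) + 0 *\<^sub>R (b *\<^sub>R J e - a *\<^sub>R e)"
    "pt (x + a / 2) (y + b / 2) 0 0 = (pt x y 0 0 + a *\<^sub>R e) + (1 / 2) *\<^sub>R (b *\<^sub>R J e - a *\<^sub>R e)"
    "pt x (y + b) 0 0 = (pt x y 0 0 + a *\<^sub>R e) + 1 *\<^sub>R (b *\<^sub>R J e - a *\<^sub>R e)"
  proof -
    have h: "a *\<^sub>R e = (a / 2) *\<^sub>R e + (a / 2) *\<^sub>R e" "b *\<^sub>R J e = (b / 2) *\<^sub>R J e + (b / 2) *\<^sub>R J e"
      unfolding scaleR_add_left[symmetric] by simp_all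
    show "pt (x + a) y 0 0 = (pt x y 0 0 + a *\<^sub>R e) + 0 *\<^sub>R (b *\<^sub>R J e - a *\<^sub>R e)" by (simp add: pt_def scaleR_add_left)
    show "pt x (y + b) 0 0 = (pt x y 0 0 + a *\<^sub>R e) + 1 *\<^sub>R (b *\<^sub>R J e - a *\<^sub>R e)" by (simp add: pt_def scaleR_add_left)
    show "pt (x + a / 2) (y + b / 2) 0 0 = (pt x y 0 0 + a *\<^sub>R e) + (1 / 2) *\<^sub>R (b *\<^sub>R J e - a *\<^sub>R e)"
      by (simp add: pt_def scaleR_add_left scaleR_diff_right) (use h in \<open>simp add: algebra_simps\<close>)
  qed
  then have h: "Fil (tri (pt (x + a) y 0 0) (pt (x + a / 2) (y + b / 2) 0 0) (pt x (y + b) 0 0)) 0"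
    using Fil_collinear[of "pt x y 0 0 + a *\<^sub>R e" 0 "b *\<^sub>R J e - a *\<^sub>R e" "1 / 2" 1] by simp
  have r: "Fil (Rect x y (a / 2) (b / 2)) (3166 / 1000 * (a / 2 * (b / 2)))" using a by (intro rect) auto
  have e: "x + a / 2 + a / 2 = x + a" "y + b / 2 + b / 2 = y + b" by simp_all
  have "Fil (T x y a b) (c + c + 3166 / 1000 * (a / 2 * (b / 2)) + 0 + 0 + 0)"
    using Fil_add[OF Fil_add[OF Fil_add[OF Fil_add[OF Fil_add[OF c] r] h] hcol[of x y "x + a / 2" "x + a"]] vcol[of x y "y + b / 2" "y + b"]]
    unfolding T_def Rect_def tri_def e by (simp only: chain_ac seg_commute)
  then show ?thesis by (rule Fil_mono) simp
qed

text \<open>Half the cost of the surrounding rectangle is the fixed point of the recursion in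
  \<open>T_step\<close>. The crude term is halved in each step: two triangles, each with a quarter
  of the squared size.\<close>

lemma T_iterate:
  assumes "0 < a" "0 \<le> b"
  shows "Fil (T x y a b) (3166 / 1000 * (a * b) / 2 * (1 - 1 / 2 ^ n) + 4 * crudeK TYPE('n) * (a + b)\<^sup>2 / 2 ^ n)"
  using assms
proof (induction n arbitrary: x y a b)
  case 0
  have "Fil (T x y a b) (crudeK TYPE('n) * (2 * (a + b))\<^sup>2)" unfolding T_def by (rule crude_pt) (use 0 in auto)
  then show ?case by (rule Fil_mono) (simp only: power_mult_distrib, simp)
next
  case (Suc n)
  have "Fil (T x' y' (a / 2) (b / 2)) (3166 / 1000 * (a / 2 * (b / 2)) / 2 * (1 - 1 / 2 ^ n) + 4 * crudeK TYPE('n) * (a / 2 + b / 2)\<^sup>2 / 2 ^ n)" for x' y'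
    by (rule Suc.IH) (use Suc.prems in auto)
  from T_step[OF Suc.prems this this] show ?case
    by (rule Fil_mono) (simp add: field_simps power2_eq_square)
qed

lemma T_area:
  assumes "0 < a" "0 \<le> b"
  shows "Fil (T x y a b) (3166 / 1000 * (a * b) / 2)"
proof (rule Fil_limit)
  fix \<epsilon> :: real assume eps: "0 < \<epsilon>"
  have "(\<lambda>n. 4 * crudeK TYPE('n) * (a + b)\<^sup>2 * (1 / 2) ^ n) \<longlonglongrightarrow> 4 * crudeK TYPE('n) * (a + b)\<^sup>2 * 0"
    by (intro tendsto_mult tendsto_const LIMSEQ_power_zero) simp
  then have "\<forall>\<^sub>F n in sequentially. 4 * crudeK TYPE('n) * (a + b)\<^sup>2 * (1 / 2) ^ n < \<epsilon>" using eps by (intro order_tendstoD(2)) auto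
  then obtain n where n: "4 * crudeK TYPE('n) * (a + b)\<^sup>2 * (1 / 2) ^ n < \<epsilon>" by (auto simp: eventually_sequentially)
  have "3166 / 1000 * (a * b) / 2 * (1 - 1 / 2 ^ n) \<le> 3166 / 1000 * (a * b) / 2 * 1"
    using assms by (intro mult_left_mono) auto
  moreover have "4 * crudeK TYPE('n) * (a + b)\<^sup>2 / 2 ^ n = 4 * crudeK TYPE('n) * (a + b)\<^sup>2 * (1 / 2) ^ n"
    by (simp add: power_one_over)
  ultimately show "Fil (T x y a b) (3166 / 1000 * (a * b) / 2 + \<epsilon>)"
    using n by (intro Fil_mono[OF T_iterate[OF assms, of x y n]]) linarith
qed

end

text \<open>In two coordinates \<open>k\<close> and \<open>m\<close>, the entries
  \<open>cnj (e $ m)\<close> and \<open>- cnj (e $ k)\<close> give a vector Hermitian orthogonal to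
  \<open>e\<close>.\<close>

lemma hermitian_orthogonal_exists:
  fixes e :: "complex ^ 'n"
  assumes n: "CARD('n) \<ge> 2" and e: "e \<noteq> 0"
  shows "\<exists>f. f \<bullet> f = 1 \<and> e \<bullet> f = 0 \<and> J e \<bullet> f = 0"
proof -
  obtain k where k: "e $ k \<noteq> 0" using e by (auto simp: vec_eq_iff)
  have "\<exists>m. k \<noteq> m"
  proof (rule ccontr)
    assume "\<not> ?thesis"
    then have "(UNIV :: 'n set) = {k}" by auto
    then have "CARD('n) = card {k}" by (rule arg_cong)
    then show False using n by simp
  qed
  then obtain m where m: "k \<noteq> m" ..
  define g :: "complex ^ 'n" where "g = (\<chi> j. if j = k then cnj (e $ m) else if j = m then - cnj (e $ k) else 0)"
  have g0: "g \<noteq> 0" using k m by (auto simp: g_def vec_eq_iff)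
  have sum2: "(\<Sum>j\<in>UNIV. if j = k then x else if j = m then y else 0) = x + y" for x y :: real
  proof -
    have "(if j = k then x else if j = m then y else 0) = (if j = k then x else 0) + (if j = m then y else 0)" for j using m by auto
    then show ?thesis by (simp add: sum.distrib)
  qed
  have "e \<bullet> g = (\<Sum>j\<in>UNIV. if j = k then Re (e $ k) * Re (e $ m) - Im (e $ k) * Im (e $ m) else if j = m then - (Re (e $ m) * Re (e $ k)) + Im (e $ m) * Im (e $ k) else 0)"
    unfolding inner_complex_vec by (rule sum.cong[OF refl]) (use m in \<open>auto simp: g_def\<close>)
  then have 1: "e \<bullet> g = 0" unfolding sum2 by simp
  have "J e \<bullet> g = (\<Sum>j\<in>UNIV. if j = k then - (Im (e $ k) * Re (e $ m)) - Re (e $ k) * Im (e $ m) else if j = m then Im (e $ m) * Re (e $ k) + Re (e $ m) * Im (e $ k) else 0)"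
    unfolding inner_complex_vec by (rule sum.cong[OF refl]) (use m in \<open>auto simp: g_def J_def\<close>)
  then have 2: "J e \<bullet> g = 0" unfolding sum2 by simp
  show ?thesis
    by (rule exI[of _ "(1 / norm g) *\<^sub>R g"]) (use g0 1 2 in \<open>simp add: power2_norm_eq_inner[symmetric] power2_eq_square\<close>)
qed

lemma right_triangle:
  fixes q u :: "complex ^ 'n"
  assumes n: "CARD('n) \<ge> 2"
  shows "Fil (tri q (q + u) (q + t *\<^sub>R J u)) (3166 / 1000 * (\<bar>t\<bar> * (norm u)\<^sup>2) / 2)"
proof (cases "u = 0 \<or> t = 0")
  case True
  have J0: "J (0 :: complex ^ 'n) = 0" by (rule linear_0[OF linear_J])
  have "Fil (tri q (q + u) (q + t *\<^sub>R J u)) 0"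
    using Fil_collinear[of q 0 u 1 0] True J0 by auto
  then show ?thesis by (rule Fil_mono) simp
next
  case False
  define a where "a = norm u"
  have a: "0 < a" using False by (simp add: a_def)
  have Fr: "\<exists>f. frame e f" if "norm e = 1" for e :: "complex ^ 'n"
  proof -
    have "e \<noteq> 0" using that by auto
    then obtain f where "f \<bullet> f = 1" "e \<bullet> f = 0" "J e \<bullet> f = 0" using hermitian_orthogonal_exists[OF n] by blast
    then have "frame e f" using that n by unfold_locales (auto simp: norm_eq_sqrt_inner)
    then show ?thesis ..
  qed
  show ?thesis
  proof (cases "0 < t")
    case True
    define e where "e = (1 / a) *\<^sub>R u"
    have "norm e = 1" using a by (simp add: e_def a_def)
    then obtain f where "frame e f" using Fr by blast
    then interpret frame q e f .
    have "pt 0 0 0 0 = q" "pt (0 + a) 0 0 0 = q + u" "pt 0 (0 + t * a) 0 0 = q + t *\<^sub>R J u"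
      unfolding pt_def using a by (simp_all add: e_def linear_scale[OF linear_J])
    then show ?thesis using T_area[of a "t * a" 0 0] a True unfolding T_def by (simp add: a_def power2_eq_square mult_ac)
  next
    \<comment> \<open>For negative \<open>t\<close> the two legs are exchanged: with
      \<open>e\<close> along \<open>- J u\<close>, the vector \<open>u\<close> points along
      \<open>J e\<close>, and \<open>t J u\<close> is a positive multiple of
      \<open>e\<close>.\<close>
    case F: False
    define e where "e = (- 1 / a) *\<^sub>R J u"
    have "norm e = 1" using a by (simp add: e_def a_def norm_J)
    then obtain f where "frame e f" using Fr by blast
    then interpret frame q e f .
    have "pt 0 0 0 0 = q" "pt 0 (0 + a) 0 0 = q + u" "pt (0 + (- t) * a) 0 0 0 = q + t *\<^sub>R J u"
      unfolding pt_def using a by (simp_all add: e_def linear_scale[OF linear_J] J_J linear_neg[OF linear_J])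
    then show ?thesis using T_area[of "(- t) * a" a 0 0] a F False unfolding T_def
      by (simp add: a_def power2_eq_square mult_ac tri_perm(2)[of q "q + u"] mult_neg_pos)
  qed
qed

section \<open>Polygons\<close>

lemma sum_roots_of_unity:
  assumes N: "0 < N" and d: "\<bar>d\<bar> < int N"
  shows "(\<Sum>k<N. cis (2 * pi * real k * real_of_int d / real N)) = (if d = 0 then of_nat N else 0)"
proof (cases "d = 0")
  case False
  define r where "r = cis (2 * pi * real_of_int d / real N)"
  have rk: "cis (2 * pi * real k * real_of_int d / real N) = r ^ k" for k
    unfolding r_def using Complex.DeMoivre[of "2 * pi * real_of_int d / real N" k] by (simp add: mult_ac)
  have "r \<noteq> 1"
  proof
    assume "r = 1"
    then have "cos (2 * pi * real_of_int d / real N) = 1" by (simp add: r_def complex_eq_iff)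
    then obtain n :: int where "2 * pi * real_of_int d / real N = real_of_int n * 2 * pi" using cos_one_2pi_int by blast
    then have "real_of_int d = real_of_int (n * int N)" using N by (simp add: field_simps)
    then have "d = n * int N" by (simp only: of_int_eq_iff)
    then show False using d False by (auto simp: abs_mult)
  qed
  moreover have "r ^ N = 1"
  proof -
    have "r ^ N = cis (2 * pi * real_of_int d)" using N unfolding r_def Complex.DeMoivre by simp
    then show ?thesis by (metis cis_multiple_2pi Ints_of_int)
  qed
  ultimately show ?thesis using False by (simp add: rk geometric_sum)
qed (use N in simp)

definition dft :: "nat \<Rightarrow> (nat \<Rightarrow> complex) \<Rightarrow> nat \<Rightarrow> complex" where
  "dft N z k = (\<Sum>j<N. z j * cis (- (2 * pi * real k * real j / real N)))"

lemma parseval: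
  assumes N: "0 < N"
  shows "(\<Sum>k<N. (cmod (dft N z k))\<^sup>2) = real N * (\<Sum>j<N. (cmod (z j))\<^sup>2)"
proof -
  have e: "cis (- (2 * pi * real k * real j / real N)) * cnj (cis (- (2 * pi * real k * real l / real N)))
      = cis (2 * pi * real k * real_of_int (int l - int j) / real N)" for k j l
    by (simp add: cis_cnj cis_mult algebra_simps diff_divide_distrib)
  have "complex_of_real (\<Sum>k<N. (cmod (dft N z k))\<^sup>2) = (\<Sum>k<N. dft N z k * cnj (dft N z k))"
    by (simp add: complex_norm_square[symmetric])
  also have "\<dots> = (\<Sum>k<N. \<Sum>j<N. \<Sum>l<N. (z j * cnj (z l)) * cis (2 * pi * real k * real_of_int (int l - int j) / real N))"
    unfolding dft_def cnj_sum sum_product e[symmetric] by (simp add: mult_ac)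
  also have "\<dots> = (\<Sum>j<N. \<Sum>l<N. (z j * cnj (z l)) * (\<Sum>k<N. cis (2 * pi * real k * real_of_int (int l - int j) / real N)))"
    unfolding sum_distrib_left by (subst sum.swap, rule sum.cong[OF refl], rule sum.swap)
  also have "\<dots> = (\<Sum>j<N. \<Sum>l<N. if l = j then of_nat N * (z j * cnj (z j)) else 0)"
  proof (intro sum.cong[OF refl])
    fix j l assume "j \<in> {..<N}" "l \<in> {..<N}"
    then show "(z j * cnj (z l)) * (\<Sum>k<N. cis (2 * pi * real k * real_of_int (int l - int j) / real N)) = (if l = j then of_nat N * (z j * cnj (z j)) else 0)"
      by (subst sum_roots_of_unity) (use N in auto)
  qed
  also have "\<dots> = complex_of_real (real N * (\<Sum>j<N. (cmod (z j))\<^sup>2))"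
    unfolding of_real_mult of_real_sum complex_norm_square sum_distrib_left by simp
  finally show ?thesis by (simp only: of_real_eq_iff)
qed

lemma dft_shift:
  assumes N: "0 < N" and z: "z N = z 0"
  shows "dft N (\<lambda>j. z (Suc j)) k = cis (2 * pi * real k / real N) * dft N z k"
proof -
  let ?e = "\<lambda>j. z j * cis (- (2 * pi * real k * real j / real N))"
  have "cis (- (2 * pi * real k)) = 1" by (metis cis_multiple_2pi Ints_minus Ints_of_nat mult_minus_right)
  then have eN: "?e N = ?e 0" using N z by simp
  have "(\<Sum>j<N. ?e (Suc j)) = (\<Sum>j<N. ?e j)"
    using sum.lessThan_Suc_shift[of ?e N] sum.lessThan_Suc[of ?e N] eN by simp
  moreover have "z (Suc j) * cis (- (2 * pi * real k * real j / real N)) = cis (2 * pi * real k / real N) * ?e (Suc j)" for j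
  proof -
    have "cis (- (2 * pi * real k * real j / real N)) = cis (2 * pi * real k / real N) * cis (- (2 * pi * real k * real (Suc j) / real N))"
      unfolding cis_mult using N by (simp add: field_simps)
    then show ?thesis by simp
  qed
  ultimately show ?thesis unfolding dft_def by (simp only: sum_distrib_left[symmetric])
qed

text \<open>Replacing \<open>k\<close> by \<open>N - k\<close> if necessary, the angle lies between
  \<open>2 \<pi> / N\<close> and \<pi>, where the cosine decreases.\<close>

lemma cos_multiple_le:
  assumes "0 < k" "k < N"
  shows "cos (2 * pi * real k / real N) \<le> cos (2 * pi / real N)"
proof (cases "2 * k \<le> N")
  case True
  then have "real (2 * k) \<le> real N" by (simp only: of_nat_le_iff)
  then have "2 * pi * real k / real N \<le> pi" using assms by (simp add: field_simps)
  moreover have "2 * pi / real N \<le> 2 * pi * real k / real N" using assms by (simp add: field_simps)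
  ultimately show ?thesis by (intro cos_monotone_0_pi_le) auto
next
  case False
  have e: "cos (2 * pi * real k / real N) = cos (2 * pi * real (N - k) / real N)"
  proof -
    have "2 * pi * real (N - k) / real N = 2 * pi - 2 * pi * real k / real N" using assms by (simp add: of_nat_diff field_simps)
    then show ?thesis by (simp add: cos_diff)
  qed
  have "N \<le> 2 * k" using False by linarith
  then have "real N \<le> real (2 * k)" by (simp only: of_nat_le_iff)
  then have "2 * pi * real (N - k) / real N \<le> pi" using assms by (simp add: of_nat_diff field_simps)
  moreover have "2 * pi * 1 / real N \<le> 2 * pi * real (N - k) / real N"
    using assms by (intro divide_right_mono mult_left_mono) auto
  ultimately show ?thesis unfolding e by (intro cos_monotone_0_pi_le) (simp_all only: mult_1_right, auto)
qed

text \<open>Taking differences multiplies the Fourier coefficient of index \<open>k\<close> by a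
  number of squared modulus \<open>2 - 2 cos (2 \<pi> k / N)\<close>. The coefficient of index 0
  vanishes by mean zero, and among the others this factor is least at \<open>k = 1\<close>.\<close>

lemma discrete_wirtinger_complex:
  assumes N: "0 < N" and z: "z N = z 0" and s: "(\<Sum>j<N. z j) = 0"
  shows "(2 - 2 * cos (2 * pi / real N)) * (\<Sum>j<N. (cmod (z j))\<^sup>2) \<le> (\<Sum>j<N. (cmod (z (Suc j) - z j))\<^sup>2)"
proof -
  have "real N * (\<Sum>j<N. (cmod (z (Suc j) - z j))\<^sup>2) = (\<Sum>k<N. (cmod (dft N (\<lambda>j. z (Suc j) - z j) k))\<^sup>2)"
    by (rule parseval[OF N, symmetric])
  also have "\<dots> = (\<Sum>k<N. (2 - 2 * cos (2 * pi * real k / real N)) * (cmod (dft N z k))\<^sup>2)"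
  proof (rule sum.cong[OF refl])
    fix k
    have "dft N (\<lambda>j. z (Suc j) - z j) k = (cis (2 * pi * real k / real N) - 1) * dft N z k"
      using dft_shift[OF N z, of k] unfolding dft_def by (simp add: left_diff_distrib sum_subtractf)
    moreover have "(cmod (cis t - 1))\<^sup>2 = 2 - 2 * cos t" for t
      unfolding cmod_power2 using sin_cos_squared_add[of t] by (simp add: power2_eq_square algebra_simps)
    ultimately show "(cmod (dft N (\<lambda>j. z (Suc j) - z j) k))\<^sup>2 = (2 - 2 * cos (2 * pi * real k / real N)) * (cmod (dft N z k))\<^sup>2"
      by (simp add: norm_mult power_mult_distrib)
  qed
  also have "\<dots> \<ge> (\<Sum>k<N. (2 - 2 * cos (2 * pi / real N)) * (cmod (dft N z k))\<^sup>2)"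
  proof (rule sum_mono)
    fix k assume k: "k \<in> {..<N}"
    show "(2 - 2 * cos (2 * pi / real N)) * (cmod (dft N z k))\<^sup>2 \<le> (2 - 2 * cos (2 * pi * real k / real N)) * (cmod (dft N z k))\<^sup>2"
    proof (cases "k = 0")
      case True then show ?thesis using s by (simp add: dft_def)
    next
      case False then show ?thesis using cos_multiple_le[of k N] k by (intro mult_right_mono) auto
    qed
  qed
  also have "(\<Sum>k<N. (2 - 2 * cos (2 * pi / real N)) * (cmod (dft N z k))\<^sup>2) =
      real N * ((2 - 2 * cos (2 * pi / real N)) * (\<Sum>j<N. (cmod (z j))\<^sup>2))"
    by (simp add: sum_distrib_left[symmetric] parseval[OF N])
  finally show ?thesis using N by simp
qed

lemma norm_vec_power2: "(norm (x :: complex ^ 'n))\<^sup>2 = (\<Sum>i\<in>UNIV. (cmod (x $ i))\<^sup>2)"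
  by (simp add: norm_vec_def L2_set_def real_sqrt_pow2 sum_nonneg)

lemma discrete_wirtinger:
  fixes z :: "nat \<Rightarrow> complex ^ 'n"
  assumes N: "0 < N" and z: "z N = z 0" and s: "(\<Sum>j<N. z j) = 0"
  shows "(2 - 2 * cos (2 * pi / real N)) * (\<Sum>j<N. (norm (z j))\<^sup>2) \<le> (\<Sum>j<N. (norm (z (Suc j) - z j))\<^sup>2)"
proof -
  have "(\<Sum>i\<in>UNIV. (2 - 2 * cos (2 * pi / real N)) * (\<Sum>j<N. (cmod (z j $ i))\<^sup>2)) \<le>
      (\<Sum>i\<in>UNIV. \<Sum>j<N. (cmod (z (Suc j) $ i - z j $ i))\<^sup>2)"
    by (intro sum_mono discrete_wirtinger_complex) (use N z arg_cong[OF s, of "\<lambda>x. x $ i" for i] in auto)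
  then show ?thesis
    unfolding norm_vec_power2 vector_minus_component sum_distrib_left[symmetric]
    by (subst (1 2) sum.swap) simp
qed

text \<open>The Wirtinger constant equals \<open>(2 sin (\<pi> / N))\<^sup>2\<close>, and
  Cauchy-Schwarz passes from squares to norms. Equality holds for regular polygons, so nothing is
  lost.\<close>

lemma mean_norm_le:
  fixes z :: "nat \<Rightarrow> complex ^ 'n"
  assumes N: "2 \<le> N" and z: "z N = z 0" and s: "(\<Sum>j<N. z j) = 0" and h: "\<And>j. j < N \<Longrightarrow> norm (z (Suc j) - z j) \<le> h" "0 \<le> h"
  shows "(\<Sum>j<N. norm (z j)) \<le> real N * h / (2 * sin (pi / real N))"
proof -
  define \<sigma> where "\<sigma> = sin (pi / real N)"
  have \<sigma>: "0 < \<sigma>" unfolding \<sigma>_def using N pi_gt_zero by (intro sin_gt_zero) (auto simp: field_simps)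
  have "2 - 2 * cos (2 * pi / real N) = (2 * \<sigma>)\<^sup>2"
    using cos_double_sin[of "pi / real N"] by (simp add: \<sigma>_def power_mult_distrib)
  then have "(2 * \<sigma>)\<^sup>2 * (\<Sum>j<N. (norm (z j))\<^sup>2) \<le> (\<Sum>j<N. (norm (z (Suc j) - z j))\<^sup>2)"
    using discrete_wirtinger[OF _ z s] N by simp
  also have "\<dots> \<le> (\<Sum>j<N. h\<^sup>2)" using h by (intro sum_mono power_mono) auto
  finally have 1: "(2 * \<sigma>)\<^sup>2 * (\<Sum>j<N. (norm (z j))\<^sup>2) \<le> real N * h\<^sup>2" by simp
  have "(\<Sum>j<N. 1 * norm (z j))\<^sup>2 \<le> (\<Sum>j<N. 1\<^sup>2) * (\<Sum>j<N. (norm (z j))\<^sup>2)" by (rule Cauchy_Schwarz_ineq_sum)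
  then have "(\<Sum>j<N. norm (z j))\<^sup>2 \<le> real N * (\<Sum>j<N. (norm (z j))\<^sup>2)" by simp
  then have "(2 * \<sigma>)\<^sup>2 * (\<Sum>j<N. norm (z j))\<^sup>2 \<le> (2 * \<sigma>)\<^sup>2 * (real N * (\<Sum>j<N. (norm (z j))\<^sup>2))" by (rule mult_left_mono) simp
  also have "\<dots> \<le> real N * (real N * h\<^sup>2)" using mult_left_mono[OF 1, of "real N"] by (simp add: mult_ac)
  finally have "(2 * \<sigma> * (\<Sum>j<N. norm (z j)))\<^sup>2 \<le> (real N * h)\<^sup>2" by (simp add: power_mult_distrib power2_eq_square mult_ac)
  from power2_le_imp_le[OF this] have "2 * \<sigma> * (\<Sum>j<N. norm (z j)) \<le> real N * h" using h(2) by simp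
  then show ?thesis using \<sigma> unfolding \<sigma>_def[symmetric] by (simp add: field_simps)
qed


section \<open>Coning a polygon from its centroid\<close>

text \<open>The edge \<open>d\<close> has components along \<open>a\<close>, along
  \<open>J a\<close>, and Hermitian orthogonal to \<open>a\<close>. To first order the radial one is
  free, the second costs 3.166 times the area of a right triangle in a complex line, and the third
  the area of a Lagrangian right triangle. The detour through \<open>a'\<close> and \<open>m\<close>
  leaves two triangles with sides at most \<delta>, which are filled crudely.\<close>

lemma thin_triangle:
  fixes q a b :: "complex ^ 'n"
  assumes n: "CARD('n) \<ge> 2"
  shows "Fil (tri q (q + a) (q + b)) (3321 / 2000 * norm a * norm (b - a) + (3321 / 2000 + 2 * crudeK TYPE('n)) * (norm (b - a))\<^sup>2)"
proof (cases "a = 0")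
  case True
  have K: "0 \<le> crudeK TYPE('n)" by (simp add: crudeK_def)
  have "Fil (tri q (q + a) (q + b)) 0" using Fil_collinear[of q 0 b 0 1] True by simp
  then show ?thesis by (rule Fil_mono) (use K in simp)
next
  case False
  define d where "d = b - a"
  define x where "x = (d \<bullet> a) / (a \<bullet> a)"
  define y where "y = (d \<bullet> J a) / (a \<bullet> a)"
  define w where "w = d - x *\<^sub>R a - y *\<^sub>R J a"
  define a' where "a' = (1 + x) *\<^sub>R a"
  define m where "m = a' + y *\<^sub>R J a"
  define A where "A = norm a"
  define \<delta> where "\<delta> = norm d"
  define r where "r = norm w"
  have A0: "0 < A" "a \<bullet> a = A * A" using False by (simp_all add: A_def power2_norm_eq_inner[symmetric] power2_eq_square)
  have i: "a \<bullet> J a = 0" "J a \<bullet> a = 0" "J a \<bullet> J a = A * A" using A0(2) by (simp_all only: inner_J_self inner_J(1))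
  have w1: "w \<bullet> a = 0" unfolding w_def x_def inner_diff_left inner_scaleR_left i using A0 by simp
  have w2: "w \<bullet> J a = 0" unfolding w_def y_def inner_diff_left inner_scaleR_left i using A0 by simp
  have w3: "a \<bullet> w = 0" "J a \<bullet> w = 0" using w1 w2 inner_commute[of w a] inner_commute[of w "J a"] by simp_all
  have dd: "d = x *\<^sub>R a + y *\<^sub>R J a + w" by (simp add: w_def)
  have sq: "norm (s *\<^sub>R a + t *\<^sub>R J a + u *\<^sub>R w) ^ 2 = (s * A)\<^sup>2 + (t * A)\<^sup>2 + (u * r)\<^sup>2" for s t u
  proof -
    have "w \<bullet> w = r * r" by (simp add: r_def power2_norm_eq_inner[symmetric] power2_eq_square)
    then show ?thesis unfolding power2_norm_eq_inner inner_add_left inner_add_right inner_scaleR_left inner_scaleR_right A0(2) i w1 w2 w3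
      by (simp add: power2_eq_square algebra_simps)
  qed
  have \<delta>2: "\<delta>\<^sup>2 = (x * A)\<^sup>2 + (y * A)\<^sup>2 + r\<^sup>2" using sq[of x y 1] dd by (simp add: \<delta>_def)
  have \<delta>0: "0 \<le> \<delta>" by (simp add: \<delta>_def)
  have nb: "norm (s *\<^sub>R a + t *\<^sub>R J a + u *\<^sub>R w) \<le> \<delta>" if "(s * A)\<^sup>2 \<le> (x * A)\<^sup>2" "(t * A)\<^sup>2 \<le> (y * A)\<^sup>2" "(u * r)\<^sup>2 \<le> r\<^sup>2" for s t u
    by (rule power2_le_imp_le[OF _ \<delta>0]) (use sq[of s t u] that \<delta>2 in linarith)
  have K: "Fil (tri P Q R) (crudeK TYPE('n) * \<delta>\<^sup>2)" if "norm (Q - P) \<le> \<delta>" "norm (R - P) \<le> \<delta>" "norm (R - Q) \<le> \<delta>" for P Q R :: "complex ^ 'n"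
    unfolding crudeK_def by (rule crude_tri[OF n that])
  have 1: "Fil (tri q (q + a) (q + a')) 0" using Fil_collinear[of q 0 a 1 "1 + x"] by (simp add: a'_def)
  have 2: "Fil (tri (q + a) (q + a') (q + b)) (crudeK TYPE('n) * \<delta>\<^sup>2)"
  proof (rule K)
    have "q + a' - (q + a) = x *\<^sub>R a + 0 *\<^sub>R J a + 0 *\<^sub>R w" by (simp add: a'_def algebra_simps)
    then show "norm (q + a' - (q + a)) \<le> \<delta>" by (simp only:) (rule nb, simp_all)
    show "norm (q + b - (q + a)) \<le> \<delta>" by (simp add: \<delta>_def d_def)
    have "q + b - (q + a') = 0 *\<^sub>R a + y *\<^sub>R J a + 1 *\<^sub>R w" using dd by (simp add: a'_def d_def algebra_simps)
    then show "norm (q + b - (q + a')) \<le> \<delta>" by (simp only:) (rule nb, simp_all)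
  qed
  have 3: "Fil (tri q (q + a') (q + m)) (3166 / 1000 * (\<bar>y\<bar> * A * (\<bar>1 + x\<bar> * A)) / 2)"
  proof (cases "1 + x = 0")
    case True
    then show ?thesis using Fil_collinear[of q 0 m 0 1] by (simp add: a'_def)
  next
    case False
    \<comment> \<open>The right angle is at \<open>q + a'\<close>, so \<open>right_triangle\<close>
      is applied there, with legs \<open>- a'\<close> and \<open>y J a\<close>.\<close>
    have e1: "q + a' + - a' = q" by simp
    have e2: "q + a' + (- y / (1 + x)) *\<^sub>R J (- a') = q + m"
      using False by (simp add: m_def a'_def linear_neg[OF linear_J] linear_scale[OF linear_J])
    have e3: "\<bar>- y / (1 + x)\<bar> * (norm (- a'))\<^sup>2 = \<bar>y\<bar> * A * (\<bar>1 + x\<bar> * A)"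
      using False by (simp add: a'_def A_def power2_eq_square abs_divide)
    have "Fil (tri (q + a') q (q + m)) (3166 / 1000 * (\<bar>y\<bar> * A * (\<bar>1 + x\<bar> * A)) / 2)"
      using right_triangle[OF n, of "q + a'" "- a'" "- y / (1 + x)"] unfolding e1 e2 e3 .
    then show ?thesis by (simp only: tri_def chain_ac seg_commute)
  qed
  have mw: "m \<bullet> w = 0" "w \<bullet> m = 0" "J m \<bullet> w = 0"
  proof -
    show "m \<bullet> w = 0" by (simp add: m_def a'_def inner_add_left w3)
    then show "w \<bullet> m = 0" by (simp add: inner_commute)
    have "J m = (1 + x) *\<^sub>R J a - y *\<^sub>R a"
      by (simp add: m_def a'_def linear_add[OF linear_J] linear_scale[OF linear_J] J_J)
    then show "J m \<bullet> w = 0" by (simp add: inner_diff_left w3)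
  qed
  have bm: "b = m + w" using dd by (simp add: m_def a'_def d_def algebra_simps)
  have 4: "Fil (tri q (q + m) (q + b)) (norm m * r / 2)"
  proof (rule Fil_tri)
    show "omega (q + m - q) (q + b - q) = 0" by (simp add: bm omega_J inner_add_right mw inner_J_self)
    show "(q + m - q) \<bullet> (q + m - q) * ((q + b - q) \<bullet> (q + b - q)) - ((q + m - q) \<bullet> (q + b - q))\<^sup>2 \<le> (2 * (norm m * r / 2))\<^sup>2"
      by (simp add: bm inner_add_left inner_add_right mw power_mult_distrib r_def power2_norm_eq_inner) (simp add: power2_eq_square algebra_simps)
  qed (simp add: r_def)
  have 5: "Fil (tri (q + a') (q + m) (q + b)) (crudeK TYPE('n) * \<delta>\<^sup>2)"
  proof (rule K)
    have "q + m - (q + a') = 0 *\<^sub>R a + y *\<^sub>R J a + 0 *\<^sub>R w" by (simp add: m_def)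
    then show "norm (q + m - (q + a')) \<le> \<delta>" by (simp only:) (rule nb, simp_all)
    have "q + b - (q + a') = 0 *\<^sub>R a + y *\<^sub>R J a + 1 *\<^sub>R w" by (simp add: bm m_def)
    then show "norm (q + b - (q + a')) \<le> \<delta>" by (simp only:) (rule nb, simp_all)
    have "q + b - (q + m) = 0 *\<^sub>R a + 0 *\<^sub>R J a + 1 *\<^sub>R w" by (simp add: bm)
    then show "norm (q + b - (q + m)) \<le> \<delta>" by (simp only:) (rule nb, simp_all)
  qed
  have F: "Fil (tri q (q + a) (q + b)) (0 + crudeK TYPE('n) * \<delta>\<^sup>2 + 3166 / 1000 * (\<bar>y\<bar> * A * (\<bar>1 + x\<bar> * A)) / 2 + norm m * r / 2 + crudeK TYPE('n) * \<delta>\<^sup>2)"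
    using Fil_add[OF Fil_add[OF Fil_add[OF Fil_add[OF 1 2] 3] 4] 5] by (simp only: tri_def chain_ac seg_commute)
  define P where "P = \<bar>y\<bar> * A"
  have P0: "0 \<le> P" "0 \<le> r" using A0 by (simp_all add: P_def r_def)
  have Pr: "P\<^sup>2 + r\<^sup>2 \<le> \<delta>\<^sup>2" unfolding \<delta>2 by (simp add: P_def power_mult_distrib)
  \<comment> \<open>Cauchy-Schwarz for the rates 3.166 and 1 in the two orthogonal directions; the
    worst edge direction yields the factor \<open>sqrt (1 + 3.166\<^sup>2) < 3.321\<close>.\<close>
  have kp: "3166 / 1000 * P + r \<le> 3321 / 1000 * \<delta>"
  proof (rule power2_le_imp_le)
    have "(3166 / 1000 * P + r)\<^sup>2 + (P - 3166 / 1000 * r)\<^sup>2 = (1 + (3166 / 1000)\<^sup>2) * (P\<^sup>2 + r\<^sup>2)"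
      by (simp add: power2_eq_square algebra_simps)
    then have "(3166 / 1000 * P + r)\<^sup>2 \<le> (1 + (3166 / 1000)\<^sup>2) * (P\<^sup>2 + r\<^sup>2)" using zero_le_power2[of "P - 3166 / 1000 * r"] by linarith
    also have "\<dots> \<le> (3321 / 1000)\<^sup>2 * \<delta>\<^sup>2" using Pr by (intro mult_mono) (simp_all add: power2_eq_square)
    finally show "(3166 / 1000 * P + r)\<^sup>2 \<le> (3321 / 1000 * \<delta>)\<^sup>2" by (simp only: power_mult_distrib)
  qed (use \<delta>0 in simp)
  have xA: "\<bar>x\<bar> * A \<le> \<delta>"
    by (rule power2_le_imp_le[OF _ \<delta>0]) (simp add: \<delta>2 power_mult_distrib)
  have "\<bar>1 + x\<bar> * A \<le> (1 + \<bar>x\<bar>) * A" using A0 by (intro mult_right_mono) auto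
  then have b1: "\<bar>1 + x\<bar> * A \<le> A + \<delta>" using xA by (simp add: distrib_right)
  have b2: "norm m \<le> A + \<delta>"
  proof -
    let ?V = "x *\<^sub>R a + y *\<^sub>R J a + 0 *\<^sub>R w"
    have mV: "m = a + ?V" by (simp add: m_def a'_def algebra_simps)
    have "norm ?V \<le> \<delta>" by (rule nb) simp_all
    then show ?thesis unfolding mV A_def using norm_triangle_ineq[of a ?V] by linarith
  qed
  have "3166 / 1000 * (P * (\<bar>1 + x\<bar> * A)) / 2 + norm m * r / 2 \<le> 3166 / 1000 * (P * (A + \<delta>)) / 2 + (A + \<delta>) * r / 2"
    using b1 b2 P0 by (intro add_mono divide_right_mono mult_left_mono mult_right_mono) auto
  also have "\<dots> = (A + \<delta>) / 2 * (3166 / 1000 * P + r)" by (simp add: algebra_simps)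
  also have "\<dots> \<le> (A + \<delta>) / 2 * (3321 / 1000 * \<delta>)" using kp A0 \<delta>0 by (intro mult_left_mono) auto
  finally have "0 + crudeK TYPE('n) * \<delta>\<^sup>2 + 3166 / 1000 * (P * (\<bar>1 + x\<bar> * A)) / 2 + norm m * r / 2 + crudeK TYPE('n) * \<delta>\<^sup>2
     \<le> 3321 / 2000 * A * \<delta> + (3321 / 2000 + 2 * crudeK TYPE('n)) * \<delta>\<^sup>2"
    by (simp add: power2_eq_square algebra_simps)
  then show ?thesis using Fil_mono[OF F] unfolding P_def A_def \<delta>_def d_def by simp
qed

text \<open>The spokes of the cone cancel modulo 2. The apex is the centroid because the Wirtinger
  inequality requires mean zero. For large \<open>N\<close> the main term is nearly
  \<open>3321 / 4000 * (N h)\<^sup>2 / \<pi>\<close>, and \<open>N h\<close> will be close to the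
  length.\<close>

lemma fine_polygon:
  fixes p :: "nat \<Rightarrow> complex ^ 'n"
  assumes n: "CARD('n) \<ge> 2" and N: "2 \<le> N" and p: "p N = p 0" and h: "\<And>j. j < N \<Longrightarrow> norm (p (Suc j) - p j) \<le> h" "0 \<le> h"
  shows "Fil (\<Sum>j<N. seg (p j) (p (Suc j))) (3321 / 4000 * (real N * h\<^sup>2 / sin (pi / real N)) + real N * ((3321 / 2000 + 2 * crudeK TYPE('n)) * h\<^sup>2))"
proof -
  define b where "b = (1 / real N) *\<^sub>R (\<Sum>j<N. p j)"
  define z where "z j = p j - b" for j
  have K: "0 \<le> crudeK TYPE('n)" by (simp add: crudeK_def)
  have "(\<Sum>j<N. z j) = 0" using N by (simp add: z_def b_def sum_subtractf sum_constant_scaleR del: sum_constant)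
  then have S: "(\<Sum>j<N. norm (z j)) \<le> real N * h / (2 * sin (pi / real N))"
    by (intro mean_norm_le N) (use p h in \<open>auto simp: z_def\<close>)
  have t: "Fil (tri b (p j) (p (Suc j))) (3321 / 2000 * h * norm (z j) + (3321 / 2000 + 2 * crudeK TYPE('n)) * h\<^sup>2)" if j: "j < N" for j
  proof -
    have e: "norm (z (Suc j) - z j) \<le> h" using h(1)[OF j] by (simp add: z_def)
    have "3321 / 2000 * norm (z j) * norm (z (Suc j) - z j) \<le> 3321 / 2000 * norm (z j) * h" using e by (intro mult_left_mono) auto
    moreover have "(3321 / 2000 + 2 * crudeK TYPE('n)) * (norm (z (Suc j) - z j))\<^sup>2 \<le> (3321 / 2000 + 2 * crudeK TYPE('n)) * h\<^sup>2"
      using e K by (intro mult_left_mono power_mono) auto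
    ultimately show ?thesis using thin_triangle[OF n, of b "z j" "z (Suc j)"]
      by (rule_tac Fil_mono) (auto simp: z_def mult_ac)
  qed
  have F: "Fil (\<Sum>j<N. tri b (p j) (p (Suc j))) (\<Sum>j<N. 3321 / 2000 * h * norm (z j) + (3321 / 2000 + 2 * crudeK TYPE('n)) * h\<^sup>2)"
    by (rule Fil_sum) (use t in auto)
  have e: "(\<Sum>j<N. tri b (p j) (p (Suc j))) = (\<Sum>j<N. seg (p j) (p (Suc j)))"
  proof -
    have "tri b (p j) (p (Suc j)) = seg (p j) (p (Suc j)) + (seg b (p j) + seg b (p (Suc j)))" for j
      by (simp only: tri_def chain_ac seg_commute)
    then have "(\<Sum>j<N. tri b (p j) (p (Suc j))) = (\<Sum>j<N. seg (p j) (p (Suc j))) + (\<Sum>j<N. seg b (p j) + seg b (p (Suc j)))"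
      by (simp only: sum.distrib)
    also have "(\<Sum>j<N. seg b (p j) + seg b (p (Suc j))) = seg b (p 0) + seg b (p N)" by (rule telescope2)
    finally show ?thesis unfolding p by (simp only: chain_ac)
  qed
  have "(\<Sum>j<N. 3321 / 2000 * h * norm (z j) + (3321 / 2000 + 2 * crudeK TYPE('n)) * h\<^sup>2)
      = 3321 / 2000 * h * (\<Sum>j<N. norm (z j)) + real N * ((3321 / 2000 + 2 * crudeK TYPE('n)) * h\<^sup>2)"
    by (simp add: sum.distrib sum_distrib_left)
  also have "\<dots> \<le> 3321 / 2000 * h * (real N * h / (2 * sin (pi / real N))) + real N * ((3321 / 2000 + 2 * crudeK TYPE('n)) * h\<^sup>2)"
    using S h(2) by (intro add_right_mono mult_left_mono) auto
  also have "\<dots> = 3321 / 4000 * (real N * h\<^sup>2 / sin (pi / real N)) + real N * ((3321 / 2000 + 2 * crudeK TYPE('n)) * h\<^sup>2)"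
    by (simp add: power2_eq_square)
  finally show ?thesis using Fil_mono[OF F] unfolding e by simp
qed

lemma sum_lessThan_add: fixes N n :: nat shows "(\<Sum>j<N + n. f j) = (\<Sum>j<N. f j) + (\<Sum>i<n. f (N + i) :: 'a::comm_monoid_add)"
  by (induction n) (simp_all add: add.assoc)

text \<open>Short edges alone do not force \<open>N\<close> to be large, for instance when edges
  have length 0; therefore each edge is cut into \<open>m\<close> more pieces than its length
  demands. The price is the term \<open>Q * (m + 1) * h\<close>, which vanishes in the limit taken
  later.\<close>

lemma refine_polygon:
  fixes v :: "nat \<Rightarrow> complex ^ 'n"
  assumes h: "0 < h" and m: "1 \<le> m"
  shows "\<exists>N p. p 0 = v 0 \<and> p N = v Q \<and> (\<forall>j<N. norm (p (Suc j) - p j) \<le> h) \<and>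
     Fil ((\<Sum>j<N. seg (p j) (p (Suc j))) + (\<Sum>k<Q. seg (v k) (v (Suc k)))) 0 \<and> Q * m \<le> N \<and>
     real N * h \<le> (\<Sum>k<Q. norm (v (Suc k) - v k)) + real Q * (real m + 1) * h"
proof (induction Q)
  case 0
  show ?case by (rule exI[of _ 0], rule exI[of _ v]) (simp only: lessThan_0 sum.empty add_0_left Fil_0 order_refl, simp)
next
  case (Suc Q)
  then obtain N p where p: "p 0 = v 0" "p N = v Q" "\<And>j. j < N \<Longrightarrow> norm (p (Suc j) - p j) \<le> h"
    "Fil ((\<Sum>j<N. seg (p j) (p (Suc j))) + (\<Sum>k<Q. seg (v k) (v (Suc k)))) 0" "Q * m \<le> N"
    "real N * h \<le> (\<Sum>k<Q. norm (v (Suc k) - v k)) + real Q * (real m + 1) * h" by blast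
  define d where "d = v (Suc Q) - v Q"
  define n where "n = nat \<lceil>norm d / h\<rceil> + m"
  have nn: "m \<le> n" "norm d / h \<le> real n" "real n \<le> norm d / h + (real m + 1)"
  proof -
    show "m \<le> n" by (simp add: n_def)
    have c: "0 \<le> norm d / h" using h by simp
    show "norm d / h \<le> real n" using c unfolding n_def by linarith
    show "real n \<le> norm d / h + (real m + 1)" using c unfolding n_def by linarith
  qed
  have n0: "0 < real n" using nn(1) m by simp
  define t where "t i = real i / real n" for i
  define p' where "p' j = (if j \<le> N then p j else v Q + t (j - N) *\<^sub>R d)" for j
  have pN: "p' (N + i) = v Q + t i *\<^sub>R d" for i using p(2) by (cases "i = 0") (auto simp: p'_def t_def)
  have pS: "p' (Suc (N + i)) = v Q + t (Suc i) *\<^sub>R d" for i using pN[of "Suc i"] by simp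
  have pl: "p' j = p j" "p' (Suc j) = p (Suc j)" if "j < N" for j using that by (auto simp: p'_def)
  have step: "norm (p' (Suc j) - p' j) \<le> h" if j: "j < N + n" for j
  proof (cases "j < N")
    case True then show ?thesis using pl p(3) by simp
  next
    case False
    then obtain i where i: "j = N + i" using le_Suc_ex not_less by blast
    have "p' (Suc j) - p' j = (1 / real n) *\<^sub>R d"
      unfolding i pS pN by (simp add: t_def scaleR_diff_left[symmetric] diff_divide_distrib[symmetric])
    then have "norm (p' (Suc j) - p' j) = norm d / real n" by simp
    also have "\<dots> \<le> h" using nn(2) n0 h by (simp add: field_simps)
    finally show ?thesis .
  qed
  have "(\<Sum>j<N + n. seg (p' j) (p' (Suc j))) = (\<Sum>j<N. seg (p j) (p (Suc j))) + (\<Sum>i<n. seg (v Q + t i *\<^sub>R d) (v Q + t (Suc i) *\<^sub>R d))"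
    unfolding sum_lessThan_add pN pS by (rule arg_cong2[of _ _ _ _ "(+)"], rule sum.cong[OF refl]) (auto simp: pl)
  moreover have "v Q + t 0 *\<^sub>R d = v Q" "v Q + t n *\<^sub>R d = v (Suc Q)" using n0 by (simp_all add: t_def d_def)
  ultimately have F: "Fil ((\<Sum>j<N + n. seg (p' j) (p' (Suc j))) + (\<Sum>k<Suc Q. seg (v k) (v (Suc k)))) 0"
    using Fil_add[OF p(4) subdivide[where p = "v Q" and t = t and d = d and N = n]]
    by (simp only: sum.lessThan_Suc chain_ac)
  have l: "real (N + n) * h \<le> (\<Sum>k<Suc Q. norm (v (Suc k) - v k)) + real (Suc Q) * (real m + 1) * h"
  proof -
    have "real n * h \<le> norm d + (real m + 1) * h" using mult_right_mono[OF nn(3), of h] h by (simp add: distrib_right)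
    then show ?thesis using p(6) by (simp add: d_def distrib_right)
  qed
  show ?case
  proof (intro exI conjI)
    show "p' 0 = v 0" using p(1) by (simp add: p'_def)
    show "p' (N + n) = v (Suc Q)" using pN[of n] n0 by (simp add: t_def d_def)
    show "\<forall>j<N + n. norm (p' (Suc j) - p' j) \<le> h" using step by blast
    show "Suc Q * m \<le> N + n" using p(5) nn(1) by simp
  qed (rule F, rule l)
qed

lemma sin_ge_cubic: "0 \<le> x \<Longrightarrow> x - x ^ 3 / 6 \<le> sin (x :: real)"
proof -
  assume "0 \<le> x"
  then have "\<bar>sin x - x\<bar> \<le> x ^ 3 / 6"
    using Maclaurin_sin_bound[of x 3] by (simp add: sin_coeff_def eval_nat_numeral)
  from abs_le_D2[OF this] show ?thesis by linarith
qed

text \<open>Otherwise \<open>1 / 2 = sin (\<pi> / 6)\<close> would be at most the Taylor bound of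
  order five at \<open>522 / 1000\<close>. The value 3.132 is just large enough for the final
  comparison of constants.\<close>

lemma pi_lower: "3132 / 1000 < pi"
proof (rule ccontr)
  assume "\<not> ?thesis"
  then have p: "pi / 6 \<le> 522 / 1000" by simp
  have "sin (pi / 6) \<le> sin (522 / 1000)"
    by (rule sin_monotone_2pi_le) (use p pi_ge_two in auto)
  moreover have "sin (522 / 1000 :: real) \<le> 522 / 1000 - (522 / 1000) ^ 3 / 6 + (522 / 1000) ^ 5 / 120"
  proof -
    have c: "sin_coeff 0 = 0" "sin_coeff (Suc 0) = 1" "sin_coeff 2 = 0" "sin_coeff 3 = - 1 / 6" "sin_coeff 4 = 0"
      by (simp_all add: sin_coeff_def fact_numeral)
    have "(\<Sum>m<5. sin_coeff m * x ^ m) = x - x ^ 3 / 6" for x :: real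
      by (simp add: lessThan_nat_numeral lessThan_Suc c)
    then have "\<bar>sin x - (x - x ^ 3 / 6)\<bar> \<le> \<bar>x\<bar> ^ 5 / 120" for x :: real
      using Maclaurin_sin_bound[of x 5] by (simp add: fact_numeral)
    from abs_le_D1[OF this[of "522 / 1000"]] show ?thesis by linarith
  qed
  moreover have "(522 / 1000 :: real) - (522 / 1000) ^ 3 / 6 + (522 / 1000) ^ 5 / 120 < 1 / 2" by (simp add: eval_nat_numeral)
  ultimately show False by (simp add: sin_30)
qed

lemma polygon:
  fixes v :: "nat \<Rightarrow> complex ^ 'n"
  assumes n: "CARD('n) \<ge> 2" and Q: "1 \<le> Q" and v: "v Q = v 0"
  defines "L \<equiv> \<Sum>k<Q. norm (v (Suc k) - v k)"
  shows "Fil (\<Sum>k<Q. seg (v k) (v (Suc k))) (3321 / 4000 * (L\<^sup>2 / pi))"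
proof (rule Fil_limit)
  fix \<epsilon> :: real assume eps: "0 < \<epsilon>"
  define K2 where "K2 = 3321 / 2000 + 2 * crudeK TYPE('n)"
  have K2: "0 \<le> K2" by (simp add: K2_def crudeK_def)
  \<comment> \<open>\<open>B m\<close> will bound \<open>N h\<close> and \<open>W m\<close> the
    whole cost for \<open>h = 1 / m\<^sup>2\<close>. With this \<open>h\<close> the excess
    \<open>Q * (m + 1) * h\<close> tends to 0, while \<open>N \<ge> m\<close> tends to
    infinity.\<close>
  define B where "B m = L + real Q * (1 / real m + 1 / real m * (1 / real m))" for m :: nat
  define W where "W m = 3321 / 4000 * ((B m)\<^sup>2 / (pi * (1 - 4 * (1 / real m * (1 / real m))))) + K2 * (B m * (1 / real m * (1 / real m)))" for m :: nat
  have i: "(\<lambda>m. 1 / real m * (1 / real m)) \<longlonglongrightarrow> 0 * 0" by (intro tendsto_mult lim_1_over_n)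
  have Bl: "B \<longlonglongrightarrow> L + real Q * (0 + 0 * 0)" unfolding B_def by (intro tendsto_intros lim_1_over_n)
  have "W \<longlonglongrightarrow> 3321 / 4000 * ((L + real Q * (0 + 0 * 0))\<^sup>2 / (pi * (1 - 4 * (0 * 0)))) + K2 * ((L + real Q * (0 + 0 * 0)) * (0 * 0))"
    unfolding W_def by (intro tendsto_intros i Bl) simp
  then have "W \<longlonglongrightarrow> 3321 / 4000 * (L\<^sup>2 / pi)" by simp
  then have "\<forall>\<^sub>F m in sequentially. W m < 3321 / 4000 * (L\<^sup>2 / pi) + \<epsilon>" using eps by (intro order_tendstoD(2)) auto
  then obtain m0 where m0: "\<And>m. m0 \<le> m \<Longrightarrow> W m < 3321 / 4000 * (L\<^sup>2 / pi) + \<epsilon>" by (auto simp: eventually_sequentially)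
  define m where "m = max m0 3"
  have m: "3 \<le> m" "W m < 3321 / 4000 * (L\<^sup>2 / pi) + \<epsilon>" using m0 by (simp_all add: m_def)
  define h where "h = 1 / real m * (1 / real m)"
  have h: "0 < h" using m by (simp add: h_def)
  obtain N p where p: "p 0 = v 0" "p N = v Q" "\<And>j. j < N \<Longrightarrow> norm (p (Suc j) - p j) \<le> h"
    "Fil ((\<Sum>j<N. seg (p j) (p (Suc j))) + (\<Sum>k<Q. seg (v k) (v (Suc k)))) 0" "Q * m \<le> N"
    "real N * h \<le> (\<Sum>k<Q. norm (v (Suc k) - v k)) + real Q * (real m + 1) * h"
    using refine_polygon[OF h, of m v Q] m by auto
  have Nm: "m \<le> N" using p(5) mult_le_mono1[OF Q, of m] by linarith
  have NB: "real N * h \<le> B m"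
    using p(6) m(1) unfolding B_def L_def h_def by (simp add: field_simps)
  have "Fil (\<Sum>j<N. seg (p j) (p (Suc j))) (3321 / 4000 * (real N * h\<^sup>2 / sin (pi / real N)) + real N * (K2 * h\<^sup>2))"
    unfolding K2_def by (rule fine_polygon[OF n]) (use Nm m p v h in auto)
  then have F: "Fil (\<Sum>k<Q. seg (v k) (v (Suc k))) (0 + (3321 / 4000 * (real N * h\<^sup>2 / sin (pi / real N)) + real N * (K2 * h\<^sup>2)))"
    by (rule Fil_diff[OF p(4)])
  have N0: "0 < real N" using Nm m by simp
  have hm: "h \<le> 1 / 9"
  proof -
    have "1 / real m \<le> 1 / 3" using m(1) by (simp add: field_simps)
    then have "1 / real m * (1 / real m) \<le> 1 / 3 * (1 / 3)" by (intro mult_mono) auto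
    then show ?thesis by (simp add: h_def)
  qed
  \<comment> \<open>The relative error of the sine is at most
    \<open>(\<pi> / N)\<^sup>2 / 6\<close>, and \<open>N \<ge> m\<close> together with
    \<open>\<pi> < 4\<close> bounds this by \<open>16 * h / 6\<close>.\<close>
  have s: "pi / real N * (1 - 4 * h) \<le> sin (pi / real N)"
  proof -
    have "pi / real N \<le> pi / real m" using Nm m by (intro divide_left_mono) auto
    then have "(pi / real N)\<^sup>2 \<le> (pi / real m)\<^sup>2" by (intro power_mono) auto
    also have "\<dots> = pi\<^sup>2 * h" by (simp add: h_def power2_eq_square)
    also have "\<dots> \<le> 4\<^sup>2 * h" using h pi_less_4 by (intro mult_right_mono power_mono) auto
    finally have "(pi / real N)\<^sup>2 / 6 \<le> 4 * h" using h by simp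
    then have "pi / real N * (1 - 4 * h) \<le> pi / real N * (1 - (pi / real N)\<^sup>2 / 6)" by (intro mult_left_mono) auto
    also have "\<dots> = pi / real N - (pi / real N) ^ 3 / 6" by (simp add: right_diff_distrib power2_eq_square power3_eq_cube)
    also have "\<dots> \<le> sin (pi / real N)" by (rule sin_ge_cubic) simp
    finally show ?thesis .
  qed
  have pos: "0 < pi / real N * (1 - 4 * h)" using N0 hm by simp
  have "real N * h\<^sup>2 / sin (pi / real N) \<le> real N * h\<^sup>2 / (pi / real N * (1 - 4 * h))"
    by (rule divide_left_mono[OF s _ mult_pos_pos[OF less_le_trans[OF pos s] pos]]) simp
  also have "\<dots> = (real N * h)\<^sup>2 / (pi * (1 - 4 * h))" using N0 by (simp add: power2_eq_square field_simps)
  also have "\<dots> \<le> (B m)\<^sup>2 / (pi * (1 - 4 * h))"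
    using NB N0 h hm by (intro divide_right_mono power_mono) auto
  finally have 1: "real N * h\<^sup>2 / sin (pi / real N) \<le> (B m)\<^sup>2 / (pi * (1 - 4 * h))" .
  have "real N * (K2 * h\<^sup>2) = K2 * (real N * h * h)" by (simp add: power2_eq_square)
  also have "\<dots> \<le> K2 * (B m * h)" using NB h K2 by (intro mult_left_mono mult_right_mono) auto
  finally have 2: "real N * (K2 * h\<^sup>2) \<le> K2 * (B m * h)" .
  have 3: "0 + (3321 / 4000 * (real N * h\<^sup>2 / sin (pi / real N)) + real N * (K2 * h\<^sup>2)) \<le> W m"
    unfolding W_def h_def[symmetric] add_0_left by (rule add_mono[OF mult_left_mono[OF 1] 2]) simp
  show "Fil (\<Sum>k<Q. seg (v k) (v (Suc k))) (3321 / 4000 * (L\<^sup>2 / pi) + \<epsilon>)"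
    by (rule Fil_mono[OF F order_trans[OF 3 less_imp_le[OF m(2)]]])
qed

section \<open>Realisation of chains\<close>

lemma even_pairing:
  fixes \<kappa> :: "'e \<Rightarrow> 'c"
  assumes "finite E" "\<And>c. even (card {e\<in>E. \<kappa> e = c})"
  shows "\<exists>\<pi>. \<forall>e\<in>E. \<pi> e \<in> E \<and> \<pi> e \<noteq> e \<and> \<pi> (\<pi> e) = e \<and> \<kappa> (\<pi> e) = \<kappa> e"
  using assms
proof (induction "card E" arbitrary: E rule: less_induct)
  case less
  show ?case
  proof (cases "E = {}")
    case False
    then obtain e where e: "e \<in> E" by blast
    let ?c = "{x\<in>E. \<kappa> x = \<kappa> e}"
    have "?c \<noteq> {e}" using less.prems(2)[of "\<kappa> e"] by auto
    then obtain e' where e': "e' \<in> E" "\<kappa> e' = \<kappa> e" "e' \<noteq> e" using e by blast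
    let ?E = "E - {e, e'}"
    have "even (card {x\<in>?E. \<kappa> x = c})" for c
    proof (cases "c = \<kappa> e")
      case True
      have "{x\<in>?E. \<kappa> x = c} = ?c - {e, e'}" using True by auto
      moreover have "card (?c - {e, e'}) = card ?c - card {e, e'}" by (rule card_Diff_subset) (use e e' in auto)
      ultimately show ?thesis using less.prems(2)[of "\<kappa> e"] e'(3) by simp
    next
      case False
      then have "{x\<in>?E. \<kappa> x = c} = {x\<in>E. \<kappa> x = c}" using e' by auto
      then show ?thesis using less.prems(2)[of c] by simp
    qed
    moreover have "card ?E < card E" by (rule psubset_card_mono) (use less.prems(1) e in auto)
    ultimately obtain \<pi> where \<pi>: "\<forall>x\<in>?E. \<pi> x \<in> ?E \<and> \<pi> x \<noteq> x \<and> \<pi> (\<pi> x) = x \<and> \<kappa> (\<pi> x) = \<kappa> x"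
      using less.hyps[of ?E] less.prems(1) by blast
    show ?thesis
    proof (rule exI[of _ "\<pi>(e := e', e' := e)"], rule ballI)
      fix x assume x: "x \<in> E"
      consider "x = e" | "x = e'" "x \<noteq> e" | "x \<in> ?E" using x by blast
      then show "(\<pi>(e := e', e' := e)) x \<in> E \<and> (\<pi>(e := e', e' := e)) x \<noteq> x \<and>
        (\<pi>(e := e', e' := e)) ((\<pi>(e := e', e' := e)) x) = x \<and> \<kappa> ((\<pi>(e := e', e' := e)) x) = \<kappa> x"
      proof cases
        case 3
        then have "\<pi> x \<in> ?E" "\<pi> x \<noteq> x" "\<pi> (\<pi> x) = x" "\<kappa> (\<pi> x) = \<kappa> x" using \<pi> by blast+
        then show ?thesis using 3 by auto
      qed (use e e' in auto)
    qed
  qed simp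
qed

text \<open>A coefficient modulo 2 vanishes exactly if its curve occurs an even number of times, so
  equal curves can be matched by \<open>even_pairing\<close>.\<close>

lemma sum_sg_even:
  assumes "finite E" "(\<Sum>e\<in>E. sg (\<gamma> e)) = 0"
  shows "even (card {e\<in>E. cls (\<gamma> e) = c})"
proof -
  have ev: "(of_nat n :: bit) = 0 \<longleftrightarrow> even n" for n by (induction n) auto
  have "0 = (\<Sum>e\<in>E. sg (\<gamma> e)) c" using assms(2) by simp
  also have "\<dots> = (\<Sum>e\<in>E. sg (\<gamma> e) c)" using assms(1) by (induction E rule: finite_induct) simp_all
  also have "\<dots> = (\<Sum>e\<in>E. if cls (\<gamma> e) = c then 1 else 0)" by (rule sum.cong[OF refl]) (auto simp: sg_def)
  also have "\<dots> = of_nat (card {e\<in>E. cls (\<gamma> e) = c})"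
    using assms(1) by (simp add: sum.If_cases Int_def)
  finally show ?thesis using ev by simp
qed

lemma cls_eqD:
  assumes "cls \<gamma> = cls \<delta>" "\<not> (\<forall>u\<in>{0..1}. \<gamma> u = \<delta> u)" "0 \<le> u" "u \<le> 1"
  shows "\<gamma> u = \<delta> (1 - u)"
proof -
  have "restrict \<gamma> {0..1} = restrict \<delta> {0..1} \<or> restrict \<gamma> {0..1} = restrict (\<lambda>u. \<delta> (1 - u)) {0..1}"
    using assms(1) unfolding cls_def by blast
  moreover have "restrict \<gamma> {0..1} \<noteq> restrict \<delta> {0..1}" using assms(2) by (metis restrict_apply')
  ultimately have "restrict \<gamma> {0..1} u = restrict (\<lambda>u. \<delta> (1 - u)) {0..1} u" by simp
  then show ?thesis using assms by simp
qed

lemma sarc_reverse: "sarc \<gamma> M \<Longrightarrow> sarc (\<lambda>u. \<gamma> (1 - u)) M"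
proof -
  assume g: "sarc \<gamma> M"
  then have sm: "smooth_upto_boundary {0..1} \<gamma>" by (simp add: sarc_def)
  have "smooth_upto_boundary {0..1} (\<lambda>u. \<gamma> (1 + - u))"
    by (rule smooth_upto_boundary_affine[OF sm]) (auto intro: bounded_linear_minus bounded_linear_ident)
  moreover have "norm (vector_derivative (\<lambda>u. \<gamma> (1 - u)) (at t)) \<le> M" if t: "t \<in> {0<..<1}" for t
  proof -
    have t': "1 - t \<in> {0<..<1}" using t by auto
    then have "1 - t \<in> interior {0..1}" by (simp add: interior_atLeastAtMost_real)
    then have "(\<gamma> has_vector_derivative vector_derivative \<gamma> (at (1 - t))) (at (1 - t))"
      using smooth_upto_differentiable[OF sm] vector_derivative_works by blast
    moreover have "((\<lambda>u. 1 - u) has_vector_derivative - 1) (at t)"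
      by (auto intro!: derivative_eq_intros simp: has_real_derivative_iff_has_vector_derivative[symmetric])
    ultimately have "((\<lambda>u. \<gamma> (1 - u)) has_vector_derivative (- 1) *\<^sub>R vector_derivative \<gamma> (at (1 - t))) (at t)"
      using vector_diff_chain_at[of "\<lambda>u. 1 - u" "- 1" t \<gamma>] by (simp add: o_def)
    then have "vector_derivative (\<lambda>u. \<gamma> (1 - u)) (at t) = - vector_derivative \<gamma> (at (1 - t))"
      by (simp add: vector_derivative_at)
    then show ?thesis using g t' by (simp add: sarc_def)
  qed
  ultimately show ?thesis by (simp add: sarc_def)
qed

lemma good_curve: "sarc \<gamma> M \<Longrightarrow> 0 \<le> M \<Longrightarrow> good (\<lambda>q. \<gamma> (1 - fst q) :: complex ^ 'n) 0"
  using good_product[of "\<lambda>x. x" "\<lambda>x. 0" 1 0 \<gamma> M \<gamma> M 0]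
  by (simp add: bounded_linear_ident bounded_linear_zero omega_def)

text \<open>A collar of two degenerate triangles along every arc separates the boundary curve from the
  chain, so that the inner sides of the collar and the sides of the chain can be paired arbitrarily.\<close>

lemma chain_realization:
  fixes C :: "real \<Rightarrow> complex ^ 'n" and \<tau> :: "nat \<Rightarrow> real"
  defines "crv \<equiv> \<lambda>i u. C ((1 - u) * \<tau> i + u * \<tau> (Suc i))"
  assumes m: "0 < m" and \<tau>: "\<tau> 0 = 0" "\<tau> m = 1" "\<And>i. i < m \<Longrightarrow> \<tau> i < \<tau> (Suc i)"
    and sm: "\<And>i. i < m \<Longrightarrow> sarc (crv i) M" "0 \<le> M" and cl: "C 0 = C 1"
    and xs: "fills xs (\<Sum>i<m. sg (crv i))"
  shows "\<exists>(K :: ((real ^ 5) \<times> (real ^ 5) \<times> (real ^ 5)) set) f. piecewise_smooth_surface K f \<and> isotropic K f \<and> bounds C K f \<and>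
    area K f \<le> sum_list (map (\<lambda>x. snd x / 2) xs)"
proof -
  define L where "L = length xs"
  \<comment> \<open>\<open>Inl a\<close> is a triangle of the filling; \<open>Inr (i, False)\<close>
    and \<open>Inr (i, True)\<close> are the outer and the inner collar triangle at arc
    \<open>i\<close>, both mapped into the curve.\<close>
  define J :: "(nat + nat \<times> bool) set" where "J = Inl ` {..<L} \<union> Inr ` ({..<m} \<times> UNIV)"
  define g where "g j = (case j of Inl a \<Rightarrow> fst (xs ! a) | Inr (i, b) \<Rightarrow> if b then (\<lambda>q. crv i (1 - fst q)) else (\<lambda>q. crv i (fst q)))" for j :: "nat + nat \<times> bool"
  define D where "D j = (case j of Inl a \<Rightarrow> snd (xs ! a) | Inr ib \<Rightarrow> 0)" for j :: "nat + nat \<times> bool"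
  \<comment> \<open>The sides to be matched: all sides of the filling and the inner side 0 of each
    collar.\<close>
  define E where "E = Inl ` {..<L} \<times> {..<3::nat} \<union> (\<lambda>i. (Inr (i, True), 0)) ` {..<m}"
  define \<gamma> where "\<gamma> x u = g (fst x) (side_pt (snd x) u)" for x :: "(nat + nat \<times> bool) \<times> nat" and u
  have finE: "finite E" by (simp add: E_def)
  have sg2: "(\<Sum>e\<in>E. sg (\<gamma> e)) = 0"
  proof -
    have "(\<Sum>e\<in>E. sg (\<gamma> e)) = (\<Sum>e\<in>Inl ` {..<L} \<times> {..<3::nat}. sg (\<gamma> e)) + (\<Sum>e\<in>(\<lambda>i. (Inr (i, True), 0)) ` {..<m}. sg (\<gamma> e))"
      unfolding E_def by (rule sum.union_disjoint) auto
    also have "(\<Sum>e\<in>(\<lambda>i. (Inr (i, True), 0)) ` {..<m}. sg (\<gamma> e)) = (\<Sum>i<m. sg (crv i))"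
    proof -
      have "sg (\<gamma> (Inr (i, True), 0)) = sg (crv i)" for i
        unfolding \<gamma>_def g_def using sg_rev[of "crv i"] by (simp add: side_pt_simps)
      then show ?thesis by (subst sum.reindex) (auto simp: inj_on_def)
    qed
    also have "(\<Sum>e\<in>Inl ` {..<L} \<times> {..<3::nat}. sg (\<gamma> e)) = (\<Sum>a<L. bd (fst (xs ! a)))"
    proof -
      have "(\<Sum>e\<in>Inl ` {..<L} \<times> {..<3::nat}. sg (\<gamma> e)) = (\<Sum>j\<in>Inl ` {..<L}. \<Sum>s<3::nat. sg (\<gamma> (j, s)))"
        by (simp add: sum.cartesian_product)
      also have "\<dots> = (\<Sum>a<L. \<Sum>s<3::nat. sg (\<gamma> (Inl a, s)))" by (subst sum.reindex) (auto simp: inj_on_def)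
      also have "\<dots> = (\<Sum>a<L. bd (fst (xs ! a)))"
      proof (rule sum.cong[OF refl])
        fix a
        have "{..<3::nat} = {0, 1, 2}" by auto
        then have "(\<Sum>s<3::nat. sg (\<gamma> (Inl a, s))) = sg (\<gamma> (Inl a, 0)) + (sg (\<gamma> (Inl a, 1)) + sg (\<gamma> (Inl a, 2)))"
          by (simp only:) (subst sum.insert; simp)+
        then show "(\<Sum>s<3::nat. sg (\<gamma> (Inl a, s))) = bd (fst (xs ! a))"
          unfolding bd_def \<gamma>_def g_def by (simp only: fst_conv snd_conv sum.case add.assoc)
      qed
      finally show ?thesis .
    qed
    also have "(\<Sum>a<L. bd (fst (xs ! a))) = (\<Sum>i<m. sg (crv i))"
      using xs unfolding fills_def L_def by (simp add: sum_list_sum_nth atLeast0LessThan)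
    finally show ?thesis by (simp only: chain_self)
  qed
  obtain p0 where p0: "\<forall>e\<in>E. p0 e \<in> E \<and> p0 e \<noteq> e \<and> p0 (p0 e) = e \<and> cls (\<gamma> (p0 e)) = cls (\<gamma> e)"
    using even_pairing[OF finE sum_sg_even[OF finE sg2]] by blast
  define nx where "nx i = (if Suc i = m then 0 else Suc i)" for i
  define pv where "pv i = (if i = 0 then m - 1 else i - 1)" for i
  have np: "nx (pv i) = i" "pv (nx i) = i" "nx i < m" "pv i < m" if "i < m" for i
    using that m by (auto simp: nx_def pv_def)
  \<comment> \<open>Sides 1 join the two collar triangles of one arc; sides 2, on which
    \<open>g\<close> is constant, join the collars of consecutive arcs at their common end point.
    The sides 0 of the outer triangles stay free and form the boundary.\<close>
  define \<pi> :: "(nat + nat \<times> bool) \<times> nat \<Rightarrow> (nat + nat \<times> bool) \<times> nat" where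
    "\<pi> x = (if x \<in> E then p0 x else case x of
        (Inr (i, b), s) \<Rightarrow> if i < m \<and> s = 1 then (Inr (i, \<not> b), 1) else if i < m \<and> s = 2 then (Inr (if b then nx i else pv i, \<not> b), 2) else x
      | _ \<Rightarrow> x)" for x
  \<comment> \<open>A matched side is reversed unless the two curves agree as they stand; glueings
    inside the collar always reverse.\<close>
  define \<epsilon> where "\<epsilon> x = (if x \<in> E then \<not> (\<forall>u\<in>{0..1}. \<gamma> (p0 x) u = \<gamma> x u) else \<pi> x \<noteq> x)" for x
  have nE: "(Inr (i, b), s) \<in> E \<longleftrightarrow> b \<and> s = 0 \<and> i < m" for i b s by (auto simp: E_def)
  have iE: "(Inl a, s) \<in> E \<longleftrightarrow> a < L \<and> s < 3" for a s by (auto simp: E_def)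
  have \<pi>1: "\<pi> (Inr (i, b), 1) = (Inr (i, \<not> b), 1)" "\<pi> (Inr (i, b), Suc 0) = (Inr (i, \<not> b), 1)"
    "\<pi> (Inr (i, b), 2) = (Inr (if b then nx i else pv i, \<not> b), 2)" "\<pi> (Inr (i, False), 0) = (Inr (i, False), 0)" if "i < m" for i b
    using that by (simp_all add: \<pi>_def nE)
  have \<pi>E: "\<pi> e = p0 e" "\<pi> e \<in> E" "\<pi> e \<noteq> e" "\<pi> (\<pi> e) = e" if "e \<in> E" for e using p0 that by (simp_all add: \<pi>_def)
  have sides: "x \<in> E \<or> (\<exists>i b. i < m \<and> (x = (Inr (i, b), 1) \<or> x = (Inr (i, b), 2))) \<or> (\<exists>i<m. x = (Inr (i, False), 0)) \<or> (x \<notin> J \<times> {..<3} \<and> \<pi> x = x)" for x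
  proof (cases x)
    case (Pair j s)
    show ?thesis
    proof (cases j)
      case (Inl a)
      then show ?thesis using Pair iE by (cases "x \<in> E") (auto simp: \<pi>_def J_def)
    next
      case (Inr ib)
      obtain i b where ib: "ib = (i, b)" by (cases ib)
      consider "i < m" "s = 0" | "i < m" "s = 1" | "i < m" "s = 2" | "\<not> i < m \<or> \<not> s < 3" using lt3[of s] by blast
      then show ?thesis
      proof cases
        case 1 then show ?thesis using Pair Inr ib nE by (cases b) auto
      next
        case 4
        then have "x \<notin> E" "\<pi> x = x" using Pair Inr ib nE by (auto simp: \<pi>_def)
        then show ?thesis using 4 Pair Inr ib by (auto simp: J_def)
      qed (use Pair Inr ib in auto)
    qed
  qed
  have \<pi>\<pi>: "\<pi> (\<pi> x) = x" for x
    using sides[of x] np by (elim disjE exE conjE) (auto simp: \<pi>E(4) \<pi>1)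
  have \<epsilon>\<pi>: "\<epsilon> (\<pi> x) = \<epsilon> x" for x
  proof (cases "x \<in> E")
    case True
    then have px: "p0 x \<in> E" "p0 (p0 x) = x" using p0 by blast+
    have "\<epsilon> (\<pi> x) = (\<not> (\<forall>u\<in>{0..1}. \<gamma> x u = \<gamma> (p0 x) u))"
      unfolding \<pi>E(1)[OF True] using px by (simp add: \<epsilon>_def)
    also have "\<dots> = (\<not> (\<forall>u\<in>{0..1}. \<gamma> (p0 x) u = \<gamma> x u))" by (simp only: eq_commute)
    also have "\<dots> = \<epsilon> x" using True by (simp add: \<epsilon>_def)
    finally show ?thesis .
  next
    case False
    then have "\<pi> x \<notin> E" using \<pi>E(2) \<pi>\<pi> by metis
    then show ?thesis using False \<pi>\<pi>[of x] by (auto simp: \<epsilon>_def)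
  qed
  have sideA: "side_pt 1 u = (1 - u, u)" "side_pt 2 u = (0, 1 - u)" "side_pt 0 u = (u, 0)" for u by (simp_all add: side_pt_simps)
  have arcs: "crv (pv i) 1 = crv i 0" if "i < m" for i
  proof (cases "i = 0")
    case True then show ?thesis using m \<tau> cl by (simp add: crv_def pv_def)
  next
    case False then show ?thesis by (simp add: crv_def pv_def)
  qed
  have "glueing J g D \<pi> \<epsilon> m (\<lambda>i. (Inr (i, False), 0))"
  proof
    show "finite J" by (simp add: J_def)
    show "good (g j) (D j)" if jJ: "j \<in> J" for j
    proof (cases j)
      case (Inl a)
      then have "xs ! a \<in> set xs" using jJ by (auto simp: J_def L_def)
      then show ?thesis using xs Inl by (simp add: fills_def g_def D_def)
    next
      case (Inr ib)
      then obtain i b where ib: "j = Inr (i, b)" "i < m" using jJ by (auto simp: J_def)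
      have "good (\<lambda>q. crv i (1 - fst q)) 0" "good (\<lambda>q. crv i (1 - (1 - fst q))) 0"
        using good_curve[OF sm(1)[OF ib(2)] sm(2)] good_curve[OF sarc_reverse[OF sm(1)[OF ib(2)]] sm(2)] by simp_all
      then show ?thesis using ib by (simp add: g_def D_def)
    qed
    show "\<pi> (j, s) \<in> J \<times> {..<3}" if js: "j \<in> J" "s < 3" for j s
    proof -
      have EJ: "E \<subseteq> J \<times> {..<3}" by (auto simp: E_def J_def)
      show ?thesis using sides[of "(j, s)"] js np
        by (elim disjE exE conjE) (use EJ \<pi>E(2) in blast, auto simp: \<pi>1 J_def)
    qed
    show "\<pi> (\<pi> x) = x" for x by (rule \<pi>\<pi>)
    show "\<epsilon> (\<pi> x) = \<epsilon> x" for x by (rule \<epsilon>\<pi>)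
    show "\<not> \<epsilon> x" if "\<pi> x = x" for x using that \<pi>E(3)[of x] by (auto simp: \<epsilon>_def)
    show "g (fst (\<pi> (j, s))) (side_pt (snd (\<pi> (j, s))) (if \<epsilon> (j, s) then 1 - u else u)) = g j (side_pt s u)"
      if js: "j \<in> J" "s < 3" "0 \<le> u" "u \<le> 1" for j s u
    proof (cases "(j, s) \<in> E")
      case True
      have c: "cls (\<gamma> (j, s)) = cls (\<gamma> (p0 (j, s)))" using p0 True by simp
      show ?thesis
      proof (cases "\<epsilon> (j, s)")
        case e: True
        then have "\<exists>u\<in>{0..1}. \<gamma> (p0 (j, s)) u \<noteq> \<gamma> (j, s) u" using True by (simp add: \<epsilon>_def)
        then obtain w where w: "w \<in> {0..1}" "\<gamma> (p0 (j, s)) w \<noteq> \<gamma> (j, s) w" ..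
        have "\<not> (\<forall>u\<in>{0..1}. \<gamma> (j, s) u = \<gamma> (p0 (j, s)) u)"
        proof
          assume "\<forall>u\<in>{0..1}. \<gamma> (j, s) u = \<gamma> (p0 (j, s)) u"
          then have "\<gamma> (j, s) w = \<gamma> (p0 (j, s)) w" using w(1) by (rule bspec)
          then show False using w(2) by simp
        qed
        from cls_eqD[OF c this js(3,4)] show ?thesis using e \<pi>E(1)[OF True] by (simp add: \<gamma>_def)
      next
        case False
        then have "\<gamma> (p0 (j, s)) u = \<gamma> (j, s) u" using True js by (auto simp: \<epsilon>_def)
        then show ?thesis using False \<pi>E(1)[OF True] by (simp add: \<gamma>_def)
      qed
    next
      case False
      have ar: "crv (nx i) 0 = crv i 1" if "i < m" for i using arcs[of "nx i"] np that by simp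
      from False sides[of "(j, s)"] js consider i b where "i < m" "j = Inr (i, b)" "s = 1" | i b where "i < m" "j = Inr (i, b)" "s = 2"
        | i where "i < m" "j = Inr (i, False)" "s = 0" by auto
      then show ?thesis
      proof cases
        case (1 i b)
        then have "\<epsilon> (j, s)" using False by (simp add: \<epsilon>_def \<pi>1)
        then show ?thesis using 1 by (cases b) (simp_all add: \<pi>1 g_def side_pt_simps)
      next
        case (2 i b)
        then have "\<epsilon> (j, s)" using False by (simp add: \<epsilon>_def \<pi>1)
        then show ?thesis using 2 arcs ar by (cases b) (simp_all add: \<pi>1 g_def side_pt_simps)
      next
        case (3 i)
        then have "\<not> \<epsilon> (j, s)" using False by (simp add: \<epsilon>_def \<pi>1)
        then show ?thesis using 3 by (simp add: \<pi>1 g_def)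
      qed
    qed
    show "0 < m" by (rule m)
    show "(Inr (i, False), 0) \<in> J \<times> {..<3::nat}" if "i < m" for i using that by (auto simp: J_def)
    show "\<pi> (Inr (i, False), 0) = (Inr (i, False), 0)" if "i < m" for i by (rule \<pi>1(4)[OF that])
    show "inj_on (\<lambda>i. (Inr (i, False) :: nat + nat \<times> bool, 0 :: nat)) {..<m}" by (auto simp: inj_on_def)
    show "\<exists>i<m. x = (Inr (i, False), 0)" if "x \<in> J \<times> {..<3}" "\<pi> x = x" for x
      using sides[of x] that \<pi>E(3)[of x] by (elim disjE exE conjE) (auto simp: \<pi>1)
  qed
  then interpret gl: glueing J g D \<pi> \<epsilon> m "\<lambda>i. (Inr (i, False), 0)" .
  let ?a1 = "gl.\<alpha> 1" and ?a2 = "gl.\<alpha> 2"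
  have e1: "\<epsilon> (Inr (i, b), 1)" "\<epsilon> (Inr (i, b), Suc 0)" "\<epsilon> (Inr (i, b), 2)" if "i < m" for i b
    using that by (simp_all add: \<epsilon>_def nE \<pi>1)
  have al1: "?a1 (j, 0, True) = (j, 1, False)" "?a1 (j, 1, False) = (j, 0, True)" "?a1 (j, 1, True) = (j, 2, False)"
    "?a1 (j, 2, False) = (j, 1, True)" "?a1 (j, 2, True) = (j, 0, False)" "?a1 (j, 0, False) = (j, 2, True)" for j
    using gl.\<alpha>_simps(2)[of 0 j] gl.\<alpha>_simps(2)[of 1 j] gl.\<alpha>_simps(2)[of 2 j] by (simp_all add: xnext_def xprev_def)
  have al2: "?a2 (Inr (i, b), 1, c) = (Inr (i, \<not> b), 1, \<not> c)"
    "?a2 (Inr (i, b), 2, c) = (Inr (if b then nx i else pv i, \<not> b), 2, \<not> c)"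
    "?a2 (Inr (i, False), 0, c) = (Inr (i, False), 0, c)" if "i < m" for i b c
    using e1[OF that] \<pi>1[OF that] nE[of i False 0] by (simp_all add: gl.\<alpha>_simps \<epsilon>_def)
  have fs: "gl.fs i b = (Inr (i, False), 0, b)" for i b by (simp add: gl.fs_def)
  \<comment> \<open>Turning around the end of arc \<open>i\<close> inside the collar leads to the
    beginning of the next boundary side.\<close>
  have link: "gl.fs (if Suc i = m then 0 else Suc i) False \<in> orb2 ?a1 ?a2 (gl.fs i True)" if i: "i < m" for i
  proof -
    let ?O = "orb2 ?a1 ?a2 (gl.fs i True)"
    note st = orb2_step[where f = ?a1 and g = ?a2 and x = "gl.fs i True"]
    have 1: "(Inr (i, False), 0, True) \<in> ?O" using orb2_self[of "gl.fs i True"] unfolding fs .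
    have 2: "(Inr (i, False), 1, False) \<in> ?O" using conjunct1[OF st[OF 1]] unfolding al1 .
    have 3: "(Inr (i, True), 1, True) \<in> ?O" using conjunct2[OF st[OF 2]] unfolding al2[OF i] by (simp only: not_False_eq_True)
    have 4: "(Inr (i, True), 2, False) \<in> ?O" using conjunct1[OF st[OF 3]] unfolding al1 .
    have 5: "(Inr (nx i, False), 2, True) \<in> ?O" using conjunct2[OF st[OF 4]] unfolding al2[OF i]
      by (simp only: not_False_eq_True not_True_eq_False if_True)
    have "(Inr (nx i, False), 0, False) \<in> ?O" using conjunct1[OF st[OF 5]] unfolding al1 .
    then show ?thesis unfolding fs nx_def .
  qed
  \<comment> \<open>A boundary vertex meets three corners of collar triangles and nothing else.
    Their six flags form an invariant set whatever the pairing \<open>p0\<close>, and only one of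
    them starts a boundary side.\<close>
  have sep: "i' = i" if i: "i < m" "i' < m" and o: "gl.fs i' False \<in> orb2 ?a1 ?a2 (gl.fs i False)" for i i'
  proof -
    let ?A = "{(Inr (i, False), 0, False), (Inr (i, False), 2, True), (Inr (pv i, True), 2, False), (Inr (pv i, True), 1, True),
      (Inr (pv i, False), 1, False), (Inr (pv i, False), 0, True)} :: ((nat + nat \<times> bool) \<times> nat \<times> bool) set"
    have "orb2 ?a1 ?a2 (gl.fs i False) \<subseteq> ?A"
    proof (rule orb2_subset)
      show "gl.fs i False \<in> ?A" by (simp add: fs)
      fix y assume "y \<in> ?A"
      then show "?a1 y \<in> ?A \<and> ?a2 y \<in> ?A"
        by (elim insertE emptyE) (simp_all only: al1 al2[OF i(1)] al2[OF np(4)[OF i(1)]] np[OF i(1)] if_True if_False simp_thms insert_iff)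
    qed
    then have "(Inr (i', False), 0, False) \<in> ?A" using o unfolding fs by blast
    then show ?thesis by auto
  qed
  obtain K :: "((real ^ 5) \<times> (real ^ 5) \<times> (real ^ 5)) set" and f h where K: "piecewise_smooth_surface K f" "isotropic K f"
    "area K f \<le> (\<Sum>j\<in>J. D j / 2)" "simple_path h" "pathfinish h = pathstart h"
    "path_image h = surface_boundary (carrier_of K)"
    "\<forall>i<m. \<forall>v\<in>{0..1}. f (h ((1 - v) * \<tau> i + v * \<tau> (Suc i))) = g (Inr (i, False)) (side_pt 0 v)"
    using gl.realization[OF link sep \<tau>] unfolding fst_conv snd_conv by blast
  have "(\<Sum>j\<in>J. D j / 2) = (\<Sum>j\<in>Inl ` {..<L}. D j / 2) + (\<Sum>j\<in>Inr ` ({..<m} \<times> UNIV). D j / 2)"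
    unfolding J_def by (rule sum.union_disjoint) auto
  also have "(\<Sum>j\<in>Inr ` ({..<m} \<times> UNIV). D j / 2) = 0" by (rule sum.neutral) (auto simp: D_def)
  also have "(\<Sum>j\<in>Inl ` {..<L}. D j / 2) = (\<Sum>a<L. snd (xs ! a) / 2)" by (subst sum.reindex) (auto simp: D_def inj_on_def)
  also have "\<dots> = sum_list (map (\<lambda>x. snd x / 2) xs)" by (simp add: sum_list_sum_nth L_def atLeast0LessThan)
  finally have ar: "area K f \<le> sum_list (map (\<lambda>x. snd x / 2) xs)" using K(3) by simp
  have "f (h t) = C t" if t: "t \<in> {0..1}" for t
  proof -
    have "\<exists>i<m. \<tau> i \<le> t \<and> t \<le> \<tau> (Suc i)"
    proof (rule ccontr)
      assume n: "\<not> ?thesis"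
      have "i \<le> m \<Longrightarrow> \<tau> i \<le> t" for i
      proof (induction i)
        case 0 then show ?case using t \<tau> by simp
      next
        case (Suc i)
        then show ?case using n by (meson Suc_le_eq Suc_leD linear)
      qed
      then have "\<tau> m \<le> t" by simp
      then have "t = 1" using t \<tau> by simp
      moreover have "\<tau> (m - 1) \<le> \<tau> m" using \<tau>(3)[of "m - 1"] m by simp
      ultimately show False using n m \<tau>(2) by (metis Suc_diff_1 diff_less order_refl zero_less_one)
    qed
    then obtain i where i: "i < m" "\<tau> i \<le> t" "t \<le> \<tau> (Suc i)" by blast
    define v where "v = (t - \<tau> i) / (\<tau> (Suc i) - \<tau> i)"
    have d: "0 < \<tau> (Suc i) - \<tau> i" using \<tau>(3)[OF i(1)] by simp
    have v: "v \<in> {0..1}" using i d by (simp add: v_def)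
    have "v * (\<tau> (Suc i) - \<tau> i) = t - \<tau> i" using d by (simp add: v_def)
    then have e: "(1 - v) * \<tau> i + v * \<tau> (Suc i) = t" by (simp add: algebra_simps)
    have "f (h ((1 - v) * \<tau> i + v * \<tau> (Suc i))) = crv i v"
      using K(7) i(1) v by (simp add: g_def side_pt_simps)
    then show ?thesis unfolding crv_def e .
  qed
  then have "bounds C K f" unfolding bounds_def using K(4-6) by (intro exI[of _ h]) auto
  then show ?thesis using K(1,2) ar by blast
qed

section \<open>Piecewise smooth curves\<close>

text \<open>At the ends of a piece \<open>C\<close> may have no velocity. The smooth extension
  \<open>g\<close> has a continuous one on the closed interval, and the two speeds can differ only
  at the end points, which integrals ignore.\<close>

lemma smooth_piece:
  fixes C :: "real \<Rightarrow> complex ^ 'n"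
  assumes ab: "a < b" and C: "smooth_upto_boundary {a..b} C"
  defines "q \<equiv> \<lambda>t. norm (vector_derivative C (at t))"
  shows "q integrable_on {a..b} \<and> (\<exists>M\<ge>0. (\<forall>x y. a \<le> x \<longrightarrow> x \<le> y \<longrightarrow> y \<le> b \<longrightarrow>
      norm (C y - C x) \<le> integral {x..y} q \<and> norm (C y - C x) \<le> M * (y - x)) \<and>
    (\<forall>t. a < t \<longrightarrow> t < b \<longrightarrow> (C has_vector_derivative vector_derivative C (at t)) (at t) \<and> q t \<le> M))"
proof -
  obtain U g where g: "{a..b} \<subseteq> U" "open U" "C_on 1 U g" "\<And>x. x \<in> {a..b} \<Longrightarrow> g x = C x"
    using C unfolding smooth_upto_boundary_def smooth_on_open_def by blast
  define dg where "dg x = frechet_derivative g (at x) 1" for x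
  have cont: "continuous_on U dg" using g(3) by (simp add: dg_def)
  then have cont': "continuous_on {x..y} dg" if "a \<le> x" "y \<le> b" for x y
    by (rule continuous_on_subset) (use g(1) that in auto)
  have dg: "(g has_vector_derivative dg x) (at x)" if "x \<in> U" for x
  proof -
    have "(g has_vector_derivative vector_derivative g (at x)) (at x)"
      using g(3) that vector_derivative_works by auto
    moreover from this have "frechet_derivative g (at x) = (\<lambda>h. h *\<^sub>R vector_derivative g (at x))"
      unfolding has_vector_derivative_def by (rule frechet_derivative_at[symmetric])
    ultimately show ?thesis by (simp add: dg_def)
  qed
  have vC: "(C has_vector_derivative dg t) (at t)" if t: "a < t" "t < b" for t
  proof -
    have "t \<in> U" using g(1) t by auto
    from dg[OF this] show ?thesis
      by (rule has_vector_derivative_transform_within_open[of g _ _ "{a<..<b}"]) (use g(4) t in auto)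
  qed
  have q: "q t = norm (dg t)" if "a < t" "t < b" for t
    unfolding q_def using vector_derivative_at[OF vC[OF that]] by simp
  have "bounded (dg ` {a..b})" by (intro compact_imp_bounded compact_continuous_image cont') auto
  then obtain M where "\<forall>z\<in>dg ` {a..b}. norm z \<le> M" unfolding bounded_iff by blast
  then have M: "norm (dg x) \<le> M" if "x \<in> {a..b}" for x using that by blast
  have M0: "0 \<le> M" using order_trans[OF norm_ge_zero M[of a]] ab by simp
  have nc: "(\<lambda>s. norm (dg s)) integrable_on {x..y}" if "a \<le> x" "y \<le> b" for x y
    by (intro integrable_continuous_real continuous_on_norm cont' that)
  have iq: "q integrable_on {a..b}"
    by (rule integrable_spike_finite[of "{a, b}" _ _ "\<lambda>s. norm (dg s)"]) (use q nc in auto)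
  have xy: "norm (C y - C x) \<le> integral {x..y} q \<and> norm (C y - C x) \<le> M * (y - x)" if h: "a \<le> x" "x \<le> y" "y \<le> b" for x y
  proof -
    have "(dg has_integral g y - g x) {x..y}"
    proof (rule fundamental_theorem_of_calculus)
      fix t assume "t \<in> {x..y}"
      then have "t \<in> U" using h g(1) by auto
      then show "(g has_vector_derivative dg t) (at t within {x..y})" by (rule has_vector_derivative_at_within[OF dg])
    qed (rule h)
    then have "C y - C x = integral {x..y} dg" using g(4)[of x] g(4)[of y] h by (simp add: integral_unique)
    also have "norm \<dots> \<le> integral {x..y} (\<lambda>s. norm (dg s))"
      by (rule integral_norm_bound_integral[OF integrable_continuous_real[OF cont'[OF h(1,3)]] nc[OF h(1,3)]]) simp
    finally have 1: "norm (C y - C x) \<le> integral {x..y} (\<lambda>s. norm (dg s))" .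
    have "integral {x..y} (\<lambda>s. norm (dg s)) = integral {x..y} q"
      by (rule integral_spike[of "{a, b}"]) (use q h in auto)
    moreover have "integral {x..y} (\<lambda>s. norm (dg s)) \<le> integral {x..y} (\<lambda>s. M)"
      by (rule integral_le) (use nc h M in auto)
    ultimately show ?thesis using 1 h by (simp add: mult.commute)
  qed
  have "(C has_vector_derivative vector_derivative C (at t)) (at t) \<and> q t \<le> M" if t: "a < t" "t < b" for t
    using vC[OF t] vector_derivative_at[OF vC[OF t]] q[OF t] M[of t] t by simp
  then show ?thesis using iq xy M0 by blast
qed

lemma sarc_subinterval:
  fixes C :: "real \<Rightarrow> complex ^ 'n"
  assumes C: "smooth_upto_boundary {a..b} C" and xy: "a \<le> x" "x < y" "y \<le> b"
    and M: "\<And>t. a < t \<Longrightarrow> t < b \<Longrightarrow> (C has_vector_derivative vector_derivative C (at t)) (at t) \<and> norm (vector_derivative C (at t)) \<le> M"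
  shows "sarc (\<lambda>u. C ((1 - u) * x + u * y)) (M * (y - x))"
proof -
  have e: "(1 - u) * x + u * y = x + u * (y - x)" for u by (simp add: algebra_simps)
  have "smooth_upto_boundary {0..1} (\<lambda>u. C (x + u * (y - x)))"
  proof (rule smooth_upto_boundary_affine[OF C])
    show "bounded_linear (\<lambda>u. u * (y - x))" by (rule bounded_linear_mult_left)
    fix u :: real assume u: "u \<in> {0..1}"
    then have "0 \<le> u * (y - x)" "u * (y - x) \<le> 1 * (y - x)" using xy by (auto intro!: mult_right_mono)
    then show "x + u * (y - x) \<in> {a..b}" using xy unfolding mult_1_left atLeastAtMost_iff by linarith
  qed
  moreover have "norm (vector_derivative (\<lambda>u. C (x + u * (y - x))) (at t)) \<le> M * (y - x)" if t: "t \<in> {0<..<1}" for t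
  proof -
    have "0 < t * (y - x)" "t * (y - x) < 1 * (y - x)" using xy t by (auto intro!: mult_strict_right_mono)
    then have s: "a < x + t * (y - x)" "x + t * (y - x) < b" using xy unfolding mult_1_left by linarith+
    have "((\<lambda>u. x + u * (y - x)) has_vector_derivative (y - x)) (at t)"
      unfolding has_real_derivative_iff_has_vector_derivative[symmetric] by (auto intro!: derivative_eq_intros)
    from vector_diff_chain_at[OF this, of C] M[OF s]
    have "((\<lambda>u. C (x + u * (y - x))) has_vector_derivative (y - x) *\<^sub>R vector_derivative C (at (x + t * (y - x)))) (at t)"
      by (simp add: o_def)
    then have "norm (vector_derivative (\<lambda>u. C (x + u * (y - x))) (at t)) = (y - x) * norm (vector_derivative C (at (x + t * (y - x))))"
      using xy by (simp add: vector_derivative_at)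
    also have "\<dots> \<le> (y - x) * M" using M[OF s] xy by (intro mult_left_mono) auto
    finally show ?thesis by (simp add: mult.commute)
  qed
  ultimately show ?thesis unfolding sarc_def e by blast
qed

lemma breakpoints:
  assumes P: "finite P" "0 \<in> P" "1 \<in> P" "P \<subseteq> {0..1::real}"
  shows "\<exists>m \<tau>. 0 < m \<and> \<tau> 0 = 0 \<and> \<tau> m = 1 \<and> (\<forall>i<m. \<tau> i < \<tau> (Suc i) \<and> \<tau> i \<in> P \<and> \<tau> (Suc i) \<in> P \<and> {\<tau> i<..<\<tau> (Suc i)} \<inter> P = {})"
proof -
  define xs where "xs = sorted_list_of_set P"
  have xs: "set xs = P" "sorted xs" "distinct xs" "sorted_wrt (<) xs" using P(1) by (simp_all add: xs_def)
  have st: "xs ! i < xs ! j" if "i < j" "j < length xs" for i j using xs(4) that by (simp add: sorted_wrt_iff_nth_less)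
  obtain i0 where i0: "i0 < length xs" "xs ! i0 = 0" using xs(1) P(2) by (metis in_set_conv_nth)
  obtain i1 where i1: "i1 < length xs" "xs ! i1 = 1" using xs(1) P(3) by (metis in_set_conv_nth)
  have in01: "0 \<le> xs ! i" "xs ! i \<le> 1" "xs ! i \<in> P" if "i < length xs" for i using nth_mem[OF that] xs(1) P(4) by auto
  have "i0 = 0"
  proof (rule ccontr)
    assume "i0 \<noteq> 0" then have "xs ! 0 < xs ! i0" using i0 by (intro st) auto
    then show False using i0 in01(1)[of 0] by (cases xs) auto
  qed
  moreover have "i1 = length xs - 1"
  proof (rule ccontr)
    assume "i1 \<noteq> length xs - 1" then have "xs ! i1 < xs ! (length xs - 1)" using i1 by (intro st) auto
    moreover have "length xs - 1 < length xs" using i1 by auto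
    ultimately show False using i1(2) in01(2)[of "length xs - 1"] by linarith
  qed
  ultimately have e: "xs ! 0 = 0" "xs ! (length xs - 1) = 1" using i0 i1 by simp_all
  have m: "0 < length xs - 1" using e by (cases "length xs - 1 = 0") auto
  have gap: "{xs ! i<..<xs ! Suc i} \<inter> P = {}" if i: "Suc i < length xs" for i
  proof (rule ccontr)
    assume "\<not> ?thesis"
    then obtain z where z: "xs ! i < z" "z < xs ! Suc i" "z \<in> P" by auto
    then obtain j where j: "j < length xs" "xs ! j = z" using xs(1) by (metis in_set_conv_nth)
    have "i < j" using z(1) j i st[of j i] by (metis Suc_lessD less_asym less_irrefl linorder_neqE_nat)
    then show False using z(2) j st[of "Suc i" j] by (metis Suc_lessI less_asym less_irrefl)
  qed
  show ?thesis
    by (intro exI[of _ "length xs - 1"] exI[of _ "\<lambda>i. xs ! i"]) (use e m st in01(3) gap in auto)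
qed

theorem corollary2:
  fixes C :: "real \<Rightarrow> complex ^ 'n" and l :: real
  assumes "CARD('n) \<ge> 2"
    and "closed_curve C"
    and "curve_length C = l"
  shows "\<exists>(K :: ((real ^ 5) \<times> (real ^ 5) \<times> (real ^ 5)) set) (f :: real ^ 5 \<Rightarrow> complex ^ 'n).
           piecewise_smooth_surface K f \<and> isotropic K f \<and> bounds C K f \<and>
           area K f \<le> 3 * l\<^sup>2 / (8 * sqrt 2)"
proof -
  note n = assms(1)
  define q where "q t = norm (vector_derivative C (at t))" for t
  have cl: "C 0 = C 1" using assms(2) by (simp add: closed_curve_def pathfinish_def pathstart_def)
  obtain P where P: "finite P" "0 \<in> P" "1 \<in> P" "P \<subseteq> {0..1}"
    "\<forall>a\<in>P. \<forall>b\<in>P. a < b \<and> {a<..<b} \<inter> P = {} \<longrightarrow> smooth_upto_boundary {a..b} C"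
    using assms(2) unfolding closed_curve_def piecewise_smooth_path_def by blast
  obtain m \<tau> where m: "0 < m" and \<tau>: "\<tau> 0 = 0" "\<tau> m = 1"
    and \<tau>s: "\<forall>i<m. \<tau> i < \<tau> (Suc i) \<and> \<tau> i \<in> P \<and> \<tau> (Suc i) \<in> P \<and> {\<tau> i<..<\<tau> (Suc i)} \<inter> P = {}"
    using breakpoints[OF P(1-4)] by blast
  have inc: "\<tau> i < \<tau> (Suc i)" and sm: "smooth_upto_boundary {\<tau> i..\<tau> (Suc i)} C" if "i < m" for i
    using \<tau>s P(5) that by blast+
  have "\<forall>i. \<exists>M. i < m \<longrightarrow> 0 \<le> M \<and> (\<forall>x y. \<tau> i \<le> x \<longrightarrow> x \<le> y \<longrightarrow> y \<le> \<tau> (Suc i) \<longrightarrow>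
      norm (C y - C x) \<le> integral {x..y} q \<and> norm (C y - C x) \<le> M * (y - x)) \<and>
    (\<forall>t. \<tau> i < t \<longrightarrow> t < \<tau> (Suc i) \<longrightarrow> (C has_vector_derivative vector_derivative C (at t)) (at t) \<and> q t \<le> M)"
    using smooth_piece[OF inc sm] unfolding q_def by blast
  then obtain MM where MM: "\<And>i. i < m \<Longrightarrow> 0 \<le> MM i \<and> (\<forall>x y. \<tau> i \<le> x \<longrightarrow> x \<le> y \<longrightarrow> y \<le> \<tau> (Suc i) \<longrightarrow>
      norm (C y - C x) \<le> integral {x..y} q \<and> norm (C y - C x) \<le> MM i * (y - x)) \<and>
    (\<forall>t. \<tau> i < t \<longrightarrow> t < \<tau> (Suc i) \<longrightarrow> (C has_vector_derivative vector_derivative C (at t)) (at t) \<and> q t \<le> MM i)"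
    by metis
  \<comment> \<open>A common speed bound for all pieces.\<close>
  define M where "M = (\<Sum>i<m. MM i)"
  have MMM: "MM i \<le> M" if "i < m" for i unfolding M_def by (rule member_le_sum) (use that MM in auto)
  have M0: "0 \<le> M" unfolding M_def by (rule sum_nonneg) (use MM in auto)
  have iq: "q integrable_on {\<tau> i..\<tau> (Suc i)}" if "i < m" for i
    using smooth_piece[OF inc sm, OF that that] unfolding q_def by blast
  have \<tau>ge: "0 \<le> \<tau> i \<and> q integrable_on {0..\<tau> i}" if "i \<le> m" for i
    using that
  proof (induction i)
    case 0
    have "q integrable_on {0 :: real}" using has_integral_refl(2) by (rule has_integral_integrable)
    then show ?case using \<tau>(1) by simp
  next
    case (Suc i)
    have "q integrable_on {0..\<tau> (Suc i)}"
      by (rule Henstock_Kurzweil_Integration.integrable_combine[of 0 "\<tau> i"]) (use Suc inc[of i] iq[of i] in auto)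
    then show ?case using Suc inc[of i] by auto
  qed
  have iq01: "q integrable_on {0..1}" using \<tau>ge[of m] \<tau>(2) by simp
  have \<tau>le: "\<tau> i \<le> 1" if "i \<le> m" for i
  proof -
    have "\<tau> i \<le> \<tau> (i + d)" if "i + d \<le> m" for d
      using that
    proof (induction d)
      case (Suc d) then show ?case using inc[of "i + d"] by simp
    qed simp
    from this[of "m - i"] show ?thesis using that \<tau>(2) by simp
  qed
  have "q = (\<lambda>t. norm (vector_derivative C (at t)))" by (rule ext) (rule q_def)
  then have l: "l = integral {0..1} q" using assms(3) by (simp only: curve_length_def)
  \<comment> \<open>Each smooth piece is cut into \<open>k\<close> intervals of equal parameter
    length, so no arc has a break point inside; reparametrized to the unit interval, the arcs have
    speed at most \<open>M / k\<close>.\<close>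
  have fine: "\<exists>\<sigma>. \<sigma> 0 = 0 \<and> \<sigma> (m * k) = 1 \<and> (\<forall>j<m * k. \<sigma> j < \<sigma> (Suc j)) \<and>
      (\<forall>j<m * k. sarc (\<lambda>u. C ((1 - u) * \<sigma> j + u * \<sigma> (Suc j))) (M / real k)) \<and>
      (\<forall>j<m * k. norm (C (\<sigma> (Suc j)) - C (\<sigma> j)) \<le> M / real k) \<and>
      (\<Sum>j<m * k. norm (C (\<sigma> (Suc j)) - C (\<sigma> j))) \<le> l" if k: "0 < k" for k
  proof -
    define \<sigma> where "\<sigma> j = \<tau> (j div k) + real (j mod k) / real k * (\<tau> (Suc (j div k)) - \<tau> (j div k))" for j
    have k0: "0 < real k" using k by simp
    have \<sigma>4: "\<sigma> (k * i + r) = \<tau> i + real r / real k * (\<tau> (Suc i) - \<tau> i)" if "r \<le> k" for i r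
    proof (cases "r = k")
      case True
      have "k * i + k = Suc i * k" by simp
      then have "(k * i + k) div k = Suc i" "(k * i + k) mod k = 0" using k by (metis nonzero_mult_div_cancel_right less_irrefl, metis mod_mult_self2_is_0)
      then show ?thesis using True k0 by (simp add: \<sigma>_def)
    next
      case False then show ?thesis using that k by (simp add: \<sigma>_def)
    qed
    have S: "\<exists>i<m. \<tau> i \<le> \<sigma> j \<and> \<sigma> j < \<sigma> (Suc j) \<and> \<sigma> (Suc j) \<le> \<tau> (Suc i) \<and> \<sigma> (Suc j) - \<sigma> j \<le> 1 / real k" if j: "j < m * k" for j
    proof -
      define i r where "i = j div k" and "r = j mod k"
      have ir: "j = k * i + r" "r < k" using k by (simp_all add: i_def r_def)
      have im: "i < m" unfolding i_def using j k by (simp add: less_mult_imp_div_less)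
      define \<Delta> where "\<Delta> = \<tau> (Suc i) - \<tau> i"
      have D: "0 < \<Delta>" "\<Delta> \<le> 1" using inc[OF im] \<tau>le[of "Suc i"] \<tau>ge[of i] im by (auto simp: \<Delta>_def)
      have s: "\<sigma> j = \<tau> i + real r / real k * \<Delta>" "\<sigma> (Suc j) = \<tau> i + real (Suc r) / real k * \<Delta>"
        using \<sigma>4[of r i] \<sigma>4[of "Suc r" i] ir unfolding \<Delta>_def by simp_all
      have a: "0 \<le> real r / real k * \<Delta>" using D by simp
      have "real (Suc r) / real k \<le> 1" using ir k0 by simp
      then have b: "real (Suc r) / real k * \<Delta> \<le> 1 * \<Delta>" using D by (intro mult_right_mono) auto
      have c: "real (Suc r) / real k * \<Delta> = real r / real k * \<Delta> + 1 / real k * \<Delta>" by (simp add: add_divide_distrib distrib_right)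
      have d: "0 < 1 / real k * \<Delta>" "1 / real k * \<Delta> \<le> 1 / real k * 1" using D k0 by (auto intro!: mult_left_mono divide_right_mono)
      show ?thesis by (rule exI[of _ i]) (use im s a b c d in \<open>auto simp: \<Delta>_def\<close>)
    qed
    have inside: "0 \<le> \<sigma> j" if "j \<le> m * k" for j
      using that
    proof (induction j)
      case 0 then show ?case using \<tau>(1) k by (simp add: \<sigma>_def)
    next
      case (Suc j) then show ?case using S[of j] by auto
    qed
    have e: "\<sigma> 0 = 0" "\<sigma> (m * k) = 1" using \<tau> k by (simp_all add: \<sigma>_def)
    have sub: "norm (C (\<sigma> (Suc j)) - C (\<sigma> j)) \<le> integral {\<sigma> j..\<sigma> (Suc j)} q \<and> norm (C (\<sigma> (Suc j)) - C (\<sigma> j)) \<le> M / real k \<and>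
        sarc (\<lambda>u. C ((1 - u) * \<sigma> j + u * \<sigma> (Suc j))) (M / real k) \<and> \<sigma> (Suc j) \<le> 1" if j: "j < m * k" for j
    proof -
      obtain i where i: "i < m" "\<tau> i \<le> \<sigma> j" "\<sigma> j < \<sigma> (Suc j)" "\<sigma> (Suc j) \<le> \<tau> (Suc i)" "\<sigma> (Suc j) - \<sigma> j \<le> 1 / real k"
        using S[OF j] by blast
      have b: "MM i * (\<sigma> (Suc j) - \<sigma> j) \<le> M / real k"
        using mult_mono[OF MMM[OF i(1)] i(5)] M0 i(3) by simp
      have 1: "norm (C (\<sigma> (Suc j)) - C (\<sigma> j)) \<le> integral {\<sigma> j..\<sigma> (Suc j)} q" "norm (C (\<sigma> (Suc j)) - C (\<sigma> j)) \<le> MM i * (\<sigma> (Suc j) - \<sigma> j)"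
        using MM[OF i(1)] i(2-4) by (meson less_imp_le)+
      have "sarc (\<lambda>u. C ((1 - u) * \<sigma> j + u * \<sigma> (Suc j))) (MM i * (\<sigma> (Suc j) - \<sigma> j))"
        by (rule sarc_subinterval[OF sm[OF i(1)] i(2,3,4)]) (use MM[OF i(1)] in \<open>auto simp: q_def\<close>)
      then have "sarc (\<lambda>u. C ((1 - u) * \<sigma> j + u * \<sigma> (Suc j))) (M / real k)"
        using b unfolding sarc_def by (meson order_trans)
      then show ?thesis using 1 b \<tau>le[of "Suc i"] i by auto
    qed
    have "(\<Sum>j<N. norm (C (\<sigma> (Suc j)) - C (\<sigma> j))) \<le> integral {0..\<sigma> N} q" if "N \<le> m * k" for N
      using that
    proof (induction N)
      case 0 then show ?case by (simp add: e)
    next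
      case (Suc N)
      have "q integrable_on {0..\<sigma> (Suc N)}"
        by (rule integrable_on_subinterval[OF iq01]) (use sub[of N] Suc.prems in auto)
      then have "integral {0..\<sigma> N} q + integral {\<sigma> N..\<sigma> (Suc N)} q = integral {0..\<sigma> (Suc N)} q"
        by (intro Henstock_Kurzweil_Integration.integral_combine) (use inside[of N] S[of N] Suc.prems in auto)
      then show ?case using Suc sub[of N] by auto
    qed
    from this[of "m * k"] have "(\<Sum>j<m * k. norm (C (\<sigma> (Suc j)) - C (\<sigma> j))) \<le> l" unfolding l e by simp
    then show ?thesis using e S sub by (intro exI[of _ \<sigma>]) auto
  qed
  show ?thesis
  proof (cases "l = 0")
    \<comment> \<open>Length 0 requires a surface of area exactly 0, which the error allowed in
      \<open>Fil\<close> cannot provide. The curve is constant, and constant triangles fill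
      it.\<close>
    case True
    obtain \<sigma> where \<sigma>: "\<sigma> 0 = 0" "\<sigma> (m * 1) = 1" "\<forall>j<m * 1. \<sigma> j < \<sigma> (Suc j)"
      "\<forall>j<m * 1. sarc (\<lambda>u. C ((1 - u) * \<sigma> j + u * \<sigma> (Suc j))) (M / real 1)" using fine[of 1] by auto
    have const: "C t = C 0" if t: "0 \<le> t" "t \<le> 1" for t
    proof -
      have *: "\<forall>t. \<tau> 0 \<le> t \<longrightarrow> t \<le> \<tau> N \<longrightarrow> C t = C 0" if "N \<le> m" for N
        using that
      proof (induction N)
        case 0 then show ?case using \<tau> by auto
      next
        case (Suc N)
        note IH = Suc.IH[OF Suc_leD[OF Suc.prems], rule_format]
        show ?case
        proof (intro allI impI)
          fix t assume t: "\<tau> 0 \<le> t" "t \<le> \<tau> (Suc N)"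
          show "C t = C 0"
          proof (cases "t \<le> \<tau> N")
            case True then show ?thesis using t(1) by (intro IH)
          next
            case False
            have "norm (C t - C (\<tau> N)) \<le> integral {\<tau> N..t} q" using MM[of N] Suc.prems False t by auto
            also have "\<dots> \<le> integral {0..1} q"
            proof (rule integral_subset_le)
              show s: "{\<tau> N..t} \<subseteq> {0..1}" using t \<tau>le[of "Suc N"] \<tau>ge[of N] Suc.prems by auto
              show "q integrable_on {\<tau> N..t}" by (rule integrable_on_subinterval[OF iq01 s])
            qed (use iq01 in \<open>auto simp: q_def\<close>)
            also have "\<dots> = 0" using True l \<open>l = 0\<close> by simp
            finally have "C t = C (\<tau> N)" by simp
            moreover have "C (\<tau> N) = C 0" by (rule IH) (use Suc.prems \<tau>(1) \<tau>ge[of N] in auto)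
            ultimately show ?thesis by simp
          qed
        qed
      qed
      show ?thesis by (rule *[OF order_refl, rule_format]) (use t \<tau>(1,2) in simp_all)
    qed
    define p where "p = C 0"
    \<comment> \<open>One constant triangle per arc: its three equal sides amount to one side modulo
      2.\<close>
    define xs where "xs = replicate m (triangle_param (p, p, p), 0 :: real)"
    have g: "good (triangle_param (p, p, p)) 0"
      using good_affine[of p p p] by (simp add: omega_def)
    have "seg p p = sg (\<lambda>u. p)" unfolding seg_def by (rule sg_cong) (simp add: algebra_simps)
    then have b: "bd (triangle_param (p, p, p)) = sg (\<lambda>u. p)" unfolding bd_affine tri_def by (simp only: chain_ac)
    have inb: "0 \<le> \<sigma> j \<and> \<sigma> j \<le> 1" if "j \<le> m" for j
    proof -
      have up: "\<sigma> i \<le> \<sigma> (i + d)" if "i + d \<le> m" for i d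
        using that
      proof (induction d)
        case (Suc d)
        then have "\<sigma> (i + d) < \<sigma> (Suc (i + d))" using \<sigma>(3) by auto
        then show ?case using Suc by simp
      qed simp
      show ?thesis using up[of 0 j] up[of j "m - j"] that \<sigma> by simp
    qed
    have c: "sg (\<lambda>u. C ((1 - u) * \<sigma> j + u * \<sigma> (Suc j))) = sg (\<lambda>u. p)" if j: "j < m" for j
    proof (rule sg_cong)
      fix u :: real assume u: "0 \<le> u" "u \<le> 1"
      have "(1 - u) * \<sigma> j + u * \<sigma> (Suc j) \<le> (1 - u) * 1 + u * 1" using inb[of j] inb[of "Suc j"] j u by (intro add_mono mult_left_mono) auto
      then show "C ((1 - u) * \<sigma> j + u * \<sigma> (Suc j)) = p" unfolding p_def
        using inb[of j] inb[of "Suc j"] j u by (intro const add_nonneg_nonneg mult_nonneg_nonneg) auto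
    qed
    have rep: "sum_list (replicate N x) = (\<Sum>i<N. x)" for N and x :: "(real \<Rightarrow> complex ^ 'n) set \<Rightarrow> bit"
      by (induction N) (simp_all only: replicate_0 replicate_Suc sum_list.Nil sum_list.Cons lessThan_0 sum.empty sum.lessThan_Suc add.commute)
    have "(\<Sum>i<m. sg (\<lambda>u. C ((1 - u) * \<sigma> i + u * \<sigma> (Suc i)))) = (\<Sum>i<m. sg (\<lambda>u. p))"
      by (rule sum.cong[OF refl]) (use c in auto)
    then have "fills xs (\<Sum>i<m. sg (\<lambda>u. C ((1 - u) * \<sigma> i + u * \<sigma> (Suc i))))"
      using g unfolding fills_def xs_def map_replicate fst_conv b rep by (auto simp: set_replicate_conv_if)
    from chain_realization[OF m _ _ _ _ _ cl this, of "M / real 1"] \<sigma> M0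
    obtain K :: "((real ^ 5) \<times> (real ^ 5) \<times> (real ^ 5)) set" and f where
      "piecewise_smooth_surface K f" "isotropic K f" "bounds C K f" "area K f \<le> sum_list (map (\<lambda>x. snd x / 2) xs)" by auto
    moreover have "sum_list (map (\<lambda>x. snd x / 2) xs) = 0" by (simp add: xs_def map_replicate sum_list_replicate)
    ultimately show ?thesis using True by auto
  next
    case False
    then have l2: "0 < l\<^sup>2" by simp
    \<comment> \<open>The decisive numerical comparison:
      \<open>3321 / 4000 * 8 * 1.4143 < 9.394\<close>, whereas
      \<open>3 * 3.132 = 9.396\<close>.\<close>
    have "sqrt 2 \<le> 14143 / 10000" by (rule real_le_lsqrt) (simp_all add: power2_eq_square)
    then have "3321 / 4000 * (8 * sqrt 2) < 3 * pi" using pi_lower by simp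
    then have ratio: "3321 / 4000 / pi < 3 / (8 * sqrt 2)" using pi_gt_zero by (simp add: field_simps)
    define \<epsilon> where "\<epsilon> = (3 / (8 * sqrt 2) - 3321 / 4000 / pi) * l\<^sup>2"
    have eps: "0 < \<epsilon>" using ratio l2 by (simp add: \<epsilon>_def)
    \<comment> \<open>Replacing the \<open>m * k\<close> arcs by their chords costs a multiple of
      \<open>(M / k)\<^sup>2\<close> each, in total \<open>A / k\<close>.\<close>
    define A where "A = real m * (720 * real CARD('n) * M\<^sup>2)"
    have A0: "0 \<le> A" by (simp add: A_def)
    \<comment> \<open>One half of \<epsilon> pays for the passage from arcs to chords, the other
      half for the error allowed in \<open>Fil\<close>.\<close>
    obtain k :: nat where k: "2 * A / \<epsilon> + 1 < real k" using reals_Archimedean2 by blast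
    have k0: "0 < real k" using k A0 eps by (smt (verit) divide_nonneg_pos)
    have Ak: "A / real k \<le> \<epsilon> / 2"
    proof -
      have "2 * A / \<epsilon> \<le> real k" using k by linarith
      then show ?thesis using k0 eps by (simp add: field_simps)
    qed
    obtain \<sigma> where \<sigma>: "\<sigma> 0 = 0" "\<sigma> (m * k) = 1" "\<forall>j<m * k. \<sigma> j < \<sigma> (Suc j)"
      "\<forall>j<m * k. sarc (\<lambda>u. C ((1 - u) * \<sigma> j + u * \<sigma> (Suc j))) (M / real k)"
      "\<forall>j<m * k. norm (C (\<sigma> (Suc j)) - C (\<sigma> j)) \<le> M / real k"
      "(\<Sum>j<m * k. norm (C (\<sigma> (Suc j)) - C (\<sigma> j))) \<le> l" using fine[of k] k0 by auto
    define \<gamma> where "\<gamma> j u = C ((1 - u) * \<sigma> j + u * \<sigma> (Suc j))" for j u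
    define L where "L = (\<Sum>j<m * k. norm (C (\<sigma> (Suc j)) - C (\<sigma> j)))"
    have "Fil (sg (\<gamma> j) + seg (\<gamma> j 0) (\<gamma> j 1)) (720 * real CARD('n) * (M / real k)\<^sup>2)" if "j < m * k" for j
      by (rule crude_arc[OF n]) (use \<sigma> that in \<open>auto simp: \<gamma>_def[abs_def]\<close>)
    then have "Fil (\<Sum>j<m * k. sg (\<gamma> j) + seg (\<gamma> j 0) (\<gamma> j 1)) (\<Sum>j<m * k. 720 * real CARD('n) * (M / real k)\<^sup>2)"
      by (intro Fil_sum) auto
    then have 1: "Fil ((\<Sum>j<m * k. sg (\<gamma> j)) + (\<Sum>j<m * k. seg (C (\<sigma> j)) (C (\<sigma> (Suc j))))) (\<Sum>j<m * k. 720 * real CARD('n) * (M / real k)\<^sup>2)"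
      unfolding sum.distrib by (simp only: \<gamma>_def diff_0_right mult_1 mult_zero_left add_0_right diff_self add_0_left)
    have "Fil (\<Sum>j<m * k. seg (C (\<sigma> j)) (C (\<sigma> (Suc j)))) (3321 / 4000 * (L\<^sup>2 / pi))"
      unfolding L_def by (rule polygon[OF n, of "m * k" "\<lambda>j. C (\<sigma> j)"]) (use m k0 \<sigma> cl in \<open>auto simp: Suc_le_eq\<close>)
    from Fil_add[OF 1 this]
    have F: "Fil (\<Sum>j<m * k. sg (\<gamma> j)) ((\<Sum>j<m * k. 720 * real CARD('n) * (M / real k)\<^sup>2) + 3321 / 4000 * (L\<^sup>2 / pi))"
      by (simp only: chain_ac)
    have "(\<Sum>j<m * k. 720 * real CARD('n) * (M / real k)\<^sup>2) = A / real k"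
      using k0 by (simp add: A_def power2_eq_square)
    moreover have "3321 / 4000 * (L\<^sup>2 / pi) \<le> 3321 / 4000 / pi * l\<^sup>2"
    proof -
      have "0 \<le> L" unfolding L_def by (rule sum_nonneg) simp
      then have "L\<^sup>2 \<le> l\<^sup>2" using \<sigma>(6) unfolding L_def by (intro power_mono) auto
      then show ?thesis by (simp add: divide_right_mono)
    qed
    ultimately obtain xs where xs: "fills xs (\<Sum>j<m * k. sg (\<gamma> j))"
      "sum_list (map (\<lambda>x. snd x / 2) xs) \<le> A / real k + 3321 / 4000 / pi * l\<^sup>2 + \<epsilon> / 2"
      using Fil_mono[OF F, of "A / real k + 3321 / 4000 / pi * l\<^sup>2"] eps unfolding Fil_def
      by (metis add_left_mono half_gt_zero)
    have "0 < m * k" using m k0 by simp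
    from chain_realization[OF this \<sigma>(1,2) _ _ _ cl xs(1)[unfolded \<gamma>_def], of "M / real k"] \<sigma>(3,4) M0
    obtain K :: "((real ^ 5) \<times> (real ^ 5) \<times> (real ^ 5)) set" and f where
      K: "piecewise_smooth_surface K f" "isotropic K f" "bounds C K f" "area K f \<le> sum_list (map (\<lambda>x. snd x / 2) xs)" by auto
    have "area K f \<le> 3321 / 4000 / pi * l\<^sup>2 + \<epsilon>" using K(4) xs(2) Ak by linarith
    also have "\<dots> = 3 * l\<^sup>2 / (8 * sqrt 2)" by (simp add: \<epsilon>_def algebra_simps)
    finally show ?thesis using K(1-3) by blast
  qed
qed

end
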